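(* Suppose assumptions (A1)–(A5) and (W1)–(W3), listed in the context, hold with discrete-time measurements. Let $\widetilde{\mathbf W}_n=\widetilde{\mathbf W}(a(n)2^j)$ be the associated discrete-time wavelet random matrix, and let $$F_{\widetilde{\mathbf W}_n}(d\upsilon)=\frac1{p(n)}\sum_{\ell=1}^{p(n)}\delta_{\frac{\log\lambda_\ell(\widetilde{\mathbf W}_n)}{\log a(n)}}(d\upsilon)$$ be the empirical spectral distribution of its rescaled log-eigenvalues. Let $F_{2\mathcal H+1}$ be the probability distribution of $2\mathcal H+1$, where $\mathcal H\sim\pi(dH)$. Then $F_{\widetilde{\mathbf W}_n}$ converges weakly, in probability, to $F_{2\mathcal H+1}$; that is, for any bounded continuous $g:\mathbb R\to\mathbb R$ and any $\varepsilon>0$, $$\lim_{n\to\infty}\mathbb P\Big(\Big|\int_{\mathbb R}g(\upsilon)F_{\widetilde{\mathbf W}_n}(d\upsilon)-\int_{\mathbb R}g(\upsilon)F_{2\mathcal H+1}(d\upsilon)\Big|>\varepsilon\Big)=0.$$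
   Context: Notation: $\mathbb N=\{1,2,\dots\}$; $^*$ is transposition; $\lambda_1(\mathbf A)\le\dots\le\lambda_p(\mathbf A)$ are the ordered eigenvalues of a symmetric matrix $\mathbf A\in\mathbb R^{p\times p}$; $\sigma_1(\mathbf M)\le\dots\le\sigma_p(\mathbf M)$ are the ordered singular values of $\mathbf M\in\mathbb R^{p\times p}$; $GL(p,\mathbb R)$ is the group of invertible $p\times p$ real matrices; $\hat f(x)=\int_{\mathbb R}e^{-\mathrm{i}xt}f(t)\,dt$. Write $a=a(n)$, $p=p(n)$. Random Hurst fractional Brownian motion (rH-fBm): a process $X_{\mathcal H}=\{X_{\mathcal H}(t)\}_{t\in\mathbb R}$ with $\mathcal H\sim\pi(dH)$ such that, conditionally on $\mathcal H=H\in(0,1)$, $X_{\mathcal H}$ is a standard fractional Brownian motion with Hurst exponent $H$ (centered Gaussian with covariance $\frac12(|s|^{2H}+|t|^{2H}-|t-s|^{2H})$). (A1) $\pi(dH)$ is a probability measure with $\pi(0,1)=1$ and finite support $\{\breve H_1,\dots,\breve H_r\}\subset(0,1)$, $r\in\mathbb N$; $\varpi:=\min\operatorname{supp}\pi$. For each $n$, $\mathbb H_n=\mathrm{diag}(\mathcal H_1,\dots,\mathcal H_{p(n)})$ is a $p(n)\times p(n)$ random diagonal matrix whose diagonal entries are chosen independently from $\pi$. (A2) For each $n$, given $\mathbb H_n$, $p(n)$ independent rH-fBm sample paths are generated, the $\ell$-th one based on the diagonal entry $\mathcal H_\ell$. They form the $p(n)$-variate latent process $X=\{X(t)\}$. (A3)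 The measurements are $Y(t)=\mathbf P(n)X(t)\in\mathbb R^{p(n)}$, where $\mathbf P(n)\in GL(p(n),\mathbb R)$ is a random matrix independent of $X$. (A4) $j\in\mathbb N\cup\{0\}$ is fixed. The scaling factors $a(n)$ (dyadic, i.e., powers of 2) and the dimensions $p(n)\in\mathbb N$ satisfy, as $n\to\infty$, $a(n)\le n/2^j$, $\frac{a(n)}n+\frac n{a(n)^{1+2\varpi}}\to0$, $p(n)<\frac n{a(n)2^j}$, $p(n)\to\infty$ and $p(n)=o(\sqrt{n/a(n)})$. The number $n_{a,j}:=n/(a(n)2^j)$ is assumed to be an integer. (A5) $\frac{\log\sigma_1(\mathbf P(n))}{\log a(n)}\to0$ and $\frac{\log\sigma_{p}(\mathbf P(n))}{\log a(n)}\to0$ in probability as $n\to\infty$. Wavelets: $\phi$ and $\psi$ are the scaling function and wavelet of an orthonormal multiresolution analysis of $L^2(\mathbb R)$ and satisfy: (W1) $\psi\in L^2(\mathbb R)$, $\int\psi^2=1$, $\int t^q\psi(t)dt=0$ for $q=0,\dots,N_\psi-1$ and $\int t^{N_\psi}\psi(t)dt\ne0$, for some integer $N_\psi\ge2$; (W2) $\phi,\psi\in L^1(\mathbb R)$ are compactly supported and $\hat\phi(0)=1$; (W3) there are constants $0<A<\infty$ and $\alpha>1$ with $\sup_x|\hat\psi(x)|(1+|x|)^\alpha<A$. Discrete-time wavelet random matrix: for $J\in\mathbb N\cup\{0\}$, let $h_{J,\ell}=2^{-J/2}\int_{\mathbb R}\phi(t+\ell)\psi(2^{-J}t)\,dt$,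 $\ell\in\mathbb Z$ (only finitely many are nonzero for each $J$), and $\widetilde D(2^J,k)=\sum_{\ell\in\mathbb Z}Y(\ell)h_{J,2^Jk-\ell}\in\mathbb R^{p(n)}$. Taking $2^J=a(n)2^j$, put $\widetilde{\mathbf W}(a(n)2^j)=\frac1{n_{a,j}}\sum_{k=1}^{n_{a,j}}\widetilde D(a(n)2^j,k)\widetilde D(a(n)2^j,k)^*$. Convention: only wavelet coefficients unaffected by the border effect are used, i.e., the $n_{a,j}$ coefficients entering $\widetilde{\mathbf W}$ coincide with those computed from the whole sequence $\{Y(\ell)\}_{\ell\in\mathbb Z}$. *)

theory Defs
  imports
    "HOL-Probability.Probability"
    "HOL-Library.Landau_Symbols"
    "Jordan_Normal_Form.Char_Poly"
begin

text \<open>Matrices and vectors are those of \<^theory>\<open>Jordan_Normal_Form.Matrix\<close>, since the dimension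
  varies with the sample size; their entries are indexed from 0. The ordered eigenvalues and
  singular values below are indexed from 1.\<close>

unbundle no vec_syntax

section \<open>Ordered eigenvalues and singular values\<close>

text \<open>\<^term>\<open>proots\<close> collects the real roots with multiplicity, so for a symmetric matrix of size
  \<open>p\<close> the list below has length \<open>p\<close>.\<close>

definition ordered_eigenvalue :: "nat \<Rightarrow> real mat \<Rightarrow> real" where
  "ordered_eigenvalue l A = sorted_list_of_multiset (proots (char_poly A)) ! (l - 1)"

definition ordered_singular_value :: "nat \<Rightarrow> real mat \<Rightarrow> real" where
  "ordered_singular_value l A = sqrt (ordered_eigenvalue l (transpose_mat A * A))"

text \<open>The uniform distribution on the rescaled logarithms of the \<open>p\<close> eigenvalues, i.e. the sum of
  Dirac masses of weight \<open>1/p\<close>. The value \<^term>\<open>ln 0 = (0::real)\<close> is used for a vanishing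
  eigenvalue.\<close>

definition log_esd :: "real \<Rightarrow> nat \<Rightarrow> real mat \<Rightarrow> real measure" where
  "log_esd a p A =
     distr (uniform_count_measure {1..p}) borel (\<lambda>l. ln (ordered_eigenvalue l A) / ln a)"

section \<open>Probability\<close>

definition tendsto_in_prob ::
    "'w measure \<Rightarrow> (nat \<Rightarrow> 'w \<Rightarrow> real) \<Rightarrow> real \<Rightarrow> nat filter \<Rightarrow> bool" where
  "tendsto_in_prob M Z c F \<longleftrightarrow>
     (\<forall>\<epsilon>>0. ((\<lambda>n. measure M {\<omega> \<in> space M. \<bar>Z n \<omega> - c\<bar> > \<epsilon>}) \<longlongrightarrow> 0) F)"

definition measure_support :: "real measure \<Rightarrow> real set" where
  "measure_support \<pi> = {x. \<forall>U. open U \<and> x \<in> U \<longrightarrow> measure \<pi> U > 0}"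

text \<open>Normal distributions with variance 0 are included.\<close>

definition gaussian_rv :: "'w measure \<Rightarrow> ('w \<Rightarrow> real) \<Rightarrow> bool" where
  "gaussian_rv M Z \<longleftrightarrow> Z \<in> borel_measurable M \<and>
     (\<exists>\<mu> \<sigma>. \<sigma> \<ge> 0 \<and>
        distr M borel Z = (if \<sigma> = 0 then return borel \<mu> else density lborel (normal_density \<mu> \<sigma>)))"

definition gaussian_process :: "'w measure \<Rightarrow> (real \<Rightarrow> 'w \<Rightarrow> real) \<Rightarrow> bool" where
  "gaussian_process M X \<longleftrightarrow> (\<forall>T c. finite T \<longrightarrow> gaussian_rv M (\<lambda>\<omega>. \<Sum>t\<in>T. c t * X t \<omega>))"

definition standard_fBm :: "'w measure \<Rightarrow> real \<Rightarrow> (real \<Rightarrow> 'w \<Rightarrow> real) \<Rightarrow> bool" where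
  "standard_fBm M H X \<longleftrightarrow>
     gaussian_process M X \<and>
     (\<forall>t. integral\<^sup>L M (X t) = 0) \<and>
     (\<forall>s t. integral\<^sup>L M (\<lambda>\<omega>. X s \<omega> * X t \<omega>) =
        (\<bar>s\<bar> powr (2 * H) + \<bar>t\<bar> powr (2 * H) - \<bar>t - s\<bar> powr (2 * H)) / 2)"

text \<open>The Hurst exponents \<open>H l\<close>, \<open>l < p\<close>, are independent with distribution \<open>\<pi>\<close>. As \<open>\<pi>\<close> has finite
  support, conditioning on the exponents is elementary conditioning on the events
  \<open>{H 0 = h 0, \<dots>, H (p - 1) = h (p - 1)}\<close> with all \<open>h l\<close> in the support; these have positive
  probability, and \<^term>\<open>uniform_measure M A\<close> is the conditional probability given \<open>A\<close>. The
  paths are conditionally independent as random elements of the function space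
  with its product \<open>\<sigma>\<close>-algebra.\<close>

definition rH_fBm_paths ::
    "'w measure \<Rightarrow> real measure \<Rightarrow> nat \<Rightarrow> (nat \<Rightarrow> 'w \<Rightarrow> real) \<Rightarrow> (nat \<Rightarrow> real \<Rightarrow> 'w \<Rightarrow> real) \<Rightarrow> bool"
  where
  "rH_fBm_paths M \<pi> p H X \<longleftrightarrow>
     prob_space.indep_vars M (\<lambda>_. borel) H {..<p} \<and>
     (\<forall>l<p. distr M borel (H l) = \<pi>) \<and>
     (\<forall>h. (\<forall>l<p. h l \<in> measure_support \<pi>) \<longrightarrow>
        (let M' = uniform_measure M {\<omega> \<in> space M. \<forall>l<p. H l \<omega> = h l} in
           prob_space.indep_vars M' (\<lambda>_. Pi\<^sub>M UNIV (\<lambda>_. borel)) (\<lambda>l \<omega> t. X l t \<omega>) {..<p} \<and>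
           (\<forall>l<p. standard_fBm M' (h l) (X l))))"

text \<open>A random invertible matrix that is independent of the whole process
  \<open>{X(t)}\<close>, \<open>t \<in> \<real>\<close>; both are viewed as families of real random variables.\<close>

definition mixing_matrix ::
    "'w measure \<Rightarrow> nat \<Rightarrow> ('w \<Rightarrow> real mat) \<Rightarrow> (nat \<Rightarrow> real \<Rightarrow> 'w \<Rightarrow> real) \<Rightarrow> bool" where
  "mixing_matrix M p P X \<longleftrightarrow>
     (\<forall>\<omega>\<in>space M. P \<omega> \<in> carrier_mat p p \<and> invertible_mat (P \<omega>)) \<and>
     prob_space.indep_var M
       (Pi\<^sub>M ({..<p} \<times> {..<p}) (\<lambda>_. borel)) (\<lambda>\<omega>. \<lambda>il\<in>{..<p} \<times> {..<p}. P \<omega> $$ il)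
       (Pi\<^sub>M ({..<p} \<times> UNIV) (\<lambda>_. borel)) (\<lambda>\<omega>. \<lambda>(l, t)\<in>{..<p} \<times> UNIV. X l t \<omega>)"

section \<open>Orthonormal multiresolution analyses of the real space \<open>L\<^sup>2(\<real>)\<close>\<close>

text \<open>Elements of \<open>L\<^sup>2(\<real>)\<close> are represented by Borel functions. An \<open>L\<^sup>2\<close>-closed set of functions
  contains with a function all square-integrable Borel functions that agree with it almost
  everywhere.\<close>

definition L2 :: "(real \<Rightarrow> real) set" where
  "L2 = {f \<in> borel_measurable borel. integrable lborel (\<lambda>t. (f t)\<^sup>2)}"

definition L2_inner :: "(real \<Rightarrow> real) \<Rightarrow> (real \<Rightarrow> real) \<Rightarrow> real" where
  "L2_inner f g = (\<integral>t. f t * g t \<partial>lborel)"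

definition L2_closure :: "(real \<Rightarrow> real) set \<Rightarrow> (real \<Rightarrow> real) set" where
  "L2_closure A = {f \<in> L2. \<forall>\<epsilon>>0. \<exists>g\<in>A. (\<integral>t. (f t - g t)\<^sup>2 \<partial>lborel) < \<epsilon>}"

definition L2_closed_subspace :: "(real \<Rightarrow> real) set \<Rightarrow> bool" where
  "L2_closed_subspace V \<longleftrightarrow>
     V \<subseteq> L2 \<and> (\<lambda>_. 0) \<in> V \<and> (\<forall>f\<in>V. \<forall>g\<in>V. \<forall>c d. (\<lambda>t. c * f t + d * g t) \<in> V) \<and> L2_closure V \<subseteq> V"

definition orthonormal_basis_of :: "(int \<Rightarrow> real \<Rightarrow> real) \<Rightarrow> (real \<Rightarrow> real) set \<Rightarrow> bool" where
  "orthonormal_basis_of e V \<longleftrightarrow>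
     (\<forall>k. e k \<in> V) \<and>
     (\<forall>k l. L2_inner (e k) (e l) = (if k = l then 1 else 0)) \<and>
     V \<subseteq> L2_closure {(\<lambda>t. \<Sum>k\<in>K. c k * e k t) | K c. finite K}"

text \<open>The spaces \<open>V J\<close> become coarser as \<open>J\<close> grows, in accordance with the scale \<open>2\<^sup>J\<close> of the
  wavelet coefficients.\<close>

definition multiresolution_analysis ::
    "(int \<Rightarrow> (real \<Rightarrow> real) set) \<Rightarrow> (real \<Rightarrow> real) \<Rightarrow> bool" where
  "multiresolution_analysis V \<phi> \<longleftrightarrow>
     (\<forall>J. L2_closed_subspace (V J)) \<and>
     (\<forall>J. V (J + 1) \<subseteq> V J) \<and>
     (\<forall>J f. f \<in> V J \<longleftrightarrow> (\<lambda>t. f (2 powi J * t)) \<in> V 0) \<and>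
     L2_closure (\<Union>J. V J) = L2 \<and>
     (\<forall>f\<in>(\<Inter>J. V J). AE t in lborel. f t = 0) \<and>
     orthonormal_basis_of (\<lambda>k t. \<phi> (t - of_int k)) (V 0)"

definition mra_wavelet :: "(real \<Rightarrow> real) \<Rightarrow> (real \<Rightarrow> real) \<Rightarrow> bool" where
  "mra_wavelet \<phi> \<psi> \<longleftrightarrow>
     (\<exists>V. multiresolution_analysis V \<phi> \<and>
        orthonormal_basis_of (\<lambda>k t. \<psi> (t - of_int k))
          {f \<in> V (- 1). \<forall>g\<in>V 0. L2_inner f g = 0})"

definition compactly_supported :: "(real \<Rightarrow> real) \<Rightarrow> bool" where
  "compactly_supported f \<longleftrightarrow> compact (closure {t. f t \<noteq> 0})"

definition fourier :: "(real \<Rightarrow> real) \<Rightarrow> real \<Rightarrow> complex" where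
  "fourier f x = (\<integral>t. exp (- \<i> * of_real x * of_real t) * of_real (f t) \<partial>lborel)"

definition vanishing_moments :: "nat \<Rightarrow> (real \<Rightarrow> real) \<Rightarrow> bool" where
  "vanishing_moments N \<psi> \<longleftrightarrow>
     \<psi> \<in> L2 \<and> (\<integral>t. (\<psi> t)\<^sup>2 \<partial>lborel) = 1 \<and>
     (\<forall>q<N. (\<integral>t. t ^ q * \<psi> t \<partial>lborel) = 0) \<and> (\<integral>t. t ^ N * \<psi> t \<partial>lborel) \<noteq> 0"

definition fourier_decay :: "real \<Rightarrow> real \<Rightarrow> (real \<Rightarrow> real) \<Rightarrow> bool" where
  "fourier_decay A \<alpha> \<psi> \<longleftrightarrow>
     bdd_above (range (\<lambda>x. cmod (fourier \<psi> x) * (1 + \<bar>x\<bar>) powr \<alpha>)) \<and>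
     (SUP x. cmod (fourier \<psi> x) * (1 + \<bar>x\<bar>) powr \<alpha>) < A"

section \<open>Discrete-time wavelet random matrices\<close>

definition wavelet_filter :: "(real \<Rightarrow> real) \<Rightarrow> (real \<Rightarrow> real) \<Rightarrow> nat \<Rightarrow> int \<Rightarrow> real" where
  "wavelet_filter \<phi> \<psi> J l =
     2 powr (- real J / 2) * (\<integral>t. \<phi> (t + of_int l) * \<psi> (2 powr (- real J) * t) \<partial>lborel)"

text \<open>For compactly supported \<open>\<phi>\<close> and \<open>\<psi>\<close> the sum over \<open>\<int>\<close> has finitely many nonzero terms.\<close>

definition wavelet_coeff ::
    "(real \<Rightarrow> real) \<Rightarrow> (real \<Rightarrow> real) \<Rightarrow> nat \<Rightarrow> (int \<Rightarrow> real vec) \<Rightarrow> nat \<Rightarrow> nat \<Rightarrow> real vec" where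
  "wavelet_coeff \<phi> \<psi> p Y J k =
     vec p (\<lambda>i. \<Sum>\<^sub>\<infinity>l\<in>UNIV. (Y l $ i) * wavelet_filter \<phi> \<psi> J (2 ^ J * int k - l))"

definition wavelet_matrix ::
    "(real \<Rightarrow> real) \<Rightarrow> (real \<Rightarrow> real) \<Rightarrow> nat \<Rightarrow> (int \<Rightarrow> real vec) \<Rightarrow> nat \<Rightarrow> nat \<Rightarrow> real mat" where
  "wavelet_matrix \<phi> \<psi> p Y J N =
     mat p p (\<lambda>(i, i'). (1 / real N) *
       (\<Sum>k=1..N. (wavelet_coeff \<phi> \<psi> p Y J k $ i) * (wavelet_coeff \<phi> \<psi> p Y J k $ i')))"

definition measurements ::
    "nat \<Rightarrow> real mat \<Rightarrow> (nat \<Rightarrow> real \<Rightarrow> real) \<Rightarrow> int \<Rightarrow> real vec" where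
  "measurements p P x t = P *\<^sub>v vec p (\<lambda>l. x l (of_int t))"

end

theory Submission
  imports Defs "HOL-Combinatorics.List_Permutation"
begin

text \<open>Write \<open>W\<^sub>X\<close> for the wavelet matrix of the latent process, so that the matrix
  of the measurements is \<open>P W\<^sub>X P\<^sup>T\<close>. The wavelet coefficients of the row
  \<open>l\<close> at scale \<open>2\<^sup>J = 2\<^sup>j a(n)\<close> are centered Gaussian, of
  size about \<open>(2\<^sup>J)\<^bsup>H\<^sub>l + 1/2\<^esup>\<close>, and rows are conditionally
  independent given the Hurst exponents. After division of each row by this power the sample
  covariance matrix of the coefficients is close to a diagonal matrix with entries in a fixed
  compact subset of the open half-line of positive numbers. Hence the quadratic form of
  \<open>W\<^sub>X\<close> is comparable, up to constant factors, with that of the diagonal matrix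
  with entries \<open>(2\<^sup>J)\<^bsup>2H\<^sub>l + 1\<^esup>\<close>. The min-max principle
  turns this into a comparison of every single ordered eigenvalue with the corresponding ordered
  diagonal entry, and passing from \<open>W\<^sub>X\<close> to \<open>P W\<^sub>X
  P\<^sup>T\<close> costs at most the squares of the extreme singular values of \<open>P\<close>.
  On dividing logarithms by \<open>log a(n)\<close> all constants and all singular values
  disappear, and what is left is the empirical distribution of \<open>2H\<^sub>l + 1\<close>, for
  which a law of large numbers holds.

  The comparison of eigenvalues is \<open>ordered_eigenvalue_le\<close> and
  \<open>ordered_eigenvalue_ge\<close>, proved from the spectral theorem. For the comparison of
  quadratic forms, \<open>filter_covariance_approx\<close> shows that the covariance of normalized
  coefficients differs from its continuous-time limit \<open>wavelet_autocov\<close> by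
  \<open>O((2\<^sup>J)\<^bsup>-H\<^esup>)\<close>; its main ingredient is that the integer
  translates of the scaling function sum to 1 (\<open>partition_of_unity\<close>), so that the
  discrete filter annihilates constants and the discrete sum can be compared with the integral
  term by term. The limit covariance is square summable in the time lag because two moments of the
  wavelet vanish (\<open>wavelet_autocov_square_summable\<close>), and its value at lag 0 is
  strictly positive by a spectral representation (\<open>wavelet_autocov_positive\<close>).

  With \<open>N\<close> coefficients in each of \<open>p\<close> rows, the formula for Gaussian
  fourth moments bounds the expected squared Frobenius distance of the normalized sample
  covariance matrix from its mean by \<open>O(p\<^sup>2 (1/N +
  (2\<^sup>J)\<^bsup>-2H\<^esup>))\<close>, where \<open>H\<close> is the smallest possible
  exponent (\<open>sample_covariance_deviation\<close>). The growth conditions on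
  \<open>a(n)\<close> and \<open>p(n)\<close> make exactly this quantity tend to 0:
  \<open>p\<^sup>2/N\<close> vanishes because \<open>p\<close> is small compared with \<open>sqrt
  (n/a)\<close>, and \<open>N (2\<^sup>J)\<^bsup>-2H\<^esup>\<close> is at most
  \<open>n/a\<^bsup>1+2H\<^esup>\<close>.\<close>

(* the symbol \<bullet> denotes the scalar product of vectors *)
unbundle no inner_syntax

section \<open>The spectral theorem for real symmetric matrices\<close>

text \<open>Over the complex numbers there is an eigenvector \<open>v\<close>, and the Hermitian form
  \<open>v\<^sup>* A v = c v\<^sup>* v\<close> is real, which forces the eigenvalue
  \<open>c\<close> to be real.\<close>

lemma symmetric_mat_real_eigenvalue:
  fixes A :: "real mat"
  assumes A: "A \<in> carrier_mat n n" and sym: "\<And>i j. i < n \<Longrightarrow> j < n \<Longrightarrow> A $$ (i, j) = A $$ (j, i)" and n: "n > 0"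
  shows "\<exists>e. eigenvalue A e"
proof -
  let ?C = "map_mat complex_of_real A"
  have C: "?C \<in> carrier_mat n n" using A by auto
  obtain as where as: "char_poly ?C = (\<Prod> a \<leftarrow> as. [:- a, 1:])" "length as = n"
    using char_poly_factorized[OF C] by blast
  with n obtain c as' where as': "as = c # as'" by (cases as) auto
  have "poly (char_poly ?C) c = 0" by (simp add: as(1) as')
  then have "eigenvalue ?C c" using eigenvalue_root_char_poly[OF C] by simp
  then obtain v where v: "v \<in> carrier_vec n" "v \<noteq> 0\<^sub>v n" "?C *\<^sub>v v = c \<cdot>\<^sub>v v"
    using C unfolding eigenvalue_def eigenvector_def by auto
  have ev: "(\<Sum>j<n. complex_of_real (A $$ (i, j)) * v $ j) = c * v $ i" if "i < n" for i
  proof -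
    have "(?C *\<^sub>v v) $ i = (\<Sum>j<n. complex_of_real (A $$ (i, j)) * v $ j)"
      using that v(1) A by (simp add: scalar_prod_def lessThan_atLeast0 del: index_smult_vec)
    then show ?thesis using v that by simp
  qed
  \<comment> \<open>\<open>s = v\<^sup>* v\<close> and \<open>T = v\<^sup>* A v\<close>.\<close>
  define s where "s = (\<Sum>i<n. v $ i * cnj (v $ i))"
  define T where "T = (\<Sum>i<n. \<Sum>j<n. of_real (A $$ (i, j)) * v $ j * cnj (v $ i))"
  have T: "T = c * s"
    unfolding T_def s_def sum_distrib_left
    by (rule sum.cong[OF refl], subst sum_distrib_right[symmetric]) (use ev in auto)
  have "cnj T = (\<Sum>i<n. \<Sum>j<n. of_real (A $$ (i, j)) * cnj (v $ j) * v $ i)"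
    unfolding T_def by simp
  also have "\<dots> = (\<Sum>j<n. \<Sum>i<n. of_real (A $$ (i, j)) * cnj (v $ j) * v $ i)"
    by (rule sum.swap)
  also have "\<dots> = T"
    unfolding T_def by (intro sum.cong refl) (use sym in auto)
  finally have cT: "cnj T = T" .
  have s: "s = of_real (\<Sum>i<n. (cmod (v $ i))\<^sup>2)"
    unfolding s_def of_real_sum by (intro sum.cong refl) (simp add: complex_norm_square[symmetric])
  obtain i where i: "i < n" "v $ i \<noteq> 0"
    using v by (metis carrier_vecD eq_vecI index_zero_vec)
  have "(\<Sum>i<n. (cmod (v $ i))\<^sup>2) > 0"
    by (rule sum_pos2[of _ i]) (use i in auto)
  then have s0: "s \<noteq> 0" unfolding s by (simp only: of_real_eq_0_iff)
  have "cnj s = s" unfolding s by simp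
  then have "cnj c = c" using cT s0 unfolding T by simp
  then obtain e where e: "c = of_real e" by (metis complex_cnj_cancel_iff complex_is_Real_iff Reals_cases Reals_cnj_iff)
  have "poly (char_poly ?C) (of_real e) = 0" using \<open>poly (char_poly ?C) c = 0\<close> e by simp
  then have "poly (map_poly of_real (char_poly A)) (complex_of_real e) = 0"
    unfolding of_real_hom.char_poly_hom[OF A] .
  then have "poly (char_poly A) e = 0" by simp
  then show ?thesis using eigenvalue_root_char_poly[OF A] by auto
qed

text \<open>The Householder reflection that exchanges \<open>v\<close> with the first basis vector. It
  completes a unit vector to an orthonormal basis without a Gram-Schmidt procedure.\<close>

lemma reflection_to_unit_vector:
  fixes v :: "nat \<Rightarrow> real"
  assumes n: "n > 0" and v: "(\<Sum>i<n. (v i)\<^sup>2) = 1"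
  shows "\<exists>Q\<in>carrier_mat n n. Q * Q = 1\<^sub>m n \<and> (\<forall>i<n. \<forall>j<n. Q $$ (i, j) = Q $$ (j, i)) \<and>
    (\<forall>i<n. Q $$ (i, 0) = v i)"
proof -
  define u where "u i = (if i = 0 then 1 else 0) - v i" for i
  define r where "r = (\<Sum>i<n. (u i)\<^sup>2)"
  \<comment> \<open>If \<open>v\<close> is the first basis vector itself, then \<open>r = 0\<close> and the identity
    serves.\<close>
  define q where "q = (if r = 0 then 0 else 2 / r)"
  define Q where "Q = mat n n (\<lambda>(i, j). (if i = j then 1 else 0) - q * u i * u j)"
  have Q: "Q \<in> carrier_mat n n" by (simp add: Q_def)
  have r: "r = 2 * u 0"
  proof -
    have "r = (\<Sum>i<n. (if i = 0 then 1 - 2 * v i else 0) + (v i)\<^sup>2)"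
      unfolding r_def by (intro sum.cong refl) (auto simp: u_def power2_eq_square algebra_simps)
    also have "\<dots> = 1 - 2 * v 0 + 1"
      using n v by (simp add: sum.distrib)
    finally show ?thesis by (simp add: u_def)
  qed
  have qr: "q * q * r = 2 * q" by (auto simp: q_def)
  have "Q * Q = 1\<^sub>m n"
  proof (rule eq_matI)
    fix i j assume "i < dim_row (1\<^sub>m n)" "j < dim_col (1\<^sub>m n)"
    then have ij: "i < n" "j < n" by auto
    have "(Q * Q) $$ (i, j) = (\<Sum>k<n. ((if i = k then 1 else 0) - q * u i * u k) * ((if k = j then 1 else 0) - q * u k * u j))"
      using ij by (simp add: Q_def scalar_prod_def lessThan_atLeast0)
    also have "\<dots> = (\<Sum>k<n. (if k = i then (if i = j then 1 else 0) - q * u i * u j else 0) - (if k = j then q * u i * u j else 0)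
        + q * q * u i * u j * (u k)\<^sup>2)"
      by (intro sum.cong refl) (auto simp: algebra_simps power2_eq_square)
    also have "\<dots> = (if i = j then 1 else 0) - 2 * (q * u i * u j) + (q * q * r) * (u i * u j)"
      using ij by (simp add: sum.distrib sum_subtractf sum_distrib_left[symmetric] r_def)
    also have "\<dots> = 1\<^sub>m n $$ (i, j)"
      using ij unfolding qr by simp
    finally show "(Q * Q) $$ (i, j) = 1\<^sub>m n $$ (i, j)" .
  qed (auto simp: Q_def)
  moreover have "Q $$ (i, 0) = v i" if "i < n" for i
  proof (cases "r = 0")
    case True
    then have "u i = 0" using that unfolding r_def
      by (subst (asm) sum_nonneg_eq_0_iff) auto
    then show ?thesis using that n True by (auto simp: Q_def q_def u_def)
  next
    case False
    then have "q * u 0 = 1" by (simp add: q_def r)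
    moreover have "Q $$ (i, 0) = (if i = 0 then 1 else 0) - (q * u 0) * u i"
      using that n by (simp add: Q_def)
    ultimately show ?thesis by (simp add: u_def)
  qed
  moreover have "\<forall>i<n. \<forall>j<n. Q $$ (i, j) = Q $$ (j, i)" by (auto simp: Q_def)
  ultimately show ?thesis using Q by blast
qed

lemma index_mult_mat_sum:
  assumes "A \<in> carrier_mat n m" "B \<in> carrier_mat m k" "i < n" "j < k"
  shows "(A * B) $$ (i, j) = (\<Sum>l<m. A $$ (i, l) * B $$ (l, j))"
  using assms by (auto simp: scalar_prod_def lessThan_atLeast0 intro!: sum.cong)

lemma index_mult_mat_vec_sum:
  assumes "A \<in> carrier_mat n m" "x \<in> carrier_vec m" "i < n"
  shows "(A *\<^sub>v x) $ i = (\<Sum>l<m. A $$ (i, l) * x $ l)"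
  using assms by (auto simp: scalar_prod_def lessThan_atLeast0 intro!: sum.cong)

lemma block_diag_mult:
  fixes X Y :: "real mat"
  assumes "X \<in> carrier_mat n n" "Y \<in> carrier_mat n n" "a \<in> carrier_mat 1 1" "b \<in> carrier_mat 1 1"
  shows "four_block_mat a (0\<^sub>m 1 n) (0\<^sub>m n 1) X * four_block_mat b (0\<^sub>m 1 n) (0\<^sub>m n 1) Y =
    four_block_mat (a * b) (0\<^sub>m 1 n) (0\<^sub>m n 1) (X * Y)"
proof -
  have "X * Y \<in> carrier_mat n n" "a * b \<in> carrier_mat 1 1" using assms by auto
  then show ?thesis
    using assms
    by (subst mult_four_block_mat[of _ 1 1 _ n _ n _ _ 1 _ n])
      (auto simp: left_mult_zero_mat[of _ n n] right_mult_zero_mat[of _ n n] left_mult_zero_mat[of _ 1 1]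
        right_mult_zero_mat[of _ 1 1] left_mult_zero_mat[of _ 1 n] left_mult_zero_mat[of _ n 1] intro!: arg_cong2[of _ _ _ _ "\<lambda>u v. four_block_mat u _ _ v"])
qed

text \<open>Induction on the size: a reflection moves a unit eigenvector to the first basis vector, after
  which symmetry makes the first row and column vanish off the diagonal, and the induction
  hypothesis applies to the remaining block.\<close>

theorem symmetric_mat_diagonalization:
  fixes A :: "real mat"
  assumes "A \<in> carrier_mat n n" "\<And>i j. i < n \<Longrightarrow> j < n \<Longrightarrow> A $$ (i, j) = A $$ (j, i)"
  shows "\<exists>U\<in>carrier_mat n n. \<exists>d. transpose_mat U * U = 1\<^sub>m n \<and> A = transpose_mat U * mat_diag n d * U"
  using assms
proof (induction n arbitrary: A)
  case 0
  then show ?case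
    by (intro bexI[of _ "1\<^sub>m 0"] exI[of _ "\<lambda>_. 0"]) (auto intro!: eq_matI)
next
  case (Suc n A)
  note A = Suc.prems(1) and sym = Suc.prems(2)
  obtain e where "eigenvalue A e" using symmetric_mat_real_eigenvalue[OF A sym] by auto
  then obtain w where w: "w \<in> carrier_vec (Suc n)" "w \<noteq> 0\<^sub>v (Suc n)" "A *\<^sub>v w = e \<cdot>\<^sub>v w"
    using A unfolding eigenvalue_def eigenvector_def by auto
  obtain i where i: "i < Suc n" "w $ i \<noteq> 0"
    using w by (metis carrier_vecD eq_vecI index_zero_vec)
  define r where "r = sqrt (\<Sum>i<Suc n. (w $ i)\<^sup>2)"
  have "(\<Sum>i<Suc n. (w $ i)\<^sup>2) > 0"
    by (rule sum_pos2[of _ i]) (use i in auto)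
  then have r: "r > 0" "r\<^sup>2 = (\<Sum>i<Suc n. (w $ i)\<^sup>2)"
    unfolding r_def by (simp_all only: real_sqrt_gt_zero real_sqrt_pow2 less_imp_le)
  define v where "v i = w $ i / r" for i
  have "(\<Sum>i<Suc n. (v i)\<^sup>2) = (\<Sum>i<Suc n. (w $ i)\<^sup>2) / r\<^sup>2"
    unfolding v_def power_divide sum_divide_distrib ..
  then have vn: "(\<Sum>i<Suc n. (v i)\<^sup>2) = 1" unfolding r(2)[symmetric] using r(1) by simp
  have Av: "(\<Sum>j<Suc n. A $$ (i, j) * v j) = e * v i" if "i < Suc n" for i
  proof -
    have "(A *\<^sub>v w) $ i = (\<Sum>j<Suc n. A $$ (i, j) * w $ j)"
      by (rule index_mult_mat_vec_sum) (use A w that in auto)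
    then have "(\<Sum>j<Suc n. A $$ (i, j) * w $ j) = e * w $ i" using w that by simp
    then show ?thesis unfolding v_def by (simp add: sum_divide_distrib[symmetric])
  qed
  obtain Q where Q: "Q \<in> carrier_mat (Suc n) (Suc n)" "Q * Q = 1\<^sub>m (Suc n)"
    and Qs: "\<forall>i<Suc n. \<forall>j<Suc n. Q $$ (i, j) = Q $$ (j, i)" and Qv: "\<forall>i<Suc n. Q $$ (i, 0) = v i"
    using reflection_to_unit_vector[OF _ vn] by auto
  have Qt: "transpose_mat Q = Q" by (rule eq_matI) (use Q(1) Qs in auto)
  have At: "transpose_mat A = A" by (rule eq_matI) (use A sym in auto)
  define B where "B = Q * A * Q"
  have B: "B \<in> carrier_mat (Suc n) (Suc n)" using Q A by (auto simp: B_def)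
  have "transpose_mat B = B"
    unfolding B_def using Q A by (simp add: transpose_mult[of _ "Suc n" "Suc n" _ "Suc n"] Qt At)
  then have Bs: "B $$ (i, j) = B $$ (j, i)" if "i < Suc n" "j < Suc n" for i j
    using that B by (metis carrier_matD index_transpose_mat(1))
  have B0: "B $$ (i, 0) = (if i = 0 then e else 0)" if i: "i < Suc n" for i
  proof -
    have "B = Q * (A * Q)" unfolding B_def using Q A by simp
    then have "B $$ (i, 0) = (\<Sum>l<Suc n. Q $$ (i, l) * (A * Q) $$ (l, 0))"
      using index_mult_mat_sum[of Q "Suc n" "Suc n" "A * Q" "Suc n" i 0] Q A i by auto
    also have "\<dots> = (\<Sum>l<Suc n. Q $$ (i, l) * (e * Q $$ (l, 0)))"
    proof (rule sum.cong[OF refl])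
      fix l assume l: "l \<in> {..<Suc n}"
      then have "(A * Q) $$ (l, 0) = (\<Sum>j<Suc n. A $$ (l, j) * Q $$ (j, 0))"
        using index_mult_mat_sum[of A "Suc n" "Suc n" Q "Suc n" l 0] Q A by auto
      also have "\<dots> = (\<Sum>j<Suc n. A $$ (l, j) * v j)" by (rule sum.cong) (use Qv in auto)
      also have "\<dots> = e * Q $$ (l, 0)" using Av Qv l by auto
      finally show "Q $$ (i, l) * (A * Q) $$ (l, 0) = Q $$ (i, l) * (e * Q $$ (l, 0))" by simp
    qed
    also have "\<dots> = e * (\<Sum>l<Suc n. Q $$ (i, l) * Q $$ (l, 0))" by (simp add: sum_distrib_left algebra_simps)
    also have "(\<Sum>l<Suc n. Q $$ (i, l) * Q $$ (l, 0)) = (Q * Q) $$ (i, 0)"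
      using index_mult_mat_sum[of Q "Suc n" "Suc n" Q "Suc n" i 0] Q(1) i by auto
    also have "\<dots> = (if i = 0 then 1 else 0)" using Q(2) i by auto
    finally show ?thesis by simp
  qed
  define A3 where "A3 = mat n n (\<lambda>(i, j). B $$ (Suc i, Suc j))"
  have A3: "A3 \<in> carrier_mat n n" by (simp add: A3_def)
  obtain U3 d3 where U3: "U3 \<in> carrier_mat n n" "transpose_mat U3 * U3 = 1\<^sub>m n"
    and A3d: "A3 = transpose_mat U3 * mat_diag n d3 * U3"
    using Suc.IH[OF A3] Bs by (auto simp: A3_def)
  define V where "V = four_block_mat (1\<^sub>m 1) (0\<^sub>m 1 n) (0\<^sub>m n 1) U3"
  have V: "V \<in> carrier_mat (Suc n) (Suc n)" unfolding V_def using U3 by auto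
  define d where "d i = (case i of 0 \<Rightarrow> e | Suc j \<Rightarrow> d3 j)" for i
  have Vt: "transpose_mat V = four_block_mat (1\<^sub>m 1) (0\<^sub>m 1 n) (0\<^sub>m n 1) (transpose_mat U3)"
    unfolding V_def by (subst transpose_four_block_mat[of _ 1 1 _ n _ n]) (use U3 in auto)
  have dd: "mat_diag (Suc n) d = four_block_mat (mat 1 1 (\<lambda>_. e)) (0\<^sub>m 1 n) (0\<^sub>m n 1) (mat_diag n d3)"
    by (rule eq_matI) (auto simp: mat_diag_def d_def split: nat.splits)
  have Bb: "B = four_block_mat (mat 1 1 (\<lambda>_. e)) (0\<^sub>m 1 n) (0\<^sub>m n 1) A3"
  proof (rule eq_matI)
    fix i j
    assume "i < dim_row (four_block_mat (mat 1 1 (\<lambda>_. e)) (0\<^sub>m 1 n) (0\<^sub>m n 1) A3)"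
      "j < dim_col (four_block_mat (mat 1 1 (\<lambda>_. e)) (0\<^sub>m 1 n) (0\<^sub>m n 1) A3)"
    then have "i < Suc n" "j < Suc n" using A3 by auto
    then show "B $$ (i, j) = four_block_mat (mat 1 1 (\<lambda>_. e)) (0\<^sub>m 1 n) (0\<^sub>m n 1) A3 $$ (i, j)"
      using B0[of i] B0[of j] Bs[of i j] A3 by (cases i; cases j) (auto simp: A3_def)
  qed (use B A3 in auto)
  have VtV: "transpose_mat V * V = 1\<^sub>m (Suc n)"
    unfolding Vt unfolding V_def
    by (subst mult_four_block_mat[of _ 1 1 _ n _ n _ _ 1 _ n]) (use U3 in auto)
  have BV: "B = transpose_mat V * mat_diag (Suc n) d * V"
    unfolding Vt dd unfolding V_def Bb A3d
    using U3 by (subst block_diag_mult[of _ n] | simp)+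
  have QQ: "Q * (Q * M) = M" if "M \<in> carrier_mat (Suc n) (Suc n)" for M
    using Q that by (simp flip: assoc_mult_mat[of Q "Suc n" "Suc n" Q "Suc n" M "Suc n"])
  have AB: "A = Q * B * Q"
  proof -
    have "Q * B * Q = Q * (Q * (A * (Q * Q)))"
      unfolding B_def using Q(1) A by (simp add: assoc_mult_mat[of _ "Suc n" "Suc n" _ "Suc n" _ "Suc n"])
    also have "\<dots> = A" using Q A QQ by simp
    finally show ?thesis ..
  qed
  show ?case
  proof (intro bexI[of _ "V * Q"] exI[of _ d] conjI)
    show "V * Q \<in> carrier_mat (Suc n) (Suc n)" using V Q by auto
    have t: "transpose_mat (V * Q) = Q * transpose_mat V"
      using V Q by (simp add: transpose_mult Qt)
    have "transpose_mat (V * Q) * (V * Q) = Q * ((transpose_mat V * V) * Q)"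
      unfolding t using V Q(1) by (simp add: assoc_mult_mat[of _ "Suc n" "Suc n" _ "Suc n" _ "Suc n"])
    then show "transpose_mat (V * Q) * (V * Q) = 1\<^sub>m (Suc n)" using VtV Q by simp
    have DV: "mat_diag (Suc n) d * V \<in> carrier_mat (Suc n) (Suc n)"
      using mult_carrier_mat[OF mat_diag_dim V] .
    then have "transpose_mat V * (mat_diag (Suc n) d * V) \<in> carrier_mat (Suc n) (Suc n)"
      using V by auto
    with DV show "A = transpose_mat (V * Q) * mat_diag (Suc n) d * (V * Q)"
      unfolding t unfolding AB unfolding BV
      using V Q(1) by (simp add: assoc_mult_mat[of _ "Suc n" "Suc n" _ "Suc n" _ "Suc n"])
  qed
qed

lemma mat_diag_char_poly: "char_poly (mat_diag n d) = (\<Prod>a\<leftarrow>map d [0..<n]. [:- a, 1:])"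
proof -
  have "char_poly (mat_diag n d) = (\<Prod>a\<leftarrow>diag_mat (mat_diag n d). [:- a, 1:])"
    by (rule char_poly_upper_triangular[of _ n]) (auto simp: mat_diag_def)
  also have "diag_mat (mat_diag n d) = map d [0..<n]"
    by (auto simp: diag_mat_def mat_diag_def)
  finally show ?thesis .
qed

text \<open>This identifies the multiset behind \<open>ordered_eigenvalue\<close> with the diagonal of a
  diagonalized matrix.\<close>

lemma proots_linear_factors: "proots (\<Prod>a\<leftarrow>xs. [:- a, 1:]) = mset (xs :: real list)"
proof (induction xs)
  case (Cons a xs)
  have "(\<Prod>a\<leftarrow>xs. [:- a, 1:]) \<noteq> 0" by (auto simp: prod_list_zero_iff)
  then have "proots ([:- a, 1:] * (\<Prod>a\<leftarrow>xs. [:- a, 1:])) = proots [:- a, 1:] + proots (\<Prod>a\<leftarrow>xs. [:- a, 1:])"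
    by (intro proots_mult) auto
  then show ?case using Cons by (simp del: mult_pCons_left)
qed simp

text \<open>Sorting is a permutation of indices; statements about the \<open>l\<close>-th smallest of
  finitely many numbers are reduced to statements about the numbers themselves.\<close>

lemma sort_reindex:
  fixes d :: "nat \<Rightarrow> real"
  obtains f where "bij_betw f {..<n} {..<n}" "\<And>i. i < n \<Longrightarrow> sort (map d [0..<n]) ! i = d (f i)"
proof -
  have "mset (sort (map d [0..<n])) = mset (map d [0..<n])" by simp
  from permutation_Ex_bij[OF this] obtain f where
    "bij_betw f {..<n} {..<n}" "\<forall>i<n. sort (map d [0..<n]) ! i = map d [0..<n] ! (f i)"
    by auto
  moreover from this have "f i < n" if "i < n" for i
    using that by (auto simp: bij_betw_def)
  ultimately show ?thesis by (intro that[of f]) auto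
qed

lemma mat_diag_quadratic_form:
  fixes y :: "real vec"
  assumes "y \<in> carrier_vec n"
  shows "y \<bullet> (mat_diag n d *\<^sub>v y) = (\<Sum>i<n. d i * (y $ i)\<^sup>2)"
proof -
  have "y \<bullet> (mat_diag n d *\<^sub>v y) = (\<Sum>i<n. y $ i * (mat_diag n d *\<^sub>v y) $ i)"
    using assms by (auto simp: scalar_prod_def lessThan_atLeast0 mat_diag_def)
  also have "\<dots> = (\<Sum>i<n. d i * (y $ i)\<^sup>2)"
  proof (rule sum.cong[OF refl])
    fix i assume i: "i \<in> {..<n}"
    have "(mat_diag n d *\<^sub>v y) $ i = (\<Sum>l<n. mat_diag n d $$ (i, l) * y $ l)"
      by (rule index_mult_mat_vec_sum) (use assms i in auto)
    also have "\<dots> = (\<Sum>l<n. if l = i then d i * y $ i else 0)"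
      by (rule sum.cong) (use i in \<open>auto simp: mat_diag_def\<close>)
    finally show "y $ i * (mat_diag n d *\<^sub>v y) $ i = d i * (y $ i)\<^sup>2"
      using i by (simp add: power2_eq_square)
  qed
  finally show ?thesis .
qed

lemma scalar_prod_self_sum: "x \<in> carrier_vec n \<Longrightarrow> x \<bullet> x = (\<Sum>i<n. (x $ i)\<^sup>2)" for x :: "real vec"
  by (auto simp: scalar_prod_def lessThan_atLeast0 power2_eq_square)

text \<open>The diagonalization with the rows of \<open>U\<close> rearranged so that the diagonal increases.
  This is the form in which the spectral theorem enters the min-max arguments.\<close>

theorem symmetric_mat_spectral_form:
  fixes A :: "real mat"
  assumes A: "A \<in> carrier_mat n n" and sym: "\<And>i j. i < n \<Longrightarrow> j < n \<Longrightarrow> A $$ (i, j) = A $$ (j, i)"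
  obtains U where "U \<in> carrier_mat n n"
    "\<And>x. x \<in> carrier_vec n \<Longrightarrow>
      x \<bullet> (A *\<^sub>v x) = (\<Sum>i<n. ordered_eigenvalue (Suc i) A * ((U *\<^sub>v x) $ i)\<^sup>2)"
    "\<And>x. x \<in> carrier_vec n \<Longrightarrow> (\<Sum>i<n. ((U *\<^sub>v x) $ i)\<^sup>2) = (\<Sum>i<n. (x $ i)\<^sup>2)"
    "\<And>i k. i \<le> k \<Longrightarrow> k < n \<Longrightarrow> ordered_eigenvalue (Suc i) A \<le> ordered_eigenvalue (Suc k) A"
proof -
  obtain V d where V: "V \<in> carrier_mat n n" "transpose_mat V * V = 1\<^sub>m n"
    and Ad: "A = transpose_mat V * mat_diag n d * V"
    using symmetric_mat_diagonalization[OF A sym] by auto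
  have VV: "V * transpose_mat V = 1\<^sub>m n"
    by (rule mat_mult_left_right_inverse[OF _ V(1) V(2)]) (use V in auto)
  have "similar_mat_wit A (mat_diag n d) (transpose_mat V) V"
    unfolding similar_mat_wit_def Let_def using A V VV Ad by auto
  then have "char_poly A = char_poly (mat_diag n d)"
    by (intro char_poly_similar) (auto simp: similar_mat_def)
  then have "proots (char_poly A) = mset (map d [0..<n])"
    unfolding mat_diag_char_poly by (simp only: proots_linear_factors)
  then have oe: "ordered_eigenvalue (Suc i) A = sort (map d [0..<n]) ! i" for i
    unfolding ordered_eigenvalue_def by (simp add: sorted_list_of_multiset_mset del: mset_map)
  obtain f where f: "bij_betw f {..<n} {..<n}" "\<And>i. i < n \<Longrightarrow> sort (map d [0..<n]) ! i = d (f i)"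
    using sort_reindex by metis
  have fn: "f i < n" if "i < n" for i using f(1) that by (auto simp: bij_betw_def)
  define U where "U = mat n n (\<lambda>(i, j). V $$ (f i, j))"
  have Ux: "(U *\<^sub>v x) $ i = (V *\<^sub>v x) $ (f i)" if "x \<in> carrier_vec n" "i < n" for x i
  proof -
    have "(U *\<^sub>v x) $ i = (\<Sum>l<n. U $$ (i, l) * x $ l)"
      by (rule index_mult_mat_vec_sum) (use that in \<open>auto simp: U_def\<close>)
    also have "\<dots> = (\<Sum>l<n. V $$ (f i, l) * x $ l)" using that by (simp add: U_def)
    also have "\<dots> = (V *\<^sub>v x) $ (f i)"
      by (rule index_mult_mat_vec_sum[symmetric]) (use that V fn in auto)
    finally show ?thesis .
  qed
  show ?thesis
  proof (rule that[of U])
    show "U \<in> carrier_mat n n" by (simp add: U_def)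
    fix x :: "real vec" assume x: "x \<in> carrier_vec n"
    have Vx: "V *\<^sub>v x \<in> carrier_vec n" using V x by auto
    have D: "mat_diag n d *\<^sub>v (V *\<^sub>v x) \<in> carrier_vec n" using mult_mat_vec_carrier[OF mat_diag_dim Vx] .
    have "A *\<^sub>v x = transpose_mat V *\<^sub>v (mat_diag n d *\<^sub>v (V *\<^sub>v x))"
      unfolding Ad using V x by (simp add: assoc_mult_mat_vec[of _ n n _ n])
    then have "x \<bullet> (A *\<^sub>v x) = (transpose_mat V *\<^sub>v (mat_diag n d *\<^sub>v (V *\<^sub>v x))) \<bullet> x"
      using x V D by (simp add: comm_scalar_prod[of _ n])
    also have "\<dots> = (mat_diag n d *\<^sub>v (V *\<^sub>v x)) \<bullet> (V *\<^sub>v x)"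
      by (rule transpose_vec_mult_scalar[OF V(1) x D])
    also have "\<dots> = (V *\<^sub>v x) \<bullet> (mat_diag n d *\<^sub>v (V *\<^sub>v x))"
      by (rule comm_scalar_prod[OF D Vx])
    also have "\<dots> = (\<Sum>i<n. d i * ((V *\<^sub>v x) $ i)\<^sup>2)" by (rule mat_diag_quadratic_form[OF Vx])
    also have "\<dots> = (\<Sum>i<n. d (f i) * ((V *\<^sub>v x) $ (f i))\<^sup>2)"
      by (rule sum.reindex_bij_betw[OF f(1), symmetric])
    also have "\<dots> = (\<Sum>i<n. ordered_eigenvalue (Suc i) A * ((U *\<^sub>v x) $ i)\<^sup>2)"
      by (rule sum.cong) (auto simp: oe f(2) Ux x)
    finally show "x \<bullet> (A *\<^sub>v x) = (\<Sum>i<n. ordered_eigenvalue (Suc i) A * ((U *\<^sub>v x) $ i)\<^sup>2)" .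
    have "(\<Sum>i<n. ((U *\<^sub>v x) $ i)\<^sup>2) = (\<Sum>i<n. ((V *\<^sub>v x) $ (f i))\<^sup>2)"
      by (rule sum.cong) (auto simp: Ux x)
    also have "\<dots> = (\<Sum>i<n. ((V *\<^sub>v x) $ i)\<^sup>2)" by (rule sum.reindex_bij_betw[OF f(1)])
    also have "\<dots> = (V *\<^sub>v x) \<bullet> (V *\<^sub>v x)" by (rule scalar_prod_self_sum[OF Vx, symmetric])
    also have "\<dots> = (transpose_mat V *\<^sub>v (V *\<^sub>v x)) \<bullet> x"
      by (rule transpose_vec_mult_scalar[OF V(1) x Vx, symmetric])
    also have "transpose_mat V *\<^sub>v (V *\<^sub>v x) = x"
      using V x by (simp add: assoc_mult_mat_vec[of _ n n _ n, symmetric])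
    finally show "(\<Sum>i<n. ((U *\<^sub>v x) $ i)\<^sup>2) = (\<Sum>i<n. (x $ i)\<^sup>2)"
      using scalar_prod_self_sum[OF x] by simp
  next
    fix i k assume "i \<le> k" "k < n"
    then show "ordered_eigenvalue (Suc i) A \<le> ordered_eigenvalue (Suc k) A"
      unfolding oe by (intro sorted_nth_mono) auto
  qed
qed

section \<open>Ordered eigenvalues and comparison of quadratic forms\<close>

text \<open>Fewer than \<open>n\<close> linear conditions have a nontrivial common solution: padded with
  zero rows they form a singular square matrix.\<close>

lemma exists_nonzero_orthogonal:
  fixes rs :: "real vec list"
  assumes rs: "set rs \<subseteq> carrier_vec n" and len: "length rs < n"
  obtains x where "x \<in> carrier_vec n" "x \<noteq> 0\<^sub>v n" "\<And>v. v \<in> set rs \<Longrightarrow> v \<bullet> x = 0"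
proof -
  define B where "B = mat n n (\<lambda>(i, j). if i < length rs then rs ! i $ j else 0)"
  have B: "B \<in> carrier_mat n n" by (simp add: B_def)
  have "det B = 0"
  proof -
    have "B = mat\<^sub>r n n (\<lambda>i. if i = length rs then 0\<^sub>v n else (if i < length rs then rs ! i else 0\<^sub>v n))"
      by (rule eq_matI) (use len in \<open>auto simp: B_def\<close>)
    also have "det \<dots> = 0"
      by (rule det_row_0[OF len]) (use rs nth_mem in fastforce)
    finally show ?thesis .
  qed
  then obtain x where x: "x \<in> carrier_vec n" "x \<noteq> 0\<^sub>v n" "B *\<^sub>v x = 0\<^sub>v n"
    using det_0_iff_vec_prod_zero_field[OF B] by auto
  show ?thesis
  proof (rule that[OF x(1,2)])
    fix v assume "v \<in> set rs"
    then obtain i where i: "i < length rs" "v = rs ! i" by (auto simp: in_set_conv_nth)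
    have v: "v \<in> carrier_vec n" using rs i by auto
    have "row B i = v" by (rule eq_vecI) (use i len v in \<open>auto simp: B_def\<close>)
    moreover have "(B *\<^sub>v x) $ i = row B i \<bullet> x" using i len B by auto
    ultimately show "v \<bullet> x = 0" using x(3) i len by simp
  qed
qed

text \<open>Dimension count behind the min-max principle: a subspace of codimension \<open>card K\<close>
  and one of codimension \<open>card L\<close> meet nontrivially if the codimensions sum to less
  than \<open>n\<close>.\<close>

lemma exists_common_zero:
  fixes U R :: "real mat"
  assumes U: "U \<in> carrier_mat n n" and R: "R \<in> carrier_mat n n"
    and KL: "finite K" "finite L" "K \<subseteq> {..<n}" "L \<subseteq> {..<n}" "card K + card L < n"
  obtains x where "x \<in> carrier_vec n" "(\<Sum>i<n. (x $ i)\<^sup>2) > 0"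
    "\<And>i. i \<in> K \<Longrightarrow> (U *\<^sub>v x) $ i = 0" "\<And>i. i \<in> L \<Longrightarrow> (R *\<^sub>v x) $ i = 0"
proof -
  define rs where "rs = map (row U) (sorted_list_of_set K) @ map (row R) (sorted_list_of_set L)"
  have "set rs \<subseteq> carrier_vec n" using U R KL by (auto simp: rs_def)
  moreover have "length rs < n" using KL by (simp add: rs_def)
  ultimately obtain x where x: "x \<in> carrier_vec n" "x \<noteq> 0\<^sub>v n" "\<And>v. v \<in> set rs \<Longrightarrow> v \<bullet> x = 0"
    using exists_nonzero_orthogonal by metis
  show ?thesis
  proof (rule that[OF x(1)])
    obtain i where i: "i < n" "x $ i \<noteq> 0"
      using x(1,2) by (metis carrier_vecD eq_vecI index_zero_vec)
    show "(\<Sum>i<n. (x $ i)\<^sup>2) > 0" by (rule sum_pos2[of _ i]) (use i in auto)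
    show "(U *\<^sub>v x) $ i = 0" if "i \<in> K" for i
    proof -
      have "row U i \<in> set rs" using that KL by (auto simp: rs_def)
      then show ?thesis using x(3) that KL U by auto
    qed
    show "(R *\<^sub>v x) $ i = 0" if "i \<in> L" for i
    proof -
      have "row R i \<in> set rs" using that KL by (auto simp: rs_def)
      then show ?thesis using x(3) that KL R by auto
    qed
  qed
qed

text \<open>One half of the Courant-Fischer principle, in the form needed for \<open>A = R\<^sup>T V
  R\<close> with \<open>V\<close> dominated by a diagonal matrix. A vector that is orthogonal to
  the eigenvectors of the \<open>l\<close> smallest eigenvalues and on which the coordinates of
  \<open>R x\<close> with the \<open>n - l - 1\<close> largest weights vanish has \<open>x
  \<bullet> A x\<close> above the eigenvalue and below the \<open>l\<close>-th smallest weight.\<close>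

theorem ordered_eigenvalue_le:
  fixes A R :: "real mat"
  assumes A: "A \<in> carrier_mat n n" and sym: "\<And>i j. i < n \<Longrightarrow> j < n \<Longrightarrow> A $$ (i, j) = A $$ (j, i)"
    and R: "R \<in> carrier_mat n n" and c: "0 \<le> c" and d: "\<And>i. i < n \<Longrightarrow> 0 \<le> d i" and l: "l < n"
    and q: "\<And>x. x \<in> carrier_vec n \<Longrightarrow> x \<bullet> (A *\<^sub>v x) \<le> c * (\<Sum>i<n. d i * ((R *\<^sub>v x) $ i)\<^sup>2)"
    and Rs: "\<And>x. x \<in> carrier_vec n \<Longrightarrow> (\<Sum>i<n. ((R *\<^sub>v x) $ i)\<^sup>2) \<le> s * (\<Sum>i<n. (x $ i)\<^sup>2)"
  shows "ordered_eigenvalue (Suc l) A \<le> c * s * sort (map d [0..<n]) ! l"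
proof -
  obtain U where U: "U \<in> carrier_mat n n"
    and qU: "\<And>x. x \<in> carrier_vec n \<Longrightarrow>
      x \<bullet> (A *\<^sub>v x) = (\<Sum>i<n. ordered_eigenvalue (Suc i) A * ((U *\<^sub>v x) $ i)\<^sup>2)"
    and nU: "\<And>x. x \<in> carrier_vec n \<Longrightarrow> (\<Sum>i<n. ((U *\<^sub>v x) $ i)\<^sup>2) = (\<Sum>i<n. (x $ i)\<^sup>2)"
    and mono: "\<And>i k. i \<le> k \<Longrightarrow> k < n \<Longrightarrow> ordered_eigenvalue (Suc i) A \<le> ordered_eigenvalue (Suc k) A"
    using symmetric_mat_spectral_form[OF A sym] by blast
  obtain f where f: "bij_betw f {..<n} {..<n}" "\<And>i. i < n \<Longrightarrow> sort (map d [0..<n]) ! i = d (f i)"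
    using sort_reindex by metis
  have finj: "inj_on f {..<n}" and fim: "f ` {..<n} = {..<n}" using f(1) by (auto simp: bij_betw_def)
  let ?D = "sort (map d [0..<n]) ! l"
  have D0: "0 \<le> ?D" using f(2)[OF l] d fim l by auto
  \<comment> \<open>\<open>f\<close> lists the weights in increasing order; \<open>L\<close> is the set of the
    positions of the \<open>n - l - 1\<close> largest ones.\<close>
  define L where "L = f ` {Suc l..<n}"
  have "card L = n - Suc l"
    unfolding L_def by (subst card_image) (auto intro: inj_on_subset[OF finj])
  then have "card {..<l} + card L < n" using l by simp
  moreover have sL: "L \<subseteq> {..<n}" unfolding L_def using fim by auto
  moreover have fL: "finite L" unfolding L_def by simp
  ultimately obtain x where x: "x \<in> carrier_vec n" "(\<Sum>i<n. (x $ i)\<^sup>2) > 0"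
    and xU: "\<And>i. i \<in> {..<l} \<Longrightarrow> (U *\<^sub>v x) $ i = 0" and xR: "\<And>i. i \<in> L \<Longrightarrow> (R *\<^sub>v x) $ i = 0"
    using exists_common_zero[OF U R finite_lessThan fL, of l]
    by (metis l lessThan_subset_iff less_imp_le)
  have "ordered_eigenvalue (Suc l) A * (\<Sum>i<n. (x $ i)\<^sup>2)
      = (\<Sum>i<n. ordered_eigenvalue (Suc l) A * ((U *\<^sub>v x) $ i)\<^sup>2)"
    unfolding nU[OF x(1), symmetric] by (rule sum_distrib_left)
  also have "\<dots> \<le> x \<bullet> (A *\<^sub>v x)"
    unfolding qU[OF x(1)]
  proof (rule sum_mono)
    fix i assume "i \<in> {..<n}"
    then show "ordered_eigenvalue (Suc l) A * ((U *\<^sub>v x) $ i)\<^sup>2 \<le> ordered_eigenvalue (Suc i) A * ((U *\<^sub>v x) $ i)\<^sup>2"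
      using xU[of i] mono[of l i] by (cases "i < l") (auto intro: mult_right_mono)
  qed
  also have "\<dots> \<le> c * (\<Sum>i<n. d i * ((R *\<^sub>v x) $ i)\<^sup>2)" by (rule q[OF x(1)])
  also have "\<dots> \<le> c * (\<Sum>i<n. ?D * ((R *\<^sub>v x) $ i)\<^sup>2)"
  proof (intro mult_left_mono sum_mono c)
    fix i assume "i \<in> {..<n}"
    then obtain k where k: "k < n" "i = f k" using fim by (metis imageE lessThan_iff)
    show "d i * ((R *\<^sub>v x) $ i)\<^sup>2 \<le> ?D * ((R *\<^sub>v x) $ i)\<^sup>2"
    proof (cases "k \<le> l")
      case True
      then have "d i \<le> ?D" unfolding k(2) f(2)[OF k(1), symmetric]
        by (intro sorted_nth_mono) (use l in auto)
      then show ?thesis by (intro mult_right_mono) auto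
    next
      case False
      then have "i \<in> L" using k by (auto simp: L_def)
      then show ?thesis using xR by simp
    qed
  qed
  also have "\<dots> = c * ?D * (\<Sum>i<n. ((R *\<^sub>v x) $ i)\<^sup>2)" by (simp add: sum_distrib_left mult.assoc)
  also have "\<dots> \<le> c * ?D * (s * (\<Sum>i<n. (x $ i)\<^sup>2))"
    by (intro mult_left_mono Rs[OF x(1)] mult_nonneg_nonneg c D0)
  finally have "ordered_eigenvalue (Suc l) A * (\<Sum>i<n. (x $ i)\<^sup>2) \<le> (c * s * ?D) * (\<Sum>i<n. (x $ i)\<^sup>2)"
    by (simp add: algebra_simps)
  then show ?thesis using x(2) by simp
qed

text \<open>The complementary half: now the coordinates belonging to the \<open>n - l - 1\<close> largest
  eigenvalues and to the \<open>l\<close> smallest weights are required to vanish.\<close>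

theorem ordered_eigenvalue_ge:
  fixes A R :: "real mat"
  assumes A: "A \<in> carrier_mat n n" and sym: "\<And>i j. i < n \<Longrightarrow> j < n \<Longrightarrow> A $$ (i, j) = A $$ (j, i)"
    and R: "R \<in> carrier_mat n n" and c: "0 \<le> c" and d: "\<And>i. i < n \<Longrightarrow> 0 \<le> d i" and l: "l < n"
    and q: "\<And>x. x \<in> carrier_vec n \<Longrightarrow> c * (\<Sum>i<n. d i * ((R *\<^sub>v x) $ i)\<^sup>2) \<le> x \<bullet> (A *\<^sub>v x)"
    and Rs: "\<And>x. x \<in> carrier_vec n \<Longrightarrow> s * (\<Sum>i<n. (x $ i)\<^sup>2) \<le> (\<Sum>i<n. ((R *\<^sub>v x) $ i)\<^sup>2)"
  shows "c * s * sort (map d [0..<n]) ! l \<le> ordered_eigenvalue (Suc l) A"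
proof -
  obtain U where U: "U \<in> carrier_mat n n"
    and qU: "\<And>x. x \<in> carrier_vec n \<Longrightarrow>
      x \<bullet> (A *\<^sub>v x) = (\<Sum>i<n. ordered_eigenvalue (Suc i) A * ((U *\<^sub>v x) $ i)\<^sup>2)"
    and nU: "\<And>x. x \<in> carrier_vec n \<Longrightarrow> (\<Sum>i<n. ((U *\<^sub>v x) $ i)\<^sup>2) = (\<Sum>i<n. (x $ i)\<^sup>2)"
    and mono: "\<And>i k. i \<le> k \<Longrightarrow> k < n \<Longrightarrow> ordered_eigenvalue (Suc i) A \<le> ordered_eigenvalue (Suc k) A"
    using symmetric_mat_spectral_form[OF A sym] by blast
  obtain f where f: "bij_betw f {..<n} {..<n}" "\<And>i. i < n \<Longrightarrow> sort (map d [0..<n]) ! i = d (f i)"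
    using sort_reindex by metis
  have finj: "inj_on f {..<n}" and fim: "f ` {..<n} = {..<n}" using f(1) by (auto simp: bij_betw_def)
  let ?D = "sort (map d [0..<n]) ! l"
  have D0: "0 \<le> ?D" using f(2)[OF l] d fim l by auto
  define L where "L = f ` {..<l}"
  have "card L = l"
    unfolding L_def by (subst card_image) (use l in \<open>auto intro: inj_on_subset[OF finj]\<close>)
  then have "card {Suc l..<n} + card L < n" using l by simp
  moreover have sL: "L \<subseteq> {..<n}" unfolding L_def using fim l by auto
  moreover have fL: "finite L" unfolding L_def by simp
  ultimately obtain x where x: "x \<in> carrier_vec n" "(\<Sum>i<n. (x $ i)\<^sup>2) > 0"
    and xU: "\<And>i. i \<in> {Suc l..<n} \<Longrightarrow> (U *\<^sub>v x) $ i = 0" and xR: "\<And>i. i \<in> L \<Longrightarrow> (R *\<^sub>v x) $ i = 0"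
    using exists_common_zero[OF U R finite_atLeastLessThan fL, of "Suc l" n]
    by (metis ivl_subset lessThan_atLeast0 le0 order_refl)
  have "(c * s * ?D) * (\<Sum>i<n. (x $ i)\<^sup>2) = c * ?D * (s * (\<Sum>i<n. (x $ i)\<^sup>2))"
    by (simp add: algebra_simps)
  also have "\<dots> \<le> c * ?D * (\<Sum>i<n. ((R *\<^sub>v x) $ i)\<^sup>2)"
    by (intro mult_left_mono Rs[OF x(1)] mult_nonneg_nonneg c D0)
  also have "\<dots> = c * (\<Sum>i<n. ?D * ((R *\<^sub>v x) $ i)\<^sup>2)" by (simp add: sum_distrib_left mult.assoc)
  also have "\<dots> \<le> c * (\<Sum>i<n. d i * ((R *\<^sub>v x) $ i)\<^sup>2)"
  proof (intro mult_left_mono sum_mono c)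
    fix i assume "i \<in> {..<n}"
    then obtain k where k: "k < n" "i = f k" using fim by (metis imageE lessThan_iff)
    show "?D * ((R *\<^sub>v x) $ i)\<^sup>2 \<le> d i * ((R *\<^sub>v x) $ i)\<^sup>2"
    proof (cases "l \<le> k")
      case True
      then have "?D \<le> d i" unfolding k(2) f(2)[OF k(1), symmetric]
        by (intro sorted_nth_mono) (use k in auto)
      then show ?thesis by (intro mult_right_mono) auto
    next
      case False
      then have "i \<in> L" using k by (auto simp: L_def)
      then show ?thesis using xR by simp
    qed
  qed
  also have "\<dots> \<le> x \<bullet> (A *\<^sub>v x)" by (rule q[OF x(1)])
  also have "\<dots> \<le> (\<Sum>i<n. ordered_eigenvalue (Suc l) A * ((U *\<^sub>v x) $ i)\<^sup>2)"
    unfolding qU[OF x(1)]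
  proof (rule sum_mono)
    fix i assume "i \<in> {..<n}"
    then show "ordered_eigenvalue (Suc i) A * ((U *\<^sub>v x) $ i)\<^sup>2 \<le> ordered_eigenvalue (Suc l) A * ((U *\<^sub>v x) $ i)\<^sup>2"
      using xU[of i] mono[of i l] l by (cases "l < i") (auto intro: mult_right_mono)
  qed
  also have "\<dots> = ordered_eigenvalue (Suc l) A * (\<Sum>i<n. (x $ i)\<^sup>2)"
    unfolding nU[OF x(1), symmetric] by (rule sum_distrib_left[symmetric])
  finally show ?thesis using x(2) by simp
qed

section \<open>Extreme eigenvalues and singular values\<close>

lemma ordered_eigenvalue_attained:
  fixes A :: "real mat"
  assumes A: "A \<in> carrier_mat n n" and sym: "\<And>i j. i < n \<Longrightarrow> j < n \<Longrightarrow> A $$ (i, j) = A $$ (j, i)"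
    and l: "l < n"
  obtains x where "x \<in> carrier_vec n" "(\<Sum>i<n. (x $ i)\<^sup>2) > 0"
    "x \<bullet> (A *\<^sub>v x) = ordered_eigenvalue (Suc l) A * (\<Sum>i<n. (x $ i)\<^sup>2)"
proof -
  obtain U where U: "U \<in> carrier_mat n n"
    and qU: "\<And>x. x \<in> carrier_vec n \<Longrightarrow>
      x \<bullet> (A *\<^sub>v x) = (\<Sum>i<n. ordered_eigenvalue (Suc i) A * ((U *\<^sub>v x) $ i)\<^sup>2)"
    and nU: "\<And>x. x \<in> carrier_vec n \<Longrightarrow> (\<Sum>i<n. ((U *\<^sub>v x) $ i)\<^sup>2) = (\<Sum>i<n. (x $ i)\<^sup>2)"
    and mono: "\<And>i k. i \<le> k \<Longrightarrow> k < n \<Longrightarrow> ordered_eigenvalue (Suc i) A \<le> ordered_eigenvalue (Suc k) A"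
    by (rule symmetric_mat_spectral_form[OF A sym]) blast+
  obtain x where x: "x \<in> carrier_vec n" "(\<Sum>i<n. (x $ i)\<^sup>2) > 0"
    and xU: "\<And>i. i \<in> {..<n} - {l} \<Longrightarrow> (U *\<^sub>v x) $ i = 0"
    using exists_common_zero[OF U U, of "{..<n} - {l}" "{}"] l by auto
  have "x \<bullet> (A *\<^sub>v x) = (\<Sum>i<n. ordered_eigenvalue (Suc l) A * ((U *\<^sub>v x) $ i)\<^sup>2)"
    unfolding qU[OF x(1)] by (rule sum.cong) (use xU in \<open>auto\<close>)
  also have "\<dots> = ordered_eigenvalue (Suc l) A * (\<Sum>i<n. (x $ i)\<^sup>2)"
    unfolding nU[OF x(1), symmetric] by (rule sum_distrib_left[symmetric])
  finally show ?thesis using that x by blast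
qed

text \<open>The variational description writes the events \<open>t \<le> \<lambda>\<^sub>1\<close> through
  inequalities in the matrix entries; it serves for measurability as well as for the bounds by
  singular values.\<close>

lemma least_eigenvalue_ge_iff:
  fixes A :: "real mat"
  assumes A: "A \<in> carrier_mat n n" and sym: "\<And>i j. i < n \<Longrightarrow> j < n \<Longrightarrow> A $$ (i, j) = A $$ (j, i)"
    and n: "n > 0"
  shows "t \<le> ordered_eigenvalue 1 A \<longleftrightarrow>
    (\<forall>x\<in>carrier_vec n. t * (\<Sum>i<n. (x $ i)\<^sup>2) \<le> x \<bullet> (A *\<^sub>v x))"
proof
  assume t: "t \<le> ordered_eigenvalue 1 A"
  obtain U where U: "U \<in> carrier_mat n n"
    and qU: "\<And>x. x \<in> carrier_vec n \<Longrightarrow>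
      x \<bullet> (A *\<^sub>v x) = (\<Sum>i<n. ordered_eigenvalue (Suc i) A * ((U *\<^sub>v x) $ i)\<^sup>2)"
    and nU: "\<And>x. x \<in> carrier_vec n \<Longrightarrow> (\<Sum>i<n. ((U *\<^sub>v x) $ i)\<^sup>2) = (\<Sum>i<n. (x $ i)\<^sup>2)"
    and mono: "\<And>i k. i \<le> k \<Longrightarrow> k < n \<Longrightarrow> ordered_eigenvalue (Suc i) A \<le> ordered_eigenvalue (Suc k) A"
    by (rule symmetric_mat_spectral_form[OF A sym]) blast+
  show "\<forall>x\<in>carrier_vec n. t * (\<Sum>i<n. (x $ i)\<^sup>2) \<le> x \<bullet> (A *\<^sub>v x)"
  proof
    fix x :: "real vec" assume x: "x \<in> carrier_vec n"
    show "t * (\<Sum>i<n. (x $ i)\<^sup>2) \<le> x \<bullet> (A *\<^sub>v x)"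
      unfolding qU[OF x] nU[OF x, symmetric] sum_distrib_left
    proof (intro sum_mono mult_right_mono)
      fix i assume "i \<in> {..<n}"
      then show "t \<le> ordered_eigenvalue (Suc i) A" using mono[of 0 i] t by simp
    qed simp
  qed
next
  assume q: "\<forall>x\<in>carrier_vec n. t * (\<Sum>i<n. (x $ i)\<^sup>2) \<le> x \<bullet> (A *\<^sub>v x)"
  obtain x where x: "x \<in> carrier_vec n" "(\<Sum>i<n. (x $ i)\<^sup>2) > 0"
    "x \<bullet> (A *\<^sub>v x) = ordered_eigenvalue 1 A * (\<Sum>i<n. (x $ i)\<^sup>2)"
    using ordered_eigenvalue_attained[OF A sym n] by auto
  then show "t \<le> ordered_eigenvalue 1 A" using q x by auto
qed

lemma greatest_eigenvalue_le_iff: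
  fixes A :: "real mat"
  assumes A: "A \<in> carrier_mat n n" and sym: "\<And>i j. i < n \<Longrightarrow> j < n \<Longrightarrow> A $$ (i, j) = A $$ (j, i)"
    and n: "n > 0"
  shows "ordered_eigenvalue n A \<le> t \<longleftrightarrow>
    (\<forall>x\<in>carrier_vec n. x \<bullet> (A *\<^sub>v x) \<le> t * (\<Sum>i<n. (x $ i)\<^sup>2))"
proof
  assume t: "ordered_eigenvalue n A \<le> t"
  obtain U where U: "U \<in> carrier_mat n n"
    and qU: "\<And>x. x \<in> carrier_vec n \<Longrightarrow>
      x \<bullet> (A *\<^sub>v x) = (\<Sum>i<n. ordered_eigenvalue (Suc i) A * ((U *\<^sub>v x) $ i)\<^sup>2)"
    and nU: "\<And>x. x \<in> carrier_vec n \<Longrightarrow> (\<Sum>i<n. ((U *\<^sub>v x) $ i)\<^sup>2) = (\<Sum>i<n. (x $ i)\<^sup>2)"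
    and mono: "\<And>i k. i \<le> k \<Longrightarrow> k < n \<Longrightarrow> ordered_eigenvalue (Suc i) A \<le> ordered_eigenvalue (Suc k) A"
    by (rule symmetric_mat_spectral_form[OF A sym]) blast+
  show "\<forall>x\<in>carrier_vec n. x \<bullet> (A *\<^sub>v x) \<le> t * (\<Sum>i<n. (x $ i)\<^sup>2)"
  proof
    fix x :: "real vec" assume x: "x \<in> carrier_vec n"
    show "x \<bullet> (A *\<^sub>v x) \<le> t * (\<Sum>i<n. (x $ i)\<^sup>2)"
      unfolding qU[OF x] nU[OF x, symmetric] sum_distrib_left
    proof (intro sum_mono mult_right_mono)
      fix i assume "i \<in> {..<n}"
      then have "i \<le> n - 1" by auto
      then show "ordered_eigenvalue (Suc i) A \<le> t" using mono[of i "n - 1"] t n by simp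
    qed simp
  qed
next
  assume q: "\<forall>x\<in>carrier_vec n. x \<bullet> (A *\<^sub>v x) \<le> t * (\<Sum>i<n. (x $ i)\<^sup>2)"
  obtain x where x: "x \<in> carrier_vec n" "(\<Sum>i<n. (x $ i)\<^sup>2) > 0"
    "x \<bullet> (A *\<^sub>v x) = ordered_eigenvalue n A * (\<Sum>i<n. (x $ i)\<^sup>2)"
    using ordered_eigenvalue_attained[OF A sym, of "n - 1"] n by auto
  then show "ordered_eigenvalue n A \<le> t" using q by (metis mult_le_cancel_right_pos)
qed

lemma quadratic_form_sum:
  fixes A :: "real mat"
  assumes "A \<in> carrier_mat n n" "x \<in> carrier_vec n"
  shows "x \<bullet> (A *\<^sub>v x) = (\<Sum>i<n. \<Sum>j<n. A $$ (i, j) * x $ i * x $ j)"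
proof -
  have "x \<bullet> (A *\<^sub>v x) = (\<Sum>i<n. x $ i * (A *\<^sub>v x) $ i)"
    using assms by (auto simp: scalar_prod_def lessThan_atLeast0)
  also have "\<dots> = (\<Sum>i<n. \<Sum>j<n. A $$ (i, j) * x $ i * x $ j)"
  proof (rule sum.cong[OF refl])
    fix i assume "i \<in> {..<n}"
    then have "(A *\<^sub>v x) $ i = (\<Sum>j<n. A $$ (i, j) * x $ j)"
      using index_mult_mat_vec_sum[of A n n x i] assms by auto
    then show "x $ i * (A *\<^sub>v x) $ i = (\<Sum>j<n. A $$ (i, j) * x $ i * x $ j)"
      by (simp add: sum_distrib_left algebra_simps)
  qed
  finally show ?thesis .
qed

lemma rat_sequence_tendsto:
  fixes r :: real
  obtains s :: "nat \<Rightarrow> rat" where "(\<lambda>k. of_rat (s k)) \<longlonglongrightarrow> r"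
proof -
  have "\<exists>q::rat. dist (of_rat q) r < 1 / real (Suc k)" for k
  proof -
    obtain q where "r < of_rat q" "of_rat q < r + 1 / real (Suc k)"
      using of_rat_dense[of r "r + 1 / real (Suc k)"] by auto
    then show ?thesis by (intro exI[of _ q]) (auto simp: dist_real_def)
  qed
  then obtain s where s: "\<And>k. dist (of_rat (s k :: rat)) r < 1 / real (Suc k)" by metis
  show ?thesis
  proof (rule that[of s], rule metric_tendsto_imp_tendsto)
    show "(\<lambda>k. 1 / real (Suc k)) \<longlonglongrightarrow> 0" by (rule LIMSEQ_Suc[OF lim_1_over_n])
    show "\<forall>\<^sub>F k in sequentially. dist (of_rat (s k)) r \<le> dist (1 / real (Suc k)) 0"
      using s by (intro always_eventually allI) (auto simp: less_imp_le)
  qed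
qed

text \<open>Continuity reduces positivity of a quadratic form to countably many conditions. Rational lists
  of arbitrary length are used as test vectors because they form a countable type; entries beyond
  the length of a list are arbitrary but fixed rationals.\<close>

lemma quadratic_inequality_rational:
  fixes B :: "nat \<Rightarrow> nat \<Rightarrow> real"
  shows "(\<forall>x\<in>carrier_vec n. (0::real) \<le> (\<Sum>i<n. \<Sum>j<n. B i j * x $ i * x $ j)) \<longleftrightarrow>
    (\<forall>q :: rat list. 0 \<le> (\<Sum>i<n. \<Sum>j<n. B i j * of_rat (q ! i) * of_rat (q ! j)))"
proof
  assume r: "\<forall>x\<in>carrier_vec n. (0::real) \<le> (\<Sum>i<n. \<Sum>j<n. B i j * x $ i * x $ j)"
  show "\<forall>q :: rat list. 0 \<le> (\<Sum>i<n. \<Sum>j<n. B i j * of_rat (q ! i) * of_rat (q ! j))"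
  proof
    fix q :: "rat list"
    show "0 \<le> (\<Sum>i<n. \<Sum>j<n. B i j * of_rat (q ! i) * of_rat (q ! j))"
      using r[rule_format, of "vec n (\<lambda>i. of_rat (q ! i))"] by simp
  qed
next
  assume r: "\<forall>q :: rat list. 0 \<le> (\<Sum>i<n. \<Sum>j<n. B i j * of_rat (q ! i) * of_rat (q ! j))"
  show "\<forall>x\<in>carrier_vec n. (0::real) \<le> (\<Sum>i<n. \<Sum>j<n. B i j * x $ i * x $ j)"
  proof
    fix x :: "real vec"
    have "\<exists>s :: nat \<Rightarrow> rat. (\<lambda>k. of_rat (s k)) \<longlonglongrightarrow> x $ i" for i
      using rat_sequence_tendsto by blast
    then obtain s where s: "\<And>i. (\<lambda>k. of_rat (s i k :: rat)) \<longlonglongrightarrow> x $ i" by metis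
    have "(\<lambda>k. \<Sum>i<n. \<Sum>j<n. B i j * of_rat (s i k) * of_rat (s j k)) \<longlonglongrightarrow> (\<Sum>i<n. \<Sum>j<n. B i j * x $ i * x $ j)"
      by (intro tendsto_intros s)
    moreover have "0 \<le> (\<Sum>i<n. \<Sum>j<n. B i j * of_rat (s i k) * of_rat (s j k))" for k
      using r[rule_format, of "map (\<lambda>i. s i k) [0..<n]"] by simp
    ultimately show "0 \<le> (\<Sum>i<n. \<Sum>j<n. B i j * x $ i * x $ j)"
      by (intro LIMSEQ_le_const) auto
  qed
qed

lemma sum_diagonal_quadratic:
  fixes x :: "nat \<Rightarrow> real"
  shows "(\<Sum>i<n. \<Sum>j<n. (if i = j then t else 0) * x i * x j) = t * (\<Sum>i<n. (x i)\<^sup>2)"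
proof -
  have "(\<Sum>j<n. (if i = j then t else 0) * x i * x j) = t * (x i)\<^sup>2" if "i < n" for i
  proof -
    have "(\<Sum>j<n. (if i = j then t else 0) * x i * x j) = (\<Sum>j<n. if j = i then t * (x i)\<^sup>2 else 0)"
      by (rule sum.cong) (auto simp: power2_eq_square)
    then show ?thesis using that by simp
  qed
  then show ?thesis by (simp add: sum_distrib_left)
qed

text \<open>Bounds on the extreme eigenvalues are intersections of countably many conditions on the entries.\<close>

lemma measurable_extreme_eigenvalues:
  fixes A :: "'w \<Rightarrow> real mat"
  assumes A: "\<And>\<omega>. \<omega> \<in> space M \<Longrightarrow> A \<omega> \<in> carrier_mat n n"
    and sym: "\<And>\<omega> i j. \<omega> \<in> space M \<Longrightarrow> i < n \<Longrightarrow> j < n \<Longrightarrow> A \<omega> $$ (i, j) = A \<omega> $$ (j, i)"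
    and n: "n > 0"
    and meas: "\<And>i j. i < n \<Longrightarrow> j < n \<Longrightarrow> (\<lambda>\<omega>. A \<omega> $$ (i, j)) \<in> borel_measurable M"
  shows "(\<lambda>\<omega>. ordered_eigenvalue 1 (A \<omega>)) \<in> borel_measurable M"
    and "(\<lambda>\<omega>. ordered_eigenvalue n (A \<omega>)) \<in> borel_measurable M"
proof -
  let ?D = "\<lambda>t i j. if i = j then t else (0::real)"
  have *: "{\<omega> \<in> space M. \<forall>q :: rat list. 0 \<le> (\<Sum>i<n. \<Sum>j<n. B \<omega> i j * of_rat (q ! i) * of_rat (q ! j))} \<in> sets M"
    if "\<And>i j. i < n \<Longrightarrow> j < n \<Longrightarrow> (\<lambda>\<omega>. B \<omega> i j) \<in> borel_measurable M" for B :: "'w \<Rightarrow> nat \<Rightarrow> nat \<Rightarrow> real"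
  proof (rule sets.sets_Collect_countable_All)
    fix q :: "rat list"
    have "(\<lambda>\<omega>. \<Sum>i<n. \<Sum>j<n. B \<omega> i j * of_rat (q ! i) * of_rat (q ! j)) \<in> borel_measurable M"
      by (intro borel_measurable_sum borel_measurable_times borel_measurable_const that) auto
    then show "{\<omega> \<in> space M. 0 \<le> (\<Sum>i<n. \<Sum>j<n. B \<omega> i j * of_rat (q ! i) * of_rat (q ! j))} \<in> sets M"
      by measurable
  qed
  show "(\<lambda>\<omega>. ordered_eigenvalue 1 (A \<omega>)) \<in> borel_measurable M"
    unfolding borel_measurable_iff_ge
  proof
    fix t :: real
    have eq: "(t \<le> ordered_eigenvalue 1 (A \<omega>)) \<longleftrightarrow>
      (\<forall>q :: rat list. 0 \<le> (\<Sum>i<n. \<Sum>j<n. (A \<omega> $$ (i, j) - ?D t i j) * of_rat (q ! i) * of_rat (q ! j)))"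
      if "\<omega> \<in> space M" for \<omega>
    proof -
      have "(t \<le> ordered_eigenvalue 1 (A \<omega>)) \<longleftrightarrow>
        (\<forall>x\<in>carrier_vec n. 0 \<le> (\<Sum>i<n. \<Sum>j<n. (A \<omega> $$ (i, j) - ?D t i j) * x $ i * x $ j))"
      proof (subst least_eigenvalue_ge_iff[OF A[OF that] _ n], goal_cases)
        case (1 i j)
        then show ?case using sym that by blast
      next
        case 2
        show ?case
        proof (rule ball_cong[OF refl])
        fix x :: "real vec" assume x: "x \<in> carrier_vec n"
        have "(\<Sum>i<n. \<Sum>j<n. (A \<omega> $$ (i, j) - ?D t i j) * x $ i * x $ j) = x \<bullet> (A \<omega> *\<^sub>v x) - t * (\<Sum>i<n. (x $ i)\<^sup>2)"
          unfolding quadratic_form_sum[OF A[OF that] x] sum_diagonal_quadratic[where n=n and t=t and x="\<lambda>i. x $ i", symmetric]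
            sum_subtractf[symmetric] left_diff_distrib ..
        then show "(t * (\<Sum>i<n. (x $ i)\<^sup>2) \<le> x \<bullet> (A \<omega> *\<^sub>v x)) = (0 \<le> (\<Sum>i<n. \<Sum>j<n. (A \<omega> $$ (i, j) - ?D t i j) * x $ i * x $ j))"
          by simp
        qed
      qed
      also have "\<dots> \<longleftrightarrow> (\<forall>q :: rat list. 0 \<le> (\<Sum>i<n. \<Sum>j<n. (A \<omega> $$ (i, j) - ?D t i j) * of_rat (q ! i) * of_rat (q ! j)))"
        by (rule quadratic_inequality_rational)
      finally show ?thesis .
    qed
    have "{\<omega> \<in> space M. t \<le> ordered_eigenvalue 1 (A \<omega>)} = {\<omega> \<in> space M.
      (\<forall>q :: rat list. 0 \<le> (\<Sum>i<n. \<Sum>j<n. (A \<omega> $$ (i, j) - ?D t i j) * of_rat (q ! i) * of_rat (q ! j)))}"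
      by (intro Collect_cong conj_cong refl eq)
    also have "\<dots> \<in> sets M"
      by (rule *) (intro borel_measurable_diff meas borel_measurable_const)
    finally show "{\<omega> \<in> space M. t \<le> ordered_eigenvalue 1 (A \<omega>)} \<in> sets M" .
  qed
  show "(\<lambda>\<omega>. ordered_eigenvalue n (A \<omega>)) \<in> borel_measurable M"
    unfolding borel_measurable_iff_le
  proof
    fix t :: real
    have eq: "(ordered_eigenvalue n (A \<omega>) \<le> t) \<longleftrightarrow>
      (\<forall>q :: rat list. 0 \<le> (\<Sum>i<n. \<Sum>j<n. (?D t i j - A \<omega> $$ (i, j)) * of_rat (q ! i) * of_rat (q ! j)))"
      if "\<omega> \<in> space M" for \<omega>
    proof -
      have "(ordered_eigenvalue n (A \<omega>) \<le> t) \<longleftrightarrow>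
        (\<forall>x\<in>carrier_vec n. 0 \<le> (\<Sum>i<n. \<Sum>j<n. (?D t i j - A \<omega> $$ (i, j)) * x $ i * x $ j))"
      proof (subst greatest_eigenvalue_le_iff[OF A[OF that] _ n], goal_cases)
        case (1 i j)
        then show ?case using sym that by blast
      next
        case 2
        show ?case
        proof (rule ball_cong[OF refl])
        fix x :: "real vec" assume x: "x \<in> carrier_vec n"
        have "(\<Sum>i<n. \<Sum>j<n. (?D t i j - A \<omega> $$ (i, j)) * x $ i * x $ j) = t * (\<Sum>i<n. (x $ i)\<^sup>2) - x \<bullet> (A \<omega> *\<^sub>v x)"
          unfolding quadratic_form_sum[OF A[OF that] x] sum_diagonal_quadratic[where n=n and t=t and x="\<lambda>i. x $ i", symmetric]
            sum_subtractf[symmetric] left_diff_distrib ..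
        then show "(x \<bullet> (A \<omega> *\<^sub>v x) \<le> t * (\<Sum>i<n. (x $ i)\<^sup>2)) = (0 \<le> (\<Sum>i<n. \<Sum>j<n. (?D t i j - A \<omega> $$ (i, j)) * x $ i * x $ j))"
          by simp
        qed
      qed
      also have "\<dots> \<longleftrightarrow> (\<forall>q :: rat list. 0 \<le> (\<Sum>i<n. \<Sum>j<n. (?D t i j - A \<omega> $$ (i, j)) * of_rat (q ! i) * of_rat (q ! j)))"
        by (rule quadratic_inequality_rational)
      finally show ?thesis .
    qed
    have "{\<omega> \<in> space M. ordered_eigenvalue n (A \<omega>) \<le> t} = {\<omega> \<in> space M.
      (\<forall>q :: rat list. 0 \<le> (\<Sum>i<n. \<Sum>j<n. (?D t i j - A \<omega> $$ (i, j)) * of_rat (q ! i) * of_rat (q ! j)))}"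
      by (intro Collect_cong conj_cong refl eq)
    also have "\<dots> \<in> sets M"
      by (rule *) (intro borel_measurable_diff meas borel_measurable_const)
    finally show "{\<omega> \<in> space M. ordered_eigenvalue n (A \<omega>) \<le> t} \<in> sets M" .
  qed
qed

lemma gram_mat_entry:
  fixes P :: "real mat"
  assumes "P \<in> carrier_mat n n" "i < n" "j < n"
  shows "(transpose_mat P * P) $$ (i, j) = (\<Sum>l<n. P $$ (l, i) * P $$ (l, j))"
proof -
  have "(transpose_mat P * P) $$ (i, j) = (\<Sum>l<n. transpose_mat P $$ (i, l) * P $$ (l, j))"
    by (rule index_mult_mat_sum) (use assms in auto)
  then show ?thesis using assms by simp
qed

lemma measurable_extreme_singular_values:
  fixes P :: "'w \<Rightarrow> real mat"
  assumes P: "\<And>\<omega>. \<omega> \<in> space M \<Longrightarrow> P \<omega> \<in> carrier_mat n n" and n: "n > 0"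
    and meas: "\<And>i j. i < n \<Longrightarrow> j < n \<Longrightarrow> (\<lambda>\<omega>. P \<omega> $$ (i, j)) \<in> borel_measurable M"
  shows "(\<lambda>\<omega>. ordered_singular_value 1 (P \<omega>)) \<in> borel_measurable M"
    and "(\<lambda>\<omega>. ordered_singular_value n (P \<omega>)) \<in> borel_measurable M"
proof -
  have c: "transpose_mat (P \<omega>) * P \<omega> \<in> carrier_mat n n" if "\<omega> \<in> space M" for \<omega>
    using P[OF that] by auto
  have s: "(transpose_mat (P \<omega>) * P \<omega>) $$ (i, j) = (transpose_mat (P \<omega>) * P \<omega>) $$ (j, i)"
    if "\<omega> \<in> space M" "i < n" "j < n" for \<omega> i j
    unfolding gram_mat_entry[OF P[OF that(1)] that(2,3)] gram_mat_entry[OF P[OF that(1)] that(3,2)]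
    by (simp add: mult.commute)
  have m: "(\<lambda>\<omega>. (transpose_mat (P \<omega>) * P \<omega>) $$ (i, j)) \<in> borel_measurable M" if "i < n" "j < n" for i j
  proof -
    have "(\<lambda>\<omega>. \<Sum>l<n. P \<omega> $$ (l, i) * P \<omega> $$ (l, j)) \<in> borel_measurable M"
      by (intro borel_measurable_sum borel_measurable_times meas) (use that in auto)
    then show ?thesis
      by (subst measurable_cong[where g = "\<lambda>\<omega>. \<Sum>l<n. P \<omega> $$ (l, i) * P \<omega> $$ (l, j)"])
        (use gram_mat_entry[OF P] that in auto)
  qed
  have [measurable]: "(\<lambda>\<omega>. ordered_eigenvalue 1 (transpose_mat (P \<omega>) * P \<omega>)) \<in> borel_measurable M"
    "(\<lambda>\<omega>. ordered_eigenvalue n (transpose_mat (P \<omega>) * P \<omega>)) \<in> borel_measurable M"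
    using measurable_extreme_eigenvalues[of M "\<lambda>\<omega>. transpose_mat (P \<omega>) * P \<omega>" n] c s n m
    by blast+
  show "(\<lambda>\<omega>. ordered_singular_value 1 (P \<omega>)) \<in> borel_measurable M"
    "(\<lambda>\<omega>. ordered_singular_value n (P \<omega>)) \<in> borel_measurable M"
    unfolding ordered_singular_value_def by measurable
qed

text \<open>The singular values are defined through \<open>P\<^sup>T P\<close>, while the inequalities are
  about \<open>P P\<^sup>T\<close>. The two matrices have the same characteristic polynomial, and
  \<open>P P\<^sup>T\<close> is positive definite for invertible \<open>P\<close>.\<close>

theorem singular_value_bounds:
  fixes P :: "real mat"
  assumes P: "P \<in> carrier_mat n n" "invertible_mat P" and n: "n > 0"
  shows "ordered_singular_value 1 P > 0" "ordered_singular_value n P > 0"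
    and "\<And>x. x \<in> carrier_vec n \<Longrightarrow>
      (ordered_singular_value 1 P)\<^sup>2 * (\<Sum>i<n. (x $ i)\<^sup>2) \<le> (\<Sum>i<n. ((transpose_mat P *\<^sub>v x) $ i)\<^sup>2)"
    and "\<And>x. x \<in> carrier_vec n \<Longrightarrow>
      (\<Sum>i<n. ((transpose_mat P *\<^sub>v x) $ i)\<^sup>2) \<le> (ordered_singular_value n P)\<^sup>2 * (\<Sum>i<n. (x $ i)\<^sup>2)"
proof -
  obtain B where B: "inverts_mat P B" "inverts_mat B P" using P by (auto simp: invertible_mat_def)
  have "dim_col B = n" "dim_row B = n"
    using B P unfolding inverts_mat_def by (metis carrier_matD index_mult_mat(2,3) index_one_mat(2,3))+
  then have Bc: "B \<in> carrier_mat n n" by auto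
  have PB: "P * B = 1\<^sub>m n" "B * P = 1\<^sub>m n" using B Bc P unfolding inverts_mat_def by auto
  let ?G = "P * transpose_mat P"
  have G: "?G \<in> carrier_mat n n" using P by auto
  have Geq: "?G = P * (transpose_mat P * P) * B"
  proof -
    have "P * (transpose_mat P * P) * B = P * transpose_mat P * P * B"
      using assoc_mult_mat[of P n n "transpose_mat P" n P n] P(1) by auto
    also have "\<dots> = P * transpose_mat P * (P * B)"
      by (rule assoc_mult_mat[OF G P(1) Bc])
    finally show ?thesis unfolding PB(1) using right_mult_one_mat[OF G] by metis
  qed
  have "similar_mat_wit ?G (transpose_mat P * P) P B"
    unfolding similar_mat_wit_def Let_def using P(1) Bc PB
    using Geq G by (metis (no_types, lifting) carrier_matD(1) empty_subsetI insert_subset mult_carrier_mat transpose_carrier_mat)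
  then have "char_poly ?G = char_poly (transpose_mat P * P)"
    by (intro char_poly_similar) (auto simp: similar_mat_def)
  then have osv: "ordered_singular_value l P = sqrt (ordered_eigenvalue l ?G)" for l
    unfolding ordered_singular_value_def ordered_eigenvalue_def by simp
  have q: "x \<bullet> (?G *\<^sub>v x) = (\<Sum>i<n. ((transpose_mat P *\<^sub>v x) $ i)\<^sup>2)" if x: "x \<in> carrier_vec n" for x
  proof -
    have Px: "transpose_mat P *\<^sub>v x \<in> carrier_vec n" using P x by auto
    have "x \<bullet> (?G *\<^sub>v x) = x \<bullet> (P *\<^sub>v (transpose_mat P *\<^sub>v x))"
      using assoc_mult_mat_vec[of P n n "transpose_mat P" n x] P(1) x by auto
    also have "\<dots> = (transpose_mat P *\<^sub>v x) \<bullet> (transpose_mat P *\<^sub>v x)"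
      by (rule transpose_vec_mult_scalar[OF P(1) Px x, symmetric])
    also have "\<dots> = (\<Sum>i<n. ((transpose_mat P *\<^sub>v x) $ i)\<^sup>2)" by (rule scalar_prod_self_sum[OF Px])
    finally show ?thesis .
  qed
  have sym: "?G $$ (i, j) = ?G $$ (j, i)" if "i < n" "j < n" for i j
    using index_mult_mat_sum[of P n n "transpose_mat P" n i j] index_mult_mat_sum[of P n n "transpose_mat P" n j i] that P
    by (auto simp: mult.commute)
  have pos: "ordered_eigenvalue (Suc l) ?G > 0" if "l < n" for l
  proof -
    obtain x where x: "x \<in> carrier_vec n" "(\<Sum>i<n. (x $ i)\<^sup>2) > 0"
      "x \<bullet> (?G *\<^sub>v x) = ordered_eigenvalue (Suc l) ?G * (\<Sum>i<n. (x $ i)\<^sup>2)"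
      using ordered_eigenvalue_attained[OF G sym \<open>l < n\<close>] by auto
    have "transpose_mat P *\<^sub>v x \<noteq> 0\<^sub>v n"
    proof
      assume "transpose_mat P *\<^sub>v x = 0\<^sub>v n"
      then have "transpose_mat B *\<^sub>v (transpose_mat P *\<^sub>v x) = 0\<^sub>v n" using Bc by auto
      moreover have "transpose_mat B *\<^sub>v (transpose_mat P *\<^sub>v x) = transpose_mat (P * B) *\<^sub>v x"
        unfolding transpose_mult[OF P(1) Bc]
        using Bc P(1) x by (intro assoc_mult_mat_vec[symmetric]) auto
      ultimately have "x = 0\<^sub>v n" using PB x by simp
      then show False using x(2) by simp
    qed
    moreover have "transpose_mat P *\<^sub>v x \<in> carrier_vec n" using P x by auto
    ultimately obtain i where "i < n" "(transpose_mat P *\<^sub>v x) $ i \<noteq> 0"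
      by (metis carrier_vecD eq_vecI index_zero_vec)
    then have "(\<Sum>i<n. ((transpose_mat P *\<^sub>v x) $ i)\<^sup>2) > 0"
      by (intro sum_pos2[of _ i]) auto
    then show ?thesis using x q[OF x(1)] by (simp add: zero_less_mult_iff)
  qed
  have p1: "ordered_eigenvalue 1 ?G > 0" and pn: "ordered_eigenvalue n ?G > 0"
    using pos[of 0] pos[of "n - 1"] n by auto
  then show "ordered_singular_value 1 P > 0" "ordered_singular_value n P > 0"
    unfolding osv by auto
  fix x :: "real vec" assume x: "x \<in> carrier_vec n"
  show "(ordered_singular_value 1 P)\<^sup>2 * (\<Sum>i<n. (x $ i)\<^sup>2) \<le> (\<Sum>i<n. ((transpose_mat P *\<^sub>v x) $ i)\<^sup>2)"
    using least_eigenvalue_ge_iff[OF G sym n, of "ordered_eigenvalue 1 ?G"] x p1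
    unfolding osv by (simp add: q del: One_nat_def)
  show "(\<Sum>i<n. ((transpose_mat P *\<^sub>v x) $ i)\<^sup>2) \<le> (ordered_singular_value n P)\<^sup>2 * (\<Sum>i<n. (x $ i)\<^sup>2)"
    using greatest_eigenvalue_le_iff[OF G sym n, of "ordered_eigenvalue n ?G"] x pn
    by (simp add: osv q)
qed

section \<open>The refinement equation of a multiresolution analysis\<close>

lemma L2_mult_integrable:
  assumes "f \<in> L2" "g \<in> L2"
  shows "integrable lborel (\<lambda>t. f t * g t)"
proof (rule Bochner_Integration.integrable_bound)
  show "integrable lborel (\<lambda>t. (f t)\<^sup>2 + (g t)\<^sup>2)"
    using assms by (auto simp: L2_def)
  show "(\<lambda>t. f t * g t) \<in> borel_measurable lborel"
    using assms by (auto simp: L2_def)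
  show "AE t in lborel. norm (f t * g t) \<le> norm ((f t)\<^sup>2 + (g t)\<^sup>2)"
  proof (rule AE_I2)
    fix t
    have "2 * (\<bar>f t\<bar> * \<bar>g t\<bar>) \<le> (f t)\<^sup>2 + (g t)\<^sup>2"
      using sum_squares_bound[of "\<bar>f t\<bar>" "\<bar>g t\<bar>"] by (simp add: mult.assoc)
    moreover have "0 \<le> \<bar>f t\<bar> * \<bar>g t\<bar>" by simp
    ultimately have "\<bar>f t\<bar> * \<bar>g t\<bar> \<le> (f t)\<^sup>2 + (g t)\<^sup>2" by linarith
    then show "norm (f t * g t) \<le> norm ((f t)\<^sup>2 + (g t)\<^sup>2)"
      by (simp add: abs_mult)
  qed
qed

lemma L2_add: "f \<in> L2 \<Longrightarrow> g \<in> L2 \<Longrightarrow> (\<lambda>t. f t + g t) \<in> L2"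
proof -
  assume fg: "f \<in> L2" "g \<in> L2"
  have "integrable lborel (\<lambda>t. (f t)\<^sup>2 + 2 * (f t * g t) + (g t)\<^sup>2)"
    using L2_mult_integrable[OF fg] fg by (auto simp: L2_def)
  then show ?thesis using fg by (auto simp: L2_def power2_sum algebra_simps)
qed

lemma L2_cmult: "f \<in> L2 \<Longrightarrow> (\<lambda>t. c * f t) \<in> L2"
  by (auto simp: L2_def power_mult_distrib)

lemma L2_zero: "(\<lambda>t. 0) \<in> L2"
  by (auto simp: L2_def)

lemma L2_sum: "(\<And>k. k \<in> K \<Longrightarrow> f k \<in> L2) \<Longrightarrow> (\<lambda>t. \<Sum>k\<in>K. f k t) \<in> L2"
  by (induction K rule: infinite_finite_induct) (auto simp: L2_zero intro!: L2_add)

lemma L2_diff: "f \<in> L2 \<Longrightarrow> g \<in> L2 \<Longrightarrow> (\<lambda>t. f t - g t) \<in> L2"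
  using L2_add[of f "\<lambda>t. (-1) * g t"] L2_cmult[of g "-1"] by simp

lemma L2_affine:
  assumes "f \<in> L2" "c \<noteq> 0"
  shows "(\<lambda>t. f (b + c * t)) \<in> L2"
proof -
  have "integrable lborel (\<lambda>t. (f t)\<^sup>2)" using assms by (auto simp: L2_def)
  from lborel_integrable_real_affine[OF this assms(2), of b]
  show ?thesis using assms by (auto simp: L2_def)
qed

lemma L2_inner_sum_left:
  assumes "\<And>k. k \<in> K \<Longrightarrow> e k \<in> L2" "g \<in> L2"
  shows "L2_inner (\<lambda>t. \<Sum>k\<in>K. c k * e k t) g = (\<Sum>k\<in>K. c k * L2_inner (e k) g)"
proof -
  have "L2_inner (\<lambda>t. \<Sum>k\<in>K. c k * e k t) g = (\<integral>t. (\<Sum>k\<in>K. c k * (e k t * g t)) \<partial>lborel)"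
    unfolding L2_inner_def by (intro Bochner_Integration.integral_cong refl) (simp add: sum_distrib_right mult.assoc)
  also have "\<dots> = (\<Sum>k\<in>K. \<integral>t. c k * (e k t * g t) \<partial>lborel)"
    by (intro Bochner_Integration.integral_sum integrable_mult_right L2_mult_integrable assms) auto
  finally show ?thesis by (simp add: L2_inner_def)
qed

lemma L2_inner_sym: "L2_inner f g = L2_inner g f"
  by (simp add: L2_inner_def mult.commute)

text \<open>A vector with only finitely many nonzero coefficients equals its finite orthonormal expansion:
  the remainder is orthogonal to all basis vectors, so that its norm is a lower bound for the
  distance from every finite combination, and this distance can be made arbitrarily small.\<close>

lemma L2_orthogonal_projection_exact:
  fixes e :: "int \<Rightarrow> real \<Rightarrow> real"
  assumes ob: "orthonormal_basis_of e V" and V: "V \<subseteq> L2" and f: "f \<in> V"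
    and K: "finite K" and c: "\<And>k. k \<notin> K \<Longrightarrow> L2_inner f (e k) = 0"
  shows "AE t in lborel. f t = (\<Sum>k\<in>K. L2_inner f (e k) * e k t)"
proof -
  have e2: "e k \<in> L2" for k using ob V by (auto simp: orthonormal_basis_of_def)
  have f2: "f \<in> L2" using f V by auto
  have on: "L2_inner (e k) (e l) = (if k = l then 1 else 0)" for k l
    using ob by (auto simp: orthonormal_basis_of_def)
  let ?c = "\<lambda>k. L2_inner f (e k)"
  define r where "r t = f t - (\<Sum>k\<in>K. ?c k * e k t)" for t
  have r2: "r \<in> L2" unfolding r_def by (intro L2_diff f2 L2_sum L2_cmult e2)
  have re: "L2_inner r (e k) = 0" for k
  proof -
    have "L2_inner r (e k) = (\<integral>t. f t * e k t - (\<Sum>l\<in>K. ?c l * e l t) * e k t \<partial>lborel)"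
      unfolding L2_inner_def r_def by (simp add: left_diff_distrib)
    also have "\<dots> = ?c k - L2_inner (\<lambda>t. \<Sum>l\<in>K. ?c l * e l t) (e k)"
      unfolding L2_inner_def
      by (intro Bochner_Integration.integral_diff L2_mult_integrable f2 e2 L2_sum L2_cmult)
    also have "\<dots> = ?c k - (\<Sum>l\<in>K. if l = k then ?c k else 0)"
      by (subst L2_inner_sum_left[OF e2 e2]) (auto simp: on intro!: sum.cong)
    also have "\<dots> = 0" using K c[of k] by auto
    finally show ?thesis .
  qed
  have small: "(\<integral>t. (r t)\<^sup>2 \<partial>lborel) < \<epsilon>" if "\<epsilon> > 0" for \<epsilon>
  proof -
    have "f \<in> L2_closure {(\<lambda>t. \<Sum>k\<in>K. c k * e k t) | K c. finite K}"
      using ob f by (auto simp: orthonormal_basis_of_def)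
    then obtain g where "g \<in> {(\<lambda>t. \<Sum>k\<in>K. c k * e k t) | K c. finite K}" "(\<integral>t. (f t - g t)\<^sup>2 \<partial>lborel) < \<epsilon>"
      unfolding L2_closure_def using \<open>\<epsilon> > 0\<close> by blast
    then obtain K' d where K': "finite K'" and d: "(\<integral>t. (f t - (\<Sum>k\<in>K'. d k * e k t))\<^sup>2 \<partial>lborel) < \<epsilon>"
      by blast
    \<comment> \<open>The difference between the expansion of \<open>f\<close> and a given finite combination; it is
      orthogonal to \<open>r\<close>.\<close>
    define b where "b k = (if k \<in> K then ?c k else 0) - (if k \<in> K' then d k else 0)" for k
    define h where "h t = (\<Sum>k\<in>K \<union> K'. b k * e k t)" for t
    have h2: "h \<in> L2" unfolding h_def by (intro L2_sum L2_cmult e2)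
    have hr: "f t - (\<Sum>k\<in>K'. d k * e k t) = r t + h t" for t
    proof -
      have "h t = (\<Sum>k\<in>K \<union> K'. (if k \<in> K then ?c k * e k t else 0)) - (\<Sum>k\<in>K \<union> K'. (if k \<in> K' then d k * e k t else 0))"
        unfolding h_def b_def sum_subtractf[symmetric] by (rule sum.cong) (auto simp: algebra_simps)
      also have "(\<Sum>k\<in>K \<union> K'. (if k \<in> K then ?c k * e k t else 0)) = (\<Sum>k\<in>K. ?c k * e k t)"
        by (rule sum.mono_neutral_cong_right) (use K K' in auto)
      also have "(\<Sum>k\<in>K \<union> K'. (if k \<in> K' then d k * e k t else 0)) = (\<Sum>k\<in>K'. d k * e k t)"
        by (rule sum.mono_neutral_cong_right) (use K K' in auto)
      finally show ?thesis by (simp add: r_def)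
    qed
    have "L2_inner h r = 0"
      unfolding h_def by (subst L2_inner_sum_left[OF e2 r2]) (simp add: re L2_inner_sym[of _ r])
    then have i0: "(\<integral>t. h t * r t \<partial>lborel) = 0" by (simp add: L2_inner_def)
    have "(\<integral>t. (f t - (\<Sum>k\<in>K'. d k * e k t))\<^sup>2 \<partial>lborel) = (\<integral>t. ((r t)\<^sup>2 + 2 * (h t * r t)) + (h t)\<^sup>2 \<partial>lborel)"
      unfolding hr by (intro Bochner_Integration.integral_cong refl) (simp add: power2_sum)
    also have "\<dots> = (\<integral>t. (r t)\<^sup>2 \<partial>lborel) + 2 * 0 + (\<integral>t. (h t)\<^sup>2 \<partial>lborel)"
      using L2_mult_integrable[OF h2 r2] r2 h2 unfolding i0[symmetric]
      by (subst Bochner_Integration.integral_add) (auto simp: L2_def)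
    finally have "(\<integral>t. (r t)\<^sup>2 \<partial>lborel) \<le> (\<integral>t. (f t - (\<Sum>k\<in>K'. d k * e k t))\<^sup>2 \<partial>lborel)"
      by simp
    with d show ?thesis by simp
  qed
  have "(\<integral>t. (r t)\<^sup>2 \<partial>lborel) = 0"
  proof (rule antisym)
    show "(\<integral>t. (r t)\<^sup>2 \<partial>lborel) \<le> 0"
      using small by (meson less_irrefl not_le_imp_less)
  qed simp
  then have "AE t in lborel. (r t)\<^sup>2 = 0"
    using r2 by (subst (asm) integral_nonneg_eq_0_iff_AE) (auto simp: L2_def)
  then show ?thesis by eventually_elim (simp add: r_def)
qed

lemma compactly_supported_bound:
  assumes "compactly_supported f"
  obtains R :: nat where "R \<ge> 1" "\<And>t. \<bar>t\<bar> > real R \<Longrightarrow> f t = 0"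
proof -
  have "bounded (closure {t. f t \<noteq> 0})"
    using assms unfolding compactly_supported_def by (rule compact_imp_bounded)
  then obtain B where B: "\<And>t. t \<in> closure {t. f t \<noteq> 0} \<Longrightarrow> norm t \<le> B"
    unfolding bounded_iff by blast
  obtain R :: nat where R: "real R \<ge> max B 1" using real_arch_simple by blast
  have "f t = 0" if "\<bar>t\<bar> > real R" for t
  proof (rule ccontr)
    assume "f t \<noteq> 0"
    then have "t \<in> closure {t. f t \<noteq> 0}" using closure_subset by fastforce
    then have "norm t \<le> B" by (rule B)
    then show False using that R by simp
  qed
  then show ?thesis using that[of R] R by simp
qed

lemma mra_shift_L2:
  assumes "multiresolution_analysis V \<phi>"
  shows "\<phi> \<in> L2" "\<phi> \<in> V 0" "V 0 \<subseteq> L2"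
    "L2_inner (\<lambda>t. \<phi> (t - of_int k)) (\<lambda>t. \<phi> (t - of_int l)) = (if k = l then 1 else 0)"
proof -
  have o: "orthonormal_basis_of (\<lambda>k t. \<phi> (t - of_int k)) (V 0)" and s: "L2_closed_subspace (V 0)"
    using assms by (auto simp: multiresolution_analysis_def)
  then have "(\<lambda>t. \<phi> (t - of_int 0)) \<in> V 0" unfolding orthonormal_basis_of_def by blast
  then show "\<phi> \<in> V 0" by simp
  show "V 0 \<subseteq> L2" using s by (simp add: L2_closed_subspace_def)
  with \<open>\<phi> \<in> V 0\<close> show "\<phi> \<in> L2" by blast
  show "L2_inner (\<lambda>t. \<phi> (t - of_int k)) (\<lambda>t. \<phi> (t - of_int l)) = (if k = l then 1 else 0)"
    using o unfolding orthonormal_basis_of_def by blast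
qed

text \<open>The function \<open>\<phi>(t/2)\<close> lies in \<open>V 0\<close>, and by compact support only
  finitely many of its coefficients in the basis of translates are nonzero.\<close>

lemma refinement_equation:
  fixes \<phi> :: "real \<Rightarrow> real" and R :: nat
  assumes mra: "multiresolution_analysis V \<phi>" and R: "\<And>t. \<bar>t\<bar> > real R \<Longrightarrow> \<phi> t = 0"
  obtains K :: "int set" and c where "finite K"
    "AE t in lborel. \<phi> (t / 2) = (\<Sum>k\<in>K. c k * \<phi> (t - of_int k))"
proof -
  define f where "f t = \<phi> (t / 2)" for t
  have o: "orthonormal_basis_of (\<lambda>k t. \<phi> (t - of_int k)) (V 0)"
    using mra by (auto simp: multiresolution_analysis_def)
  have "V ((-1) + 1) \<subseteq> V (-1)"
    using mra unfolding multiresolution_analysis_def by blast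
  then have "\<phi> \<in> V (-1)" using mra_shift_L2(2)[OF mra] by auto
  then have "(\<lambda>t. \<phi> (2 powi (-1) * t)) \<in> V 0"
    using mra unfolding multiresolution_analysis_def by blast
  then have f: "f \<in> V 0" by (simp add: f_def[abs_def] field_simps power_int_minus)
  have z: "L2_inner f (\<lambda>t. \<phi> (t - of_int k)) = 0" if "k \<notin> {- 3 * int R..3 * int R}" for k
  proof -
    have "f t * \<phi> (t - of_int k) = 0" for t
    proof (cases "\<bar>t / 2\<bar> > real R \<or> \<bar>t - of_int k\<bar> > real R")
      case True
      then show ?thesis using R by (auto simp: f_def)
    next
      case False
      then have "\<bar>of_int k\<bar> \<le> 3 * real R" by linarith
      then have "\<bar>k\<bar> \<le> 3 * int R" by linarith
      then show ?thesis using that by auto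
    qed
    then have "(\<lambda>t. f t * \<phi> (t - of_int k)) = (\<lambda>_. 0)" by (rule ext)
    then show ?thesis unfolding L2_inner_def by (simp only: Bochner_Integration.integral_zero)
  qed
  have "AE t in lborel. f t = (\<Sum>k\<in>{- 3 * int R..3 * int R}. L2_inner f (\<lambda>t. \<phi> (t - of_int k)) * \<phi> (t - of_int k))"
    by (rule L2_orthogonal_projection_exact[OF o mra_shift_L2(3)[OF mra] f _ z]) auto
  then show ?thesis
    by (intro that[of "{- 3 * int R..3 * int R}" "\<lambda>k. L2_inner f (\<lambda>t. \<phi> (t - of_int k))"]) (auto simp: f_def)
qed

text \<open>The left-hand side collects the pairs of coefficients that are tested by orthogonality of
  \<open>\<phi>(t/2)\<close> to its translates by even integers.\<close>

lemma sum_indicator_parity: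
  fixes c :: "int \<Rightarrow> real"
  assumes "finite K"
  shows "(\<Sum>k\<in>K. \<Sum>k'\<in>K. if even (k - k') then c k * c k' else 0) =
    (\<Sum>k\<in>{k\<in>K. even k}. c k)\<^sup>2 + (\<Sum>k\<in>{k\<in>K. odd k}. c k)\<^sup>2"
proof -
  have "(\<Sum>k\<in>K. \<Sum>k'\<in>K. if even (k - k') then c k * c k' else 0) =
     (\<Sum>k\<in>K. \<Sum>k'\<in>K. (if even k then c k else 0) * (if even k' then c k' else 0) +
       (if odd k then c k else 0) * (if odd k' then c k' else 0))"
    by (intro sum.cong refl) auto
  also have "\<dots> = (\<Sum>k\<in>K. if even k then c k else 0)\<^sup>2 + (\<Sum>k\<in>K. if odd k then c k else 0)\<^sup>2"
    by (simp only: sum.distrib sum_product[symmetric] power2_eq_square)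
  also have "(\<Sum>k\<in>K. if even k then c k else 0) = (\<Sum>k\<in>{k\<in>K. even k}. c k)"
    using assms by (simp add: sum.If_cases Int_def)
  also have "(\<Sum>k\<in>K. if odd k then c k else 0) = (\<Sum>k\<in>{k\<in>K. odd k}. c k)"
    using assms by (simp add: sum.inter_filter[symmetric])
  finally show ?thesis .
qed

text \<open>Let \<open>e\<close> and \<open>o\<close> be the two sums. Integrating the refinement equation
  gives \<open>e + o = 2\<close>. Orthonormality of the translates, summed over all even shifts,
  gives \<open>e\<^sup>2 + o\<^sup>2 = 2\<close>. Therefore \<open>(e - o)\<^sup>2 = 0\<close>.\<close>

lemma refinement_coefficients:
  fixes \<phi> :: "real \<Rightarrow> real"
  assumes mra: "multiresolution_analysis V \<phi>" and K: "finite K"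
    and ref: "AE t in lborel. \<phi> (t / 2) = (\<Sum>k\<in>K. c k * \<phi> (t - of_int k))"
    and int: "integrable lborel \<phi>" "(\<integral>t. \<phi> t \<partial>lborel) = 1"
  shows "(\<Sum>k\<in>{k\<in>K. even k}. c k) = 1" "(\<Sum>k\<in>{k\<in>K. odd k}. c k) = 1"
proof -
  let ?e = "\<Sum>k\<in>{k\<in>K. even k}. c k" and ?o = "\<Sum>k\<in>{k\<in>K. odd k}. c k"
  have [measurable]: "\<phi> \<in> borel_measurable borel" using mra_shift_L2(1)[OF mra] by (simp add: L2_def)
  have sh: "(\<integral>t. \<phi> (t - of_int k) \<partial>lborel) = 1" "integrable lborel (\<lambda>t. \<phi> (t - of_int k))" for k
    using lborel_integral_real_affine[of 1 \<phi> "- of_int k"] lborel_integrable_real_affine[OF int(1), of 1 "- of_int k"] int(2)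
    by (simp_all add: algebra_simps)
  have e2: "(\<lambda>t. \<phi> (t - of_int k)) \<in> L2" for k
    using L2_affine[OF mra_shift_L2(1)[OF mra], of 1 "- of_int k"] by simp
  have on: "L2_inner (\<lambda>t. \<phi> (t - of_int k)) (\<lambda>t. \<phi> (t - of_int l)) = (if k = l then 1 else 0)" for k l
    by (rule mra_shift_L2(4)[OF mra])
  have half: "(\<integral>t. h (t / 2) \<partial>lborel) = 2 * (\<integral>t. h t \<partial>lborel)" for h :: "real \<Rightarrow> real"
    using lborel_integral_real_affine[of "1/2" h 0] by simp
  have "2 = (\<integral>t. \<phi> (t / 2) \<partial>lborel)" using half[of \<phi>] int by simp
  also have "\<dots> = (\<integral>t. (\<Sum>k\<in>K. c k * \<phi> (t - of_int k)) \<partial>lborel)"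
    by (rule integral_cong_AE) (use ref in auto)
  also have "\<dots> = (\<Sum>k\<in>K. c k)"
    by (subst Bochner_Integration.integral_sum) (auto simp: sh)
  also have "\<dots> = ?e + ?o"
    using K by (subst sum.union_disjoint[symmetric]) (auto intro!: sum.cong)
  finally have s1: "?e + ?o = 2" ..
  obtain B :: nat where B: "\<And>k. k \<in> K \<Longrightarrow> \<bar>k\<bar> \<le> int B"
  proof -
    have "\<bar>k\<bar> \<le> int (nat (Max (insert 0 (abs ` K))))" if "k \<in> K" for k
    proof -
      have "\<bar>k\<bar> \<le> Max (insert 0 (abs ` K))" by (rule Max_ge) (use K that in auto)
      moreover have "0 \<le> Max (insert 0 (abs ` K))" by (rule Max_ge) (use K in auto)
      ultimately show ?thesis by simp
    qed
    then show ?thesis using that by blast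
  qed
  \<comment> \<open>Outside this range of shifts \<open>l\<close> no two elements of \<open>K\<close> differ by
    \<open>2 l\<close>.\<close>
  let ?L = "{- (2 * int B)..2 * int B}"
  have inner: "(\<Sum>k\<in>K. \<Sum>k'\<in>K. if k = k' + 2 * l then c k * c k' else 0) = (if l = 0 then 2 else 0)" for l
  proof -
    have ref_l: "AE t in lborel. \<phi> (t / 2 - of_int l) = (\<Sum>k\<in>K. c k * \<phi> (t - of_int (k + 2 * l)))"
    proof -
      have "AE t in lborel. \<phi> ((- 2 * of_int l + 1 * t) / 2) = (\<Sum>k\<in>K. c k * \<phi> ((- 2 * of_int l + 1 * t) - of_int k))"
        by (rule AE_borel_affine[OF _ _ ref]) (simp, measurable)
      then show ?thesis
      proof eventually_elim
        case (elim t)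
        have eqs: "(- 2 * of_int l + 1 * t) / 2 = t / 2 - real_of_int l"
          "- 2 * of_int l + 1 * t - of_int k = t - real_of_int (k + 2 * l)" for k by auto
        show ?case using elim by (simp only: eqs)
      qed
    qed
    have "(if l = 0 then 2 else 0) = 2 * L2_inner (\<lambda>t. \<phi> (t - of_int 0)) (\<lambda>t. \<phi> (t - of_int l))"
      using on[of 0 l] by simp
    also have "\<dots> = (\<integral>t. \<phi> (t / 2) * \<phi> (t / 2 - of_int l) \<partial>lborel)"
      using half[of "\<lambda>t. \<phi> t * \<phi> (t - of_int l)"] by (simp add: L2_inner_def)
    also have "\<dots> = (\<integral>t. (\<Sum>k\<in>K. c k * \<phi> (t - of_int k)) * (\<Sum>k\<in>K. c k * \<phi> (t - of_int (k + 2 * l))) \<partial>lborel)"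
      by (rule integral_cong_AE) (use ref ref_l in auto)
    also have "\<dots> = L2_inner (\<lambda>t. \<Sum>k\<in>K. c k * \<phi> (t - of_int k)) (\<lambda>t. \<Sum>k\<in>K. c k * \<phi> (t - of_int (k + 2 * l)))"
      by (simp add: L2_inner_def)
    also have "\<dots> = (\<Sum>k\<in>K. c k * L2_inner (\<lambda>t. \<phi> (t - of_int k)) (\<lambda>t. \<Sum>k\<in>K. c k * \<phi> (t - of_int (k + 2 * l))))"
      by (intro L2_inner_sum_left e2 L2_sum L2_cmult)
    also have "\<dots> = (\<Sum>k\<in>K. c k * (\<Sum>k'\<in>K. c k' * L2_inner (\<lambda>t. \<phi> (t - of_int (k' + 2 * l))) (\<lambda>t. \<phi> (t - of_int k))))"
      by (intro sum.cong arg_cong2[of _ _ _ _ times] refl) (subst L2_inner_sym, intro L2_inner_sum_left e2)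
    also have "\<dots> = (\<Sum>k\<in>K. \<Sum>k'\<in>K. if k = k' + 2 * l then c k * c k' else 0)"
      unfolding on sum_distrib_left by (intro sum.cong refl) auto
    finally show ?thesis ..
  qed
  have "2 = (\<Sum>l\<in>?L. if l = 0 then 2 else (0::real))" by (subst sum.delta) auto
  also have "\<dots> = (\<Sum>l\<in>?L. \<Sum>k\<in>K. \<Sum>k'\<in>K. if k = k' + 2 * l then c k * c k' else 0)"
    unfolding inner ..
  also have "\<dots> = (\<Sum>k\<in>K. \<Sum>k'\<in>K. \<Sum>l\<in>?L. if k = k' + 2 * l then c k * c k' else 0)"
    unfolding sum.swap[of _ ?L K] by (intro sum.cong refl sum.swap)
  also have "\<dots> = (\<Sum>k\<in>K. \<Sum>k'\<in>K. if even (k - k') then c k * c k' else 0)"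
  proof (intro sum.cong refl)
    fix k k' assume kk: "k \<in> K" "k' \<in> K"
    show "(\<Sum>l\<in>?L. if k = k' + 2 * l then c k * c k' else 0) = (if even (k - k') then c k * c k' else 0)"
    proof (cases "even (k - k')")
      case True
      then obtain m where m: "k - k' = 2 * m" by (rule evenE)
      have "m \<in> ?L" using B[OF kk(1)] B[OF kk(2)] m by auto
      moreover have "(\<Sum>l\<in>?L. if k = k' + 2 * l then c k * c k' else 0) = (\<Sum>l\<in>?L. if l = m then c k * c k' else 0)"
        by (intro sum.cong refl) (use m in auto)
      ultimately show ?thesis using True by simp
    next
      case False
      then have "k \<noteq> k' + 2 * l" for l by auto
      then show ?thesis using False by simp
    qed
  qed
  also have "\<dots> = ?e\<^sup>2 + ?o\<^sup>2" by (rule sum_indicator_parity[OF K])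
  finally have "?e\<^sup>2 + ?o\<^sup>2 = 2" ..
  then have "(?e - ?o)\<^sup>2 = 2 * 2 - (?e + ?o)\<^sup>2" by (simp add: power2_sum power2_diff)
  then have "?e = ?o" using s1 by simp
  then show "?e = 1" "?o = 1" using s1 by auto
qed

section \<open>Partition of unity by integer translates\<close>

text \<open>The sum of the translates of \<open>f\<close> along a lattice of mesh \<open>h\<close>.
  Restricting it to nonzero terms makes it an ordinary finite sum for every \<open>f\<close> of
  bounded support, without a common index set for all \<open>t\<close>.\<close>

definition lattice_sum :: "int \<Rightarrow> (real \<Rightarrow> real) \<Rightarrow> real \<Rightarrow> real" where
  "lattice_sum h f t = (\<Sum>l\<in>{l. f (t + of_int (h * l)) \<noteq> 0}. f (t + of_int (h * l)))"

lemma lattice_support_finite: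
  fixes f :: "real \<Rightarrow> real"
  assumes R: "\<And>t. \<bar>t\<bar> > real R \<Longrightarrow> f t = 0" and h: "h \<noteq> 0"
  shows "finite {l. f (t + of_int (h * l)) \<noteq> 0}"
proof (rule finite_subset)
  show "{l. f (t + of_int (h * l)) \<noteq> 0} \<subseteq> {- \<lceil>\<bar>t\<bar> + real R\<rceil>..\<lceil>\<bar>t\<bar> + real R\<rceil>}"
  proof
    fix l assume "l \<in> {l. f (t + of_int (h * l)) \<noteq> 0}"
    then have "\<bar>t + of_int (h * l)\<bar> \<le> real R" using R by force
    then have "\<bar>real_of_int (h * l)\<bar> \<le> \<bar>t\<bar> + real R" by linarith
    moreover have "1 \<le> \<bar>h\<bar>" using h by linarith
    then have "\<bar>l\<bar> \<le> \<bar>h * l\<bar>" using mult_right_mono[of 1 "\<bar>h\<bar>" "\<bar>l\<bar>"] by (simp add: abs_mult)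
    then have "\<bar>real_of_int l\<bar> \<le> \<bar>real_of_int (h * l)\<bar>" by linarith
    ultimately have "\<bar>real_of_int l\<bar> \<le> \<bar>t\<bar> + real R" by linarith
    then have "\<bar>l\<bar> \<le> \<lceil>\<bar>t\<bar> + real R\<rceil>" by linarith
    then show "l \<in> {- \<lceil>\<bar>t\<bar> + real R\<rceil>..\<lceil>\<bar>t\<bar> + real R\<rceil>}" by auto
  qed
qed simp

lemma lattice_sum_eq:
  assumes "finite S" "{l. f (t + of_int (h * l)) \<noteq> 0} \<subseteq> S"
  shows "lattice_sum h f t = (\<Sum>l\<in>S. f (t + of_int (h * l)))"
  unfolding lattice_sum_def by (rule sum.mono_neutral_left) (use assms in auto)

lemma lattice_sum_shift: "lattice_sum h f (t + of_int (h * j)) = lattice_sum h f t"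
  unfolding lattice_sum_def
  by (rule sum.reindex_bij_witness[where j = "\<lambda>l. l + j" and i = "\<lambda>l. l - j"]) (auto simp: algebra_simps)

lemma lattice_sum_split:
  assumes R: "\<And>t. \<bar>t\<bar> > real R \<Longrightarrow> f t = 0"
  shows "lattice_sum 1 f t = lattice_sum 2 f t + lattice_sum 2 f (t + 1)"
proof -
  let ?A = "{l. f (t + of_int (1 * l)) \<noteq> 0}"
  have fin: "finite ?A" by (rule lattice_support_finite[OF R]) auto
  have "lattice_sum 1 f t = (\<Sum>l\<in>{l\<in>?A. even l}. f (t + of_int (1 * l))) + (\<Sum>l\<in>{l\<in>?A. odd l}. f (t + of_int (1 * l)))"
    unfolding lattice_sum_def using fin
    by (subst sum.union_disjoint[symmetric]) (auto intro!: sum.cong)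
  also have "(\<Sum>l\<in>{l\<in>?A. even l}. f (t + of_int (1 * l))) = lattice_sum 2 f t"
    unfolding lattice_sum_def
    by (rule sum.reindex_bij_witness[where j = "\<lambda>l. l div 2" and i = "\<lambda>l. 2 * l"]) auto
  also have "(\<Sum>l\<in>{l\<in>?A. odd l}. f (t + of_int (1 * l))) = lattice_sum 2 f (t + 1)"
    unfolding lattice_sum_def
    by (rule sum.reindex_bij_witness[where j = "\<lambda>l. (l - 1) div 2" and i = "\<lambda>l. 2 * l + 1"])
      (auto simp: algebra_simps elim!: oddE)
  finally show ?thesis .
qed

text \<open>Inserting the refinement equation splits the lattice sum at \<open>t/2\<close> into even and odd
  translates, each of which receives total weight 1.\<close>

lemma lattice_sum_halving:
  fixes f :: "real \<Rightarrow> real"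
  assumes R: "\<And>t. \<bar>t\<bar> > real R \<Longrightarrow> f t = 0" and K: "finite K"
    and ref: "\<And>l::int. f ((t + of_int (2 * l)) / 2) = (\<Sum>k\<in>K. c k * f (t + of_int (2 * l) - of_int k))"
    and ev: "(\<Sum>k\<in>{k\<in>K. even k}. c k) = 1" and od: "(\<Sum>k\<in>{k\<in>K. odd k}. c k) = 1"
  shows "lattice_sum 1 f (t / 2) = lattice_sum 1 f t"
proof -
  define S where "S = {l. f (t / 2 + of_int (1 * l)) \<noteq> 0} \<union> (\<Union>k\<in>K. {l. f (t - of_int k + of_int (2 * l)) \<noteq> 0})"
  have fin1: "finite {l. f (u + of_int (1 * l)) \<noteq> 0}" for u by (rule lattice_support_finite[OF R]) auto
  have fin2: "finite {l. f (u + of_int (2 * l)) \<noteq> 0}" for u by (rule lattice_support_finite[OF R]) auto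
  have S: "finite S" unfolding S_def using K fin1 fin2 by (intro finite_UnI finite_UN_I) auto
  have "lattice_sum 1 f (t / 2) = (\<Sum>l\<in>S. f (t / 2 + of_int (1 * l)))"
    by (rule lattice_sum_eq[OF S]) (auto simp: S_def)
  also have "\<dots> = (\<Sum>l\<in>S. \<Sum>k\<in>K. c k * f (t - of_int k + of_int (2 * l)))"
  proof (rule sum.cong[OF refl])
    fix l
    have "f (t / 2 + of_int (1 * l)) = f ((t + of_int (2 * l)) / 2)" by (simp add: add_divide_distrib)
    also have "\<dots> = (\<Sum>k\<in>K. c k * f (t - of_int k + of_int (2 * l)))"
      unfolding ref by (simp add: algebra_simps)
    finally show "f (t / 2 + of_int (1 * l)) = (\<Sum>k\<in>K. c k * f (t - of_int k + of_int (2 * l)))" .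
  qed
  also have "\<dots> = (\<Sum>k\<in>K. c k * (\<Sum>l\<in>S. f (t - of_int k + of_int (2 * l))))"
    unfolding sum_distrib_left by (rule sum.swap)
  also have "\<dots> = (\<Sum>k\<in>K. c k * lattice_sum 2 f (t - of_int k))"
  proof (intro sum.cong refl arg_cong2[of _ _ _ _ times])
    fix k assume "k \<in> K"
    then show "(\<Sum>l\<in>S. f (t - of_int k + of_int (2 * l))) = lattice_sum 2 f (t - of_int k)"
      by (intro lattice_sum_eq[OF S, symmetric]) (auto simp: S_def)
  qed
  also have "\<dots> = (\<Sum>k\<in>K. (if even k then c k else 0) * lattice_sum 2 f t + (if odd k then c k else 0) * lattice_sum 2 f (t + 1))"
  proof (intro sum.cong refl)
    fix k assume "k \<in> K"
    show "c k * lattice_sum 2 f (t - of_int k) =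
      (if even k then c k else 0) * lattice_sum 2 f t + (if odd k then c k else 0) * lattice_sum 2 f (t + 1)"
    proof (cases "even k")
      case True
      then obtain m where m: "k = 2 * m" by (rule evenE)
      show ?thesis using lattice_sum_shift[of 2 f t "- m"] m by simp
    next
      case False
      then obtain m where m: "k = 2 * m + 1" by (rule oddE)
      have e: "t + 1 + real_of_int (2 * (- m - 1)) = t - of_int k" using m by simp
      show ?thesis using lattice_sum_shift[of 2 f "t + 1" "- m - 1", unfolded e] False by simp
    qed
  qed
  also have "\<dots> = (\<Sum>k\<in>K. if even k then c k else 0) * lattice_sum 2 f t + (\<Sum>k\<in>K. if odd k then c k else 0) * lattice_sum 2 f (t + 1)"
    by (simp only: sum.distrib sum_distrib_right)
  also have "(\<Sum>k\<in>K. if even k then c k else 0) = 1" using K ev by (simp add: sum.inter_filter)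
  also have "(\<Sum>k\<in>K. if odd k then c k else 0) = 1" using K od by (simp add: sum.inter_filter)
  finally show ?thesis using lattice_sum_split[of R f t] R by simp
qed

lemma lattice_sum_local:
  fixes f :: "real \<Rightarrow> real"
  assumes R: "\<And>t. \<bar>t\<bar> > real R \<Longrightarrow> f t = 0" and t: "\<bar>t\<bar> \<le> real T"
  shows "lattice_sum 1 f t = (\<Sum>l\<in>{- int (T + R)..int (T + R)}. f (t + of_int l))"
proof -
  have "lattice_sum 1 f t = (\<Sum>l\<in>{- int (T + R)..int (T + R)}. f (t + of_int (1 * l)))"
  proof (rule lattice_sum_eq)
    show "{l. f (t + of_int (1 * l)) \<noteq> 0} \<subseteq> {- int (T + R)..int (T + R)}"
    proof
      fix l assume "l \<in> {l. f (t + of_int (1 * l)) \<noteq> 0}"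
      then have "\<bar>t + of_int l\<bar> \<le> real R" using R by force
      then have "\<bar>real_of_int l\<bar> \<le> real (T + R)" using t by simp
      then show "l \<in> {- int (T + R)..int (T + R)}" by auto
    qed
  qed simp
  then show ?thesis by simp
qed

lemma lattice_sum_measurable:
  fixes f :: "real \<Rightarrow> real"
  assumes R: "\<And>t. \<bar>t\<bar> > real R \<Longrightarrow> f t = 0" and f[measurable]: "f \<in> borel_measurable borel"
  shows "lattice_sum 1 f \<in> borel_measurable borel"
proof (rule borel_measurable_LIMSEQ_real)
  fix T :: nat
  show "(\<lambda>t. \<Sum>l\<in>{- int (T + R)..int (T + R)}. f (t + of_int l)) \<in> borel_measurable borel" by measurable
next
  fix t :: real
  have "\<forall>\<^sub>F T in sequentially. lattice_sum 1 f t = (\<Sum>l\<in>{- int (T + R)..int (T + R)}. f (t + of_int l))"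
  proof -
    obtain T0 :: nat where "\<bar>t\<bar> \<le> real T0" using real_arch_simple by blast
    then have "\<bar>t\<bar> \<le> real T" if "T \<ge> T0" for T using that by linarith
    then show ?thesis unfolding eventually_sequentially
      by (intro exI[of _ T0] allI impI lattice_sum_local R)
  qed
  then show "(\<lambda>T. \<Sum>l\<in>{- int (T + R)..int (T + R)}. f (t + of_int l)) \<longlonglongrightarrow> lattice_sum 1 f t"
    by (rule tendsto_eventually[OF eventually_mono]) simp
qed

lemma lattice_sum_locally_integrable:
  fixes f :: "real \<Rightarrow> real"
  assumes R: "\<And>t. \<bar>t\<bar> > real R \<Longrightarrow> f t = 0" and f: "integrable lborel f"
    and B: "B \<in> sets borel" "B \<subseteq> {- real T..real T}"
  shows "integrable lborel (\<lambda>t. indicator B t * lattice_sum 1 f t)"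
    and "(\<integral>t. indicator B t * lattice_sum 1 f t \<partial>lborel) =
      (\<Sum>l\<in>{- int (T + R)..int (T + R)}. \<integral>t. indicator B t * f (t + of_int l) \<partial>lborel)"
proof -
  have eq: "indicator B t * lattice_sum 1 f t = (\<Sum>l\<in>{- int (T + R)..int (T + R)}. indicator B t * f (t + of_int l))" for t
  proof (cases "t \<in> B")
    case True
    then have "t \<in> {- real T..real T}" using B by blast
    then have "\<bar>t\<bar> \<le> real T" by auto
    then show ?thesis using True by (simp add: lattice_sum_local[OF R])
  qed simp
  have i: "integrable lborel (\<lambda>t. indicator B t * f (t + of_int l))" for l
    using lborel_integrable_real_affine[OF f, of 1 "of_int l"] B(1)
      integrable_mult_indicator[of B lborel "\<lambda>t. f (t + of_int l)"]
    by (simp add: add.commute)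
  show "integrable lborel (\<lambda>t. indicator B t * lattice_sum 1 f t)"
    unfolding eq by (intro Bochner_Integration.integrable_sum i)
  show "(\<integral>t. indicator B t * lattice_sum 1 f t \<partial>lborel) =
      (\<Sum>l\<in>{- int (T + R)..int (T + R)}. \<integral>t. indicator B t * f (t + of_int l) \<partial>lborel)"
    unfolding eq by (intro Bochner_Integration.integral_sum i)
qed

text \<open>The translates of a unit interval tile the line, hence periodization preserves the integral.\<close>

lemma lattice_sum_unit_interval_integral:
  fixes f :: "real \<Rightarrow> real" and i :: int
  assumes R: "\<And>t. \<bar>t\<bar> > real R \<Longrightarrow> f t = 0" and f: "integrable lborel f"
  shows "(\<integral>t. indicator {of_int i..<of_int i + 1} t * lattice_sum 1 f t \<partial>lborel) = (\<integral>t. f t \<partial>lborel)"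
proof -
  define T where "T = nat \<bar>i\<bar> + 1"
  have sub: "{of_int i..<of_int i + 1} \<subseteq> {- real T..real T}" unfolding T_def by (auto simp: T_def)
  let ?L = "{- int (T + R)..int (T + R)}"
  have sh: "(\<integral>t. indicator {of_int i..<of_int i + 1} t * f (t + of_int l) \<partial>lborel)
    = (\<integral>t. indicator {of_int (i + l)..<of_int (i + l) + 1} t * f t \<partial>lborel)" for l :: int
    by (subst lborel_integral_real_affine[of 1 _ "- of_int l"])
      (auto intro!: Bochner_Integration.integral_cong simp: indicator_def)
  have "(\<integral>t. indicator {of_int i..<of_int i + 1} t * lattice_sum 1 f t \<partial>lborel)
    = (\<Sum>l\<in>?L. \<integral>t. indicator {of_int (i + l)..<of_int (i + l) + 1} t * f t \<partial>lborel)"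
    by (subst lattice_sum_locally_integrable(2)[OF R f _ sub]) (simp_all add: sh)
  also have "\<dots> = (\<integral>t. (\<Sum>l\<in>?L. indicator {of_int (i + l)..<of_int (i + l) + 1} t * f t) \<partial>lborel)"
    using integrable_mult_indicator[OF _ f]
    by (intro Bochner_Integration.integral_sum[symmetric]) simp
  also have "\<dots> = (\<integral>t. f t \<partial>lborel)"
  proof (intro Bochner_Integration.integral_cong refl)
    fix t
    show "(\<Sum>l\<in>?L. indicator {of_int (i + l)..<of_int (i + l) + 1} t * f t) = f t"
    proof (cases "f t = 0")
      case False
      then have tR: "\<bar>t\<bar> \<le> real R" using R by force
      have "\<bar>\<lfloor>t\<rfloor> - i\<bar> \<le> int (T + R)" using tR unfolding T_def by linarith
      then have m: "\<lfloor>t\<rfloor> - i \<in> ?L" by auto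
      have "(\<Sum>l\<in>?L. indicator {of_int (i + l)..<of_int (i + l) + 1} t * f t) = (\<Sum>l\<in>?L. if l = \<lfloor>t\<rfloor> - i then f t else 0)"
      proof (intro sum.cong refl)
        fix l
        have "t \<in> {of_int (i + l)..<of_int (i + l) + 1} \<longleftrightarrow> \<lfloor>t\<rfloor> = i + l" by (auto simp: floor_eq_iff)
        then show "indicator {of_int (i + l)..<of_int (i + l) + 1} t * f t = (if l = \<lfloor>t\<rfloor> - i then f t else 0)"
          by (auto simp: indicator_def)
      qed
      then show ?thesis using m by simp
    qed simp
  qed
  finally show ?thesis .
qed

text \<open>Invariance under halving the argument carries the unit interval over to all dyadic intervals.\<close>

lemma lattice_sum_dyadic_integral:
  fixes f :: "real \<Rightarrow> real" and i :: int
  assumes R: "\<And>t. \<bar>t\<bar> > real R \<Longrightarrow> f t = 0" and f: "integrable lborel f"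
    and inv: "AE t in lborel. lattice_sum 1 f (t / 2) = lattice_sum 1 f t"
  shows "(\<integral>t. indicator {of_int i / 2 ^ q..<(of_int i + 1) / 2 ^ q} t * lattice_sum 1 f t \<partial>lborel)
    = (\<integral>t. f t \<partial>lborel) / 2 ^ q"
proof (induction q)
  case 0
  then show ?case using lattice_sum_unit_interval_integral[OF R f, of R i] by simp
next
  case (Suc q)
  have [measurable]: "f \<in> borel_measurable borel" using f by auto
  have [measurable]: "lattice_sum 1 f \<in> borel_measurable borel" by (rule lattice_sum_measurable[OF R]) auto
  have "(\<integral>t. indicator {of_int i / 2 ^ Suc q..<(of_int i + 1) / 2 ^ Suc q} t * lattice_sum 1 f t \<partial>lborel)
    = (1/2) * (\<integral>t. indicator {of_int i / 2 ^ q..<(of_int i + 1) / 2 ^ q} t * lattice_sum 1 f (t / 2) \<partial>lborel)"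
    by (subst lborel_integral_real_affine[of "1/2" _ 0])
      (auto intro!: Bochner_Integration.integral_cong simp: indicator_def field_simps)
  also have "(\<integral>t. indicator {of_int i / 2 ^ q..<(of_int i + 1) / 2 ^ q} t * lattice_sum 1 f (t / 2) \<partial>lborel)
    = (\<integral>t. indicator {of_int i / 2 ^ q..<(of_int i + 1) / 2 ^ q} t * lattice_sum 1 f t \<partial>lborel)"
    by (rule integral_cong_AE) (use inv in auto)
  finally show ?case unfolding Suc by simp
qed

text \<open>The positive and the negative part of \<open>g\<close> define finite measures that agree on all
  half-lines and are therefore equal.\<close>

lemma AE_zero_if_tail_integrals_zero:
  fixes g :: "real \<Rightarrow> real"
  assumes g: "integrable lborel g" and z: "\<And>x. (\<integral>t. indicator {x<..} t * g t \<partial>lborel) = 0"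
  shows "AE t in lborel. g t = 0"
proof -
  have [measurable]: "g \<in> borel_measurable borel" using g by auto
  have gi: "integrable lborel (\<lambda>t. indicator {x<..} t * g t)" for x :: real
    using integrable_mult_indicator[OF _ g, of "{x<..}"] by simp
  have em: "emeasure (density lborel (\<lambda>t. ennreal (s * g t))) {x<..} = ennreal (\<integral>t. max 0 (s * (indicator {x<..} t * g t)) \<partial>lborel)"
    for x s :: real
  proof -
    have "emeasure (density lborel (\<lambda>t. ennreal (s * g t))) {x<..} = (\<integral>\<^sup>+t. ennreal (s * g t) * indicator {x<..} t \<partial>lborel)"
      by (rule emeasure_density) auto
    also have "\<dots> = (\<integral>\<^sup>+t. ennreal (max 0 (s * (indicator {x<..} t * g t))) \<partial>lborel)"
      by (intro nn_integral_cong) (auto simp: indicator_def max_def ennreal_neg)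
    also have "\<dots> = ennreal (\<integral>t. max 0 (s * (indicator {x<..} t * g t)) \<partial>lborel)"
      using gi by (intro nn_integral_eq_integral integrable_max integrable_mult_right) auto
    finally show ?thesis .
  qed
  have mx: "integrable lborel (\<lambda>t. max 0 (s * (indicator {x<..} t * g t)))" for s x :: real
    using gi by (intro integrable_max integrable_mult_right) auto
  have eq: "(\<integral>t. max 0 (1 * (indicator {x<..} t * g t)) \<partial>lborel) = (\<integral>t. max 0 ((-1) * (indicator {x<..} t * g t)) \<partial>lborel)" for x
  proof -
    have "(\<integral>t. max 0 (1 * (indicator {x<..} t * g t)) \<partial>lborel) - (\<integral>t. max 0 ((-1) * (indicator {x<..} t * g t)) \<partial>lborel)
      = (\<integral>t. max 0 (1 * (indicator {x<..} t * g t)) - max 0 ((-1) * (indicator {x<..} t * g t)) \<partial>lborel)"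
      by (rule Bochner_Integration.integral_diff[symmetric]) (rule mx)+
    also have "\<dots> = (\<integral>t. indicator {x<..} t * g t \<partial>lborel)"
      by (intro Bochner_Integration.integral_cong refl) auto
    finally show ?thesis using z by simp
  qed
  have "density lborel (\<lambda>t. ennreal (1 * g t)) = density lborel (\<lambda>t. ennreal ((-1) * g t))"
  proof (rule measure_eqI_lessThan)
    show "emeasure (density lborel (\<lambda>t. ennreal (1 * g t))) {x<..} < \<infinity>" for x
      unfolding em by simp
    show "emeasure (density lborel (\<lambda>t. ennreal (1 * g t))) {x<..} = emeasure (density lborel (\<lambda>t. ennreal ((-1) * g t))) {x<..}" for x
      unfolding em eq ..
  qed auto
  moreover have "(\<integral>\<^sup>+t. ennreal (1 * g t) \<partial>lborel) \<noteq> \<infinity>"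
  proof -
    have "(\<integral>\<^sup>+t. ennreal (1 * g t) \<partial>lborel) \<le> (\<integral>\<^sup>+t. ennreal (norm (g t)) \<partial>lborel)"
      by (intro nn_integral_mono ennreal_leI) auto
    also have "\<dots> < \<infinity>" using g by (simp add: integrable_iff_bounded)
    finally show ?thesis by simp
  qed
  ultimately have "AE t in lborel. ennreal (1 * g t) = ennreal ((-1) * g t)"
    by (subst (asm) finite_density_unique) auto
  then show ?thesis
  proof eventually_elim
    case (elim t)
    then show ?case
      by (cases "g t \<ge> 0") (auto simp: ennreal_neg ennreal_eq_0_iff dest!: sym[of 0])
  qed
qed

lemma integrable_indicator_Ico:
  fixes u v :: real
  assumes "u \<le> v"
  shows "integrable lborel (\<lambda>t. indicator {u..<v} t :: real)"
    and "(\<integral>t. indicator {u..<v} t \<partial>lborel) = v - u"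
proof -
  show "integrable lborel (\<lambda>t. indicator {u..<v} t :: real)"
    using assms by (intro integrable_real_indicator) auto
  have "(\<integral>t. indicator {u..<v} t \<partial>lborel) = measure lborel {u..<v}"
    using Bochner_Integration.integral_indicator[of lborel "{u..<v}"] by simp
  also have "\<dots> = v - u" using assms by (rule measure_lborel_Ico)
  finally show "(\<integral>t. indicator {u..<v} t \<partial>lborel) = v - u" .
qed

lemma lattice_sum_dyadic_interval_integral:
  fixes f :: "real \<Rightarrow> real" and i i' :: int
  assumes R: "\<And>t. \<bar>t\<bar> > real R \<Longrightarrow> f t = 0" and f: "integrable lborel f" "(\<integral>t. f t \<partial>lborel) = 1"
    and inv: "AE t in lborel. lattice_sum 1 f (t / 2) = lattice_sum 1 f t" and "i \<le> i'"
  shows "(\<integral>t. indicator {real_of_int i / 2 ^ q..<of_int i' / 2 ^ q} t * lattice_sum 1 f t \<partial>lborel)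
    = (of_int i' - of_int i) / 2 ^ q"
  using \<open>i \<le> i'\<close>
proof (induction i' rule: int_ge_induct)
  case base
  then show ?case by simp
next
  case (step k)
  have bnd: "\<exists>T::nat. {real_of_int i / 2 ^ q..<of_int k / 2 ^ q} \<subseteq> {- real T..real T}" for i k :: int
  proof -
    obtain T :: nat where "real T \<ge> max \<bar>of_int i / 2 ^ q\<bar> \<bar>of_int k / 2 ^ q\<bar>"
      using real_arch_simple by blast
    then have "\<bar>of_int i / 2 ^ q\<bar> \<le> real T" "\<bar>of_int k / 2 ^ q\<bar> \<le> real T" by linarith+
    then have "{real_of_int i / 2 ^ q..<of_int k / 2 ^ q} \<subseteq> {- real T..real T}"
      unfolding abs_le_iff subset_iff atLeastLessThan_iff atLeastAtMost_iff by (intro allI impI) linarith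
    then show ?thesis ..
  qed
  have int: "integrable lborel (\<lambda>t. indicator {real_of_int i / 2 ^ q..<of_int k / 2 ^ q} t * lattice_sum 1 f t)" for i k :: int
    using bnd[of i k] lattice_sum_locally_integrable(1)[where f=f and R=R, OF R f(1), where B = "{real_of_int i / 2 ^ q..<of_int k / 2 ^ q}"] by auto
  have le: "real_of_int i / 2 ^ q \<le> of_int k / 2 ^ q" "real_of_int k / 2 ^ q \<le> of_int (k + 1) / 2 ^ q"
    using step by (auto intro: divide_right_mono)
  have "(\<integral>t. indicator {real_of_int i / 2 ^ q..<of_int (k + 1) / 2 ^ q} t * lattice_sum 1 f t \<partial>lborel)
    = (\<integral>t. indicator {real_of_int i / 2 ^ q..<of_int k / 2 ^ q} t * lattice_sum 1 f t +
        indicator {of_int k / 2 ^ q..<of_int (k + 1) / 2 ^ q} t * lattice_sum 1 f t \<partial>lborel)"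
    using le by (intro Bochner_Integration.integral_cong refl) (auto simp: indicator_def)
  also have "\<dots> = (of_int k - of_int i) / 2 ^ q + 1 / 2 ^ q"
    using lattice_sum_dyadic_integral[where f=f and R=R, OF R f(1) inv, where i = k and q = q] step.IH f(2)
    by (subst Bochner_Integration.integral_add[OF int int]) simp
  finally show ?case by (simp add: field_simps)
qed

text \<open>The periodization of \<open>\<phi>\<close> has the same mean 1 over every dyadic interval, and a
  locally integrable function is determined by these means.\<close>

theorem partition_of_unity:
  fixes \<phi> :: "real \<Rightarrow> real" and R :: nat
  assumes mra: "multiresolution_analysis V \<phi>" and R: "\<And>t. \<bar>t\<bar> > real R \<Longrightarrow> \<phi> t = 0"
    and int: "integrable lborel \<phi>" "(\<integral>t. \<phi> t \<partial>lborel) = 1"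
  shows "AE t in lborel. lattice_sum 1 \<phi> t = 1"
proof -
  have [measurable]: "\<phi> \<in> borel_measurable borel" using int by auto
  have [measurable]: "lattice_sum 1 \<phi> \<in> borel_measurable borel" by (rule lattice_sum_measurable[where f=\<phi> and R=R, OF R]) auto
  obtain K :: "int set" and c where K: "finite K" and ref: "AE t in lborel. \<phi> (t / 2) = (\<Sum>k\<in>K. c k * \<phi> (t - of_int k))"
    by (rule refinement_equation[OF mra R])
  have "AE t in lborel. \<phi> ((of_int (2 * l) + 1 * t) / 2) = (\<Sum>k\<in>K. c k * \<phi> ((of_int (2 * l) + 1 * t) - of_int k))" for l :: int
    by (rule AE_borel_affine[OF _ _ ref]) (simp, measurable)
  then have "AE t in lborel. \<forall>l::int. \<phi> ((t + of_int (2 * l)) / 2) = (\<Sum>k\<in>K. c k * \<phi> (t + of_int (2 * l) - of_int k))"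
    by (subst AE_all_countable) (simp add: add.commute)
  then have inv: "AE t in lborel. lattice_sum 1 \<phi> (t / 2) = lattice_sum 1 \<phi> t"
  proof eventually_elim
    case (elim t)
    show ?case
      by (rule lattice_sum_halving[where f=\<phi> and R=R and c=c, OF R K])
        (use elim refinement_coefficients[OF mra K ref int] in auto)
  qed
  have "AE t in lborel. indicator {- real T..<real T} t * (lattice_sum 1 \<phi> t - 1) = 0" for T :: nat
  proof (rule AE_zero_if_tail_integrals_zero)
    let ?g = "\<lambda>t. indicator {- real T..<real T} t * (lattice_sum 1 \<phi> t - 1)"
    have gi: "integrable lborel ?g"
    proof -
      have "integrable lborel (\<lambda>t. indicator {- real T..<real T} t * lattice_sum 1 \<phi> t)"
        by (rule lattice_sum_locally_integrable(1)[where f=\<phi> and R=R and T=T, OF R int(1)]) auto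
      then have "integrable lborel (\<lambda>t. indicator {- real T..<real T} t * lattice_sum 1 \<phi> t - indicator {- real T..<real T} t)"
        by (rule Bochner_Integration.integrable_diff) auto
      then show ?thesis by (simp add: right_diff_distrib)
    qed
    then show "integrable lborel ?g" .
    have dy: "(\<integral>t. indicator {real_of_int i / 2 ^ q..} t * ?g t \<partial>lborel) = 0" for i :: int and q
    proof -
      \<comment> \<open>The dyadic point is truncated to the window \<open>[-T, T]\<close>.\<close>
      define i' where "i' = max (- int T * 2 ^ q) (min (int T * 2 ^ q) i)"
      have a0: "0 \<le> int T * 2 ^ q" by simp
      then have "i' \<le> int T * 2 ^ q" unfolding i'_def by linarith
      have i'_eq: "indicator {real_of_int i / 2 ^ q..} t * indicator {- real T..<real T} t
        = (indicator {real_of_int i' / 2 ^ q..<of_int (int T * 2 ^ q) / 2 ^ q} t :: real)" for t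
      proof -
        have "real_of_int i' = max (- real T * 2 ^ q) (min (real T * 2 ^ q) (of_int i))"
          unfolding i'_def by (simp add: of_int_max of_int_min)
        then have "real_of_int i' / 2 ^ q = max (- real T) (min (real T) (of_int i / 2 ^ q))"
          by (auto simp: max_def min_def field_simps)
        then show ?thesis by (auto simp: indicator_def)
      qed
      have i1: "integrable lborel (\<lambda>t. indicator {real_of_int i' / 2 ^ q..<of_int (int T * 2 ^ q) / 2 ^ q} t * lattice_sum 1 \<phi> t)"
      proof (rule lattice_sum_locally_integrable(1)[where f=\<phi> and R=R, OF R int(1)])
        have "- int T * 2 ^ q \<le> i'" unfolding i'_def by (rule max.cobounded1)
        then have "real_of_int (- int T * 2 ^ q) \<le> real_of_int i'" by (rule of_int_le_iff[THEN iffD2])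
        then have "- real T \<le> real_of_int i' / 2 ^ q" by (simp add: field_simps)
        then show "{real_of_int i' / 2 ^ q..<of_int (int T * 2 ^ q) / 2 ^ q} \<subseteq> {- real T..real T}" by auto
      qed auto
      have ile: "real_of_int i' / 2 ^ q \<le> of_int (int T * 2 ^ q) / 2 ^ q"
        by (rule divide_right_mono[OF of_int_le_iff[THEN iffD2, OF \<open>i' \<le> int T * 2 ^ q\<close>]]) simp
      have "(\<integral>t. indicator {real_of_int i / 2 ^ q..} t * ?g t \<partial>lborel) =
        (\<integral>t. indicator {real_of_int i' / 2 ^ q..<of_int (int T * 2 ^ q) / 2 ^ q} t * lattice_sum 1 \<phi> t
          - indicator {real_of_int i' / 2 ^ q..<of_int (int T * 2 ^ q) / 2 ^ q} t \<partial>lborel)"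
        unfolding i'_eq[symmetric] by (intro Bochner_Integration.integral_cong refl) (simp add: algebra_simps)
      also have "\<dots> = (\<integral>t. indicator {real_of_int i' / 2 ^ q..<of_int (int T * 2 ^ q) / 2 ^ q} t * lattice_sum 1 \<phi> t \<partial>lborel)
          - (\<integral>t. indicator {real_of_int i' / 2 ^ q..<of_int (int T * 2 ^ q) / 2 ^ q} t \<partial>lborel)"
        by (rule Bochner_Integration.integral_diff[OF i1 integrable_indicator_Ico(1)[OF ile]])
      also have "(\<integral>t. indicator {real_of_int i' / 2 ^ q..<of_int (int T * 2 ^ q) / 2 ^ q} t * lattice_sum 1 \<phi> t \<partial>lborel)
          = (of_int (int T * 2 ^ q) - of_int i') / 2 ^ q"
        by (rule lattice_sum_dyadic_interval_integral[of R]) (fact R int inv \<open>i' \<le> int T * 2 ^ q\<close>)+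
      also have "(\<integral>t. indicator {real_of_int i' / 2 ^ q..<of_int (int T * 2 ^ q) / 2 ^ q} t \<partial>lborel) = real_of_int (int T * 2 ^ q) / 2 ^ q - real_of_int i' / 2 ^ q"
        by (rule integrable_indicator_Ico(2)[OF ile])
      finally show ?thesis by (simp add: diff_divide_distrib)
    qed
    show "(\<integral>t. indicator {x<..} t * ?g t \<partial>lborel) = 0" for x
    proof -
      \<comment> \<open>Dyadic points that converge to \<open>x\<close> from above; as they never equal
        \<open>x\<close>, the closed half-lines beginning at \<open>y q\<close> exhaust the open one
        beginning at \<open>x\<close>.\<close>
      define y where "y q = of_int (\<lfloor>x * 2 ^ q\<rfloor> + 1) / (2::real) ^ q" for q
      have y1: "x < y q" for q
      proof -
        have "x * 2 ^ q < of_int (\<lfloor>x * 2 ^ q\<rfloor> + 1)" by linarith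
        then show ?thesis by (simp add: y_def field_simps)
      qed
      have y2: "y q \<le> x + (1/2) ^ q" for q
      proof -
        have "of_int (\<lfloor>x * 2 ^ q\<rfloor> + 1) \<le> x * 2 ^ q + 1" by linarith
        then show ?thesis by (simp add: y_def field_simps)
      qed
      have yl: "y \<longlonglongrightarrow> x"
      proof (rule tendsto_sandwich)
        show "(\<lambda>q. x) \<longlonglongrightarrow> x" by simp
        have "(\<lambda>q. x + (1/2) ^ q) \<longlonglongrightarrow> x + 0" by (intro tendsto_intros) auto
        then show "(\<lambda>q. x + (1/2) ^ q) \<longlonglongrightarrow> x" by simp
      qed (use y1 y2 in \<open>auto intro!: always_eventually less_imp_le\<close>)
      have "(\<lambda>q. \<integral>t. indicator {y q..} t * ?g t \<partial>lborel) \<longlonglongrightarrow> (\<integral>t. indicator {x<..} t * ?g t \<partial>lborel)"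
      proof (rule integral_dominated_convergence[where w = "\<lambda>t. norm (?g t)"])
        show "integrable lborel (\<lambda>t. norm (?g t))" using gi by (rule integrable_norm)
        show "AE t in lborel. (\<lambda>q. indicator {y q..} t * ?g t) \<longlonglongrightarrow> indicator {x<..} t * ?g t"
        proof (rule AE_I2)
          fix t
          have "\<forall>\<^sub>F q in sequentially. indicator {y q..} t * ?g t = indicator {x<..} t * ?g t"
          proof (cases "x < t")
            case True
            then have "\<forall>\<^sub>F q in sequentially. y q < t" using order_tendstoD(2)[OF yl] by simp
            then show ?thesis by eventually_elim (use True in \<open>auto simp: indicator_def\<close>)
          next
            case False
            then have "t < y q" for q using y1[of q] by simp
            then show ?thesis using False by (intro always_eventually allI) (auto simp: indicator_def not_le)
          qed
          then show "(\<lambda>q. indicator {y q..} t * ?g t) \<longlonglongrightarrow> indicator {x<..} t * ?g t"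
            by (rule tendsto_eventually)
        qed
        show "AE t in lborel. norm (indicator {y q..} t * ?g t) \<le> norm (?g t)" for q
          by (intro AE_I2) (auto simp: indicator_def)
      qed auto
      then have "(\<lambda>q. 0::real) \<longlonglongrightarrow> (\<integral>t. indicator {x<..} t * ?g t \<partial>lborel)"
        unfolding y_def dy .
      then show ?thesis by (simp add: LIMSEQ_const_iff)
    qed
  qed
  then have "AE t in lborel. \<forall>T::nat. indicator {- real T..<real T} t * (lattice_sum 1 \<phi> t - 1) = 0"
    by (subst AE_all_countable) blast
  then show ?thesis
  proof eventually_elim
    case (elim t)
    obtain T :: nat where "\<bar>t\<bar> < real T" using reals_Archimedean2 by blast
    then show ?case using elim[rule_format, of T] by (auto simp: indicator_def split: if_splits)
  qed
qed

section \<open>Discrete wavelet filters and their covariances\<close>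

text \<open>All double integrals below are taken with respect to the product measure of two copies of
  \<open>lborel\<close>; integrands of product form are evaluated by this rule.\<close>

lemma tensor_integral:
  fixes f g :: "real \<Rightarrow> real"
  assumes f: "integrable lborel f" and g: "integrable lborel g"
  shows "integrable (lborel \<Otimes>\<^sub>M lborel) (\<lambda>z. f (fst z) * g (snd z))"
    and "(\<integral>z. f (fst z) * g (snd z) \<partial>(lborel \<Otimes>\<^sub>M lborel)) = (\<integral>t. f t \<partial>lborel) * (\<integral>t. g t \<partial>lborel)"
proof -
  have [measurable]: "f \<in> borel_measurable borel" "g \<in> borel_measurable borel" using f g by auto
  show i: "integrable (lborel \<Otimes>\<^sub>M lborel) (\<lambda>z. f (fst z) * g (snd z))"
  proof (rule lborel_pair.Fubini_integrable)
    show "integrable lborel (\<lambda>x. \<integral>y. norm (f (fst (x, y)) * g (snd (x, y))) \<partial>lborel)"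
      using f by (simp add: abs_mult)
    show "AE x in lborel. integrable lborel (\<lambda>y. f (fst (x, y)) * g (snd (x, y)))"
      using g by simp
  qed simp
  show "(\<integral>z. f (fst z) * g (snd z) \<partial>(lborel \<Otimes>\<^sub>M lborel)) = (\<integral>t. f t \<partial>lborel) * (\<integral>t. g t \<partial>lborel)"
    using lborel_pair.integral_fst'[OF i] by simp
qed

text \<open>The covariance of the increments \<open>X u - X v\<close> and \<open>X u' - X v'\<close> of a
  standard fractional Brownian motion, see \<open>fBm_increments\<close>.\<close>

definition increment_cov :: "real \<Rightarrow> real \<Rightarrow> real \<Rightarrow> real \<Rightarrow> real \<Rightarrow> real" where
  "increment_cov H u v u' v' =
    (\<bar>u - v'\<bar> powr (2 * H) + \<bar>v - u'\<bar> powr (2 * H) - \<bar>u - u'\<bar> powr (2 * H) - \<bar>v - v'\<bar> powr (2 * H)) / 2"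

text \<open>The covariance at lag \<open>m\<close> of the continuous-time wavelet coefficients at scale 1.
  As the wavelet has mean 0, only the term \<open>- \<bar>s - t\<bar>\<^bsup>2H\<^esup> /
  2\<close> of the covariance of fractional Brownian motion contributes.\<close>

definition wavelet_autocov :: "(real \<Rightarrow> real) \<Rightarrow> real \<Rightarrow> int \<Rightarrow> real" where
  "wavelet_autocov \<psi> H m =
    (\<integral>z. \<psi> (fst z) * \<psi> (snd z) * (- (\<bar>fst z - snd z + of_int m\<bar> powr (2 * H)) / 2) \<partial>(lborel \<Otimes>\<^sub>M lborel))"

text \<open>The properties of the pair \<open>\<phi>, \<psi>\<close> on which everything below depends. The
  partition of unity replaces the multiresolution analysis; \<open>R\<close> bounds both supports.\<close>

locale compact_wavelet =
  fixes \<phi> \<psi> :: "real \<Rightarrow> real" and R N :: nat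
  assumes R1: "R \<ge> 1" and N2: "N \<ge> 2"
    and \<phi>_supp: "\<And>t. \<bar>t\<bar> > real R \<Longrightarrow> \<phi> t = 0" and \<psi>_supp: "\<And>t. \<bar>t\<bar> > real R \<Longrightarrow> \<psi> t = 0"
    and \<phi>_L2: "\<phi> \<in> L2" and \<psi>_L2: "\<psi> \<in> L2"
    and \<phi>_int: "integrable lborel \<phi>" and \<psi>_int: "integrable lborel \<psi>"
    and \<psi>_moment: "\<And>q. q < N \<Longrightarrow> (\<integral>t. t ^ q * \<psi> t \<partial>lborel) = 0"
    and \<psi>_moment_N: "(\<integral>t. t ^ N * \<psi> t \<partial>lborel) \<noteq> 0"
    and unity: "AE t in lborel. lattice_sum 1 \<phi> t = 1"
begin

lemma \<phi>_meas [measurable]: "\<phi> \<in> borel_measurable borel" and \<psi>_meas [measurable]: "\<psi> \<in> borel_measurable borel"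
  using \<phi>_int \<psi>_int by auto

lemma \<psi>_mean: "(\<integral>t. \<psi> t \<partial>lborel) = 0"
  using \<psi>_moment[of 0] N2 by simp

lemma \<psi>_bounded_mult:
  assumes [measurable]: "k \<in> borel_measurable borel" and k: "\<And>t. \<bar>t\<bar> \<le> real R \<Longrightarrow> \<bar>k t\<bar> \<le> B"
  shows "integrable lborel (\<lambda>t. \<psi> t * k t)"
proof (rule Bochner_Integration.integrable_bound)
  show "integrable lborel (\<lambda>t. \<psi> t * B)" using \<psi>_int by simp
  show "AE t in lborel. norm (\<psi> t * k t) \<le> norm (\<psi> t * B)"
  proof (rule AE_I2)
    fix t show "norm (\<psi> t * k t) \<le> norm (\<psi> t * B)"
    proof (cases "\<bar>t\<bar> \<le> real R")
      case True
      then have "\<bar>k t\<bar> \<le> \<bar>B\<bar>" using k[OF True] by linarith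
      then show ?thesis by (simp add: abs_mult mult_left_mono)
    qed (use \<psi>_supp in auto)
  qed
qed measurable

lemma \<psi>_kernel_integrable:
  assumes [measurable]: "k \<in> borel_measurable (borel \<Otimes>\<^sub>M borel)"
    and k: "\<And>t s. \<bar>t\<bar> \<le> real R \<Longrightarrow> \<bar>s\<bar> \<le> real R \<Longrightarrow> \<bar>k (t, s)\<bar> \<le> B"
  shows "integrable (lborel \<Otimes>\<^sub>M lborel) (\<lambda>z. \<psi> (fst z) * \<psi> (snd z) * k z)"
proof (rule Bochner_Integration.integrable_bound)
  show "integrable (lborel \<Otimes>\<^sub>M lborel) (\<lambda>z. \<psi> (fst z) * \<psi> (snd z) * B)"
    by (intro integrable_mult_left tensor_integral(1) \<psi>_int)
  show "(\<lambda>z. \<psi> (fst z) * \<psi> (snd z) * k z) \<in> borel_measurable (lborel \<Otimes>\<^sub>M lborel)"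
    by measurable
  show "AE z in lborel \<Otimes>\<^sub>M lborel. norm (\<psi> (fst z) * \<psi> (snd z) * k z) \<le> norm (\<psi> (fst z) * \<psi> (snd z) * B)"
  proof (rule AE_I2)
    fix z :: "real \<times> real"
    show "norm (\<psi> (fst z) * \<psi> (snd z) * k z) \<le> norm (\<psi> (fst z) * \<psi> (snd z) * B)"
    proof (cases "\<bar>fst z\<bar> \<le> real R \<and> \<bar>snd z\<bar> \<le> real R")
      case True
      then have "\<bar>k z\<bar> \<le> \<bar>B\<bar>" using k[of "fst z" "snd z"] by (simp add: abs_if split: if_splits)
      then show ?thesis by (simp add: abs_mult mult_left_mono)
    next
      case False
      then have "\<psi> (fst z) = 0 \<or> \<psi> (snd z) = 0" using \<psi>_supp[of "fst z"] \<psi>_supp[of "snd z"] by linarith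
      then show ?thesis by auto
    qed
  qed
qed

text \<open>Self-similarity: after the terms that depend on one variable only have been removed by the
  vanishing mean, the kernel is homogeneous of degree \<open>2H\<close>.\<close>

lemma increment_cov_integral:
  assumes H: "0 < H"
  shows "integrable (lborel \<Otimes>\<^sub>M lborel)
      (\<lambda>z. \<psi> (fst z) * \<psi> (snd z) * increment_cov H (a * of_int m + a * fst z) (a * of_int m) (a * snd z) 0)"
    and "a \<ge> 0 \<Longrightarrow> (\<integral>z. \<psi> (fst z) * \<psi> (snd z) * increment_cov H (a * of_int m + a * fst z) (a * of_int m) (a * snd z) 0 \<partial>(lborel \<Otimes>\<^sub>M lborel))
      = a powr (2 * H) * wavelet_autocov \<psi> H m"
proof -
  let ?M = "lborel \<Otimes>\<^sub>M (lborel :: real measure)"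
  let ?\<tau> = "a * of_int m"
  define f where "f t = \<bar>?\<tau> + a * t\<bar> powr (2 * H)" for t
  define g where "g t = \<bar>?\<tau> - a * t\<bar> powr (2 * H)" for t
  define k where "k z = - (\<bar>?\<tau> + a * fst z - a * snd z\<bar> powr (2 * H)) / 2" for z :: "real \<times> real"
  have b: "\<bar>x * t\<bar> \<le> \<bar>x\<bar> * real R" if "\<bar>t\<bar> \<le> real R" for x t :: real
    using that by (simp add: abs_mult mult_left_mono)
  have fi: "integrable lborel (\<lambda>t. \<psi> t * f t)"
  proof (rule \<psi>_bounded_mult)
    show "f \<in> borel_measurable borel" unfolding f_def by measurable
    fix t assume "\<bar>t\<bar> \<le> real R"
    then have "\<bar>?\<tau> + a * t\<bar> \<le> \<bar>?\<tau>\<bar> + \<bar>a\<bar> * real R" using b[of t a] by linarith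
    then have "f t \<le> (\<bar>?\<tau>\<bar> + \<bar>a\<bar> * real R) powr (2 * H)" unfolding f_def using H by (intro powr_mono2) auto
    then show "\<bar>f t\<bar> \<le> (\<bar>?\<tau>\<bar> + \<bar>a\<bar> * real R) powr (2 * H)" by (simp add: f_def)
  qed
  have gi: "integrable lborel (\<lambda>t. \<psi> t * g t)"
  proof (rule \<psi>_bounded_mult)
    show "g \<in> borel_measurable borel" unfolding g_def by measurable
    fix t assume "\<bar>t\<bar> \<le> real R"
    then have "\<bar>?\<tau> - a * t\<bar> \<le> \<bar>?\<tau>\<bar> + \<bar>a\<bar> * real R" using b[of t a] by linarith
    then have "g t \<le> (\<bar>?\<tau>\<bar> + \<bar>a\<bar> * real R) powr (2 * H)" unfolding g_def using H by (intro powr_mono2) auto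
    then show "\<bar>g t\<bar> \<le> (\<bar>?\<tau>\<bar> + \<bar>a\<bar> * real R) powr (2 * H)" by (simp add: g_def)
  qed
  have ki: "integrable ?M (\<lambda>z. \<psi> (fst z) * \<psi> (snd z) * k z)"
  proof (rule \<psi>_kernel_integrable)
    show "k \<in> borel_measurable (borel \<Otimes>\<^sub>M borel)" unfolding k_def by measurable
    fix t s assume "\<bar>t\<bar> \<le> real R" "\<bar>s\<bar> \<le> real R"
    then have "\<bar>?\<tau> + a * t - a * s\<bar> \<le> \<bar>?\<tau>\<bar> + \<bar>a\<bar> * real R + \<bar>a\<bar> * real R" using b[of t a] b[of s a] by linarith
    then have "\<bar>?\<tau> + a * t - a * s\<bar> powr (2 * H) \<le> (\<bar>?\<tau>\<bar> + \<bar>a\<bar> * real R + \<bar>a\<bar> * real R) powr (2 * H)" using H by (intro powr_mono2) auto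
    then show "\<bar>k (t, s)\<bar> \<le> (\<bar>?\<tau>\<bar> + \<bar>a\<bar> * real R + \<bar>a\<bar> * real R) powr (2 * H) / 2" by (simp add: k_def)
  qed
  \<comment> \<open>The part of the integrand that is a sum of products with one factor equal to
    \<open>\<psi>\<close>; it integrates to 0.\<close>
  define T where "T z = ((\<psi> (fst z) * f (fst z)) * \<psi> (snd z) + \<psi> (fst z) * (\<psi> (snd z) * g (snd z)) -
      \<bar>?\<tau>\<bar> powr (2 * H) * (\<psi> (fst z) * \<psi> (snd z))) / 2" for z
  note ti = tensor_integral[OF fi \<psi>_int] tensor_integral[OF \<psi>_int gi] tensor_integral[OF \<psi>_int \<psi>_int]
  have Ti: "integrable ?M T" unfolding T_def
    by (intro integrable_divide Bochner_Integration.integrable_diff Bochner_Integration.integrable_add integrable_mult_right ti)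
  have T0: "(\<integral>z. T z \<partial>?M) = 0"
    unfolding T_def
    by (simp add: ti \<psi>_mean Bochner_Integration.integral_diff Bochner_Integration.integral_add)
  have eq: "\<psi> (fst z) * \<psi> (snd z) * increment_cov H (?\<tau> + a * fst z) ?\<tau> (a * snd z) 0
      = T z + \<psi> (fst z) * \<psi> (snd z) * k z" for z
    by (simp add: T_def increment_cov_def f_def g_def k_def field_simps)
  show "integrable ?M (\<lambda>z. \<psi> (fst z) * \<psi> (snd z) * increment_cov H (?\<tau> + a * fst z) ?\<tau> (a * snd z) 0)"
    unfolding eq by (intro Bochner_Integration.integrable_add Ti ki)
  assume a: "a \<ge> 0"
  have kz: "\<psi> (fst z) * \<psi> (snd z) * k z =
    a powr (2 * H) * (\<psi> (fst z) * \<psi> (snd z) * (- (\<bar>fst z - snd z + of_int m\<bar> powr (2 * H)) / 2))" for z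
  proof -
    have "\<bar>?\<tau> + a * fst z - a * snd z\<bar> = a * \<bar>fst z - snd z + of_int m\<bar>"
      using a by (simp add: abs_mult[of a, symmetric, unfolded abs_of_nonneg[OF a]] algebra_simps)
    then have "\<bar>?\<tau> + a * fst z - a * snd z\<bar> powr (2 * H) = a powr (2 * H) * \<bar>fst z - snd z + of_int m\<bar> powr (2 * H)"
      using a by (simp add: powr_mult)
    then show ?thesis unfolding k_def by simp
  qed
  have "(\<integral>z. \<psi> (fst z) * \<psi> (snd z) * increment_cov H (?\<tau> + a * fst z) ?\<tau> (a * snd z) 0 \<partial>?M)
    = (\<integral>z. T z \<partial>?M) + (\<integral>z. \<psi> (fst z) * \<psi> (snd z) * k z \<partial>?M)"
    unfolding eq by (intro Bochner_Integration.integral_add Ti ki)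
  also have "(\<integral>z. \<psi> (fst z) * \<psi> (snd z) * k z \<partial>?M) = a powr (2 * H) * wavelet_autocov \<psi> H m"
    unfolding kz wavelet_autocov_def by (rule integral_mult_right_zero)
  finally show "(\<integral>z. \<psi> (fst z) * \<psi> (snd z) * increment_cov H (?\<tau> + a * fst z) ?\<tau> (a * snd z) 0 \<partial>?M)
      = a powr (2 * H) * wavelet_autocov \<psi> H m" using T0 by simp
qed

text \<open>For \<open>\<bar>i\<bar>\<close> above this value the supports of \<open>\<phi>(2\<^sup>J t +
  i)\<close> and \<open>\<psi>(t)\<close> are disjoint.\<close>

definition filter_radius :: "nat \<Rightarrow> int" where
  "filter_radius J = int R * (2 ^ J + 1)"

lemma filter_product_integrable: "integrable lborel (\<lambda>t. \<phi> (2 ^ J * t + of_int i) * \<psi> t)"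
  using L2_mult_integrable[OF L2_affine[OF \<phi>_L2, of "2 ^ J" "of_int i"] \<psi>_L2] by (simp add: add.commute)

lemma wavelet_filter_rescaled:
  "wavelet_filter \<phi> \<psi> J i = 2 powr (real J / 2) * (\<integral>t. \<phi> (2 ^ J * t + of_int i) * \<psi> t \<partial>lborel)"
proof -
  have p: "2 powr (- real J) * (2 ^ J * t) = t" for t :: real
    by (simp add: powr_minus powr_realpow)
  have "(\<integral>t. \<phi> (t + of_int i) * \<psi> (2 powr (- real J) * t) \<partial>lborel)
    = 2 ^ J * (\<integral>t. \<phi> (2 ^ J * t + of_int i) * \<psi> t \<partial>lborel)"
    by (subst lborel_integral_real_affine[of "2 ^ J" _ 0]) (simp_all add: p)
  moreover have "2 powr (- real J / 2) * 2 ^ J = (2::real) powr (real J / 2)"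
    by (simp add: powr_realpow[symmetric] powr_add[symmetric])
  ultimately show ?thesis unfolding wavelet_filter_def by (simp add: mult.assoc[symmetric])
qed

lemma filter_support: "\<phi> (2 ^ J * t + of_int i) * \<psi> t \<noteq> 0 \<Longrightarrow> \<bar>i\<bar> \<le> filter_radius J"
proof -
  assume "\<phi> (2 ^ J * t + of_int i) * \<psi> t \<noteq> 0"
  then have "\<bar>2 ^ J * t + of_int i\<bar> \<le> real R" "\<bar>t\<bar> \<le> real R"
    using \<phi>_supp[of "2 ^ J * t + of_int i"] \<psi>_supp[of t] by (auto simp: not_less[symmetric])
  moreover have "\<bar>2 ^ J * t\<bar> \<le> 2 ^ J * real R"
    using \<open>\<bar>t\<bar> \<le> real R\<close> by (simp add: abs_mult)
  ultimately have "\<bar>real_of_int i\<bar> \<le> real R + 2 ^ J * real R" by linarith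
  then have "real_of_int \<bar>i\<bar> \<le> real_of_int (filter_radius J)"
    by (simp add: filter_radius_def algebra_simps)
  then show ?thesis by linarith
qed

lemma wavelet_filter_support: "\<bar>i\<bar> > filter_radius J \<Longrightarrow> wavelet_filter \<phi> \<psi> J i = 0"
proof -
  assume "\<bar>i\<bar> > filter_radius J"
  then have "(\<lambda>t. \<phi> (2 ^ J * t + of_int i) * \<psi> t) = (\<lambda>_. 0)"
    using filter_support[of J _ i] by force
  then show ?thesis unfolding wavelet_filter_rescaled by simp
qed

text \<open>Multiplied by \<open>\<psi>\<close>, the partition of unity becomes a finite sum with a range of
  indices that does not depend on \<open>t\<close>.\<close>

lemma unity_scaled:
  "AE t in lborel. (\<Sum>i\<in>{- filter_radius J..filter_radius J}. \<phi> (2 ^ J * t + of_int i) * \<psi> t) = \<psi> t"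
proof -
  have [measurable]: "lattice_sum 1 \<phi> \<in> borel_measurable borel"
    by (rule lattice_sum_measurable[of R]) (use \<phi>_supp in auto)
  have "AE t in lborel. lattice_sum 1 \<phi> (0 + 2 ^ J * t) = 1"
    by (rule AE_borel_affine[OF _ _ unity]) (simp, measurable)
  then show ?thesis
  proof eventually_elim
    case (elim t)
    show ?case
    proof (cases "\<psi> t = 0")
      case False
      have "lattice_sum 1 \<phi> (2 ^ J * t) = (\<Sum>i\<in>{- filter_radius J..filter_radius J}. \<phi> (2 ^ J * t + of_int (1 * i)))"
      proof (rule lattice_sum_eq)
        show "{l. \<phi> (2 ^ J * t + of_int (1 * l)) \<noteq> 0} \<subseteq> {- filter_radius J..filter_radius J}"
        proof
          fix l assume "l \<in> {l. \<phi> (2 ^ J * t + of_int (1 * l)) \<noteq> 0}"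
          then have "\<bar>l\<bar> \<le> filter_radius J" using filter_support[of J t l] False by simp
          then show "l \<in> {- filter_radius J..filter_radius J}" by auto
        qed
      qed simp
      then show ?thesis using elim by (simp add: sum_distrib_right[symmetric])
    qed simp
  qed
qed

text \<open>The discrete filter annihilates constants, since the translates of \<open>\<phi>\<close> sum to
  1 and \<open>\<psi>\<close> has mean 0.\<close>

lemma wavelet_filter_sum: "(\<Sum>i\<in>{- filter_radius J..filter_radius J}. wavelet_filter \<phi> \<psi> J i) = 0"
proof -
  have "(\<Sum>i\<in>{- filter_radius J..filter_radius J}. wavelet_filter \<phi> \<psi> J i) = 2 powr (real J / 2) *
      (\<integral>t. (\<Sum>i\<in>{- filter_radius J..filter_radius J}. \<phi> (2 ^ J * t + of_int i) * \<psi> t) \<partial>lborel)"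
    unfolding wavelet_filter_rescaled sum_distrib_left[symmetric]
    by (subst Bochner_Integration.integral_sum) (auto intro: filter_product_integrable)
  also have "(\<integral>t. (\<Sum>i\<in>{- filter_radius J..filter_radius J}. \<phi> (2 ^ J * t + of_int i) * \<psi> t) \<partial>lborel) = (\<integral>t. \<psi> t \<partial>lborel)"
    by (rule integral_cong_AE) (use unity_scaled in auto)
  finally show ?thesis using \<psi>_mean by simp
qed

text \<open>The total mass with which the discrete filter replaces \<open>\<psi>\<close>. Its integral has
  to be bounded uniformly in \<open>J\<close>, because it multiplies the pointwise discretization
  error.\<close>

definition overlap :: "nat \<Rightarrow> real \<Rightarrow> real" where
  "overlap J t = (\<Sum>i\<in>{- filter_radius J..filter_radius J}. \<bar>\<phi> (2 ^ J * t + of_int i)\<bar> * \<bar>\<psi> t\<bar>)"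

definition overlap_bound :: real where
  "overlap_bound = ((2 * real R + 1) * (\<integral>t. (\<psi> t)\<^sup>2 \<partial>lborel) + 5 * real R * (\<integral>t. (\<phi> t)\<^sup>2 \<partial>lborel)) / 2"

text \<open>The elementary inequality \<open>2xy \<le> x\<^sup>2 + y\<^sup>2\<close> separates the two
  functions: at each point at most \<open>2R + 1\<close> translates are nonzero, and at most
  \<open>5R 2\<^sup>J\<close> translates, each with squared norm of order
  \<open>2\<^bsup>-J\<^esup>\<close>, occur altogether.\<close>

lemma overlap_integral:
  shows "integrable lborel (overlap J)" and "0 \<le> (\<integral>t. overlap J t \<partial>lborel)"
    and "(\<integral>t. overlap J t \<partial>lborel) \<le> overlap_bound"
proof -
  let ?I = "{- filter_radius J..filter_radius J}"
  have "integrable lborel (\<lambda>t. \<bar>\<phi> (2 ^ J * t + of_int i)\<bar> * \<bar>\<psi> t\<bar>)" for i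
    using integrable_abs[OF filter_product_integrable[of J i]] by (simp add: abs_mult)
  then show oi: "integrable lborel (overlap J)"
    unfolding overlap_def[abs_def] by (intro Bochner_Integration.integrable_sum) auto
  show "0 \<le> (\<integral>t. overlap J t \<partial>lborel)"
    by (rule Bochner_Integration.integral_nonneg) (auto simp: overlap_def intro!: sum_nonneg)
  have p2: "integrable lborel (\<lambda>t. (\<psi> t)\<^sup>2)" and f2: "integrable lborel (\<lambda>t. (\<phi> t)\<^sup>2)"
    using \<psi>_L2 \<phi>_L2 by (auto simp: L2_def)
  have fs: "integrable lborel (\<lambda>t. (\<phi> (2 ^ J * t + of_int i))\<^sup>2)"
    "(\<integral>t. (\<phi> (2 ^ J * t + of_int i))\<^sup>2 \<partial>lborel) = (\<integral>t. (\<phi> t)\<^sup>2 \<partial>lborel) / 2 ^ J" for i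
    using lborel_integrable_real_affine[OF f2, of "2 ^ J" "of_int i"]
      lborel_integral_real_affine[of "2 ^ J" "\<lambda>t. (\<phi> t)\<^sup>2" "of_int i"]
    by (simp_all add: add.commute)
  have pt: "overlap J t \<le> ((2 * real R + 1) * (\<psi> t)\<^sup>2 + (\<Sum>i\<in>?I. (\<phi> (2 ^ J * t + of_int i))\<^sup>2)) / 2" for t
  proof -
    let ?A = "{i\<in>?I. \<bar>2 ^ J * t + of_int i\<bar> \<le> real R}"
    have "overlap J t = (\<Sum>i\<in>?A. \<bar>\<phi> (2 ^ J * t + of_int i)\<bar> * \<bar>\<psi> t\<bar>)"
      unfolding overlap_def
    proof (rule sum.mono_neutral_right)
      show "\<forall>i\<in>?I - ?A. \<bar>\<phi> (2 ^ J * t + of_int i)\<bar> * \<bar>\<psi> t\<bar> = 0"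
      proof
        fix i assume "i \<in> ?I - ?A"
        then have "\<bar>2 ^ J * t + of_int i\<bar> > real R" by (auto simp: not_le)
        then show "\<bar>\<phi> (2 ^ J * t + of_int i)\<bar> * \<bar>\<psi> t\<bar> = 0" using \<phi>_supp by simp
      qed
    qed auto
    also have "\<dots> \<le> (\<Sum>i\<in>?A. ((\<psi> t)\<^sup>2 + (\<phi> (2 ^ J * t + of_int i))\<^sup>2) / 2)"
    proof (rule sum_mono)
      fix i
      show "\<bar>\<phi> (2 ^ J * t + of_int i)\<bar> * \<bar>\<psi> t\<bar> \<le> ((\<psi> t)\<^sup>2 + (\<phi> (2 ^ J * t + of_int i))\<^sup>2) / 2"
        using sum_squares_bound[of "\<bar>\<phi> (2 ^ J * t + of_int i)\<bar>" "\<bar>\<psi> t\<bar>"] by simp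
    qed
    also have "\<dots> = (real (card ?A) * (\<psi> t)\<^sup>2 + (\<Sum>i\<in>?A. (\<phi> (2 ^ J * t + of_int i))\<^sup>2)) / 2"
      by (simp add: sum_divide_distrib[symmetric] sum.distrib)
    also have "\<dots> \<le> ((2 * real R + 1) * (\<psi> t)\<^sup>2 + (\<Sum>i\<in>?I. (\<phi> (2 ^ J * t + of_int i))\<^sup>2)) / 2"
    proof -
      have "?A \<subseteq> {\<lceil>- real R - 2 ^ J * t\<rceil>..\<lfloor>real R - 2 ^ J * t\<rfloor>}"
        by (auto simp: ceiling_le_iff le_floor_iff)
      then have "card ?A \<le> card {\<lceil>- real R - 2 ^ J * t\<rceil>..\<lfloor>real R - 2 ^ J * t\<rfloor>}" by (intro card_mono) auto
      also have "\<dots> \<le> 2 * R + 1" unfolding card_atLeastAtMost_int by linarith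
      finally have "real (card ?A) \<le> 2 * real R + 1" by linarith
      then have "real (card ?A) * (\<psi> t)\<^sup>2 \<le> (2 * real R + 1) * (\<psi> t)\<^sup>2" by (rule mult_right_mono) simp
      moreover have "(\<Sum>i\<in>?A. (\<phi> (2 ^ J * t + of_int i))\<^sup>2) \<le> (\<Sum>i\<in>?I. (\<phi> (2 ^ J * t + of_int i))\<^sup>2)"
        by (rule sum_mono2) auto
      ultimately show ?thesis by (intro divide_right_mono add_mono) auto
    qed
    finally show ?thesis .
  qed
  have "(\<integral>t. overlap J t \<partial>lborel) \<le> (\<integral>t. ((2 * real R + 1) * (\<psi> t)\<^sup>2 + (\<Sum>i\<in>?I. (\<phi> (2 ^ J * t + of_int i))\<^sup>2)) / 2 \<partial>lborel)"
    by (intro integral_mono oi pt integrable_divide Bochner_Integration.integrable_add integrable_mult_right p2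
        Bochner_Integration.integrable_sum fs)
  also have "\<dots> = ((2 * real R + 1) * (\<integral>t. (\<psi> t)\<^sup>2 \<partial>lborel) + (\<Sum>i\<in>?I. (\<integral>t. (\<phi> t)\<^sup>2 \<partial>lborel) / 2 ^ J)) / 2"
  proof -
    have "integrable lborel (\<lambda>t. (2 * real R + 1) * (\<psi> t)\<^sup>2)" using p2 by simp
    moreover have "integrable lborel (\<lambda>t. \<Sum>i\<in>?I. (\<phi> (2 ^ J * t + of_int i))\<^sup>2)"
      by (rule Bochner_Integration.integrable_sum) (rule fs)
    moreover have "(\<integral>t. (\<Sum>i\<in>?I. (\<phi> (2 ^ J * t + of_int i))\<^sup>2) \<partial>lborel) = (\<Sum>i\<in>?I. (\<integral>t. (\<phi> t)\<^sup>2 \<partial>lborel) / 2 ^ J)"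
      by (subst Bochner_Integration.integral_sum) (auto simp: fs)
    ultimately show ?thesis by (simp add: Bochner_Integration.integral_add)
  qed
  also have "\<dots> \<le> overlap_bound"
  proof -
    have "(\<Sum>i\<in>?I. (\<integral>t. (\<phi> t)\<^sup>2 \<partial>lborel) / 2 ^ J) = (real (card ?I) / 2 ^ J) * (\<integral>t. (\<phi> t)\<^sup>2 \<partial>lborel)" by simp
    also have "\<dots> \<le> (5 * real R) * (\<integral>t. (\<phi> t)\<^sup>2 \<partial>lborel)"
    proof (rule mult_right_mono)
      have "real (card ?I) = 2 * real R * (2 ^ J + 1) + 1"
        unfolding filter_radius_def by simp
      also have "\<dots> \<le> 5 * real R * 2 ^ J"
      proof -
        have "(1::real) \<le> 2 ^ J" by simp
        then have "real R * 1 \<le> real R * 2 ^ J" by (rule mult_left_mono) simp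
        moreover have "1 \<le> real R" using R1 by simp
        moreover have "2 * real R * (2 ^ J + 1) + 1 = 2 * (real R * 2 ^ J) + 2 * real R + 1"
          "5 * real R * 2 ^ J = 5 * (real R * 2 ^ J)"
          by (simp_all add: algebra_simps)
        ultimately show ?thesis by linarith
      qed
      finally show "real (card ?I) / 2 ^ J \<le> 5 * real R" by (simp add: field_simps)
    qed simp
    finally have le: "(\<Sum>i\<in>?I. (\<integral>t. (\<phi> t)\<^sup>2 \<partial>lborel) / 2 ^ J) \<le> (5 * real R) * (\<integral>t. (\<phi> t)\<^sup>2 \<partial>lborel)" .
    show ?thesis unfolding overlap_bound_def by (intro divide_right_mono add_left_mono le) simp
  qed
  finally show "(\<integral>t. overlap J t \<partial>lborel) \<le> overlap_bound" .
qed

lemma increment_cov_split: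
  "increment_cov H u v u' v' - increment_cov H w v z v' = increment_cov H u w u' v' + increment_cov H w v u' z"
  unfolding increment_cov_def by (simp add: field_simps)

definition discretization_const :: real where
  "discretization_const = 4 * (real R)\<^sup>2 * overlap_bound\<^sup>2"

text \<open>Both the discrete double sum and the integral \<open>wavelet_autocov\<close> are written as
  double integrals against products of \<open>\<phi>(2\<^sup>J t + i) \<psi>(t)\<close>, thanks to
  the partition of unity. They then differ only in that the point \<open>- i\<close> is used in
  place of \<open>2\<^sup>J t\<close>. These points are at distance at most \<open>R\<close> on
  the support, which changes the covariance of increments by
  \<open>O((2\<^sup>J)\<^bsup>H\<^esup>)\<close> according to the Cauchy-Schwarz inequality
  \<open>inc\<close>. That inequality holds as soon as a process with the given covariance exists,
  and it is obtained from the process itself in \<open>fBm_increments\<close>.\<close>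

theorem filter_covariance_approx:
  assumes H: "0 < H" "H < 1"
    and inc: "\<And>u v u' v'. \<bar>increment_cov H u v u' v'\<bar> \<le> \<bar>u - v\<bar> powr H * \<bar>u' - v'\<bar> powr H"
  shows "\<bar>(\<Sum>i\<in>{- filter_radius J..filter_radius J}. \<Sum>i'\<in>{- filter_radius J..filter_radius J}.
      wavelet_filter \<phi> \<psi> J i * wavelet_filter \<phi> \<psi> J i' *
        (- (\<bar>2 ^ J * of_int m - of_int i + of_int i'\<bar> powr (2 * H)) / 2))
      - (2 ^ J) powr (2 * H + 1) * wavelet_autocov \<psi> H m\<bar> \<le> discretization_const * (2 ^ J) powr (1 + H)"
proof -
  let ?M = "lborel \<Otimes>\<^sub>M (lborel :: real measure)"
  let ?I = "{- filter_radius J..filter_radius J}"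
  let ?h = "wavelet_filter \<phi> \<psi> J"
  define a where "a = (2::real) ^ J"
  have a1: "a \<ge> 1" and a0: "a > 0" unfolding a_def by auto
  define \<tau> where "\<tau> = a * of_int m"
  define p where "p i t = \<phi> (a * t + of_int i) * \<psi> t" for i t
  have p_int: "integrable lborel (p i)" for i unfolding p_def[abs_def] a_def by (rule filter_product_integrable)
  have [measurable]: "p i \<in> borel_measurable borel" for i unfolding p_def[abs_def] by measurable
  \<comment> \<open>\<open>B\<close> is the covariance of increments at the sampled points, \<open>D\<close> the one
    at the points of continuous time.\<close>
  define B where "B i i' = increment_cov H (\<tau> - of_int i) \<tau> (- of_int i') 0" for i i' :: int
  define D where "D z = increment_cov H (\<tau> + a * fst z) \<tau> (a * snd z) 0" for z :: "real \<times> real"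
  have hh: "?h i * ?h i' = a * ((\<integral>t. p i t \<partial>lborel) * (\<integral>t. p i' t \<partial>lborel))" for i i'
  proof -
    have "2 powr (real J / 2) * 2 powr (real J / 2) = a"
      unfolding a_def by (simp add: powr_add[symmetric] powr_realpow)
    moreover have "?h i * ?h i' = (2 powr (real J / 2) * 2 powr (real J / 2)) * ((\<integral>t. p i t \<partial>lborel) * (\<integral>t. p i' t \<partial>lborel))"
      unfolding wavelet_filter_rescaled p_def a_def by simp
    ultimately show ?thesis by simp
  qed
  have s0: "(\<Sum>i\<in>?I. ?h i) = 0" by (rule wavelet_filter_sum)
  define S where "S = (\<Sum>i\<in>?I. \<Sum>i'\<in>?I. ?h i * ?h i' * (- (\<bar>2 ^ J * of_int m - of_int i + of_int i'\<bar> powr (2 * H)) / 2))"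
  \<comment> \<open>Since the filter sums to 0, the kernel may be completed to a covariance of increments.\<close>
  have SB: "S = (\<Sum>i\<in>?I. \<Sum>i'\<in>?I. ?h i * ?h i' * B i i')"
  proof -
    have "(\<Sum>i\<in>?I. \<Sum>i'\<in>?I. ?h i * ?h i' * B i i') = (\<Sum>i\<in>?I. \<Sum>i'\<in>?I.
       (?h i * (\<bar>\<tau> - of_int i\<bar> powr (2 * H) / 2)) * ?h i' + ?h i * (?h i' * (\<bar>\<tau> + of_int i'\<bar> powr (2 * H) / 2))
       + ?h i * ?h i' * (- (\<bar>2 ^ J * of_int m - of_int i + of_int i'\<bar> powr (2 * H)) / 2) - (?h i * (\<bar>\<tau>\<bar> powr (2 * H) / 2)) * ?h i')"
      by (intro sum.cong refl) (simp add: B_def increment_cov_def \<tau>_def a_def field_simps)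
    also have "\<dots> = (\<Sum>i\<in>?I. ?h i * (\<bar>\<tau> - of_int i\<bar> powr (2 * H) / 2)) * (\<Sum>i\<in>?I. ?h i)
       + (\<Sum>i\<in>?I. ?h i) * (\<Sum>i'\<in>?I. ?h i' * (\<bar>\<tau> + of_int i'\<bar> powr (2 * H) / 2)) + S
       - (\<Sum>i\<in>?I. ?h i * (\<bar>\<tau>\<bar> powr (2 * H) / 2)) * (\<Sum>i\<in>?I. ?h i)"
      unfolding S_def sum_product by (simp only: sum.distrib sum_subtractf)
    finally show ?thesis using s0 by simp
  qed
  define Z where "Z z = (\<Sum>i\<in>?I. \<Sum>i'\<in>?I. p i (fst z) * p i' (snd z) * B i i')" for z
  have Z_int: "integrable ?M Z"
    unfolding Z_def[abs_def]
    by (intro Bochner_Integration.integrable_sum integrable_mult_left tensor_integral(1) p_int)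
  have SZ: "S = a * (\<integral>z. Z z \<partial>?M)"
  proof -
    have "(\<integral>z. Z z \<partial>?M) = (\<Sum>i\<in>?I. \<Sum>i'\<in>?I. (\<integral>z. p i (fst z) * p i' (snd z) * B i i' \<partial>?M))"
      unfolding Z_def
      by (subst Bochner_Integration.integral_sum,
          intro Bochner_Integration.integrable_sum integrable_mult_left tensor_integral(1) p_int,
          intro sum.cong refl Bochner_Integration.integral_sum integrable_mult_left tensor_integral(1) p_int)
    also have "\<dots> = (\<Sum>i\<in>?I. \<Sum>i'\<in>?I. (\<integral>t. p i t \<partial>lborel) * (\<integral>t. p i' t \<partial>lborel) * B i i')"
      by (simp add: tensor_integral(2)[OF p_int p_int])
    finally show ?thesis unfolding SB hh by (simp add: sum_distrib_left mult.assoc)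
  qed
  let ?\<psi>\<psi> = "\<lambda>z. \<psi> (fst z) * \<psi> (snd z)"
  have D_int: "integrable ?M (\<lambda>z. ?\<psi>\<psi> z * D z)"
    and aD: "(\<integral>z. ?\<psi>\<psi> z * D z \<partial>?M) = a powr (2 * H) * wavelet_autocov \<psi> H m"
    unfolding D_def \<tau>_def using increment_cov_integral[OF H(1)] a0 by simp_all
  have [measurable]: "D \<in> borel_measurable (borel \<Otimes>\<^sub>M borel)"
    unfolding D_def[abs_def] increment_cov_def by measurable
  define E where "E z = (\<Sum>i\<in>?I. \<Sum>i'\<in>?I. p i (fst z) * p i' (snd z) * (B i i' - D z))" for z
  have ae: "AE z in ?M. Z z - ?\<psi>\<psi> z * D z = E z"
  proof -
    have "AE z in ?M. (\<Sum>i\<in>?I. p i (fst z)) = \<psi> (fst z) \<and> (\<Sum>i\<in>?I. p i (snd z)) = \<psi> (snd z)"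
    proof (rule lborel_pair.AE_pair_measure)
      show "AE x in lborel. AE y in lborel. (\<Sum>i\<in>?I. p i (fst (x, y))) = \<psi> (fst (x, y)) \<and> (\<Sum>i\<in>?I. p i (snd (x, y))) = \<psi> (snd (x, y))"
        using unity_scaled[of J] unfolding p_def a_def by auto
    qed measurable
    then show ?thesis
    proof eventually_elim
      case (elim z)
      have "E z = Z z - (\<Sum>i\<in>?I. p i (fst z)) * (\<Sum>i\<in>?I. p i (snd z)) * D z"
        unfolding E_def Z_def sum_product unfolding sum_distrib_right by (simp add: right_diff_distrib sum_subtractf)
      then show ?case using elim by simp
    qed
  qed
  have E_int: "integrable ?M E"
  proof -
    have "integrable ?M (\<lambda>z. Z z - ?\<psi>\<psi> z * D z)" by (intro Bochner_Integration.integrable_diff Z_int D_int)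
    moreover have "E \<in> borel_measurable ?M" unfolding E_def[abs_def] by measurable
    ultimately show ?thesis using ae by (auto intro: integrable_cong_AE_imp)
  qed
  define K where "K = 4 * (real R)\<^sup>2 * a powr H"
  have K0: "K \<ge> 0" unfolding K_def by simp
  have Eb: "\<bar>E z\<bar> \<le> K * (overlap J (fst z) * overlap J (snd z))" for z
  proof -
    have "\<bar>E z\<bar> \<le> (\<Sum>i\<in>?I. \<Sum>i'\<in>?I. \<bar>p i (fst z)\<bar> * \<bar>p i' (snd z)\<bar> * K)"
      unfolding E_def
    proof (intro order.trans[OF sum_abs] sum_mono)
      fix i i'
      show "\<bar>p i (fst z) * p i' (snd z) * (B i i' - D z)\<bar> \<le> \<bar>p i (fst z)\<bar> * \<bar>p i' (snd z)\<bar> * K"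
      proof (cases "p i (fst z) = 0 \<or> p i' (snd z) = 0")
        case False
        then have nz: "p i (fst z) \<noteq> 0" "p i' (snd z) \<noteq> 0" by auto
        have r: "\<bar>a * fst z + of_int i\<bar> \<le> real R" "\<bar>fst z\<bar> \<le> real R" "\<bar>a * snd z + of_int i'\<bar> \<le> real R"
          using nz \<phi>_supp[of "a * fst z + of_int i"] \<psi>_supp[of "fst z"] \<phi>_supp[of "a * snd z + of_int i'"]
          unfolding p_def by (force simp: not_le[symmetric])+
        have i': "\<bar>real_of_int i'\<bar> \<le> 2 * real R * a"
        proof -
          have "\<bar>i'\<bar> \<le> filter_radius J" using nz(2) filter_support[of J "snd z" i'] unfolding p_def a_def by simp
          then have "real_of_int \<bar>i'\<bar> \<le> real_of_int (filter_radius J)" by (rule of_int_le_iff[THEN iffD2])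
          also have "\<dots> = real R * (a + 1)" by (simp add: filter_radius_def a_def)
          also have "\<dots> \<le> real R * (2 * a)" using a1 by (intro mult_left_mono) auto
          finally show ?thesis by simp
        qed
        have fz: "\<bar>a * fst z\<bar> \<le> real R * a"
          using r(2) a0 by (simp add: abs_mult mult.commute)
        have R1': "real R \<ge> 1" using R1 by simp
        have pb: "x powr H \<le> y powr H" if "0 \<le> x" "x \<le> y" for x y :: real
          using that H by (intro powr_mono2) auto
        have big: "x powr H \<le> x" if "x \<ge> 1" for x :: real
          using powr_mono[of H 1 x] that H by simp
        have bound: "(real R * (2 * real R * a)) powr H \<le> 2 * (real R)\<^sup>2 * a powr H"
        proof -
          have RR: "1 \<le> (real R)\<^sup>2" using R1' by simp
          have "(real R * (2 * real R * a)) powr H = (2 * (real R)\<^sup>2) powr H * a powr H"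
            using a0 by (subst powr_mult[symmetric]) (auto simp: power2_eq_square algebra_simps)
          also have "\<dots> \<le> 2 * (real R)\<^sup>2 * a powr H"
            using RR by (intro mult_right_mono big) auto
          finally show ?thesis .
        qed
        have e: "B i i' - D z = increment_cov H (\<tau> - of_int i) (\<tau> + a * fst z) (- of_int i') 0
            + increment_cov H (\<tau> + a * fst z) \<tau> (- of_int i') (a * snd z)"
          unfolding B_def D_def by (rule increment_cov_split)
        have "\<bar>increment_cov H (\<tau> - of_int i) (\<tau> + a * fst z) (- of_int i') 0\<bar>
          \<le> \<bar>\<tau> - of_int i - (\<tau> + a * fst z)\<bar> powr H * \<bar>- of_int i' - 0\<bar> powr H" by (rule inc)
        also have "\<dots> \<le> real R powr H * (2 * real R * a) powr H"
          using r(1) i' by (intro mult_mono pb) auto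
        also have "\<dots> = (real R * (2 * real R * a)) powr H" using a0 by (simp add: powr_mult)
        also note bound
        finally have b1: "\<bar>increment_cov H (\<tau> - of_int i) (\<tau> + a * fst z) (- of_int i') 0\<bar> \<le> 2 * (real R)\<^sup>2 * a powr H" .
        have "\<bar>increment_cov H (\<tau> + a * fst z) \<tau> (- of_int i') (a * snd z)\<bar>
          \<le> \<bar>\<tau> + a * fst z - \<tau>\<bar> powr H * \<bar>- of_int i' - a * snd z\<bar> powr H" by (rule inc)
        also have "\<dots> \<le> (real R * a) powr H * real R powr H"
          using r(3) fz by (intro mult_mono pb) auto
        also have "\<dots> = (real R * a * real R) powr H" using a0 by (simp add: powr_mult)
        also have "\<dots> \<le> (real R * (2 * real R * a)) powr H" using a0 by (intro pb) auto
        also note bound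
        finally have b2: "\<bar>increment_cov H (\<tau> + a * fst z) \<tau> (- of_int i') (a * snd z)\<bar> \<le> 2 * (real R)\<^sup>2 * a powr H" .
        have "\<bar>B i i' - D z\<bar> \<le> K" unfolding e K_def using b1 b2 by linarith
        then show ?thesis unfolding abs_mult by (intro mult_left_mono) auto
      qed auto
    qed
    also have "\<dots> = (\<Sum>i\<in>?I. \<bar>p i (fst z)\<bar>) * (\<Sum>i'\<in>?I. \<bar>p i' (snd z)\<bar>) * K"
      unfolding sum_product unfolding sum_distrib_right ..
    also have "\<dots> = K * (overlap J (fst z) * overlap J (snd z))"
      unfolding overlap_def p_def a_def abs_mult by (rule mult.commute)
    finally show ?thesis .
  qed
  have "\<bar>\<integral>z. E z \<partial>?M\<bar> \<le> (\<integral>z. \<bar>E z\<bar> \<partial>?M)" by (rule integral_abs_bound)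
  also have "\<dots> \<le> (\<integral>z. K * (overlap J (fst z) * overlap J (snd z)) \<partial>?M)"
    by (intro integral_mono Eb integrable_abs E_int integrable_mult_right tensor_integral(1) overlap_integral(1))
  also have "\<dots> = K * ((\<integral>t. overlap J t \<partial>lborel) * (\<integral>t. overlap J t \<partial>lborel))"
    by (simp add: tensor_integral(2)[OF overlap_integral(1) overlap_integral(1)])
  also have "\<dots> \<le> K * (overlap_bound * overlap_bound)"
    using overlap_integral(2,3)[of J] by (intro mult_left_mono mult_mono K0) auto
  finally have Eint: "\<bar>\<integral>z. E z \<partial>?M\<bar> \<le> K * (overlap_bound * overlap_bound)" .
  have "S - a powr (2 * H + 1) * wavelet_autocov \<psi> H m = a * ((\<integral>z. Z z \<partial>?M) - (\<integral>z. ?\<psi>\<psi> z * D z \<partial>?M))"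
    unfolding SZ aD using a0 by (simp add: powr_add right_diff_distrib)
  also have "(\<integral>z. Z z \<partial>?M) - (\<integral>z. ?\<psi>\<psi> z * D z \<partial>?M) = (\<integral>z. Z z - ?\<psi>\<psi> z * D z \<partial>?M)"
    by (rule Bochner_Integration.integral_diff[OF Z_int D_int, symmetric])
  also have "\<dots> = (\<integral>z. E z \<partial>?M)"
    by (rule integral_cong_AE) (use ae Z_int D_int E_int in auto)
  finally have "\<bar>S - a powr (2 * H + 1) * wavelet_autocov \<psi> H m\<bar> = a * \<bar>\<integral>z. E z \<partial>?M\<bar>"
    using a0 by (simp add: abs_mult)
  also have "\<dots> \<le> a * (K * (overlap_bound * overlap_bound))" using Eint a0 by (intro mult_left_mono) auto
  also have "\<dots> = discretization_const * a powr (1 + H)"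
    unfolding K_def discretization_const_def using a0 by (simp add: powr_add power2_eq_square)
  finally show ?thesis unfolding S_def a_def .
qed

end

section \<open>Decay of the wavelet autocovariance\<close>

text \<open>For \<open>p < 2\<close> the third derivative of \<open>x\<^bsup>p\<^esup>\<close> is at most
  \<open>4 x\<^bsup>p - 3\<^esup>\<close>, which is \<open>O(1/x)\<close>.\<close>

lemma powr_taylor_remainder:
  fixes x u p :: real
  assumes p: "0 < p" "p < 2" and x: "x \<ge> 2" and u: "\<bar>u\<bar> \<le> x / 2"
  shows "\<bar>(x + u) powr p - (x powr p + p * x powr (p - 1) * u + p * (p - 1) * x powr (p - 2) * u\<^sup>2 / 2)\<bar>
    \<le> 2 * \<bar>u\<bar> ^ 3 / x"
proof (cases "u = 0")
  case False
  \<comment> \<open>The \<open>m\<close>-th derivative of \<open>y powr p\<close>.\<close>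
  define diff where "diff m y = (\<Prod>i<m. p - real i) * y powr (p - real m)" for m :: nat and y :: real
  have "\<forall>m t. m < 3 \<and> x / 2 \<le> t \<and> t \<le> 2 * x \<longrightarrow> DERIV (diff m) t :> diff (Suc m) t"
  proof (intro allI impI)
    fix m :: nat and t :: real assume "m < 3 \<and> x / 2 \<le> t \<and> t \<le> 2 * x"
    then have "t > 0" using x by linarith
    then show "DERIV (diff m) t :> diff (Suc m) t"
      unfolding diff_def by (auto intro!: derivative_eq_intros simp: algebra_simps)
  qed
  then obtain t where t: "if x + u < x then x + u < t \<and> t < x else x < t \<and> t < x + u"
    and eq: "(x + u) powr p = (\<Sum>m<3. (diff m x / fact m) * (x + u - x) ^ m) + (diff 3 t / fact 3) * (x + u - x) ^ 3"
  proof -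
    have "\<exists>t. (if x + u < x then x + u < t \<and> t < x else x < t \<and> t < x + u) \<and>
      (x + u) powr p = (\<Sum>m<3. (diff m x / fact m) * (x + u - x) ^ m) + (diff 3 t / fact 3) * (x + u - x) ^ 3"
    proof (rule Taylor)
      show "diff 0 = (\<lambda>y. y powr p)" by (simp add: diff_def fun_eq_iff)
      show "\<forall>m t. m < 3 \<and> x / 2 \<le> t \<and> t \<le> 2 * x \<longrightarrow> DERIV (diff m) t :> diff (Suc m) t" by fact
      show "x / 2 \<le> x + u" "x + u \<le> 2 * x" using u x by (auto simp: abs_le_iff)
    qed (use x False in auto)
    then show ?thesis using that by blast
  qed
  have t2: "t \<ge> x / 2" using t u by (auto split: if_splits)
  have "t powr (p - 3) \<le> (x / 2) powr (p - 3)"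
    using t2 x p by (intro powr_mono2') auto
  also have "\<dots> \<le> (x / 2) powr (- 1)" using x p by (intro powr_mono) auto
  also have "\<dots> = 2 / x" using x by (simp add: powr_minus field_simps)
  finally have tp: "t powr (p - 3) \<le> 2 / x" .
  have c: "\<bar>p * (p - 1) * (p - 2)\<bar> \<le> 2 * 1 * 2"
    unfolding abs_mult using p by (intro mult_mono) auto
  have d3: "diff 3 t = p * (p - 1) * (p - 2) * t powr (p - 3)"
    by (simp add: diff_def eval_nat_numeral algebra_simps)
  have sum: "(\<Sum>m<3. (diff m x / fact m) * (x + u - x) ^ m)
    = x powr p + p * x powr (p - 1) * u + p * (p - 1) * x powr (p - 2) * u\<^sup>2 / 2"
    by (simp add: diff_def eval_nat_numeral algebra_simps)
  have "\<bar>(x + u) powr p - (x powr p + p * x powr (p - 1) * u + p * (p - 1) * x powr (p - 2) * u\<^sup>2 / 2)\<bar>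
    = \<bar>p * (p - 1) * (p - 2)\<bar> * t powr (p - 3) / 6 * \<bar>u\<bar> ^ 3"
    unfolding eq sum d3 by (simp add: abs_mult power_abs fact_numeral)
  also have "\<dots> \<le> (2 * 1 * 2) * (2 / x) / 6 * \<bar>u\<bar> ^ 3"
    using c tp x by (intro mult_right_mono divide_right_mono mult_mono) auto
  also have "\<dots> \<le> 2 * \<bar>u\<bar> ^ 3 / x" using x by (simp add: field_simps)
  finally show ?thesis .
qed simp

lemma inverse_square_sum_bound:
  "\<exists>B::real. \<forall>A :: int set. finite A \<longrightarrow> (\<Sum>m\<in>A. 1 / (1 + (of_int m)\<^sup>2)) \<le> B"
proof -
  define f where "f n = 1 / (1 + (real n)\<^sup>2)" for n
  have f0: "0 \<le> f n" for n by (simp add: f_def)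
  have sm: "summable f"
  proof (rule summable_comparison_test)
    show "summable (\<lambda>n. inverse (real n ^ 2))" by (rule inverse_power_summable) auto
    show "\<exists>N. \<forall>n\<ge>N. norm (f n) \<le> inverse (real n ^ 2)"
      by (intro exI[of _ 1]) (auto simp: f_def field_simps add_pos_nonneg)
  qed
  have "(\<Sum>m\<in>A. 1 / (1 + (of_int m)\<^sup>2)) \<le> 2 * suminf f" if A: "finite A" for A :: "int set"
  proof -
    have h: "(\<Sum>m\<in>B. 1 / (1 + (of_int m)\<^sup>2)) \<le> suminf f" if B: "finite B" and inj: "inj_on (\<lambda>m. nat \<bar>m\<bar>) B" for B :: "int set"
    proof -
      have "(\<Sum>m\<in>B. 1 / (1 + (of_int m)\<^sup>2)) = (\<Sum>m\<in>B. f (nat \<bar>m\<bar>))"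
        by (intro sum.cong refl) (simp add: f_def)
      also have "\<dots> = sum f ((\<lambda>m. nat \<bar>m\<bar>) ` B)" using inj by (simp add: sum.reindex)
      also have "\<dots> \<le> suminf f" using B f0 by (intro sum_le_suminf sm) auto
      finally show ?thesis .
    qed
    have "(\<Sum>m\<in>A. 1 / (1 + (of_int m)\<^sup>2)) = (\<Sum>m\<in>{m\<in>A. 0 \<le> m}. 1 / (1 + (real_of_int m)\<^sup>2)) + (\<Sum>m\<in>{m\<in>A. m < 0}. 1 / (1 + (of_int m)\<^sup>2))"
      using A by (subst sum.union_disjoint[symmetric]) (auto intro!: sum.cong)
    also have "\<dots> \<le> suminf f + suminf f"
      using A by (intro add_mono h) (auto simp: inj_on_def)
    finally show ?thesis by simp
  qed
  then show ?thesis by blast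
qed

context compact_wavelet
begin

lemma \<psi>_power_integrable: "integrable lborel (\<lambda>t. t ^ q * \<psi> t)"
proof -
  have "integrable lborel (\<lambda>t. \<psi> t * t ^ q)"
    by (rule \<psi>_bounded_mult[where B = "real R ^ q"]) (auto simp: power_abs intro: power_mono)
  then show ?thesis by (simp add: mult.commute)
qed

lemma wavelet_autocov_kernel_integrable:
  assumes "0 < H"
  shows "integrable (lborel \<Otimes>\<^sub>M lborel) (\<lambda>z. \<psi> (fst z) * \<psi> (snd z) * (- (\<bar>fst z - snd z + x\<bar> powr (2 * H)) / 2))"
proof (rule \<psi>_kernel_integrable)
  fix t s assume "\<bar>t\<bar> \<le> real R" "\<bar>s\<bar> \<le> real R"
  then have "\<bar>t - s + x\<bar> \<le> 2 * real R + \<bar>x\<bar>" by linarith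
  then have "\<bar>t - s + x\<bar> powr (2 * H) \<le> (2 * real R + \<bar>x\<bar>) powr (2 * H)" using assms by (intro powr_mono2) auto
  then show "\<bar>- (\<bar>fst (t, s) - snd (t, s) + x\<bar> powr (2 * H)) / 2\<bar> \<le> (2 * real R + \<bar>x\<bar>) powr (2 * H) / 2" by simp
qed measurable

text \<open>The second-order Taylor polynomial of the kernel at \<open>\<bar>m\<bar>\<close> integrates to
  0: each of its monomials contains one of the variables in degree at most 1, and the moments of
  degree 0 and 1 vanish.\<close>

lemma wavelet_autocov_decay:
  assumes H: "0 < H" "H < 1" and m: "\<bar>m\<bar> \<ge> 4 * int R"
  shows "\<bar>wavelet_autocov \<psi> H m\<bar> \<le> 8 * real R ^ 3 * (\<integral>t. \<bar>\<psi> t\<bar> \<partial>lborel)\<^sup>2 / \<bar>of_int m\<bar>"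
proof -
  let ?M = "lborel \<Otimes>\<^sub>M (lborel :: real measure)"
  define x where "x = real_of_int \<bar>m\<bar>"
  define s where "s = (if m \<ge> 0 then 1 else - 1 :: real)"
  have ms: "real_of_int m = s * x" "s * s = 1" "\<bar>s\<bar> = 1" by (auto simp: s_def x_def)
  have x4: "x \<ge> 4 * real R" using m unfolding x_def by linarith
  have x2: "x \<ge> 2" using x4 R1 by linarith
  define p where "p = 2 * H"
  define c0 c1 c2 where "c0 = x powr p" and "c1 = p * x powr (p - 1) * s" and "c2 = p * (p - 1) * x powr (p - 2) / 2"
  \<comment> \<open>The Taylor polynomial of the kernel in \<open>fst z - snd z\<close>, multiplied out and grouped
    by moments of \<open>\<psi>\<close>.\<close>
  define T where "T z = c0 * (\<psi> (fst z) * \<psi> (snd z))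
     + c1 * ((fst z ^ 1 * \<psi> (fst z)) * \<psi> (snd z)) - c1 * (\<psi> (fst z) * (snd z ^ 1 * \<psi> (snd z)))
     + c2 * ((fst z ^ 2 * \<psi> (fst z)) * \<psi> (snd z)) - 2 * c2 * ((fst z ^ 1 * \<psi> (fst z)) * (snd z ^ 1 * \<psi> (snd z)))
     + c2 * (\<psi> (fst z) * (snd z ^ 2 * \<psi> (snd z)))" for z :: "real \<times> real"
  note pp = \<psi>_power_integrable
  note ti = tensor_integral[OF \<psi>_int \<psi>_int] tensor_integral[OF pp \<psi>_int] tensor_integral[OF \<psi>_int pp] tensor_integral[OF pp pp]
  have T_int: "integrable ?M T"
    unfolding T_def[abs_def] by (intro Bochner_Integration.integrable_add Bochner_Integration.integrable_diff integrable_mult_right ti)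
  have m1: "(\<integral>t. t ^ 1 * \<psi> t \<partial>lborel) = 0" using \<psi>_moment[of 1] N2 by simp
  have T0: "(\<integral>z. T z \<partial>?M) = 0"
  proof -
    have "(\<integral>z. T z \<partial>?M) = c0 * ((\<integral>t. \<psi> t \<partial>lborel) * (\<integral>t. \<psi> t \<partial>lborel))
      + c1 * ((\<integral>t. t ^ 1 * \<psi> t \<partial>lborel) * (\<integral>t. \<psi> t \<partial>lborel)) - c1 * ((\<integral>t. \<psi> t \<partial>lborel) * (\<integral>t. t ^ 1 * \<psi> t \<partial>lborel))
      + c2 * ((\<integral>t. t ^ 2 * \<psi> t \<partial>lborel) * (\<integral>t. \<psi> t \<partial>lborel))
      - 2 * c2 * ((\<integral>t. t ^ 1 * \<psi> t \<partial>lborel) * (\<integral>t. t ^ 1 * \<psi> t \<partial>lborel))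
      + c2 * ((\<integral>t. \<psi> t \<partial>lborel) * (\<integral>t. t ^ 2 * \<psi> t \<partial>lborel))"
      unfolding T_def ti(2,4,6,8)[symmetric]
      by (subst Bochner_Integration.integral_add Bochner_Integration.integral_diff,
          intro Bochner_Integration.integrable_add Bochner_Integration.integrable_diff integrable_mult_right ti,
          intro Bochner_Integration.integrable_add Bochner_Integration.integrable_diff integrable_mult_right ti)+ simp
    then show ?thesis unfolding \<psi>_mean m1 by simp
  qed
  define G where "G z = \<psi> (fst z) * \<psi> (snd z) * (- (\<bar>fst z - snd z + of_int m\<bar> powr p) / 2)" for z
  have G_int: "integrable ?M G" unfolding G_def[abs_def] p_def by (rule wavelet_autocov_kernel_integrable[OF H(1)])
  define C where "C = 8 * real R ^ 3 / x"
  have bound: "\<bar>G z + T z / 2\<bar> \<le> C * (\<bar>\<psi> (fst z)\<bar> * \<bar>\<psi> (snd z)\<bar>)" for z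
  proof (cases "\<psi> (fst z) = 0 \<or> \<psi> (snd z) = 0")
    case False
    then have r: "\<bar>fst z\<bar> \<le> real R" "\<bar>snd z\<bar> \<le> real R"
      using \<psi>_supp[of "fst z"] \<psi>_supp[of "snd z"] by (auto simp: not_less[symmetric])
    define u where "u = s * (fst z - snd z)"
    have ua: "\<bar>u\<bar> \<le> 2 * real R" unfolding u_def abs_mult ms(3) mult_1_left using r by linarith
    have "\<bar>fst z - snd z + of_int m\<bar> = \<bar>s * (fst z - snd z + of_int m)\<bar>" unfolding abs_mult ms(3) by simp
    also have "s * (fst z - snd z + of_int m) = x + u" unfolding u_def ms(1) using ms(2) by (simp add: algebra_simps)
    also have "\<bar>x + u\<bar> = x + u" using ua x4 by linarith
    finally have xu: "\<bar>fst z - snd z + of_int m\<bar> = x + u" .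
    have u2: "u\<^sup>2 = (fst z - snd z)\<^sup>2" unfolding u_def power_mult_distrib using ms(2) by (simp add: power2_eq_square)
    have "G z + T z / 2 = - (\<psi> (fst z) * \<psi> (snd z)) / 2 *
      ((x + u) powr p - (x powr p + p * x powr (p - 1) * u + p * (p - 1) * x powr (p - 2) * u\<^sup>2 / 2))"
    proof -
      have "T z = \<psi> (fst z) * \<psi> (snd z) * (c0 + c1 * (fst z - snd z) + c2 * (fst z - snd z)\<^sup>2)"
        unfolding T_def by (simp add: power2_eq_square algebra_simps)
      also have "c1 * (fst z - snd z) = p * x powr (p - 1) * u" by (simp add: c1_def u_def)
      also have "c2 * (fst z - snd z)\<^sup>2 = p * (p - 1) * x powr (p - 2) * u\<^sup>2 / 2" by (simp add: c2_def u2)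
      finally have Tz: "T z = \<psi> (fst z) * \<psi> (snd z) * (x powr p + p * x powr (p - 1) * u + p * (p - 1) * x powr (p - 2) * u\<^sup>2 / 2)"
        unfolding c0_def .
      have "q * (- v / 2) + q * w / 2 = - q / 2 * (v - w)" for q v w :: real by (simp add: field_simps)
      then show ?thesis unfolding G_def Tz xu .
    qed
    then have "\<bar>G z + T z / 2\<bar> = \<bar>\<psi> (fst z)\<bar> * \<bar>\<psi> (snd z)\<bar> / 2 *
      \<bar>(x + u) powr p - (x powr p + p * x powr (p - 1) * u + p * (p - 1) * x powr (p - 2) * u\<^sup>2 / 2)\<bar>"
      by (simp only: abs_mult abs_divide abs_minus_cancel abs_numeral)
    also have "\<dots> \<le> \<bar>\<psi> (fst z)\<bar> * \<bar>\<psi> (snd z)\<bar> / 2 * (2 * \<bar>u\<bar> ^ 3 / x)"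
    proof (intro mult_left_mono)
      show "\<bar>(x + u) powr p - (x powr p + p * x powr (p - 1) * u + p * (p - 1) * x powr (p - 2) * u\<^sup>2 / 2)\<bar> \<le> 2 * \<bar>u\<bar> ^ 3 / x"
        by (rule powr_taylor_remainder) (use H x2 x4 ua in \<open>auto simp: p_def\<close>)
    qed simp
    also have "\<dots> \<le> \<bar>\<psi> (fst z)\<bar> * \<bar>\<psi> (snd z)\<bar> / 2 * (2 * (2 * real R) ^ 3 / x)"
      using x2 ua by (intro mult_left_mono divide_right_mono power_mono) auto
    also have "\<dots> = C * (\<bar>\<psi> (fst z)\<bar> * \<bar>\<psi> (snd z)\<bar>)" unfolding C_def by (simp add: power_mult_distrib)
    finally show ?thesis .
  qed (auto simp: G_def T_def)
  have "wavelet_autocov \<psi> H m = (\<integral>z. G z \<partial>?M)" unfolding wavelet_autocov_def G_def p_def ..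
  also have "\<dots> = (\<integral>z. G z + T z / 2 \<partial>?M)"
    using T0 T_int G_int by (subst Bochner_Integration.integral_add) auto
  finally have "\<bar>wavelet_autocov \<psi> H m\<bar> \<le> (\<integral>z. \<bar>G z + T z / 2\<bar> \<partial>?M)"
    using integral_abs_bound[of ?M "\<lambda>z. G z + T z / 2"] by simp
  also have "\<dots> \<le> (\<integral>z. C * (\<bar>\<psi> (fst z)\<bar> * \<bar>\<psi> (snd z)\<bar>) \<partial>?M)"
    using T_int G_int bound tensor_integral(1)[OF integrable_abs[OF \<psi>_int] integrable_abs[OF \<psi>_int]]
    by (intro integral_mono integrable_abs Bochner_Integration.integrable_add integrable_divide integrable_mult_right) auto
  also have "\<dots> = C * (\<integral>t. \<bar>\<psi> t\<bar> \<partial>lborel)\<^sup>2"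
    using tensor_integral(2)[OF integrable_abs[OF \<psi>_int] integrable_abs[OF \<psi>_int]] by (simp add: power2_eq_square)
  finally show ?thesis unfolding C_def x_def by simp
qed

text \<open>The rate \<open>1/\<bar>m\<bar>\<close> is not summable but square summable, and only squares
  enter the variance of sample covariances.\<close>

theorem wavelet_autocov_square_summable:
  assumes H: "0 < H" "H < 1"
  shows "\<exists>S. \<forall>A. finite A \<longrightarrow> (\<Sum>m\<in>A. (wavelet_autocov \<psi> H m)\<^sup>2) \<le> S"
proof -
  obtain B where B: "\<And>A :: int set. finite A \<Longrightarrow> (\<Sum>m\<in>A. 1 / (1 + (of_int m)\<^sup>2)) \<le> (B::real)"
    using inverse_square_sum_bound by blast
  define K where "K = 8 * real R ^ 3 * (\<integral>t. \<bar>\<psi> t\<bar> \<partial>lborel)\<^sup>2"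
  have K0: "0 \<le> K" unfolding K_def by simp
  let ?g = "\<lambda>m. (wavelet_autocov \<psi> H m)\<^sup>2"
  let ?L = "{- (4 * int R)..4 * int R}"
  have "(\<Sum>m\<in>A. ?g m) \<le> (\<Sum>m\<in>?L. ?g m) + 2 * K\<^sup>2 * B" if A: "finite A" for A
  proof -
    have "(\<Sum>m\<in>A. ?g m) = (\<Sum>m\<in>A \<inter> ?L. ?g m) + (\<Sum>m\<in>A - ?L. ?g m)"
      using A by (rule sum.Int_Diff)
    also have "(\<Sum>m\<in>A \<inter> ?L. ?g m) \<le> (\<Sum>m\<in>?L. ?g m)" by (rule sum_mono2) auto
    also have "(\<Sum>m\<in>A - ?L. ?g m) \<le> (\<Sum>m\<in>A - ?L. 2 * K\<^sup>2 * (1 / (1 + (of_int m)\<^sup>2)))"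
    proof (rule sum_mono)
      fix m assume "m \<in> A - ?L"
      then have m4: "\<bar>m\<bar> \<ge> 4 * int R" by auto
      then have m1: "\<bar>real_of_int m\<bar> \<ge> 1" using R1 by linarith
      have "\<bar>wavelet_autocov \<psi> H m\<bar> \<le> K / \<bar>of_int m\<bar>"
        unfolding K_def by (rule wavelet_autocov_decay[OF H m4])
      then have "?g m \<le> (K / \<bar>of_int m\<bar>)\<^sup>2" using abs_le_square_iff K0 by (metis abs_abs abs_divide abs_of_nonneg)
      also have "\<dots> = K\<^sup>2 * (1 / (of_int m)\<^sup>2)" by (simp add: power_divide)
      also have "\<dots> \<le> K\<^sup>2 * (2 * (1 / (1 + (of_int m)\<^sup>2)))"
      proof (rule mult_left_mono)
        have "1 \<le> (real_of_int m)\<^sup>2" using m1 by (simp add: abs_square_le_1 abs_le_square_iff[of 1, simplified])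
        then have "1 + (real_of_int m)\<^sup>2 \<le> 2 * (real_of_int m)\<^sup>2" "0 < (real_of_int m)\<^sup>2" by linarith+
        then show "1 / (real_of_int m)\<^sup>2 \<le> 2 * (1 / (1 + (of_int m)\<^sup>2))"
          by (simp add: divide_simps)
      qed simp
      also have "\<dots> = 2 * K\<^sup>2 * (1 / (1 + (of_int m)\<^sup>2))" by simp
      finally show "?g m \<le> 2 * K\<^sup>2 * (1 / (1 + (of_int m)\<^sup>2))" by simp
    qed
    also have "\<dots> = 2 * K\<^sup>2 * (\<Sum>m\<in>A - ?L. 1 / (1 + (of_int m)\<^sup>2))" by (rule sum_distrib_left[symmetric])
    also have "\<dots> \<le> 2 * K\<^sup>2 * B" by (intro mult_left_mono B) (use A in auto)
    finally show ?thesis by simp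
  qed
  then show ?thesis by blast
qed

end

section \<open>Positivity of the wavelet variance\<close>

text \<open>The spectral density of fractional Brownian motion, up to a constant and restricted to positive
  frequencies.\<close>

definition fractional_weight :: "real \<Rightarrow> real \<Rightarrow> real" where
  "fractional_weight H x = indicator {0<..} x * x powr (- 1 - 2 * H)"

lemma fractional_weight_nonneg: "0 \<le> fractional_weight H x"
  by (simp add: fractional_weight_def)

lemma fractional_weight_measurable [measurable]: "fractional_weight H \<in> borel_measurable borel"
  unfolding fractional_weight_def[abs_def] by measurable

lemma one_minus_cos_bounds: "0 \<le> 1 - cos x" "1 - cos x \<le> 2" "1 - cos x \<le> x\<^sup>2 / 2" for x :: real
proof -
  show "0 \<le> 1 - cos x" by simp
  have "- 1 \<le> cos x" by (rule cos_ge_minus_one)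
  then show "1 - cos x \<le> 2" by linarith
  have "cos x = 1 - 2 * (sin (x / 2))\<^sup>2" using cos_double_sin[of "x / 2"] by simp
  moreover have "(sin (x / 2))\<^sup>2 \<le> (x / 2)\<^sup>2"
    by (rule abs_le_square_iff[THEN iffD1, OF abs_sin_x_le_abs_x])
  ultimately show "1 - cos x \<le> x\<^sup>2 / 2" by (simp add: power_divide)
qed

lemma fractional_weight_cos_integrable:
  assumes H: "0 < H" "H < 1"
  shows "integrable lborel (\<lambda>x. (1 - cos x) * fractional_weight H x)"
proof (rule Bochner_Integration.integrable_bound)
  \<comment> \<open>The bounds \<open>x\<^sup>2\<close> and 2 for \<open>1 - cos x\<close> are used near 0 and near
    infinity, respectively.\<close>
  define f where "f x = indicator {0..1} x * x powr (1 - 2 * H) + 2 * (indicator {1..} x * x powr (- 1 - 2 * H))" for x :: real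
  have i1: "integrable lborel (\<lambda>x::real. indicator {0..1} x * x powr (1 - 2 * H))"
  proof (rule integrableI_nonneg)
    have "integral\<^sup>N lborel (\<lambda>x. indicator {0..1} x * x powr (1 - 2 * H)) = ennreal (1 powr (1 - 2 * H + 1) / (1 - 2 * H + 1))"
      by (rule nn_integral_has_integral_lebesgue[OF _ has_integral_powr_from_0]) (use H in auto)
    then show "integral\<^sup>N lborel (\<lambda>x. indicator {0..1} x * x powr (1 - 2 * H)) < \<infinity>" by (simp del: ennreal_numeral)
  qed auto
  have i2: "integrable lborel (\<lambda>x::real. indicator {1..} x * x powr (- 1 - 2 * H))"
  proof (rule integrableI_nonneg)
    have "integral\<^sup>N lborel (\<lambda>x. indicator {1..} x * x powr (- 1 - 2 * H)) = ennreal (- (1 powr (- 1 - 2 * H + 1)) / (- 1 - 2 * H + 1))"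
      by (rule nn_integral_has_integral_lebesgue[OF _ has_integral_powr_to_inf]) (use H in auto)
    then show "integral\<^sup>N lborel (\<lambda>x. indicator {1..} x * x powr (- 1 - 2 * H)) < \<infinity>" by (simp del: ennreal_numeral)
  qed auto
  show "integrable lborel f" unfolding f_def[abs_def]
    by (intro Bochner_Integration.integrable_add integrable_mult_right i1 i2)
  show "AE x in lborel. norm ((1 - cos x) * fractional_weight H x) \<le> norm (f x)"
  proof (rule AE_I2)
    fix x :: real
    have f0: "0 \<le> f x" by (simp add: f_def)
    have "(1 - cos x) * fractional_weight H x \<le> f x"
    proof (cases "x > 0")
      case True
      show ?thesis
      proof (cases "x \<le> 1")
        case x1: True
        have "(1 - cos x) * fractional_weight H x \<le> (x\<^sup>2 / 2) * x powr (- 1 - 2 * H)"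
          using True one_minus_cos_bounds(3)[of x] by (simp add: fractional_weight_def mult_right_mono)
        also have "\<dots> \<le> x powr 2 * x powr (- 1 - 2 * H)" using True by (simp add: powr_numeral)
        also have "\<dots> = x powr (1 - 2 * H)" by (simp add: powr_add[symmetric])
        also have "\<dots> \<le> f x" using x1 True by (simp add: f_def indicator_def)
        finally show ?thesis .
      next
        case False
        have "(1 - cos x) * fractional_weight H x \<le> 2 * x powr (- 1 - 2 * H)"
          using True one_minus_cos_bounds(2)[of x] by (simp add: fractional_weight_def mult_right_mono)
        also have "\<dots> \<le> f x" using False by (simp add: f_def)
        finally show ?thesis .
      qed
    qed (use f0 in \<open>simp add: fractional_weight_def\<close>)
    then show "norm ((1 - cos x) * fractional_weight H x) \<le> norm (f x)"
      using f0 one_minus_cos_bounds(1)[of x] fractional_weight_nonneg[of H x] by simp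
  qed
qed measurable

definition fractional_const :: "real \<Rightarrow> real" where
  "fractional_const H = (\<integral>x. (1 - cos x) * fractional_weight H x \<partial>lborel)"

text \<open>The substitution \<open>\<xi> \<mapsto> \<bar>x\<bar> \<xi>\<close> turns one side into the
  other. The formula expresses \<open>\<bar>x\<bar>\<^bsup>2H\<^esup>\<close> as a mixture of the
  negative definite functions \<open>1 - cos (x \<xi>)\<close>.\<close>

lemma abs_powr_spectral_representation:
  assumes H: "0 < H" "H < 1"
  shows "integrable lborel (\<lambda>\<xi>. (1 - cos (x * \<xi>)) * fractional_weight H \<xi>)"
    and "(\<integral>\<xi>. (1 - cos (x * \<xi>)) * fractional_weight H \<xi> \<partial>lborel) = \<bar>x\<bar> powr (2 * H) * fractional_const H"
proof -
  have "integrable lborel (\<lambda>\<xi>. (1 - cos (x * \<xi>)) * fractional_weight H \<xi>) \<and>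
    (\<integral>\<xi>. (1 - cos (x * \<xi>)) * fractional_weight H \<xi> \<partial>lborel) = \<bar>x\<bar> powr (2 * H) * fractional_const H"
  proof (cases "x = 0")
    case False
    then have x: "\<bar>x\<bar> > 0" by simp
    have w: "fractional_weight H (\<bar>x\<bar> * \<xi>) = \<bar>x\<bar> powr (- 1 - 2 * H) * fractional_weight H \<xi>" for \<xi>
      using x by (auto simp: fractional_weight_def indicator_def powr_mult zero_less_mult_iff)
    have c: "cos (\<bar>x\<bar> * \<xi>) = cos (x * \<xi>)" for \<xi> by (simp add: abs_if)
    have e: "(1 - cos (\<bar>x\<bar> * \<xi>)) * fractional_weight H (\<bar>x\<bar> * \<xi>)
      = \<bar>x\<bar> powr (- 1 - 2 * H) * ((1 - cos (x * \<xi>)) * fractional_weight H \<xi>)" for \<xi>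
      unfolding w c by simp
    have "integrable lborel (\<lambda>\<xi>. (1 - cos (0 + \<bar>x\<bar> * \<xi>)) * fractional_weight H (0 + \<bar>x\<bar> * \<xi>))"
      using False by (intro lborel_integrable_real_affine[OF fractional_weight_cos_integrable[OF H]]) auto
    then have i: "integrable lborel (\<lambda>\<xi>. \<bar>x\<bar> powr (- 1 - 2 * H) * ((1 - cos (x * \<xi>)) * fractional_weight H \<xi>))"
      unfolding add_0_left e .
    have "fractional_const H = \<bar>x\<bar> * (\<integral>\<xi>. (1 - cos (0 + \<bar>x\<bar> * \<xi>)) * fractional_weight H (0 + \<bar>x\<bar> * \<xi>) \<partial>lborel)"
      unfolding fractional_const_def using False by (subst lborel_integral_real_affine[of "\<bar>x\<bar>" _ 0]) auto
    also have "\<dots> = (\<bar>x\<bar> * \<bar>x\<bar> powr (- 1 - 2 * H)) * (\<integral>\<xi>. (1 - cos (x * \<xi>)) * fractional_weight H \<xi> \<partial>lborel)"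
      unfolding add_0_left e by simp
    also have "\<bar>x\<bar> * \<bar>x\<bar> powr (- 1 - 2 * H) = \<bar>x\<bar> powr (- (2 * H))"
      using x powr_add[of "\<bar>x\<bar>" 1 "- 1 - 2 * H"] by simp
    finally have "\<bar>x\<bar> powr (2 * H) * fractional_const H = (\<integral>\<xi>. (1 - cos (x * \<xi>)) * fractional_weight H \<xi> \<partial>lborel)"
      using x by (simp add: powr_minus field_simps)
    then show ?thesis using i x by simp
  qed simp
  then show "integrable lborel (\<lambda>\<xi>. (1 - cos (x * \<xi>)) * fractional_weight H \<xi>)"
    "(\<integral>\<xi>. (1 - cos (x * \<xi>)) * fractional_weight H \<xi> \<partial>lborel) = \<bar>x\<bar> powr (2 * H) * fractional_const H"
    by auto
qed

lemma fractional_const_nonneg: "0 \<le> fractional_const H"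
  unfolding fractional_const_def
  using fractional_weight_nonneg one_minus_cos_bounds(1) by (intro Bochner_Integration.integral_nonneg) auto

context compact_wavelet
begin

text \<open>The square of the modulus of the Fourier transform of \<open>\<psi>\<close>, in real form.\<close>

definition energy_spectrum :: "real \<Rightarrow> real" where
  "energy_spectrum \<xi> = (\<integral>t. \<psi> t * cos (t * \<xi>) \<partial>lborel)\<^sup>2 + (\<integral>t. \<psi> t * sin (t * \<xi>) \<partial>lborel)\<^sup>2"

lemma trig_integrable:
  "integrable lborel (\<lambda>t. \<psi> t * cos (t * \<xi>))" "integrable lborel (\<lambda>t. \<psi> t * sin (t * \<xi>))"
  by (rule \<psi>_bounded_mult[where B = 1]; simp)+

lemma energy_spectrum_eq:
  "(\<integral>z. \<psi> (fst z) * \<psi> (snd z) * (1 - cos ((fst z - snd z) * \<xi>)) \<partial>(lborel \<Otimes>\<^sub>M lborel)) = - energy_spectrum \<xi>"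
proof -
  let ?M = "lborel \<Otimes>\<^sub>M (lborel :: real measure)"
  let ?c = "\<lambda>t. \<psi> t * cos (t * \<xi>)" and ?s = "\<lambda>t. \<psi> t * sin (t * \<xi>)"
  note ti = tensor_integral[OF \<psi>_int \<psi>_int] tensor_integral[OF trig_integrable(1) trig_integrable(1), of \<xi> \<xi>]
    tensor_integral[OF trig_integrable(2) trig_integrable(2), of \<xi> \<xi>]
  have "(\<integral>z. \<psi> (fst z) * \<psi> (snd z) * (1 - cos ((fst z - snd z) * \<xi>)) \<partial>?M)
    = (\<integral>z. \<psi> (fst z) * \<psi> (snd z) - ?c (fst z) * ?c (snd z) - ?s (fst z) * ?s (snd z) \<partial>?M)"
    by (intro Bochner_Integration.integral_cong refl) (simp add: left_diff_distrib cos_diff algebra_simps)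
  also have "\<dots> = (\<integral>z. \<psi> (fst z) * \<psi> (snd z) - ?c (fst z) * ?c (snd z) \<partial>?M) - (\<integral>z. ?s (fst z) * ?s (snd z) \<partial>?M)"
    by (rule Bochner_Integration.integral_diff[OF Bochner_Integration.integrable_diff[OF ti(1) ti(3)] ti(5)])
  also have "(\<integral>z. \<psi> (fst z) * \<psi> (snd z) - ?c (fst z) * ?c (snd z) \<partial>?M)
    = (\<integral>z. \<psi> (fst z) * \<psi> (snd z) \<partial>?M) - (\<integral>z. ?c (fst z) * ?c (snd z) \<partial>?M)"
    by (rule Bochner_Integration.integral_diff[OF ti(1) ti(3)])
  finally show ?thesis unfolding ti(2,4,6) \<psi>_mean by (simp add: energy_spectrum_def power2_eq_square)
qed

text \<open>The first nonvanishing moment of \<open>\<psi>\<close> dominates the Taylor expansion of its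
  Fourier transform at 0, which therefore has no zero in a punctured neighbourhood.\<close>

lemma energy_spectrum_near_zero:
  "\<exists>\<delta>>0. \<forall>\<xi>. 0 < \<xi> \<and> \<xi> < \<delta> \<longrightarrow> energy_spectrum \<xi> > 0"
proof -
  define \<mu> where "\<mu> = (\<integral>t. t ^ N * \<psi> t \<partial>lborel)"
  define B where "B = (\<integral>t. \<bar>t ^ Suc N * \<psi> t\<bar> \<partial>lborel)"
  have B0: "0 \<le> B" unfolding B_def by simp
  have \<mu>0: "\<bar>\<mu>\<bar> > 0" using \<psi>_moment_N unfolding \<mu>_def by simp
  have pos: "energy_spectrum \<xi> > 0" if \<xi>: "0 < \<xi>" "\<xi> < \<bar>\<mu>\<bar> / (B + 1)" for \<xi>
  proof (rule ccontr)
    assume "\<not> energy_spectrum \<xi> > 0"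
    then have "(\<integral>t. \<psi> t * cos (t * \<xi>) \<partial>lborel)\<^sup>2 + (\<integral>t. \<psi> t * sin (t * \<xi>) \<partial>lborel)\<^sup>2 = 0"
      unfolding energy_spectrum_def by (smt (verit) zero_le_power2)
    then have z: "(\<integral>t. \<psi> t * cos (t * \<xi>) \<partial>lborel) = 0" "(\<integral>t. \<psi> t * sin (t * \<xi>) \<partial>lborel) = 0"
      by (simp_all add: sum_power2_eq_zero_iff)
    \<comment> \<open>The Taylor polynomial of \<open>exp (i \<xi> t)\<close> of degree \<open>N\<close>, whose
      integral against \<open>\<psi>\<close> consists of the term of degree \<open>N\<close> alone.\<close>
    let ?P = "\<lambda>t::real. \<Sum>k\<le>N. (\<i> * of_real (\<xi> * t)) ^ k / fact k"
    define F where "F t = complex_of_real (\<psi> t) * iexp (\<xi> * t)" for t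
    define G where "G t = complex_of_real (\<psi> t) * ?P t" for t
    have F_eq: "F t = of_real (\<psi> t * cos (t * \<xi>)) + \<i> * of_real (\<psi> t * sin (t * \<xi>))" for t
      unfolding F_def by (simp add: exp_eq_polar cis.ctr complex_eq_iff mult.commute)
    have F_int: "integrable lborel F"
      unfolding F_eq[abs_def] by (intro Bochner_Integration.integrable_add integrable_mult_right integrable_of_real trig_integrable)
    have F0: "(\<integral>t. F t \<partial>lborel) = 0"
      unfolding F_eq using trig_integrable[of \<xi>] z
      by (subst Bochner_Integration.integral_add) (auto intro!: integrable_mult_right integrable_of_real simp del: of_real_mult)
    have G_eq: "G t = (\<Sum>k\<le>N. ((\<i> * of_real \<xi>) ^ k / fact k) * of_real (t ^ k * \<psi> t))" for t
      unfolding G_def sum_distrib_left by (intro sum.cong refl) (simp add: power_mult_distrib)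
    have G_int: "integrable lborel G"
      unfolding G_eq[abs_def] by (intro Bochner_Integration.integrable_sum integrable_mult_right integrable_of_real \<psi>_power_integrable)
    have "(\<integral>t. G t \<partial>lborel) = (\<Sum>k\<le>N. ((\<i> * of_real \<xi>) ^ k / fact k) * of_real (\<integral>t. t ^ k * \<psi> t \<partial>lborel))"
      unfolding G_eq
      by (subst Bochner_Integration.integral_sum)
        (auto intro!: integrable_mult_right integrable_of_real \<psi>_power_integrable sum.cong simp del: of_real_mult of_real_power)
    also have "\<dots> = (\<Sum>k\<le>N. if k = N then ((\<i> * of_real \<xi>) ^ N / fact N) * of_real \<mu> else 0)"
      by (intro sum.cong refl) (use \<psi>_moment in \<open>auto simp: \<mu>_def\<close>)
    finally have G0: "(\<integral>t. G t \<partial>lborel) = ((\<i> * of_real \<xi>) ^ N / fact N) * of_real \<mu>" by simp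
    have "cmod (\<integral>t. F t - G t \<partial>lborel) \<le> (\<integral>t. cmod (F t - G t) \<partial>lborel)" by (rule integral_norm_bound)
    also have "\<dots> \<le> (\<integral>t. (\<xi> ^ Suc N / fact (Suc N)) * \<bar>t ^ Suc N * \<psi> t\<bar> \<partial>lborel)"
    proof (intro integral_mono integrable_norm Bochner_Integration.integrable_diff F_int G_int integrable_mult_right integrable_abs \<psi>_power_integrable)
      fix t
      have "cmod (F t - G t) = \<bar>\<psi> t\<bar> * cmod (iexp (\<xi> * t) - ?P t)"
        unfolding F_def G_def by (simp only: right_diff_distrib[symmetric] norm_mult norm_of_real)
      also have "\<dots> \<le> \<bar>\<psi> t\<bar> * (\<bar>\<xi> * t\<bar> ^ Suc N / fact (Suc N))"
        by (intro mult_left_mono iexp_approx1) auto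
      also have "\<dots> = (\<xi> ^ Suc N / fact (Suc N)) * \<bar>t ^ Suc N * \<psi> t\<bar>"
        using \<xi> by (simp add: abs_mult power_mult_distrib power_abs)
      finally show "cmod (F t - G t) \<le> (\<xi> ^ Suc N / fact (Suc N)) * \<bar>t ^ Suc N * \<psi> t\<bar>" .
    qed
    also have "\<dots> = (\<xi> ^ Suc N / fact (Suc N)) * B" unfolding B_def by simp
    finally have le: "cmod (\<integral>t. F t - G t \<partial>lborel) \<le> (\<xi> ^ Suc N / fact (Suc N)) * B" .
    have "(\<integral>t. F t - G t \<partial>lborel) = - (((\<i> * of_real \<xi>) ^ N / fact N) * of_real \<mu>)"
      unfolding Bochner_Integration.integral_diff[OF F_int G_int] F0 G0 by simp
    then have cm: "cmod (\<integral>t. F t - G t \<partial>lborel) = \<xi> ^ N / fact N * \<bar>\<mu>\<bar>"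
      using \<xi> by (simp add: norm_mult norm_divide norm_power)
    have "\<xi> ^ Suc N / fact (Suc N) * B = \<xi> ^ N / fact N * (\<xi> / real (Suc N) * B)"
      by (simp add: divide_simps)
    then have "\<xi> ^ N / fact N * \<bar>\<mu>\<bar> \<le> \<xi> ^ N / fact N * (\<xi> / real (Suc N) * B)"
      using le unfolding cm by simp
    moreover have "0 < \<xi> ^ N / fact N" using \<xi> by simp
    ultimately have "\<bar>\<mu>\<bar> \<le> \<xi> / real (Suc N) * B" using mult_le_cancel_left_pos by blast
    also have "\<dots> \<le> \<xi> * B" using \<xi> B0 by (intro mult_right_mono) (auto simp: field_simps)
    also have "\<dots> \<le> \<xi> * (B + 1)" using \<xi> by simp
    also have "\<dots> < \<bar>\<mu>\<bar>" using \<xi> B0 by (simp add: field_simps)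
    finally show False by simp
  qed
  show ?thesis
    by (rule exI[of _ "\<bar>\<mu>\<bar> / (B + 1)"]) (use pos \<mu>0 B0 in auto)
qed

text \<open>By Fubini, \<open>wavelet_autocov \<psi> H 0\<close> is a positive multiple of the integral of
  the energy spectrum against the spectral density. This integral cannot vanish as the energy
  spectrum is positive near 0.\<close>

theorem wavelet_autocov_positive:
  assumes H: "0 < H" "H < 1"
  shows "0 < wavelet_autocov \<psi> H 0"
proof -
  let ?M = "lborel \<Otimes>\<^sub>M (lborel :: real measure)"
  let ?L = "lborel :: (real \<times> real) measure"
  let ?w = "fractional_weight H"
  let ?\<kappa> = "fractional_const H"
  define f where "f z \<xi> = \<psi> (fst z) * \<psi> (snd z) * (1 - cos ((fst z - snd z) * \<xi>)) * ?w \<xi>" for z :: "real \<times> real" and \<xi>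
  have lpair: "?M = ?L" by (rule lborel_prod)
  note spec = abs_powr_spectral_representation[OF H]
  have f1: "(\<integral>\<xi>. f z \<xi> \<partial>lborel) = \<psi> (fst z) * \<psi> (snd z) * (\<bar>fst z - snd z\<bar> powr (2 * H) * ?\<kappa>)" for z
    unfolding f_def mult.assoc[of "_ * _" "1 - cos _"] spec(2)[symmetric] by simp
  have f2: "(\<integral>\<xi>. norm (f z \<xi>) \<partial>lborel) = \<bar>\<psi> (fst z) * \<psi> (snd z)\<bar> * (\<bar>fst z - snd z\<bar> powr (2 * H) * ?\<kappa>)" for z
  proof -
    have "norm (f z \<xi>) = \<bar>\<psi> (fst z) * \<psi> (snd z)\<bar> * ((1 - cos ((fst z - snd z) * \<xi>)) * ?w \<xi>)" for \<xi>
      using one_minus_cos_bounds(1) fractional_weight_nonneg by (simp add: f_def abs_mult)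
    then show ?thesis using spec(2) by simp
  qed
  have f_meas: "(\<lambda>(z, \<xi>). f z \<xi>) \<in> borel_measurable (?L \<Otimes>\<^sub>M lborel)"
    unfolding f_def lpair[symmetric] by measurable
  have k_int: "integrable ?M (\<lambda>z. \<psi> (fst z) * \<psi> (snd z) * \<bar>fst z - snd z\<bar> powr (2 * H))"
    using integrable_mult_right[OF wavelet_autocov_kernel_integrable[OF H(1), of 0], of "-2"] by simp
  have f_int: "integrable (?L \<Otimes>\<^sub>M lborel) (\<lambda>(z, \<xi>). f z \<xi>)"
  proof (rule lborel_pair.Fubini_integrable[OF f_meas])
    show "integrable ?L (\<lambda>z. \<integral>\<xi>. norm (case (z, \<xi>) of (z, \<xi>) \<Rightarrow> f z \<xi>) \<partial>lborel)"
      unfolding prod.case f2 lpair[symmetric]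
      using integrable_mult_left[OF integrable_abs[OF k_int], of ?\<kappa>] by (simp add: abs_mult mult.assoc)
    show "AE z in ?L. integrable lborel (\<lambda>\<xi>. case (z, \<xi>) of (z, \<xi>) \<Rightarrow> f z \<xi>)"
      unfolding prod.case f_def mult.assoc[of "_ * _" "1 - cos _"] using spec(1) by (intro AE_I2) simp
  qed
  have swap: "(\<integral>z. (\<integral>\<xi>. f z \<xi> \<partial>lborel) \<partial>?L) = (\<integral>\<xi>. (\<integral>z. f z \<xi> \<partial>?L) \<partial>lborel)"
    by (rule lborel_pair.Fubini_integral[OF f_int, symmetric])
  have g: "(\<integral>z. f z \<xi> \<partial>?L) = - energy_spectrum \<xi> * ?w \<xi>" for \<xi>
    unfolding f_def energy_spectrum_eq[symmetric] lpair by simp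
  have g_int: "integrable lborel (\<lambda>\<xi>. energy_spectrum \<xi> * ?w \<xi>)"
    using lborel_pair.integrable_snd[OF f_int] unfolding g by simp
  have "2 * wavelet_autocov \<psi> H 0 * ?\<kappa> = - (\<integral>z. (\<integral>\<xi>. f z \<xi> \<partial>lborel) \<partial>?L)"
    unfolding f1 wavelet_autocov_def lpair[symmetric] by (simp add: mult.assoc[symmetric])
  also have "\<dots> = (\<integral>\<xi>. energy_spectrum \<xi> * ?w \<xi> \<partial>lborel)"
    unfolding swap g by simp
  also have "\<dots> > 0"
  proof (rule ccontr)
    have e0: "0 \<le> energy_spectrum \<xi> * ?w \<xi>" for \<xi>
      using fractional_weight_nonneg by (auto simp: energy_spectrum_def)
    assume "\<not> (\<integral>\<xi>. energy_spectrum \<xi> * ?w \<xi> \<partial>lborel) > 0"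
    then have "(\<integral>\<xi>. energy_spectrum \<xi> * ?w \<xi> \<partial>lborel) = 0"
      using Bochner_Integration.integral_nonneg[of lborel "\<lambda>\<xi>. energy_spectrum \<xi> * ?w \<xi>", OF e0] by linarith
    then have ae: "AE \<xi> in lborel. energy_spectrum \<xi> * ?w \<xi> = 0"
      using integral_nonneg_eq_0_iff_AE[OF g_int] e0 by auto
    obtain \<delta> where \<delta>: "\<delta> > 0" "\<And>\<xi>. 0 < \<xi> \<Longrightarrow> \<xi> < \<delta> \<Longrightarrow> energy_spectrum \<xi> > 0"
      using energy_spectrum_near_zero by blast
    have "AE \<xi> in lborel. \<xi> \<notin> {0<..<\<delta>}"
      using ae
    proof eventually_elim
      case (elim \<xi>)
      then show ?case using \<delta>(2)[of \<xi>] by (auto simp: fractional_weight_def)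
    qed
    then have "emeasure lborel {0<..<\<delta>} = 0"
      by (subst (asm) AE_iff_measurable[of "{0<..<\<delta>}"]) auto
    then show False using \<delta>(1) by simp
  qed
  finally have "0 < wavelet_autocov \<psi> H 0 * ?\<kappa>" by (simp add: mult.commute)
  then show ?thesis using fractional_const_nonneg[of H] by (simp add: zero_less_mult_iff)
qed

end

section \<open>Gaussian sample covariances\<close>

lemma gaussian_rv_centered_moments:
  assumes "prob_space M" and Z: "gaussian_rv M Z" and mean: "integral\<^sup>L M Z = 0"
  shows "integrable M Z" "integrable M (\<lambda>\<omega>. Z \<omega> ^ 2)" "integrable M (\<lambda>\<omega>. Z \<omega> ^ 4)"
    and "(\<integral>\<omega>. Z \<omega> ^ 4 \<partial>M) = 3 * (\<integral>\<omega>. Z \<omega> ^ 2 \<partial>M)\<^sup>2"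
proof -
  interpret prob_space M by fact
  obtain \<mu> \<sigma> where Zm: "Z \<in> borel_measurable M" and \<sigma>: "\<sigma> \<ge> 0"
    and d: "distr M borel Z = (if \<sigma> = 0 then return borel \<mu> else density lborel (normal_density \<mu> \<sigma>))"
    using Z by (auto simp: gaussian_rv_def)
  note [measurable] = Zm
  have "integrable M Z \<and> integrable M (\<lambda>\<omega>. Z \<omega> ^ 2) \<and> integrable M (\<lambda>\<omega>. Z \<omega> ^ 4) \<and>
    (\<integral>\<omega>. Z \<omega> ^ 4 \<partial>M) = 3 * (\<integral>\<omega>. Z \<omega> ^ 2 \<partial>M)\<^sup>2"
  proof (cases "\<sigma> = 0")
    case True
    have dd: "distr M borel Z = return borel \<mu>" using d True by simp
    have "AE x in distr M borel Z. x = \<mu>" unfolding dd by (subst AE_return) auto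
    then have ae: "AE \<omega> in M. Z \<omega> = \<mu>" by (subst (asm) AE_distr_iff) auto
    have int: "integrable M (\<lambda>\<omega>. f (Z \<omega>)) \<and> (\<integral>\<omega>. f (Z \<omega>) \<partial>M) = f \<mu>" if [measurable]: "f \<in> borel_measurable borel" for f :: "real \<Rightarrow> real"
    proof
      show "integrable M (\<lambda>\<omega>. f (Z \<omega>))"
        by (subst integrable_cong_AE[where g = "\<lambda>_. f \<mu>"]) (use ae in auto)
      have "(\<integral>\<omega>. f (Z \<omega>) \<partial>M) = (\<integral>\<omega>. f \<mu> \<partial>M)"
        by (rule integral_cong_AE) (use ae in auto)
      then show "(\<integral>\<omega>. f (Z \<omega>) \<partial>M) = f \<mu>" by (simp add: prob_space)
    qed
    have "\<mu> = 0" using int[of "\<lambda>x. x"] mean by simp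
    then show ?thesis using int[of "\<lambda>x. x"] int[of "\<lambda>x. x ^ 2"] int[of "\<lambda>x. x ^ 4"] by simp
  next
    case False
    then have \<sigma>0: "\<sigma> > 0" using \<sigma> by simp
    have D: "distributed M lborel Z (\<lambda>x. ennreal (normal_density \<mu> \<sigma> x))"
    proof -
      have "distr M lborel Z = distr M borel Z" by (rule distr_cong) auto
      also have "\<dots> = density lborel (\<lambda>x. ennreal (normal_density \<mu> \<sigma> x))" using d False by simp
      finally show ?thesis unfolding distributed_def using Zm by simp
    qed
    have "\<mu> = 0" using normal_distributed_expectation[OF \<sigma>0 D] mean by simp
    then have D0: "distributed M lborel Z (\<lambda>x. ennreal (normal_density 0 \<sigma> x))" using D by simp
    have i: "integrable M (\<lambda>\<omega>. Z \<omega> ^ k)" for k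
      using distributed_integrable[OF D0, of "\<lambda>x. x ^ k"] integrable_normal_moment[OF \<sigma>0, of 0 k] by simp
    have v: "(\<integral>\<omega>. Z \<omega> ^ (2 * k) \<partial>M) = fact (2 * k) / ((2 / \<sigma>\<^sup>2) ^ k * fact k)" for k
      using distributed_integral[OF D0, of "\<lambda>x. x ^ (2 * k)"] integral_normal_moment_even[OF \<sigma>0, of 0 k] by simp
    have v1: "(\<integral>\<omega>. Z \<omega> ^ 2 \<partial>M) = \<sigma>\<^sup>2" using v[of 1] \<sigma>0 by (simp add: fact_numeral)
    have v2: "(\<integral>\<omega>. Z \<omega> ^ 4 \<partial>M) = 3 * \<sigma> ^ 4" using v[of 2] \<sigma>0 by (simp add: fact_numeral power_divide field_simps)
    have "(\<integral>\<omega>. Z \<omega> ^ 4 \<partial>M) = 3 * (\<integral>\<omega>. Z \<omega> ^ 2 \<partial>M)\<^sup>2" unfolding v1 v2 by (simp flip: power_mult)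
    then show ?thesis using i[of 1] i[of 2] i[of 4] by simp
  qed
  then show "integrable M Z" "integrable M (\<lambda>\<omega>. Z \<omega> ^ 2)" "integrable M (\<lambda>\<omega>. Z \<omega> ^ 4)"
    "(\<integral>\<omega>. Z \<omega> ^ 4 \<partial>M) = 3 * (\<integral>\<omega>. Z \<omega> ^ 2 \<partial>M)\<^sup>2" by auto
qed

text \<open>The formula of Isserlis for two variables. By polarization it follows from the fourth moments of
  the combinations \<open>U\<close>, \<open>V\<close>, \<open>U + V\<close> and \<open>U -
  V\<close>, so that no joint density is required.\<close>

lemma gaussian_pair_fourth_moment:
  assumes M: "prob_space M" and G: "\<And>a b. gaussian_rv M (\<lambda>\<omega>. a * U \<omega> + b * V \<omega>)"
    and mean: "\<And>a b. (\<integral>\<omega>. a * U \<omega> + b * V \<omega> \<partial>M) = 0"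
  shows "integrable M (\<lambda>\<omega>. U \<omega> * V \<omega>)" "integrable M (\<lambda>\<omega>. U \<omega> ^ 2 * V \<omega> ^ 2)"
    and "(\<integral>\<omega>. U \<omega> ^ 2 * V \<omega> ^ 2 \<partial>M) = (\<integral>\<omega>. U \<omega> ^ 2 \<partial>M) * (\<integral>\<omega>. V \<omega> ^ 2 \<partial>M) + 2 * (\<integral>\<omega>. U \<omega> * V \<omega> \<partial>M)\<^sup>2"
proof -
  note mo = gaussian_rv_centered_moments[OF M G mean]
  have U: "integrable M (\<lambda>\<omega>. U \<omega> ^ 2)" "integrable M (\<lambda>\<omega>. U \<omega> ^ 4)" "(\<integral>\<omega>. U \<omega> ^ 4 \<partial>M) = 3 * (\<integral>\<omega>. U \<omega> ^ 2 \<partial>M)\<^sup>2"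
    using mo[of 1 0] by simp_all
  have V: "integrable M (\<lambda>\<omega>. V \<omega> ^ 2)" "integrable M (\<lambda>\<omega>. V \<omega> ^ 4)" "(\<integral>\<omega>. V \<omega> ^ 4 \<partial>M) = 3 * (\<integral>\<omega>. V \<omega> ^ 2 \<partial>M)\<^sup>2"
    using mo[of 0 1] by simp_all
  have S: "integrable M (\<lambda>\<omega>. (U \<omega> + V \<omega>) ^ 2)" "integrable M (\<lambda>\<omega>. (U \<omega> + V \<omega>) ^ 4)"
    "(\<integral>\<omega>. (U \<omega> + V \<omega>) ^ 4 \<partial>M) = 3 * (\<integral>\<omega>. (U \<omega> + V \<omega>) ^ 2 \<partial>M)\<^sup>2"
    using mo[of 1 1] by simp_all
  have D: "integrable M (\<lambda>\<omega>. (U \<omega> - V \<omega>) ^ 2)" "integrable M (\<lambda>\<omega>. (U \<omega> - V \<omega>) ^ 4)"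
    "(\<integral>\<omega>. (U \<omega> - V \<omega>) ^ 4 \<partial>M) = 3 * (\<integral>\<omega>. (U \<omega> - V \<omega>) ^ 2 \<partial>M)\<^sup>2"
    using mo[of 1 "-1"] by simp_all
  have uv: "U \<omega> * V \<omega> = ((U \<omega> + V \<omega>) ^ 2 - (U \<omega> - V \<omega>) ^ 2) / 4" for \<omega>
    by (simp add: power2_eq_square algebra_simps)
  have "integrable M (\<lambda>\<omega>. ((U \<omega> + V \<omega>) ^ 2 - (U \<omega> - V \<omega>) ^ 2) / 4)"
    by (intro integrable_divide Bochner_Integration.integrable_diff S D)
  then show UV: "integrable M (\<lambda>\<omega>. U \<omega> * V \<omega>)" unfolding uv .
  \<comment> \<open>Polarization of the product of squares.\<close>
  have uv4: "U \<omega> ^ 2 * V \<omega> ^ 2 = ((U \<omega> + V \<omega>) ^ 4 + (U \<omega> - V \<omega>) ^ 4 - 2 * U \<omega> ^ 4 - 2 * V \<omega> ^ 4) / 12" for \<omega>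
    by (simp add: power2_eq_square power4_eq_xxxx algebra_simps)
  have i4: "integrable M (\<lambda>\<omega>. ((U \<omega> + V \<omega>) ^ 4 + (U \<omega> - V \<omega>) ^ 4 - 2 * U \<omega> ^ 4 - 2 * V \<omega> ^ 4) / 12)"
    by (intro integrable_divide Bochner_Integration.integrable_diff Bochner_Integration.integrable_add integrable_mult_right S D U V)
  then show "integrable M (\<lambda>\<omega>. U \<omega> ^ 2 * V \<omega> ^ 2)" unfolding uv4 .
  let ?u = "\<integral>\<omega>. U \<omega> ^ 2 \<partial>M" and ?v = "\<integral>\<omega>. V \<omega> ^ 2 \<partial>M" and ?c = "\<integral>\<omega>. U \<omega> * V \<omega> \<partial>M"
  have s2: "(\<integral>\<omega>. (U \<omega> + V \<omega>) ^ 2 \<partial>M) = ?u + ?v + 2 * ?c"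
  proof -
    have "(\<integral>\<omega>. (U \<omega> + V \<omega>) ^ 2 \<partial>M) = (\<integral>\<omega>. U \<omega> ^ 2 + V \<omega> ^ 2 + 2 * (U \<omega> * V \<omega>) \<partial>M)"
      by (simp add: power2_sum mult.assoc)
    then show ?thesis using U V UV by simp
  qed
  have d2: "(\<integral>\<omega>. (U \<omega> - V \<omega>) ^ 2 \<partial>M) = ?u + ?v - 2 * ?c"
  proof -
    have "(\<integral>\<omega>. (U \<omega> - V \<omega>) ^ 2 \<partial>M) = (\<integral>\<omega>. U \<omega> ^ 2 + V \<omega> ^ 2 - 2 * (U \<omega> * V \<omega>) \<partial>M)"
      by (simp add: power2_diff mult.assoc)
    then show ?thesis using U V UV by simp
  qed
  have "(\<integral>\<omega>. U \<omega> ^ 2 * V \<omega> ^ 2 \<partial>M) = ((\<integral>\<omega>. (U \<omega> + V \<omega>) ^ 4 \<partial>M) + (\<integral>\<omega>. (U \<omega> - V \<omega>) ^ 4 \<partial>M)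
      - 2 * (\<integral>\<omega>. U \<omega> ^ 4 \<partial>M) - 2 * (\<integral>\<omega>. V \<omega> ^ 4 \<partial>M)) / 12"
    unfolding uv4 using S D U V by simp
  also have "\<dots> = ?u * ?v + 2 * ?c\<^sup>2"
    unfolding S(3) D(3) U(3) V(3) s2 d2 by (simp add: power2_eq_square algebra_simps)
  finally show "(\<integral>\<omega>. U \<omega> ^ 2 * V \<omega> ^ 2 \<partial>M) = ?u * ?v + 2 * ?c\<^sup>2" .
qed

text \<open>The last inequality is the Cauchy-Schwarz inequality, since the increment \<open>X u - X
  v\<close> has variance \<open>\<bar>u - v\<bar>\<^bsup>2H\<^esup>\<close>.\<close>

lemma fBm_increments:
  assumes M: "prob_space M" and X: "standard_fBm M H X" and H: "0 < H"
  shows "integrable M (\<lambda>\<omega>. X s \<omega> * X t \<omega>)"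
    and "(\<integral>\<omega>. (X u \<omega> - X v \<omega>) * (X u' \<omega> - X v' \<omega>) \<partial>M) = increment_cov H u v u' v'"
    and "\<bar>increment_cov H u v u' v'\<bar> \<le> \<bar>u - v\<bar> powr H * \<bar>u' - v'\<bar> powr H"
proof -
  interpret prob_space M by fact
  have gp: "gaussian_process M X" and mean: "\<And>t. integral\<^sup>L M (X t) = 0"
    and cov: "\<And>s t. integral\<^sup>L M (\<lambda>\<omega>. X s \<omega> * X t \<omega>) =
        (\<bar>s\<bar> powr (2 * H) + \<bar>t\<bar> powr (2 * H) - \<bar>t - s\<bar> powr (2 * H)) / 2"
    using X by (auto simp: standard_fBm_def)
  have G1: "gaussian_rv M (X t)" for t
    using gp[unfolded gaussian_process_def, rule_format, of "{t}" "\<lambda>_. 1"] by simp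
  have X2: "integrable M (\<lambda>\<omega>. X t \<omega> ^ 2)" for t
    by (rule gaussian_rv_centered_moments(2)[OF M G1 mean])
  have [measurable]: "X t \<in> borel_measurable M" for t using G1 by (auto simp: gaussian_rv_def)
  have prod: "integrable M (\<lambda>\<omega>. X s \<omega> * X t \<omega>)" for s t
  proof (rule Bochner_Integration.integrable_bound)
    show "integrable M (\<lambda>\<omega>. X s \<omega> ^ 2 + X t \<omega> ^ 2)" by (intro Bochner_Integration.integrable_add X2)
    show "AE \<omega> in M. norm (X s \<omega> * X t \<omega>) \<le> norm (X s \<omega> ^ 2 + X t \<omega> ^ 2)"
    proof (rule AE_I2)
      fix \<omega>
      have "2 * (\<bar>X s \<omega>\<bar> * \<bar>X t \<omega>\<bar>) \<le> X s \<omega> ^ 2 + X t \<omega> ^ 2"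
        using sum_squares_bound[of "\<bar>X s \<omega>\<bar>" "\<bar>X t \<omega>\<bar>"] by (simp add: mult.assoc)
      moreover have "0 \<le> \<bar>X s \<omega>\<bar> * \<bar>X t \<omega>\<bar>" by simp
      ultimately have "\<bar>X s \<omega>\<bar> * \<bar>X t \<omega>\<bar> \<le> X s \<omega> ^ 2 + X t \<omega> ^ 2" by linarith
      then show "norm (X s \<omega> * X t \<omega>) \<le> norm (X s \<omega> ^ 2 + X t \<omega> ^ 2)" by (simp add: abs_mult)
    qed
  qed measurable
  show "integrable M (\<lambda>\<omega>. X s \<omega> * X t \<omega>)" by (rule prod)
  have pexp: "(X u \<omega> - X v \<omega>) * (X u' \<omega> - X v' \<omega>) = X u \<omega> * X u' \<omega> - X u \<omega> * X v' \<omega> - X v \<omega> * X u' \<omega> + X v \<omega> * X v' \<omega>" for u v u' v' \<omega>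
    by (simp add: algebra_simps)
  have pi: "integrable M (\<lambda>\<omega>. (X u \<omega> - X v \<omega>) * (X u' \<omega> - X v' \<omega>))" for u v u' v'
    unfolding pexp by (intro Bochner_Integration.integrable_add Bochner_Integration.integrable_diff prod)
  have ic: "(\<integral>\<omega>. (X u \<omega> - X v \<omega>) * (X u' \<omega> - X v' \<omega>) \<partial>M) = increment_cov H u v u' v'" for u v u' v'
  proof -
    have "(\<integral>\<omega>. (X u \<omega> - X v \<omega>) * (X u' \<omega> - X v' \<omega>) \<partial>M) =
      (\<integral>\<omega>. X u \<omega> * X u' \<omega> \<partial>M) - (\<integral>\<omega>. X u \<omega> * X v' \<omega> \<partial>M) - (\<integral>\<omega>. X v \<omega> * X u' \<omega> \<partial>M) + (\<integral>\<omega>. X v \<omega> * X v' \<omega> \<partial>M)"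
      unfolding pexp using prod by simp
    then show ?thesis unfolding cov increment_cov_def
      by (simp add: field_simps abs_minus_commute)
  qed
  show "(\<integral>\<omega>. (X u \<omega> - X v \<omega>) * (X u' \<omega> - X v' \<omega>) \<partial>M) = increment_cov H u v u' v'" by (rule ic)
  have sq: "(\<integral>\<omega>. (X u \<omega> - X v \<omega>)\<^sup>2 \<partial>M) = (\<bar>u - v\<bar> powr H)\<^sup>2" for u v
  proof -
    have "(\<integral>\<omega>. (X u \<omega> - X v \<omega>)\<^sup>2 \<partial>M) = increment_cov H u v u v" unfolding power2_eq_square ic ..
    also have "\<dots> = \<bar>u - v\<bar> powr (2 * H)" using H by (simp add: increment_cov_def abs_minus_commute)
    also have "\<dots> = (\<bar>u - v\<bar> powr H)\<^sup>2" by (simp add: power2_eq_square powr_add[symmetric])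
    finally show ?thesis .
  qed
  show "\<bar>increment_cov H u v u' v'\<bar> \<le> \<bar>u - v\<bar> powr H * \<bar>u' - v'\<bar> powr H"
  proof (cases "u = v \<or> u' = v'")
    case True
    then show ?thesis by (auto simp: increment_cov_def)
  next
    case False
    \<comment> \<open>The standard deviations of the two increments; the weights \<open>y/x\<close> and
      \<open>x/y\<close> make the arithmetic-geometric inequality sharp.\<close>
    define x y where "x = \<bar>u - v\<bar> powr H" and "y = \<bar>u' - v'\<bar> powr H"
    have xy: "x > 0" "y > 0" using False by (auto simp: x_def y_def)
    define A where "A \<omega> = X u \<omega> - X v \<omega>" for \<omega>
    define B where "B \<omega> = X u' \<omega> - X v' \<omega>" for \<omega>
    have A2: "integrable M (\<lambda>\<omega>. (A \<omega>)\<^sup>2)" "(\<integral>\<omega>. (A \<omega>)\<^sup>2 \<partial>M) = x\<^sup>2"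
      and B2: "integrable M (\<lambda>\<omega>. (B \<omega>)\<^sup>2)" "(\<integral>\<omega>. (B \<omega>)\<^sup>2 \<partial>M) = y\<^sup>2"
      and AB: "integrable M (\<lambda>\<omega>. A \<omega> * B \<omega>)"
      using pi sq unfolding A_def B_def x_def y_def power2_eq_square by auto
    have "\<bar>increment_cov H u v u' v'\<bar> = \<bar>\<integral>\<omega>. A \<omega> * B \<omega> \<partial>M\<bar>" unfolding A_def B_def ic ..
    also have "\<dots> \<le> (\<integral>\<omega>. \<bar>A \<omega> * B \<omega>\<bar> \<partial>M)" by (rule integral_abs_bound)
    also have "\<dots> \<le> (\<integral>\<omega>. (y / x * (A \<omega>)\<^sup>2 + x / y * (B \<omega>)\<^sup>2) / 2 \<partial>M)"
    proof (rule integral_mono)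
      show "integrable M (\<lambda>\<omega>. \<bar>A \<omega> * B \<omega>\<bar>)" using AB by simp
      show "integrable M (\<lambda>\<omega>. (y / x * (A \<omega>)\<^sup>2 + x / y * (B \<omega>)\<^sup>2) / 2)" using A2 B2 by simp
      fix \<omega>
      have "0 \<le> (y * \<bar>A \<omega>\<bar> - x * \<bar>B \<omega>\<bar>)\<^sup>2 / (x * y)" using xy by simp
      also have "\<dots> = y / x * (A \<omega>)\<^sup>2 + x / y * (B \<omega>)\<^sup>2 - 2 * \<bar>A \<omega> * B \<omega>\<bar>"
        using xy by (simp add: power2_diff power_mult_distrib abs_mult field_simps power2_eq_square)
      finally show "\<bar>A \<omega> * B \<omega>\<bar> \<le> (y / x * (A \<omega>)\<^sup>2 + x / y * (B \<omega>)\<^sup>2) / 2" by simp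
    qed
    also have "\<dots> = (y / x * x\<^sup>2 + x / y * y\<^sup>2) / 2" using A2 B2 by simp
    also have "\<dots> = x * y" using xy by (simp add: power2_eq_square)
    finally show ?thesis unfolding x_def y_def .
  qed
qed

text \<open>Entrywise variances. On the diagonal, Gaussian fourth moments give \<open>2/N\<^sup>2\<close>
  times the sum of the squared covariances; off the diagonal, independence of the rows gives
  \<open>1/N\<^sup>2\<close> times the sum of the products of covariances of the two rows. Both
  are \<open>O(S/N)\<close>. Gaussianity and independence are stated as the moment identities they
  are used for.\<close>

theorem sample_covariance_deviation:
  fixes Z :: "nat \<Rightarrow> nat \<Rightarrow> 'w \<Rightarrow> real"
  assumes N: "N \<ge> 1"
    and i2: "\<And>l k. l < p \<Longrightarrow> integrable M (\<lambda>\<omega>. Z l k \<omega> ^ 2)"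
    and i4: "\<And>l k k'. l < p \<Longrightarrow> integrable M (\<lambda>\<omega>. Z l k \<omega> ^ 2 * Z l k' \<omega> ^ 2)"
    and m4: "\<And>l k k'. l < p \<Longrightarrow> (\<integral>\<omega>. Z l k \<omega> ^ 2 * Z l k' \<omega> ^ 2 \<partial>M) =
      (\<integral>\<omega>. Z l k \<omega> ^ 2 \<partial>M) * (\<integral>\<omega>. Z l k' \<omega> ^ 2 \<partial>M) + 2 * (\<integral>\<omega>. Z l k \<omega> * Z l k' \<omega> \<partial>M)\<^sup>2"
    and ip: "\<And>l l' k k'. l < p \<Longrightarrow> l' < p \<Longrightarrow> l \<noteq> l' \<Longrightarrow> integrable M (\<lambda>\<omega>. (Z l k \<omega> * Z l k' \<omega>) * (Z l' k \<omega> * Z l' k' \<omega>))"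
    and mp: "\<And>l l' k k'. l < p \<Longrightarrow> l' < p \<Longrightarrow> l \<noteq> l' \<Longrightarrow> (\<integral>\<omega>. (Z l k \<omega> * Z l k' \<omega>) * (Z l' k \<omega> * Z l' k' \<omega>) \<partial>M)
      = (\<integral>\<omega>. Z l k \<omega> * Z l k' \<omega> \<partial>M) * (\<integral>\<omega>. Z l' k \<omega> * Z l' k' \<omega> \<partial>M)"
    and S: "\<And>l. l < p \<Longrightarrow> (\<Sum>k=1..N. \<Sum>k'=1..N. (\<integral>\<omega>. Z l k \<omega> * Z l k' \<omega> \<partial>M)\<^sup>2) \<le> real N * S"
    and M: "prob_space M"
  defines "V \<equiv> \<lambda>l l' \<omega>. (\<Sum>k=1..N. Z l k \<omega> * Z l' k \<omega>) / real N"
    and "m \<equiv> \<lambda>l l'. if l = l' then (\<Sum>k=1..N. \<integral>\<omega>. Z l k \<omega> ^ 2 \<partial>M) / real N else 0"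
  shows "integrable M (\<lambda>\<omega>. \<Sum>l<p. \<Sum>l'<p. (V l l' \<omega> - m l l')\<^sup>2)"
    and "(\<integral>\<omega>. (\<Sum>l<p. \<Sum>l'<p. (V l l' \<omega> - m l l')\<^sup>2) \<partial>M) \<le> 2 * (real p)\<^sup>2 * S / real N"
proof -
  interpret prob_space M by fact
  define c where "c l k k' = (\<integral>\<omega>. Z l k \<omega> * Z l k' \<omega> \<partial>M)" for l k k'
  define e where "e l k = (\<integral>\<omega>. Z l k \<omega> ^ 2 \<partial>M)" for l k
  have N0: "real N > 0" using N by simp
  have sq: "((\<Sum>k=1..N. f k) / real N)\<^sup>2 = (\<Sum>k=1..N. \<Sum>k'=1..N. f k * f k') / (real N)\<^sup>2" for f :: "nat \<Rightarrow> real"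
    by (simp add: power_divide power2_eq_square sum_product)
  have *: "integrable M (\<lambda>\<omega>. (V l l' \<omega> - m l l')\<^sup>2) \<and> (\<integral>\<omega>. (V l l' \<omega> - m l l')\<^sup>2 \<partial>M) \<le> 2 * S / real N"
    if l: "l < p" "l' < p" for l l'
  proof (cases "l = l'")
    case True
    have eq: "(V l l' \<omega> - m l l')\<^sup>2 = (\<Sum>k=1..N. \<Sum>k'=1..N. Z l k \<omega> ^ 2 * Z l k' \<omega> ^ 2 - e l k' * Z l k \<omega> ^ 2 - e l k * Z l k' \<omega> ^ 2 + e l k * e l k') / (real N)\<^sup>2" for \<omega>
    proof -
      have "V l l' \<omega> - m l l' = (\<Sum>k=1..N. Z l k \<omega> ^ 2 - e l k) / real N"
        unfolding V_def m_def e_def using True by (simp add: sum_subtractf diff_divide_distrib power2_eq_square)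
      then show ?thesis unfolding sq[symmetric] by (simp only: sq) (simp add: algebra_simps)
    qed
    have int: "integrable M (\<lambda>\<omega>. Z l k \<omega> ^ 2 * Z l k' \<omega> ^ 2 - e l k' * Z l k \<omega> ^ 2 - e l k * Z l k' \<omega> ^ 2 + e l k * e l k')" for k k'
      by (intro Bochner_Integration.integrable_add Bochner_Integration.integrable_diff integrable_mult_right i4 i2 l integrable_const)
    have val: "(\<integral>\<omega>. Z l k \<omega> ^ 2 * Z l k' \<omega> ^ 2 - e l k' * Z l k \<omega> ^ 2 - e l k * Z l k' \<omega> ^ 2 + e l k * e l k' \<partial>M) = 2 * (c l k k')\<^sup>2" for k k'
    proof -
      have "(\<integral>\<omega>. Z l k \<omega> ^ 2 * Z l k' \<omega> ^ 2 - e l k' * Z l k \<omega> ^ 2 - e l k * Z l k' \<omega> ^ 2 + e l k * e l k' \<partial>M)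
        = (\<integral>\<omega>. Z l k \<omega> ^ 2 * Z l k' \<omega> ^ 2 \<partial>M) - e l k' * e l k - e l k * e l k' + e l k * e l k'"
        using i4[OF l(1), of k k'] i2[OF l(1), of k] i2[OF l(1), of k'] by (simp add: e_def prob_space)
      then show ?thesis unfolding m4[OF l(1)] c_def e_def by simp
    qed
    have I: "integrable M (\<lambda>\<omega>. (V l l' \<omega> - m l l')\<^sup>2)"
      unfolding eq by (intro integrable_divide Bochner_Integration.integrable_sum int)
    have "(\<integral>\<omega>. (V l l' \<omega> - m l l')\<^sup>2 \<partial>M) = (\<Sum>k=1..N. \<Sum>k'=1..N. 2 * (c l k k')\<^sup>2) / (real N)\<^sup>2"
      unfolding eq integral_divide_zero
      by (subst Bochner_Integration.integral_sum, intro Bochner_Integration.integrable_sum int)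
        (subst Bochner_Integration.integral_sum, intro int, simp only: val)
    also have "\<dots> = 2 * (\<Sum>k=1..N. \<Sum>k'=1..N. (c l k k')\<^sup>2) / (real N)\<^sup>2" by (simp add: sum_distrib_left)
    also have "\<dots> \<le> 2 * (real N * S) / (real N)\<^sup>2"
      using S[OF l(1)] unfolding c_def by (intro divide_right_mono mult_left_mono) auto
    also have "\<dots> = 2 * S / real N" using N0 by (simp add: power2_eq_square)
    finally show ?thesis using I by simp
  next
    case False
    have eq: "(V l l' \<omega> - m l l')\<^sup>2 = (\<Sum>k=1..N. \<Sum>k'=1..N. (Z l k \<omega> * Z l k' \<omega>) * (Z l' k \<omega> * Z l' k' \<omega>)) / (real N)\<^sup>2" for \<omega>
      unfolding V_def m_def using False by (simp only: sq if_False diff_0_right) (simp add: algebra_simps)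
    have I: "integrable M (\<lambda>\<omega>. (V l l' \<omega> - m l l')\<^sup>2)"
      unfolding eq by (intro integrable_divide Bochner_Integration.integrable_sum ip l False)
    have "(\<integral>\<omega>. (V l l' \<omega> - m l l')\<^sup>2 \<partial>M) = (\<Sum>k=1..N. \<Sum>k'=1..N. c l k k' * c l' k k') / (real N)\<^sup>2"
      unfolding eq integral_divide_zero
      by (subst Bochner_Integration.integral_sum, intro Bochner_Integration.integrable_sum ip l False)
        (subst Bochner_Integration.integral_sum, intro ip l False, simp only: mp[OF l False] c_def)
    also have "\<dots> \<le> (\<Sum>k=1..N. \<Sum>k'=1..N. ((c l k k')\<^sup>2 + (c l' k k')\<^sup>2) / 2) / (real N)\<^sup>2"
    proof (intro divide_right_mono sum_mono)
      fix k k'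
      show "c l k k' * c l' k k' \<le> ((c l k k')\<^sup>2 + (c l' k k')\<^sup>2) / 2"
        using sum_squares_bound[of "c l k k'" "c l' k k'"] by simp
    qed simp
    also have "\<dots> = ((\<Sum>k=1..N. \<Sum>k'=1..N. (c l k k')\<^sup>2) + (\<Sum>k=1..N. \<Sum>k'=1..N. (c l' k k')\<^sup>2)) / 2 / (real N)\<^sup>2"
      by (simp only: sum_divide_distrib[symmetric] sum.distrib)
    also have "\<dots> \<le> (real N * S + real N * S) / 2 / (real N)\<^sup>2"
      using S[OF l(1)] S[OF l(2)] unfolding c_def by (intro divide_right_mono add_mono) auto
    also have "\<dots> = S / real N" using N0 by (simp add: power2_eq_square)
    also have "\<dots> \<le> 2 * S / real N"
    proof -
      have "0 \<le> real N * S" using S[OF l(1)] by (intro order.trans[OF _ S[OF l(1)]] sum_nonneg) auto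
      then have "0 \<le> S" using N0 by (simp add: zero_le_mult_iff)
      then show ?thesis using N0 by (intro divide_right_mono) auto
    qed
    finally show ?thesis using I by simp
  qed
  then show "integrable M (\<lambda>\<omega>. \<Sum>l<p. \<Sum>l'<p. (V l l' \<omega> - m l l')\<^sup>2)"
    by (intro Bochner_Integration.integrable_sum) auto
  have "(\<integral>\<omega>. (\<Sum>l<p. \<Sum>l'<p. (V l l' \<omega> - m l l')\<^sup>2) \<partial>M) = (\<Sum>l<p. \<Sum>l'<p. \<integral>\<omega>. (V l l' \<omega> - m l l')\<^sup>2 \<partial>M)"
    using * by (subst Bochner_Integration.integral_sum) (auto intro!: Bochner_Integration.integrable_sum sum.cong Bochner_Integration.integral_sum)
  also have "\<dots> \<le> (\<Sum>l<p. \<Sum>l'<p. 2 * S / real N)"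
    using * by (intro sum_mono) auto
  also have "\<dots> = 2 * (real p)\<^sup>2 * S / real N" by (simp add: power2_eq_square)
  finally show "(\<integral>\<omega>. (\<Sum>l<p. \<Sum>l'<p. (V l l' \<omega> - m l l')\<^sup>2) \<partial>M) \<le> 2 * (real p)\<^sup>2 * S / real N" .
qed

text \<open>The operator norm is bounded by the Frobenius norm.\<close>

lemma quadratic_form_perturbation:
  fixes V m :: "nat \<Rightarrow> nat \<Rightarrow> real" and y :: "nat \<Rightarrow> real"
  assumes dev: "(\<Sum>l<p. \<Sum>l'<p. (V l l' - (if l = l' then m l l else 0))\<^sup>2) \<le> \<eta>\<^sup>2" and \<eta>: "0 \<le> \<eta>"
    and lo: "\<And>l. l < p \<Longrightarrow> 2 * \<eta> \<le> m l l" and hi: "\<And>l. l < p \<Longrightarrow> m l l \<le> B"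
  shows "\<eta> * (\<Sum>l<p. (y l)\<^sup>2) \<le> (\<Sum>l<p. \<Sum>l'<p. y l * y l' * V l l')"
    and "(\<Sum>l<p. \<Sum>l'<p. y l * y l' * V l l') \<le> (B + \<eta>) * (\<Sum>l<p. (y l)\<^sup>2)"
proof -
  let ?E = "\<lambda>l l'. V l l' - (if l = l' then m l l else 0)"
  let ?P = "{..<p} \<times> {..<p}"
  let ?s = "\<Sum>l<p. (y l)\<^sup>2"
  have s0: "0 \<le> ?s" by (intro sum_nonneg) auto
  have "(\<Sum>z\<in>?P. (y (fst z) * y (snd z)) * ?E (fst z) (snd z))\<^sup>2 \<le>
    (\<Sum>z\<in>?P. (y (fst z) * y (snd z))\<^sup>2) * (\<Sum>z\<in>?P. (?E (fst z) (snd z))\<^sup>2)"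
    by (rule Cauchy_Schwarz_ineq_sum)
  also have "(\<Sum>z\<in>?P. (y (fst z) * y (snd z))\<^sup>2) = ?s * ?s"
    unfolding sum_product sum.cartesian_product by (intro sum.cong) (auto simp: power_mult_distrib)
  also have "(\<Sum>z\<in>?P. (?E (fst z) (snd z))\<^sup>2) = (\<Sum>l<p. \<Sum>l'<p. (?E l l')\<^sup>2)"
    unfolding sum.cartesian_product by (intro sum.cong) auto
  also have "?s * ?s * (\<Sum>l<p. \<Sum>l'<p. (?E l l')\<^sup>2) \<le> ?s * ?s * \<eta>\<^sup>2"
    using dev s0 by (intro mult_left_mono) auto
  also have "\<dots> = (\<eta> * ?s)\<^sup>2" by (simp add: power2_eq_square)
  finally have "\<bar>\<Sum>z\<in>?P. (y (fst z) * y (snd z)) * ?E (fst z) (snd z)\<bar> \<le> \<bar>\<eta> * ?s\<bar>"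
    by (simp add: abs_le_square_iff)
  also have "\<bar>\<eta> * ?s\<bar> = \<eta> * ?s" using \<eta> s0 by simp
  also have "(\<Sum>z\<in>?P. (y (fst z) * y (snd z)) * ?E (fst z) (snd z)) = (\<Sum>l<p. \<Sum>l'<p. y l * y l' * ?E l l')"
    unfolding sum.cartesian_product by (intro sum.cong) auto
  also have "\<dots> = (\<Sum>l<p. \<Sum>l'<p. y l * y l' * V l l') - (\<Sum>l<p. m l l * (y l)\<^sup>2)"
  proof -
    have "(\<Sum>l'<p. y l * y l' * ?E l l') = (\<Sum>l'<p. y l * y l' * V l l') - m l l * (y l)\<^sup>2" if "l < p" for l
    proof -
      have "(\<Sum>l'<p. y l * y l' * ?E l l') = (\<Sum>l'<p. y l * y l' * V l l' - (if l' = l then m l l * (y l)\<^sup>2 else 0))"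
        by (intro sum.cong refl) (auto simp: power2_eq_square algebra_simps)
      then show ?thesis using that by (simp add: sum_subtractf)
    qed
    then show ?thesis by (simp add: sum_subtractf)
  qed
  finally have *: "\<bar>(\<Sum>l<p. \<Sum>l'<p. y l * y l' * V l l') - (\<Sum>l<p. m l l * (y l)\<^sup>2)\<bar> \<le> \<eta> * ?s" .
  have "2 * \<eta> * ?s \<le> (\<Sum>l<p. m l l * (y l)\<^sup>2)"
    unfolding sum_distrib_left by (intro sum_mono mult_right_mono lo) auto
  then show "\<eta> * ?s \<le> (\<Sum>l<p. \<Sum>l'<p. y l * y l' * V l l')" using * by linarith
  have "(\<Sum>l<p. m l l * (y l)\<^sup>2) \<le> B * ?s"
    unfolding sum_distrib_left by (intro sum_mono mult_right_mono hi) auto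
  then show "(\<Sum>l<p. \<Sum>l'<p. y l * y l' * V l l') \<le> (B + \<eta>) * ?s" using * by (simp add: algebra_simps)
qed

section \<open>Wavelet coefficients of fractional Brownian motion\<close>

context compact_wavelet
begin

text \<open>The wavelet coefficient of a scalar path \<open>x\<close> sampled at the integers, as a finite
  sum.\<close>

definition filtered :: "nat \<Rightarrow> (int \<Rightarrow> real) \<Rightarrow> nat \<Rightarrow> real" where
  "filtered J x k = (\<Sum>i\<in>{- filter_radius J..filter_radius J}. wavelet_filter \<phi> \<psi> J i * x (2 ^ J * int k - i))"

text \<open>Two coefficients are linear functionals of the values of the path on one finite set, so that
  Gaussianity of the process applies to their combinations.\<close>

lemma filtered_gaussian:
  assumes gp: "gaussian_process M X"
  shows "gaussian_rv M (\<lambda>\<omega>. a * filtered J (\<lambda>l. X (of_int l) \<omega>) k + b * filtered J (\<lambda>l. X (of_int l) \<omega>) k')"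
proof -
  let ?Q = "filter_radius J"
  define S where "S k = {2 ^ J * int k - ?Q..2 ^ J * int k + ?Q}" for k
  define c where "c k l = (if l \<in> S k then wavelet_filter \<phi> \<psi> J (2 ^ J * int k - l) else 0)" for k l
  have f: "filtered J x k = (\<Sum>l\<in>S k \<union> S k'. c k l * x l)" "filtered J x k' = (\<Sum>l\<in>S k \<union> S k'. c k' l * x l)" for x
  proof -
    have "filtered J x k = (\<Sum>l\<in>S k. c k l * x l)" for k
      unfolding filtered_def
      by (rule sum.reindex_bij_witness[where i = "\<lambda>l. 2 ^ J * int k - l" and j = "\<lambda>i. 2 ^ J * int k - i"])
        (auto simp: S_def c_def)
    moreover have "(\<Sum>l\<in>S k. c k l * x l) = (\<Sum>l\<in>S k \<union> S k'. c k l * x l)" "(\<Sum>l\<in>S k'. c k' l * x l) = (\<Sum>l\<in>S k \<union> S k'. c k' l * x l)"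
      by (rule sum.mono_neutral_left; auto simp: S_def c_def)+
    ultimately show "filtered J x k = (\<Sum>l\<in>S k \<union> S k'. c k l * x l)" "filtered J x k' = (\<Sum>l\<in>S k \<union> S k'. c k' l * x l)" by simp_all
  qed
  have "gaussian_rv M (\<lambda>\<omega>. \<Sum>t\<in>real_of_int ` (S k \<union> S k'). (a * c k \<lfloor>t\<rfloor> + b * c k' \<lfloor>t\<rfloor>) * X t \<omega>)"
    using gp[unfolded gaussian_process_def, rule_format, of "real_of_int ` (S k \<union> S k')" "\<lambda>t. a * c k \<lfloor>t\<rfloor> + b * c k' \<lfloor>t\<rfloor>"]
    by (simp add: S_def)
  also have "(\<lambda>\<omega>. \<Sum>t\<in>real_of_int ` (S k \<union> S k'). (a * c k \<lfloor>t\<rfloor> + b * c k' \<lfloor>t\<rfloor>) * X t \<omega>)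
    = (\<lambda>\<omega>. \<Sum>l\<in>S k \<union> S k'. (a * c k l + b * c k' l) * X (of_int l) \<omega>)"
    by (rule ext, subst sum.reindex) (auto simp: inj_on_def)
  also have "\<dots> = (\<lambda>\<omega>. a * filtered J (\<lambda>l. X (of_int l) \<omega>) k + b * filtered J (\<lambda>l. X (of_int l) \<omega>) k')"
    unfolding f by (simp add: sum.distrib sum_distrib_left algebra_simps)
  finally show ?thesis .
qed

text \<open>As the filter annihilates constants, the path may be replaced by its increments from the time
  \<open>2\<^sup>J k\<close>.\<close>

lemma filtered_covariance:
  assumes M: "prob_space M" and X: "standard_fBm M H X" and H: "0 < H" "H < 1"
  shows "(\<integral>\<omega>. a * filtered J (\<lambda>l. X (of_int l) \<omega>) k + b * filtered J (\<lambda>l. X (of_int l) \<omega>) k' \<partial>M) = 0"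
    and "\<bar>(\<integral>\<omega>. filtered J (\<lambda>l. X (of_int l) \<omega>) k * filtered J (\<lambda>l. X (of_int l) \<omega>) k' \<partial>M)
      - (2 ^ J) powr (2 * H + 1) * wavelet_autocov \<psi> H (int k - int k')\<bar> \<le> discretization_const * (2 ^ J) powr (1 + H)"
proof -
  interpret prob_space M by fact
  let ?Q = "filter_radius J"
  let ?I = "{- ?Q..?Q}"
  let ?h = "wavelet_filter \<phi> \<psi> J"
  have gp: "gaussian_process M X" and mean: "\<And>t. integral\<^sup>L M (X t) = 0"
    using X by (auto simp: standard_fBm_def)
  have G1: "gaussian_rv M (X t)" for t
    using gp[unfolded gaussian_process_def, rule_format, of "{t}" "\<lambda>_. 1"] by simp
  have X1: "integrable M (X t)" for t
    by (rule gaussian_rv_centered_moments(1)[OF M G1 mean])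
  have fi: "integrable M (\<lambda>\<omega>. filtered J (\<lambda>l. X (of_int l) \<omega>) k)" for k
    unfolding filtered_def by (intro Bochner_Integration.integrable_sum integrable_mult_right X1)
  have f0: "(\<integral>\<omega>. filtered J (\<lambda>l. X (of_int l) \<omega>) k \<partial>M) = 0" for k
    unfolding filtered_def using X1 by (subst Bochner_Integration.integral_sum) (auto simp: mean)
  show "(\<integral>\<omega>. a * filtered J (\<lambda>l. X (of_int l) \<omega>) k + b * filtered J (\<lambda>l. X (of_int l) \<omega>) k' \<partial>M) = 0"
    using fi f0 by simp
  note inc = fBm_increments[OF M X H(1)]
  define \<tau> where "\<tau> k = real_of_int (2 ^ J * int k)" for k
  have s0: "(\<Sum>i\<in>?I. ?h i) = 0" by (rule wavelet_filter_sum)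
  have shift: "filtered J (\<lambda>l. X (of_int l) \<omega>) k = (\<Sum>i\<in>?I. ?h i * (X (\<tau> k - of_int i) \<omega> - X (\<tau> k) \<omega>))" for k \<omega>
  proof -
    have "(\<Sum>i\<in>?I. ?h i * (X (\<tau> k - of_int i) \<omega> - X (\<tau> k) \<omega>)) =
      (\<Sum>i\<in>?I. ?h i * X (\<tau> k - of_int i) \<omega>) - (\<Sum>i\<in>?I. ?h i) * X (\<tau> k) \<omega>"
      by (simp add: right_diff_distrib sum_subtractf sum_distrib_right)
    then show ?thesis unfolding s0 filtered_def \<tau>_def by simp
  qed
  have di: "integrable M (\<lambda>\<omega>. (X u \<omega> - X v \<omega>) * (X u' \<omega> - X v' \<omega>))" for u v u' v'
  proof -
    have "(X u \<omega> - X v \<omega>) * (X u' \<omega> - X v' \<omega>) = X u \<omega> * X u' \<omega> - X u \<omega> * X v' \<omega> - X v \<omega> * X u' \<omega> + X v \<omega> * X v' \<omega>" for \<omega>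
      by (simp add: algebra_simps)
    then show ?thesis using inc(1) by simp
  qed
  have "(\<integral>\<omega>. filtered J (\<lambda>l. X (of_int l) \<omega>) k * filtered J (\<lambda>l. X (of_int l) \<omega>) k' \<partial>M) =
    (\<integral>\<omega>. (\<Sum>i\<in>?I. \<Sum>i'\<in>?I. (?h i * ?h i') * ((X (\<tau> k - of_int i) \<omega> - X (\<tau> k) \<omega>) * (X (\<tau> k' - of_int i') \<omega> - X (\<tau> k') \<omega>))) \<partial>M)"
    unfolding shift sum_product by (simp add: ac_simps)
  also have "\<dots> = (\<Sum>i\<in>?I. \<Sum>i'\<in>?I. (?h i * ?h i') * increment_cov H (\<tau> k - of_int i) (\<tau> k) (\<tau> k' - of_int i') (\<tau> k'))"
    by (subst Bochner_Integration.integral_sum, intro Bochner_Integration.integrable_sum integrable_mult_right di,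
        subst Bochner_Integration.integral_sum, intro integrable_mult_right di, simp add: inc(2))
  also have "\<dots> = (\<Sum>i\<in>?I. \<Sum>i'\<in>?I.
       (?h i * (\<bar>\<tau> k - \<tau> k' - of_int i\<bar> powr (2 * H) / 2)) * ?h i' + ?h i * (?h i' * (\<bar>\<tau> k - \<tau> k' + of_int i'\<bar> powr (2 * H) / 2))
       + ?h i * ?h i' * (- (\<bar>2 ^ J * of_int (int k - int k') - of_int i + of_int i'\<bar> powr (2 * H)) / 2) - (?h i * (\<bar>\<tau> k - \<tau> k'\<bar> powr (2 * H) / 2)) * ?h i')"
    by (intro sum.cong refl) (simp add: increment_cov_def \<tau>_def field_simps)
  also have "\<dots> = (\<Sum>i\<in>?I. ?h i * (\<bar>\<tau> k - \<tau> k' - of_int i\<bar> powr (2 * H) / 2)) * (\<Sum>i\<in>?I. ?h i)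
       + (\<Sum>i\<in>?I. ?h i) * (\<Sum>i'\<in>?I. ?h i' * (\<bar>\<tau> k - \<tau> k' + of_int i'\<bar> powr (2 * H) / 2))
       + (\<Sum>i\<in>?I. \<Sum>i'\<in>?I. ?h i * ?h i' * (- (\<bar>2 ^ J * of_int (int k - int k') - of_int i + of_int i'\<bar> powr (2 * H)) / 2))
       - (\<Sum>i\<in>?I. ?h i * (\<bar>\<tau> k - \<tau> k'\<bar> powr (2 * H) / 2)) * (\<Sum>i\<in>?I. ?h i)"
    unfolding sum_product by (simp only: sum.distrib sum_subtractf)
  finally have "(\<integral>\<omega>. filtered J (\<lambda>l. X (of_int l) \<omega>) k * filtered J (\<lambda>l. X (of_int l) \<omega>) k' \<partial>M) =
    (\<Sum>i\<in>?I. \<Sum>i'\<in>?I. ?h i * ?h i' * (- (\<bar>2 ^ J * of_int (int k - int k') - of_int i + of_int i'\<bar> powr (2 * H)) / 2))"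
    using s0 by simp
  then show "\<bar>(\<integral>\<omega>. filtered J (\<lambda>l. X (of_int l) \<omega>) k * filtered J (\<lambda>l. X (of_int l) \<omega>) k' \<partial>M)
      - (2 ^ J) powr (2 * H + 1) * wavelet_autocov \<psi> H (int k - int k')\<bar> \<le> discretization_const * (2 ^ J) powr (1 + H)"
    using filter_covariance_approx[OF H inc(3), of J "int k - int k'"] by simp
qed

text \<open>Division by the standard deviation of the coefficient up to a constant factor, for a path with
  Hurst exponent \<open>h\<close>.\<close>

definition normalized :: "nat \<Rightarrow> real \<Rightarrow> (real \<Rightarrow> real) \<Rightarrow> nat \<Rightarrow> real" where
  "normalized J h x k = filtered J (\<lambda>l. x (of_int l)) k / (2 ^ J) powr (h + 1 / 2)"

lemma normalized_covariance:
  assumes M: "prob_space M" and X: "standard_fBm M H X" and H: "0 < H" "H < 1"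
  shows "\<bar>(\<integral>\<omega>. normalized J H (\<lambda>t. X t \<omega>) k * normalized J H (\<lambda>t. X t \<omega>) k' \<partial>M) - wavelet_autocov \<psi> H (int k - int k')\<bar>
    \<le> discretization_const * (2 ^ J) powr (- H)"
proof -
  define b :: real where "b = (2 ^ J) powr (2 * H + 1)"
  have b: "b > 0" "((2 ^ J) powr (H + 1 / 2)) * ((2 ^ J) powr (H + 1 / 2)) = b"
    unfolding b_def by (simp_all add: powr_add[symmetric])
  let ?c = "\<integral>\<omega>. filtered J (\<lambda>l. X (of_int l) \<omega>) k * filtered J (\<lambda>l. X (of_int l) \<omega>) k' \<partial>M"
  have "(\<integral>\<omega>. normalized J H (\<lambda>t. X t \<omega>) k * normalized J H (\<lambda>t. X t \<omega>) k' \<partial>M) = ?c / b"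
    unfolding normalized_def times_divide_times_eq b(2) by simp
  moreover have "\<bar>?c / b - wavelet_autocov \<psi> H (int k - int k')\<bar> = \<bar>?c - b * wavelet_autocov \<psi> H (int k - int k')\<bar> / b"
    using b(1) by (simp add: abs_divide[symmetric, of _ b, unfolded abs_of_pos[OF b(1)]] diff_divide_distrib)
  moreover have "\<dots> \<le> discretization_const * (2 ^ J) powr (1 + H) / b"
    using filtered_covariance(2)[OF M X H, of J k k'] b(1) unfolding b_def by (intro divide_right_mono) auto
  moreover have "(2 ^ J) powr (1 + H) / b = (2 ^ J) powr (- H)"
    unfolding b_def by (simp add: powr_diff[symmetric])
  ultimately show ?thesis by (simp only: times_divide_eq_right[symmetric])
qed

lemma normalized_measurable:
  "(\<lambda>f. normalized J h f k) \<in> borel_measurable (Pi\<^sub>M UNIV (\<lambda>_. borel))"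
  unfolding normalized_def filtered_def
  by (intro borel_measurable_divide borel_measurable_sum borel_measurable_times borel_measurable_const
      measurable_component_singleton) auto

text \<open>The sample covariance matrix of the normalized coefficients lies between \<open>c\<close> and
  \<open>C\<close> times the identity.\<close>

definition quadratic_form_bounds ::
  "nat \<Rightarrow> nat \<Rightarrow> nat \<Rightarrow> real \<Rightarrow> real \<Rightarrow> (nat \<Rightarrow> real) \<Rightarrow> (nat \<Rightarrow> real \<Rightarrow> real) \<Rightarrow> bool" where
  "quadratic_form_bounds J p n c C h x \<longleftrightarrow>
    (\<forall>y. c * (\<Sum>l<p. (y l)\<^sup>2) \<le> (\<Sum>k=1..n. (\<Sum>l<p. y l * normalized J (h l) (x l) k)\<^sup>2) / real n \<and>
      (\<Sum>k=1..n. (\<Sum>l<p. y l * normalized J (h l) (x l) k)\<^sup>2) / real n \<le> C * (\<Sum>l<p. (y l)\<^sup>2))"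

lemma discretization_const_nonneg: "0 \<le> discretization_const"
  unfolding discretization_const_def by simp

text \<open>The case of deterministic Hurst exponents. The expected squared Frobenius deviation is bounded
  by \<open>sample_covariance_deviation\<close>, and the inequality of Markov yields the
  exceptional set \<open>E\<close>. The diagonal means are within \<open>\<eta>\<close> of
  \<open>wavelet_autocov \<psi> (h l) 0\<close>, hence at least \<open>2 \<eta>\<close>, and a
  deviation of norm at most \<open>\<eta>\<close> leaves the lower bound \<open>\<eta>\<close>. An
  exceptional set is exhibited because the complementary event is described by uncountably many
  vectors.\<close>

theorem conditional_quadratic_form_bounds:
  fixes X :: "nat \<Rightarrow> real \<Rightarrow> 'w \<Rightarrow> real" and h :: "nat \<Rightarrow> real"
  assumes M: "prob_space M"
    and indep: "prob_space.indep_vars M (\<lambda>_. Pi\<^sub>M UNIV (\<lambda>_. borel)) (\<lambda>l \<omega> t. X l t \<omega>) {..<p}"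
    and X: "\<And>l. l < p \<Longrightarrow> standard_fBm M (h l) (X l)"
    and h: "\<And>l. l < p \<Longrightarrow> 0 < h l \<and> h l < 1" and hmin: "\<And>l. l < p \<Longrightarrow> Hmin \<le> h l"
    and S0: "\<And>l A. l < p \<Longrightarrow> finite A \<Longrightarrow> (\<Sum>m\<in>A. (wavelet_autocov \<psi> (h l) m)\<^sup>2) \<le> S0"
    and g0: "\<And>l. l < p \<Longrightarrow> 3 * \<eta> \<le> wavelet_autocov \<psi> (h l) 0"
    and g1: "\<And>l. l < p \<Longrightarrow> wavelet_autocov \<psi> (h l) 0 \<le> B"
    and small: "discretization_const * (2 ^ J) powr (- Hmin) \<le> \<eta>"
    and n: "n \<ge> 1" and \<eta>: "\<eta> > 0"
  shows "\<exists>E\<in>sets M. measure M E \<le>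
      2 * (real p)\<^sup>2 * (2 * S0 + 2 * real n * (discretization_const * (2 ^ J) powr (- Hmin))\<^sup>2) / (real n * \<eta>\<^sup>2) \<and>
    (\<forall>\<omega>\<in>space M - E. quadratic_form_bounds J p n \<eta> (B + 2 * \<eta>) h (\<lambda>l t. X l t \<omega>))"
proof -
  interpret prob_space M by fact
  define Z where "Z l k \<omega> = normalized J (h l) (\<lambda>t. X l t \<omega>) k" for l k \<omega>
  define d where "d = discretization_const * (2 ^ J) powr (- Hmin)"
  define S where "S = 2 * S0 + 2 * real n * d\<^sup>2"
  have N0: "real n > 0" using n by simp
  have cov: "\<bar>(\<integral>\<omega>. Z l k \<omega> * Z l k' \<omega> \<partial>M) - wavelet_autocov \<psi> (h l) (int k - int k')\<bar> \<le> d" if l: "l < p" for l k k'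
  proof -
    have "\<bar>(\<integral>\<omega>. Z l k \<omega> * Z l k' \<omega> \<partial>M) - wavelet_autocov \<psi> (h l) (int k - int k')\<bar>
      \<le> discretization_const * (2 ^ J) powr (- h l)"
      unfolding Z_def using normalized_covariance[OF M X[OF l]] h[OF l] by blast
    also have "\<dots> \<le> d"
      unfolding d_def using hmin[OF l] discretization_const_nonneg by (intro mult_left_mono powr_mono) auto
    finally show ?thesis .
  qed
  have G: "gaussian_rv M (\<lambda>\<omega>. a * Z l k \<omega> + b * Z l k' \<omega>)" and mean: "(\<integral>\<omega>. a * Z l k \<omega> + b * Z l k' \<omega> \<partial>M) = 0"
    if l: "l < p" for a b l k k'
  proof -
    let ?c = "(2 ^ J) powr (h l + 1 / 2) :: real"
    have eq: "a * Z l k \<omega> + b * Z l k' \<omega> = (a / ?c) * filtered J (\<lambda>i. X l (of_int i) \<omega>) k + (b / ?c) * filtered J (\<lambda>i. X l (of_int i) \<omega>) k'" for \<omega>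
      unfolding Z_def normalized_def by simp
    show "gaussian_rv M (\<lambda>\<omega>. a * Z l k \<omega> + b * Z l k' \<omega>)"
      unfolding eq by (rule filtered_gaussian) (use X[OF l] in \<open>simp add: standard_fBm_def\<close>)
    show "(\<integral>\<omega>. a * Z l k \<omega> + b * Z l k' \<omega> \<partial>M) = 0"
      unfolding eq by (rule filtered_covariance(1)[OF M X[OF l]]) (use h[OF l] in auto)
  qed
  note fourth = gaussian_pair_fourth_moment[OF M G mean]
  have i2: "integrable M (\<lambda>\<omega>. Z l k \<omega> ^ 2)" if "l < p" for l k
    using fourth(1)[OF that that, of k k] by (simp add: power2_eq_square)
  have pr: "(\<integral>\<omega>. (Z l k \<omega> * Z l k' \<omega>) * (Z l' k \<omega> * Z l' k' \<omega>) \<partial>M)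
      = (\<integral>\<omega>. Z l k \<omega> * Z l k' \<omega> \<partial>M) * (\<integral>\<omega>. Z l' k \<omega> * Z l' k' \<omega> \<partial>M) \<and>
      integrable M (\<lambda>\<omega>. (Z l k \<omega> * Z l k' \<omega>) * (Z l' k \<omega> * Z l' k' \<omega>))"
    if l: "l < p" "l' < p" "l \<noteq> l'" for l l' k k'
  proof -
    have "indep_vars (\<lambda>_. borel) (\<lambda>i \<omega>. normalized J (h i) (\<lambda>t. X i t \<omega>) k * normalized J (h i) (\<lambda>t. X i t \<omega>) k') {..<p}"
      by (rule indep_vars_compose2[OF indep]) (intro borel_measurable_times normalized_measurable)
    then have iv: "indep_vars (\<lambda>_. borel) (\<lambda>i \<omega>. Z i k \<omega> * Z i k' \<omega>) {l, l'}"
      unfolding Z_def by (rule indep_vars_subset) (use l in auto)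
    have int: "integrable M (\<lambda>\<omega>. Z i k \<omega> * Z i k' \<omega>)" if "i \<in> {l, l'}" for i
      using fourth(1)[of i] that l by auto
    show ?thesis
      using indep_vars_lebesgue_integral[OF _ iv int] indep_vars_integrable[OF _ iv int] l(3) by simp
  qed
  have Sb: "(\<Sum>k=1..n. \<Sum>k'=1..n. (\<integral>\<omega>. Z l k \<omega> * Z l k' \<omega> \<partial>M)\<^sup>2) \<le> real n * S" if l: "l < p" for l
  proof -
    have "(\<Sum>k'=1..n. (\<integral>\<omega>. Z l k \<omega> * Z l k' \<omega> \<partial>M)\<^sup>2) \<le> S" for k
    proof -
      have "(\<Sum>k'=1..n. (\<integral>\<omega>. Z l k \<omega> * Z l k' \<omega> \<partial>M)\<^sup>2) \<le> (\<Sum>k'=1..n. 2 * (wavelet_autocov \<psi> (h l) (int k - int k'))\<^sup>2 + 2 * d\<^sup>2)"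
      proof (rule sum_mono)
        fix k'
        let ?u = "\<integral>\<omega>. Z l k \<omega> * Z l k' \<omega> \<partial>M" and ?g = "wavelet_autocov \<psi> (h l) (int k - int k')"
        have "(?u - ?g)\<^sup>2 \<le> d\<^sup>2" using cov[OF l, of k k'] by (simp add: abs_le_square_iff[symmetric])
        moreover have "?u\<^sup>2 \<le> 2 * ?g\<^sup>2 + 2 * (?u - ?g)\<^sup>2"
          using zero_le_power2[of "?u - 2 * ?g"] by (simp add: power2_eq_square algebra_simps)
        ultimately show "?u\<^sup>2 \<le> 2 * ?g\<^sup>2 + 2 * d\<^sup>2" by linarith
      qed
      also have "\<dots> = 2 * (\<Sum>k'=1..n. (wavelet_autocov \<psi> (h l) (int k - int k'))\<^sup>2) + 2 * real n * d\<^sup>2"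
        by (simp add: sum.distrib sum_distrib_left)
      also have "(\<Sum>k'=1..n. (wavelet_autocov \<psi> (h l) (int k - int k'))\<^sup>2) =
        (\<Sum>m\<in>(\<lambda>k'. int k - int k') ` {1..n}. (wavelet_autocov \<psi> (h l) m)\<^sup>2)"
        by (subst sum.reindex) (auto simp: inj_on_def)
      also have "2 * \<dots> + 2 * real n * d\<^sup>2 \<le> S"
        unfolding S_def using S0[OF l, of "(\<lambda>k'. int k - int k') ` {1..n}"] by simp
      finally show ?thesis .
    qed
    then have "(\<Sum>k=1..n. \<Sum>k'=1..n. (\<integral>\<omega>. Z l k \<omega> * Z l k' \<omega> \<partial>M)\<^sup>2) \<le> (\<Sum>k=1..n. S)" by (rule sum_mono)
    then show ?thesis by simp
  qed
  define V where "V l l' \<omega> = (\<Sum>k=1..n. Z l k \<omega> * Z l' k \<omega>) / real n" for l l' \<omega>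
  define m where "m l l' = (if l = l' then (\<Sum>k=1..n. \<integral>\<omega>. Z l k \<omega> ^ 2 \<partial>M) / real n else 0)" for l l'
  have dev_int: "integrable M (\<lambda>\<omega>. \<Sum>l<p. \<Sum>l'<p. (V l l' \<omega> - m l l')\<^sup>2)"
    and dev: "(\<integral>\<omega>. (\<Sum>l<p. \<Sum>l'<p. (V l l' \<omega> - m l l')\<^sup>2) \<partial>M) \<le> 2 * (real p)\<^sup>2 * S / real n"
    unfolding V_def m_def
    by (rule sample_covariance_deviation[OF n i2 fourth(2) fourth(3) _ _ Sb M]; use pr in blast)+
  define E where "E = {\<omega>\<in>space M. (\<Sum>l<p. \<Sum>l'<p. (V l l' \<omega> - m l l')\<^sup>2) \<ge> \<eta>\<^sup>2}"
  have E_sets: "E \<in> sets M"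
    unfolding E_def using borel_measurable_integrable[OF dev_int] by measurable
  have "measure M E \<le> (\<integral>\<omega>. (\<Sum>l<p. \<Sum>l'<p. (V l l' \<omega> - m l l')\<^sup>2) \<partial>M) / \<eta>\<^sup>2"
    unfolding E_def by (rule integral_Markov_inequality_measure[OF dev_int sets.top]) (use \<eta> in \<open>auto intro!: sum_nonneg\<close>)
  also have "\<dots> \<le> (2 * (real p)\<^sup>2 * S / real n) / \<eta>\<^sup>2" by (rule divide_right_mono[OF dev]) simp
  also have "\<dots> = 2 * (real p)\<^sup>2 * S / (real n * \<eta>\<^sup>2)" by simp
  finally have PE: "measure M E \<le> 2 * (real p)\<^sup>2 * S / (real n * \<eta>\<^sup>2)" .
  have mb: "2 * \<eta> \<le> m l l \<and> m l l \<le> B + \<eta>" if l: "l < p" for l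
  proof -
    have e: "2 * \<eta> \<le> (\<integral>\<omega>. Z l k \<omega> ^ 2 \<partial>M) \<and> (\<integral>\<omega>. Z l k \<omega> ^ 2 \<partial>M) \<le> B + \<eta>" for k
      using cov[OF l, of k k] g0[OF l] g1[OF l] small unfolding d_def[symmetric] by (simp add: power2_eq_square abs_le_iff)
    have "(\<Sum>k=1..n. 2 * \<eta>) \<le> (\<Sum>k=1..n. \<integral>\<omega>. Z l k \<omega> ^ 2 \<partial>M)" "(\<Sum>k=1..n. \<integral>\<omega>. Z l k \<omega> ^ 2 \<partial>M) \<le> (\<Sum>k=1..n. B + \<eta>)"
      using e by (intro sum_mono; blast)+
    then have "real n * (2 * \<eta>) \<le> (\<Sum>k=1..n. \<integral>\<omega>. Z l k \<omega> ^ 2 \<partial>M)" "(\<Sum>k=1..n. \<integral>\<omega>. Z l k \<omega> ^ 2 \<partial>M) \<le> real n * (B + \<eta>)" by simp_all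
    then show ?thesis unfolding m_def using N0 by (simp add: field_simps)
  qed
  have "quadratic_form_bounds J p n \<eta> (B + 2 * \<eta>) h (\<lambda>l t. X l t \<omega>)" if \<omega>: "\<omega> \<in> space M - E" for \<omega>
    unfolding quadratic_form_bounds_def
  proof
    fix y :: "nat \<Rightarrow> real"
    have q: "(\<Sum>k=1..n. (\<Sum>l<p. y l * normalized J (h l) (\<lambda>t. X l t \<omega>) k)\<^sup>2) / real n = (\<Sum>l<p. \<Sum>l'<p. y l * y l' * V l l' \<omega>)"
    proof -
      have "(\<Sum>k=1..n. (\<Sum>l<p. y l * Z l k \<omega>)\<^sup>2) = (\<Sum>k=1..n. \<Sum>l<p. \<Sum>l'<p. y l * y l' * (Z l k \<omega> * Z l' k \<omega>))"
        by (intro sum.cong refl) (simp add: power2_eq_square sum_product ac_simps)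
      also have "\<dots> = (\<Sum>l<p. \<Sum>k=1..n. \<Sum>l'<p. y l * y l' * (Z l k \<omega> * Z l' k \<omega>))" by (rule sum.swap)
      also have "\<dots> = (\<Sum>l<p. \<Sum>l'<p. \<Sum>k=1..n. y l * y l' * (Z l k \<omega> * Z l' k \<omega>))"
        by (intro sum.cong refl sum.swap)
      finally show ?thesis unfolding V_def Z_def
        by (simp add: sum_divide_distrib sum_distrib_left)
    qed
    have dv: "(\<Sum>l<p. \<Sum>l'<p. (V l l' \<omega> - (if l = l' then m l l else 0))\<^sup>2) \<le> \<eta>\<^sup>2"
    proof -
      have "(if l = l' then m l l else 0) = m l l'" for l l' unfolding m_def by simp
      then have "(\<Sum>l<p. \<Sum>l'<p. (V l l' \<omega> - (if l = l' then m l l else 0))\<^sup>2) = (\<Sum>l<p. \<Sum>l'<p. (V l l' \<omega> - m l l')\<^sup>2)" by presburger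
      also have "\<dots> \<le> \<eta>\<^sup>2" using \<omega> unfolding E_def by auto
      finally show ?thesis .
    qed
    have "\<eta> * (\<Sum>l<p. (y l)\<^sup>2) \<le> (\<Sum>l<p. \<Sum>l'<p. y l * y l' * V l l' \<omega>)"
      by (rule quadratic_form_perturbation(1)[where V="\<lambda>l l'. V l l' \<omega>" and m=m and p=p and \<eta>=\<eta> and B="B + \<eta>" and y=y, OF dv]) (use mb \<eta> in auto)
    moreover have "(\<Sum>l<p. \<Sum>l'<p. y l * y l' * V l l' \<omega>) \<le> (B + \<eta> + \<eta>) * (\<Sum>l<p. (y l)\<^sup>2)"
      by (rule quadratic_form_perturbation(2)[where V="\<lambda>l l'. V l l' \<omega>" and m=m and p=p and \<eta>=\<eta> and B="B + \<eta>" and y=y, OF dv]) (use mb \<eta> in auto)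
    ultimately show "\<eta> * (\<Sum>l<p. (y l)\<^sup>2) \<le> (\<Sum>k=1..n. (\<Sum>l<p. y l * normalized J (h l) (\<lambda>t. X l t \<omega>) k)\<^sup>2) / real n \<and>
      (\<Sum>k=1..n. (\<Sum>l<p. y l * normalized J (h l) (\<lambda>t. X l t \<omega>) k)\<^sup>2) / real n \<le> (B + 2 * \<eta>) * (\<Sum>l<p. (y l)\<^sup>2)"
      unfolding q by (simp add: algebra_simps)
  qed
  then show ?thesis using E_sets PE unfolding S_def d_def by blast
qed

end

section \<open>Random Hurst exponents\<close>

text \<open>By second countability the complement of the support is a countable union of open null sets.\<close>

lemma measure_support_complement_null:
  assumes "real_distribution \<pi>"
  shows "- measure_support \<pi> \<in> null_sets \<pi>"
proof -
  interpret real_distribution \<pi> by fact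
  obtain B :: "real set set" where B: "countable B" "topological_basis B" using ex_countable_basis by blast
  define N where "N = {b\<in>B. measure \<pi> b = 0}"
  have "- measure_support \<pi> = \<Union>N"
  proof
    show "- measure_support \<pi> \<subseteq> \<Union>N"
    proof
      fix x assume "x \<in> - measure_support \<pi>"
      then obtain U where U: "open U" "x \<in> U" "\<not> measure \<pi> U > 0" by (auto simp: measure_support_def)
      obtain b where b: "b \<in> B" "x \<in> b" "b \<subseteq> U" using topological_basisE[OF B(2) U(1,2)] by blast
      have "measure \<pi> b \<le> measure \<pi> U" using b(3) U(1) by (intro finite_measure_mono) auto
      then have "measure \<pi> b = 0" using U(3) measure_nonneg[of \<pi> b] by linarith
      then show "x \<in> \<Union>N" using b by (auto simp: N_def)
    qed
    show "\<Union>N \<subseteq> - measure_support \<pi>"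
      using topological_basis_open[OF B(2)] by (force simp: N_def measure_support_def)
  qed
  also have "\<dots> \<in> null_sets \<pi>"
  proof (rule null_sets_UN'[of N "\<lambda>b. b", simplified])
    show "countable N" using B(1) by (auto simp: N_def)
    fix b assume "b \<in> N"
    then have "b \<in> sets \<pi>" "measure \<pi> b = 0" using topological_basis_open[OF B(2)] by (auto simp: N_def)
    then show "b \<in> null_sets \<pi>" by (simp add: null_sets_def emeasure_eq_measure)
  qed
  finally show ?thesis .
qed

lemma finite_support_atom:
  assumes \<pi>: "real_distribution \<pi>" and fin: "finite (measure_support \<pi>)" and x: "x \<in> measure_support \<pi>"
  shows "measure \<pi> {x} > 0"
proof -
  interpret real_distribution \<pi> by fact
  let ?U = "- (measure_support \<pi> - {x})"
  have o: "open ?U" using fin by (intro open_Compl finite_imp_closed) auto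
  then have "measure \<pi> ?U > 0" using x by (auto simp: measure_support_def)
  moreover have "measure \<pi> ?U \<le> measure \<pi> ({x} \<union> - measure_support \<pi>)"
    using measure_support_complement_null[OF \<pi>] by (intro finite_measure_mono) (auto simp: null_sets_def)
  moreover have "measure \<pi> ({x} \<union> - measure_support \<pi>) \<le> measure \<pi> {x} + measure \<pi> (- measure_support \<pi>)"
    using measure_support_complement_null[OF \<pi>] by (intro measure_Un_le) (auto simp: null_sets_def)
  moreover have "measure \<pi> (- measure_support \<pi>) = 0"
    using measure_support_complement_null[OF \<pi>] by (simp add: null_sets_def measure_def)
  ultimately show ?thesis by linarith
qed

text \<open>The weak law of large numbers, in the quantitative form of Hoeffding's inequality: the number of
  summands and the underlying variables change with the sample size, so that a bound for every
  fixed size is required.\<close>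

theorem average_concentration:
  fixes H :: "nat \<Rightarrow> 'w \<Rightarrow> real" and g :: "real \<Rightarrow> real"
  assumes M: "prob_space M" and p: "p \<ge> 1"
    and indep: "prob_space.indep_vars M (\<lambda>_. borel) H {..<p}" and distr: "\<And>l. l < p \<Longrightarrow> distr M borel (H l) = \<pi>"
    and g[measurable]: "g \<in> borel_measurable borel" and B: "\<And>x. \<bar>g x\<bar> \<le> B" "B > 0" and \<epsilon>: "\<epsilon> > 0"
  shows "{\<omega>\<in>space M. \<bar>(\<Sum>l<p. g (H l \<omega>)) / real p - (\<integral>x. g x \<partial>\<pi>)\<bar> \<ge> \<epsilon>} \<in> sets M"
    and "measure M {\<omega>\<in>space M. \<bar>(\<Sum>l<p. g (H l \<omega>)) / real p - (\<integral>x. g x \<partial>\<pi>)\<bar> \<ge> \<epsilon>}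
      \<le> 2 * exp (- (\<epsilon>\<^sup>2 / (2 * B\<^sup>2)) * real p)"
proof -
  interpret prob_space M by fact
  have Hm: "H l \<in> borel_measurable M" if "l < p" for l
    using indep that unfolding indep_vars_def by auto
  have gm: "(\<lambda>\<omega>. g (H l \<omega>)) \<in> borel_measurable M" if "l < p" for l
    using measurable_compose[OF Hm[OF that] g] .
  have "(\<lambda>\<omega>. (\<Sum>l<p. g (H l \<omega>)) / real p - (\<integral>x. g x \<partial>\<pi>)) \<in> borel_measurable M"
    by (intro borel_measurable_diff borel_measurable_divide borel_measurable_sum gm borel_measurable_const) auto
  then show "{\<omega>\<in>space M. \<bar>(\<Sum>l<p. g (H l \<omega>)) / real p - (\<integral>x. g x \<partial>\<pi>)\<bar> \<ge> \<epsilon>} \<in> sets M"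
    by measurable
  interpret Hoeffding_ineq M "{..<p}" "\<lambda>l \<omega>. g (H l \<omega>)" "\<lambda>_. - B" "\<lambda>_. B" "\<Sum>l<p. expectation (\<lambda>\<omega>. g (H l \<omega>))"
  proof unfold_locales
    show "indep_vars (\<lambda>_. borel) (\<lambda>l \<omega>. g (H l \<omega>)) {..<p}"
      by (rule indep_vars_compose2[OF indep]) auto
    show "AE x in M. g (H i x) \<in> {- B..B}" for i
      using B(1) by (intro AE_I2) (auto simp: abs_le_iff minus_le_iff)
  qed auto
  have ex: "expectation (\<lambda>\<omega>. g (H l \<omega>)) = (\<integral>x. g x \<partial>\<pi>)" if "l < p" for l
    using integral_distr[OF Hm[OF that] g] distr[OF that] by simp
  have s: "(\<Sum>l<p. expectation (\<lambda>\<omega>. g (H l \<omega>))) = real p * (\<integral>x. g x \<partial>\<pi>)" by (simp add: ex)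
  have w: "(\<Sum>i<p. (B - - B)\<^sup>2) = real p * (4 * B\<^sup>2)" by (simp add: power2_eq_square)
  have p0: "real p > 0" using p by simp
  have "{\<omega>\<in>space M. \<bar>(\<Sum>l<p. g (H l \<omega>)) / real p - (\<integral>x. g x \<partial>\<pi>)\<bar> \<ge> \<epsilon>}
    = {\<omega>\<in>space M. \<bar>(\<Sum>l<p. g (H l \<omega>)) - (\<Sum>l<p. expectation (\<lambda>\<omega>. g (H l \<omega>)))\<bar> \<ge> \<epsilon> * real p}"
  proof (intro Collect_cong conj_cong refl)
    fix \<omega>
    have "(\<Sum>l<p. g (H l \<omega>)) - (\<Sum>l<p. expectation (\<lambda>\<omega>. g (H l \<omega>))) = ((\<Sum>l<p. g (H l \<omega>)) / real p - (\<integral>x. g x \<partial>\<pi>)) * real p"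
      unfolding s using p0 by (simp add: left_diff_distrib)
    then have "\<bar>(\<Sum>l<p. g (H l \<omega>)) - (\<Sum>l<p. expectation (\<lambda>\<omega>. g (H l \<omega>)))\<bar> = \<bar>(\<Sum>l<p. g (H l \<omega>)) / real p - (\<integral>x. g x \<partial>\<pi>)\<bar> * real p"
      by (simp add: abs_mult)
    then show "(\<epsilon> \<le> \<bar>(\<Sum>l<p. g (H l \<omega>)) / real p - (\<integral>x. g x \<partial>\<pi>)\<bar>) = (\<epsilon> * real p \<le> \<bar>(\<Sum>l<p. g (H l \<omega>)) - (\<Sum>l<p. expectation (\<lambda>\<omega>. g (H l \<omega>)))\<bar>)"
      using p0 by simp
  qed
  also have "prob \<dots> \<le> 2 * exp (- 2 * (\<epsilon> * real p)\<^sup>2 / (\<Sum>i<p. (B - - B)\<^sup>2))"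
    by (rule Hoeffding_ineq_abs_ge) (use \<epsilon> p0 B w in auto)
  also have "- 2 * (\<epsilon> * real p)\<^sup>2 / (\<Sum>i<p. (B - - B)\<^sup>2) = - (\<epsilon>\<^sup>2 / (2 * B\<^sup>2)) * real p"
    unfolding w using p0 B by (simp add: power2_eq_square field_simps)
  finally show "measure M {\<omega>\<in>space M. \<bar>(\<Sum>l<p. g (H l \<omega>)) / real p - (\<integral>x. g x \<partial>\<pi>)\<bar> \<ge> \<epsilon>}
      \<le> 2 * exp (- (\<epsilon>\<^sup>2 / (2 * B\<^sup>2)) * real p)" .
qed

context compact_wavelet
begin

lemma quadratic_form_bounds_cong:
  assumes "\<And>l. l < p \<Longrightarrow> h l = h' l"
  shows "quadratic_form_bounds J p n c C h x = quadratic_form_bounds J p n c C h' x"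
proof -
  have "(\<Sum>l<p. y l * normalized J (h l) (x l) k) = (\<Sum>l<p. y l * normalized J (h' l) (x l) k)" for y k
    by (rule sum.cong) (simp_all add: assms)
  then show ?thesis unfolding quadratic_form_bounds_def by simp
qed

text \<open>Averaging the conditional bounds over the finitely many possible vectors of Hurst exponents. The
  event that some exponent lies outside the support is null and is added to the exceptional set.\<close>

theorem rH_fBm_quadratic_form_bounds:
  fixes X :: "nat \<Rightarrow> real \<Rightarrow> 'w \<Rightarrow> real" and H :: "nat \<Rightarrow> 'w \<Rightarrow> real"
  assumes M: "prob_space M" and \<pi>: "real_distribution \<pi>" and p: "p \<ge> 1"
    and fin: "finite (measure_support \<pi>)" and supp: "measure_support \<pi> \<subseteq> {0<..<1}"
    and paths: "rH_fBm_paths M \<pi> p H X"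
    and hmin: "\<And>h. h \<in> measure_support \<pi> \<Longrightarrow> Hmin \<le> h"
    and S0: "0 \<le> S0" "\<And>h A. h \<in> measure_support \<pi> \<Longrightarrow> finite A \<Longrightarrow> (\<Sum>m\<in>A. (wavelet_autocov \<psi> h m)\<^sup>2) \<le> S0"
    and g0: "\<And>h. h \<in> measure_support \<pi> \<Longrightarrow> 3 * \<eta> \<le> wavelet_autocov \<psi> h 0"
    and g1: "\<And>h. h \<in> measure_support \<pi> \<Longrightarrow> wavelet_autocov \<psi> h 0 \<le> B"
    and small: "discretization_const * (2 ^ J) powr (- Hmin) \<le> \<eta>"
    and n: "n \<ge> 1" and \<eta>: "\<eta> > 0"
  shows "\<exists>E\<in>sets M. measure M E \<le>
      2 * (real p)\<^sup>2 * (2 * S0 + 2 * real n * (discretization_const * (2 ^ J) powr (- Hmin))\<^sup>2) / (real n * \<eta>\<^sup>2) \<and>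
    (\<forall>\<omega>\<in>space M - E. (\<forall>l<p. H l \<omega> \<in> measure_support \<pi>) \<and>
      quadratic_form_bounds J p n \<eta> (B + 2 * \<eta>) (\<lambda>l. H l \<omega>) (\<lambda>l t. X l t \<omega>))"
proof -
  interpret prob_space M by fact
  define \<beta> where "\<beta> = 2 * (real p)\<^sup>2 * (2 * S0 + 2 * real n * (discretization_const * (2 ^ J) powr (- Hmin))\<^sup>2) / (real n * \<eta>\<^sup>2)"
  have \<beta>0: "0 \<le> \<beta>" unfolding \<beta>_def using S0(1) by simp
  have indep: "indep_vars (\<lambda>_. borel) H {..<p}" and distr: "\<And>l. l < p \<Longrightarrow> distr M borel (H l) = \<pi>"
    using paths unfolding rH_fBm_paths_def by auto
  have Hm: "H l \<in> borel_measurable M" if "l < p" for l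
    using indep that unfolding indep_vars_def by auto
  have ne: "{..<p} \<noteq> {}" using p by (simp add: lessThan_empty_iff)
  \<comment> \<open>The possible vectors of exponents, taken as extensional functions so that the events \<open>A
    h\<close> are pairwise disjoint.\<close>
  define T where "T = PiE {..<p} (\<lambda>_. measure_support \<pi>)"
  define A where "A h = {\<omega>\<in>space M. \<forall>l<p. H l \<omega> = h l}" for h
  have T: "finite T" unfolding T_def using fin by (intro finite_PiE) auto
  have A_eq: "A h = (\<Inter>l\<in>{..<p}. H l -` {h l} \<inter> space M)" for h
  proof (intro equalityI subsetI)
    fix \<omega> assume "\<omega> \<in> A h"
    then show "\<omega> \<in> (\<Inter>l\<in>{..<p}. H l -` {h l} \<inter> space M)" unfolding A_def by auto
  next
    fix \<omega> assume a: "\<omega> \<in> (\<Inter>l\<in>{..<p}. H l -` {h l} \<inter> space M)"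
    have "0 \<in> {..<p}" using p by simp
    then have "\<omega> \<in> space M" using a by blast
    moreover have "H l \<omega> = h l" if "l < p" for l using a that by blast
    ultimately show "\<omega> \<in> A h" unfolding A_def by blast
  qed
  have A_sets: "A h \<in> sets M" for h
    unfolding A_eq by (rule sets.finite_INT) (use ne Hm in \<open>auto intro!: measurable_sets[of _ M borel] simp del: lessThan_empty_iff\<close>)
  have A_pos: "prob (A h) > 0" if h: "h \<in> T" for h
  proof -
    have "prob (A h) = (\<Prod>l<p. prob (H l -` {h l} \<inter> space M))"
      unfolding A_eq by (rule indep_varsD_finite[OF indep ne]) auto
    moreover have "prob (H l -` {h l} \<inter> space M) > 0" if l: "l < p" for l
    proof -
      have "prob (H l -` {h l} \<inter> space M) = measure \<pi> {h l}"
        unfolding distr[OF l, symmetric] by (rule measure_distr[symmetric]) (use Hm[OF l] in auto)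
      also have "\<dots> > 0" by (rule finite_support_atom[OF \<pi> fin]) (use h l in \<open>auto simp: T_def\<close>)
      finally show ?thesis .
    qed
    ultimately show ?thesis by (auto intro!: prod_pos)
  qed
  have "\<exists>E\<in>sets M. prob (A h \<inter> E) \<le> \<beta> * prob (A h) \<and>
      (\<forall>\<omega>\<in>space M - E. quadratic_form_bounds J p n \<eta> (B + 2 * \<eta>) h (\<lambda>l t. X l t \<omega>))" if h: "h \<in> T" for h
  proof -
    define M' where "M' = uniform_measure M (A h)"
    have e: "emeasure M (A h) \<noteq> 0" "emeasure M (A h) \<noteq> \<infinity>"
      using A_pos[OF h] by (auto simp: emeasure_eq_measure)
    have M': "prob_space M'" unfolding M'_def by (rule prob_space_uniform_measure[OF e])
    have hs: "h l \<in> measure_support \<pi>" if "l < p" for l using h that by (auto simp: T_def)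
    have c: "prob_space.indep_vars M' (\<lambda>_. Pi\<^sub>M UNIV (\<lambda>_. borel)) (\<lambda>l \<omega> t. X l t \<omega>) {..<p}"
      "\<And>l. l < p \<Longrightarrow> standard_fBm M' (h l) (X l)"
      using paths hs unfolding rH_fBm_paths_def M'_def A_def Let_def by blast+
    have h01: "0 < h l \<and> h l < 1" if "l < p" for l using hs[OF that] supp by auto
    obtain E where E: "E \<in> sets M'" "measure M' E \<le> \<beta>"
      "\<forall>\<omega>\<in>space M' - E. quadratic_form_bounds J p n \<eta> (B + 2 * \<eta>) h (\<lambda>l t. X l t \<omega>)"
      using conditional_quadratic_form_bounds[OF M' c h01 hmin[OF hs] S0(2)[OF hs] g0[OF hs] g1[OF hs] small n \<eta>]
      unfolding \<beta>_def by blast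
    have Es: "E \<in> sets M" "space M' = space M" using E(1) unfolding M'_def by auto
    have "measure M' E = prob (A h \<inter> E) / prob (A h)"
      unfolding M'_def by (rule measure_uniform_measure) (use e Es in auto)
    then have "prob (A h \<inter> E) \<le> \<beta> * prob (A h)" using mult_right_mono[OF E(2), of "prob (A h)"] A_pos[OF h] by simp
    then show ?thesis using Es E(3) by auto
  qed
  then obtain E where E: "\<And>h. h \<in> T \<Longrightarrow> E h \<in> sets M" "\<And>h. h \<in> T \<Longrightarrow> prob (A h \<inter> E h) \<le> \<beta> * prob (A h)"
    "\<And>h \<omega>. h \<in> T \<Longrightarrow> \<omega> \<in> space M - E h \<Longrightarrow> quadratic_form_bounds J p n \<eta> (B + 2 * \<eta>) h (\<lambda>l t. X l t \<omega>)"
    by metis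
  define U where "U = (\<Union>l\<in>{..<p}. H l -` (- measure_support \<pi>) \<inter> space M)"
  have "H l -` (- measure_support \<pi>) \<inter> space M \<in> null_sets M" if "l < p" for l
    using null_sets_distr_iff[OF Hm[OF that], of "- measure_support \<pi>"] measure_support_complement_null[OF \<pi>]
    unfolding distr[OF that] by simp
  then have U: "U \<in> null_sets M" unfolding U_def by (intro null_sets_UN') auto
  define G where "G = U \<union> (\<Union>h\<in>T. A h \<inter> E h)"
  have G_sets: "(\<Union>h\<in>T. A h \<inter> E h) \<in> sets M" using T A_sets E(1) by auto
  have "prob G = prob (\<Union>h\<in>T. A h \<inter> E h)"
    unfolding G_def using measure_Un_null_set[OF G_sets U] by (simp add: Un_commute)
  also have "\<dots> \<le> (\<Sum>h\<in>T. prob (A h \<inter> E h))"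
    by (rule measure_UNION_le) (use T A_sets E(1) in auto)
  also have "\<dots> \<le> (\<Sum>h\<in>T. \<beta> * prob (A h))" by (rule sum_mono) (rule E(2))
  also have "\<dots> = \<beta> * prob (\<Union>h\<in>T. A h)"
  proof -
    have "disjoint_family_on A T"
      unfolding disjoint_family_on_def
    proof (intro ballI impI)
      fix h h' assume hh: "h \<in> T" "h' \<in> T" "h \<noteq> h'"
      have False if "\<omega> \<in> A h \<inter> A h'" for \<omega>
      proof -
        have "h l = h' l" if "l \<in> {..<p}" for l using \<open>\<omega> \<in> A h \<inter> A h'\<close> that by (auto simp: A_def)
        then have "h = h'" using hh unfolding T_def by (intro PiE_ext)
        then show False using hh by simp
      qed
      then show "A h \<inter> A h' = {}" by blast
    qed
    then have "prob (\<Union>h\<in>T. A h) = (\<Sum>h\<in>T. prob (A h))"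
      using T A_sets by (intro finite_measure_finite_Union) auto
    then show ?thesis by (simp add: sum_distrib_left)
  qed
  also have "\<dots> \<le> \<beta>" using mult_left_mono[OF prob_le_1 \<beta>0] by simp
  finally have "prob G \<le> \<beta>" .
  moreover have "G \<in> sets M" using G_sets U unfolding G_def by auto
  moreover have "(\<forall>l<p. H l \<omega> \<in> measure_support \<pi>) \<and>
      quadratic_form_bounds J p n \<eta> (B + 2 * \<eta>) (\<lambda>l. H l \<omega>) (\<lambda>l t. X l t \<omega>)" if \<omega>: "\<omega> \<in> space M - G" for \<omega>
  proof -
    have s: "H l \<omega> \<in> measure_support \<pi>" if "l < p" for l using \<omega> that by (auto simp: G_def U_def)
    define h where "h = restrict (\<lambda>l. H l \<omega>) {..<p}"
    have h: "h \<in> T" "\<omega> \<in> A h" using s \<omega> by (auto simp: h_def T_def A_def)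
    then have "\<omega> \<in> space M - E h" using \<omega> by (auto simp: G_def)
    then have "quadratic_form_bounds J p n \<eta> (B + 2 * \<eta>) h (\<lambda>l t. X l t \<omega>)" using E(3) h by blast
    moreover have "h l = H l \<omega>" if "l < p" for l using that by (simp add: h_def)
    ultimately show ?thesis using s quadratic_form_bounds_cong[of p h "\<lambda>l. H l \<omega>"] by blast
  qed
  ultimately show ?thesis unfolding \<beta>_def by blast
qed

end

section \<open>Eigenvalues of the wavelet random matrix\<close>

context compact_wavelet
begin

text \<open>Reindexing the defining infinite sum by the argument of the filter leaves finitely many nonzero
  terms; the mixing by \<open>P\<close> commutes with the filter.\<close>

lemma wavelet_coeff_filtered:
  assumes P: "P \<in> carrier_mat p p" and i: "i < p"
  shows "wavelet_coeff \<phi> \<psi> p (measurements p P x) J k $ i = (\<Sum>l<p. P $$ (i, l) * filtered J (\<lambda>t. x l (of_int t)) k)"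
proof -
  let ?Q = "filter_radius J" and ?h = "wavelet_filter \<phi> \<psi> J"
  let ?Y = "\<lambda>t. measurements p P x t $ i"
  have Y: "?Y t = (\<Sum>l<p. P $$ (i, l) * x l (of_int t))" for t
    using index_mult_mat_vec_sum[of P p p "vec p (\<lambda>l. x l (of_int t))" i] P i by (simp add: measurements_def)
  have bij: "bij_betw (\<lambda>s. 2 ^ J * int k - s) UNIV UNIV"
    by (rule bij_betwI[where g = "\<lambda>s. 2 ^ J * int k - s"]) auto
  have "wavelet_coeff \<phi> \<psi> p (measurements p P x) J k $ i = (\<Sum>\<^sub>\<infinity>t\<in>UNIV. ?Y t * ?h (2 ^ J * int k - t))"
    unfolding wavelet_coeff_def using i by simp
  also have "\<dots> = (\<Sum>\<^sub>\<infinity>s\<in>UNIV. ?Y (2 ^ J * int k - s) * ?h s)"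
    using infsum_reindex_bij_betw[OF bij, of "\<lambda>t. ?Y t * ?h (2 ^ J * int k - t)"] by simp
  also have "\<dots> = (\<Sum>\<^sub>\<infinity>s\<in>{- ?Q..?Q}. ?Y (2 ^ J * int k - s) * ?h s)"
    by (rule infsum_cong_neutral) (auto simp: wavelet_filter_support)
  also have "\<dots> = (\<Sum>s\<in>{- ?Q..?Q}. ?Y (2 ^ J * int k - s) * ?h s)" by simp
  also have "\<dots> = (\<Sum>s\<in>{- ?Q..?Q}. \<Sum>l<p. P $$ (i, l) * (?h s * x l (of_int (2 ^ J * int k - s))))"
    unfolding Y by (intro sum.cong refl) (simp add: sum_distrib_left sum_distrib_right ac_simps)
  also have "\<dots> = (\<Sum>l<p. \<Sum>s\<in>{- ?Q..?Q}. P $$ (i, l) * (?h s * x l (of_int (2 ^ J * int k - s))))"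
    by (rule sum.swap)
  also have "\<dots> = (\<Sum>l<p. P $$ (i, l) * filtered J (\<lambda>t. x l (of_int t)) k)"
    unfolding filtered_def by (simp only: sum_distrib_left)
  finally show ?thesis .
qed

text \<open>The identity \<open>W = P W\<^sub>X P\<^sup>T\<close> expressed through quadratic forms.\<close>

lemma wavelet_matrix_quadratic_form:
  assumes P: "P \<in> carrier_mat p p" and y: "y \<in> carrier_vec p"
  shows "y \<bullet> (wavelet_matrix \<phi> \<psi> p (measurements p P x) J n *\<^sub>v y) =
    (\<Sum>k=1..n. (\<Sum>l<p. (transpose_mat P *\<^sub>v y) $ l * filtered J (\<lambda>t. x l (of_int t)) k)\<^sup>2) / real n"
proof -
  let ?c = "\<lambda>k i. wavelet_coeff \<phi> \<psi> p (measurements p P x) J k $ i"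
  let ?D = "\<lambda>l k. filtered J (\<lambda>t. x l (of_int t)) k"
  have quad: "y \<bullet> (wavelet_matrix \<phi> \<psi> p (measurements p P x) J n *\<^sub>v y) =
    (\<Sum>i<p. \<Sum>i'<p. \<Sum>k=1..n. (?c k i * y $ i) * (?c k i' * y $ i')) / real n"
  proof -
  have "y \<bullet> (wavelet_matrix \<phi> \<psi> p (measurements p P x) J n *\<^sub>v y) =
    (\<Sum>i<p. \<Sum>i'<p. wavelet_matrix \<phi> \<psi> p (measurements p P x) J n $$ (i, i') * y $ i * y $ i')"
    by (rule quadratic_form_sum[OF _ y]) (simp add: wavelet_matrix_def)
  also have "\<dots> = (\<Sum>i<p. \<Sum>i'<p. \<Sum>k=1..n. (?c k i * y $ i) * (?c k i' * y $ i')) / real n"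
    by (simp add: wavelet_matrix_def sum_divide_distrib sum_distrib_left sum_distrib_right ac_simps)
  finally show ?thesis .
  qed
  have "(\<Sum>i<p. \<Sum>i'<p. \<Sum>k=1..n. (?c k i * y $ i) * (?c k i' * y $ i')) = (\<Sum>i<p. \<Sum>k=1..n. \<Sum>i'<p. (?c k i * y $ i) * (?c k i' * y $ i'))"
    by (intro sum.cong refl sum.swap)
  also have "\<dots> = (\<Sum>k=1..n. \<Sum>i<p. \<Sum>i'<p. (?c k i * y $ i) * (?c k i' * y $ i'))" by (rule sum.swap)
  also have "\<dots> = (\<Sum>k=1..n. (\<Sum>i<p. ?c k i * y $ i)\<^sup>2)" by (simp add: power2_eq_square sum_product)
  also have "\<dots> = (\<Sum>k=1..n. (\<Sum>l<p. (transpose_mat P *\<^sub>v y) $ l * ?D l k)\<^sup>2)"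
  proof (rule sum.cong[OF refl])
    fix k
    have "(\<Sum>i<p. ?c k i * y $ i) = (\<Sum>i<p. \<Sum>l<p. P $$ (i, l) * y $ i * ?D l k)"
      by (intro sum.cong refl) (simp add: wavelet_coeff_filtered[OF P] sum_distrib_left sum_distrib_right ac_simps)
    also have "\<dots> = (\<Sum>l<p. \<Sum>i<p. P $$ (i, l) * y $ i * ?D l k)" by (rule sum.swap)
    also have "\<dots> = (\<Sum>l<p. (transpose_mat P *\<^sub>v y) $ l * ?D l k)"
    proof (rule sum.cong[OF refl])
      fix l assume l: "l \<in> {..<p}"
      have "(transpose_mat P *\<^sub>v y) $ l = (\<Sum>i<p. transpose_mat P $$ (l, i) * y $ i)"
        by (rule index_mult_mat_vec_sum) (use P y l in auto)
      also have "\<dots> = (\<Sum>i<p. P $$ (i, l) * y $ i)" using P l by (intro sum.cong refl) auto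
      finally show "(\<Sum>i<p. P $$ (i, l) * y $ i * ?D l k) = (transpose_mat P *\<^sub>v y) $ l * ?D l k"
        by (simp add: sum_distrib_right)
    qed
    finally show "(\<Sum>i<p. ?c k i * y $ i)\<^sup>2 = (\<Sum>l<p. (transpose_mat P *\<^sub>v y) $ l * ?D l k)\<^sup>2" by simp
  qed
  finally show ?thesis unfolding quad by simp
qed

text \<open>The min-max comparison with \<open>R = P\<^sup>T\<close> and weights \<open>(2\<^sup>J)\<^bsup>2
  h l + 1\<^esup>\<close>. These are increasing in \<open>h l\<close>, so sorting the weights and
  sorting the exponents amounts to the same.\<close>

theorem wavelet_eigenvalue_bounds:
  assumes P: "P \<in> carrier_mat p p" "invertible_mat P" and l: "l < p"
    and q: "quadratic_form_bounds J p n c C h x" and c: "0 \<le> c" "0 \<le> C"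
  shows "c * (ordered_singular_value 1 P)\<^sup>2 * (2 ^ J) powr (2 * sort (map h [0..<p]) ! l + 1)
      \<le> ordered_eigenvalue (Suc l) (wavelet_matrix \<phi> \<psi> p (measurements p P x) J n)"
    and "ordered_eigenvalue (Suc l) (wavelet_matrix \<phi> \<psi> p (measurements p P x) J n)
      \<le> C * (ordered_singular_value p P)\<^sup>2 * (2 ^ J) powr (2 * sort (map h [0..<p]) ! l + 1)"
proof -
  let ?W = "wavelet_matrix \<phi> \<psi> p (measurements p P x) J n" and ?R = "transpose_mat P"
  define f :: "real \<Rightarrow> real" where "f t = (2 ^ J) powr (2 * t + 1)" for t
  define d where "d l = f (h l)" for l
  have p: "p > 0" using l by simp
  have W: "?W \<in> carrier_mat p p" "\<And>i i'. i < p \<Longrightarrow> i' < p \<Longrightarrow> ?W $$ (i, i') = ?W $$ (i', i)"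
    by (auto simp: wavelet_matrix_def mult.commute)
  have d0: "0 \<le> d i" for i by (simp add: d_def f_def)
  have quad: "y \<bullet> (?W *\<^sub>v y) = (\<Sum>k=1..n. (\<Sum>l<p. ((?R *\<^sub>v y) $ l * (2 ^ J) powr (h l + 1 / 2)) * normalized J (h l) (x l) k)\<^sup>2) / real n"
    and norm: "(\<Sum>l<p. ((?R *\<^sub>v y) $ l * (2 ^ J) powr (h l + 1 / 2))\<^sup>2) = (\<Sum>l<p. d l * ((?R *\<^sub>v y) $ l)\<^sup>2)"
    if y: "y \<in> carrier_vec p" for y
  proof -
    show "y \<bullet> (?W *\<^sub>v y) = (\<Sum>k=1..n. (\<Sum>l<p. ((?R *\<^sub>v y) $ l * (2 ^ J) powr (h l + 1 / 2)) * normalized J (h l) (x l) k)\<^sup>2) / real n"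
      unfolding wavelet_matrix_quadratic_form[OF P(1) y] normalized_def by simp
    have "((2 ^ J) powr (h l + 1 / 2))\<^sup>2 = d l" for l
      unfolding d_def f_def power2_eq_square by (simp add: powr_add[symmetric])
    then show "(\<Sum>l<p. ((?R *\<^sub>v y) $ l * (2 ^ J) powr (h l + 1 / 2))\<^sup>2) = (\<Sum>l<p. d l * ((?R *\<^sub>v y) $ l)\<^sup>2)"
      by (simp add: power_mult_distrib mult.commute)
  qed
  have lo: "c * (\<Sum>i<p. d i * ((?R *\<^sub>v y) $ i)\<^sup>2) \<le> y \<bullet> (?W *\<^sub>v y)"
    and hi: "y \<bullet> (?W *\<^sub>v y) \<le> C * (\<Sum>i<p. d i * ((?R *\<^sub>v y) $ i)\<^sup>2)" if y: "y \<in> carrier_vec p" for y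
    using q[unfolded quadratic_form_bounds_def, rule_format, of "\<lambda>l. (?R *\<^sub>v y) $ l * (2 ^ J) powr (h l + 1 / 2)"]
    unfolding quad[OF y] norm[OF y] by blast+
  have "mono f" unfolding f_def by (intro monoI powr_mono) auto
  then have "sorted (map f (sort (map h [0..<p])))"
    unfolding sorted_map by (auto intro: sorted_wrt_mono_rel[OF _ sorted_sort] dest: monoD)
  then have "sort (map d [0..<p]) = map f (sort (map h [0..<p]))"
    by (intro properties_for_sort) (simp_all add: d_def[abs_def] image_mset.compositionality comp_def)
  then have s: "sort (map d [0..<p]) ! l = (2 ^ J) powr (2 * sort (map h [0..<p]) ! l + 1)"
    using l by (simp add: f_def)
  note sv = singular_value_bounds(3,4)[OF P p]
  show "c * (ordered_singular_value 1 P)\<^sup>2 * (2 ^ J) powr (2 * sort (map h [0..<p]) ! l + 1) \<le> ordered_eigenvalue (Suc l) ?W"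
    unfolding s[symmetric]
    by (rule ordered_eigenvalue_ge[where A="?W" and R="?R" and n=p and d=d, OF W]) (use P c d0 l lo sv in auto)
  show "ordered_eigenvalue (Suc l) ?W \<le> C * (ordered_singular_value p P)\<^sup>2 * (2 ^ J) powr (2 * sort (map h [0..<p]) ! l + 1)"
    unfolding s[symmetric]
    by (rule ordered_eigenvalue_le[where A="?W" and R="?R" and n=p and d=d, OF W]) (use P c d0 l hi sv in auto)
qed

end

text \<open>Here \<open>2 \<theta> + 1 \<le> 3\<close> explains the constant in front of \<open>j ln
  2\<close>, the price for normalizing by \<open>ln a\<close> instead of the logarithm of the full
  scale \<open>2\<^sup>j a\<close>.\<close>

lemma log_eigenvalue_bound:
  fixes c C s s' \<theta> L :: real and m j :: nat
  assumes pos: "0 < c" "0 < C" "0 < s" "0 < s'" and \<theta>: "0 < \<theta>" "\<theta> < 1" and m: "m \<ge> 1"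
    and lo: "c * s\<^sup>2 * (2 ^ (m + j)) powr (2 * \<theta> + 1) \<le> L" and hi: "L \<le> C * s'\<^sup>2 * (2 ^ (m + j)) powr (2 * \<theta> + 1)"
  shows "\<bar>ln L / ln (2 ^ m) - (2 * \<theta> + 1)\<bar> \<le>
    (\<bar>ln c\<bar> + \<bar>ln C\<bar> + 3 * real j * ln 2) / ln (2 ^ m) + 2 * \<bar>ln s / ln (2 ^ m)\<bar> + 2 * \<bar>ln s' / ln (2 ^ m)\<bar>"
proof -
  let ?D = "(2 ^ (m + j)) powr (2 * \<theta> + 1) :: real" and ?a = "ln (2 ^ m) :: real"
  have a: "?a > 0" using m by simp
  have lnD: "ln ?D = (2 * \<theta> + 1) * ?a + (2 * \<theta> + 1) * (real j * ln 2)"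
    by (simp add: ln_powr ln_realpow algebra_simps)
  have e: "0 \<le> (2 * \<theta> + 1) * (real j * ln 2)" "(2 * \<theta> + 1) * (real j * ln 2) \<le> 3 * (real j * ln 2)"
    using \<theta> by (auto intro!: mult_right_mono)
  have "0 < c * s\<^sup>2 * ?D" using pos by simp
  then have L: "0 < L" using lo by linarith
  have "ln (c * s\<^sup>2 * ?D) \<le> ln L" using lo \<open>0 < c * s\<^sup>2 * ?D\<close> by (simp add: L)
  moreover have "ln (c * s\<^sup>2 * ?D) = ln c + 2 * ln s + ln ?D" using pos by (simp add: ln_mult ln_realpow)
  ultimately have lo': "ln c + 2 * ln s + (2 * \<theta> + 1) * ?a \<le> ln L" using lnD e by linarith
  have "ln L \<le> ln (C * s'\<^sup>2 * ?D)" using hi L by simp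
  moreover have "ln (C * s'\<^sup>2 * ?D) = ln C + 2 * ln s' + ln ?D" using pos by (simp add: ln_mult ln_realpow)
  ultimately have hi': "ln L \<le> ln C + 2 * ln s' + (2 * \<theta> + 1) * ?a + 3 * real j * ln 2" using lnD e by linarith
  have j0: "0 \<le> 3 * real j * ln 2" by simp
  have "\<bar>ln L - (2 * \<theta> + 1) * ?a\<bar> \<le> \<bar>ln c\<bar> + \<bar>ln C\<bar> + 3 * real j * ln 2 + 2 * \<bar>ln s\<bar> + 2 * \<bar>ln s'\<bar>"
    using lo' hi' j0 by linarith
  then have "\<bar>ln L - (2 * \<theta> + 1) * ?a\<bar> / ?a \<le> (\<bar>ln c\<bar> + \<bar>ln C\<bar> + 3 * real j * ln 2 + 2 * \<bar>ln s\<bar> + 2 * \<bar>ln s'\<bar>) / ?a"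
    using a by (intro divide_right_mono) auto
  moreover have "\<bar>ln L - (2 * \<theta> + 1) * ?a\<bar> / ?a = \<bar>ln L / ?a - (2 * \<theta> + 1)\<bar>"
  proof -
    have "ln L / ?a - (2 * \<theta> + 1) = (ln L - (2 * \<theta> + 1) * ?a) / ?a" using a by (simp add: diff_divide_distrib)
    then show ?thesis using a by simp
  qed
  moreover have "\<bar>ln t / ?a\<bar> = \<bar>ln t\<bar> / ?a" for t using a by simp
  ultimately show ?thesis by (simp add: add_divide_distrib)
qed

lemma log_esd_integral:
  assumes [measurable]: "g \<in> borel_measurable borel" and p: "p \<ge> 1"
  shows "(\<integral>\<upsilon>. g \<upsilon> \<partial>log_esd a p A) = (\<Sum>l<p. g (ln (ordered_eigenvalue (Suc l) A) / ln a)) / real p"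
proof -
  let ?f = "\<lambda>l. ln (ordered_eigenvalue l A) / ln a"
  have "(\<integral>\<upsilon>. g \<upsilon> \<partial>log_esd a p A) = (\<integral>l. g (?f l) \<partial>uniform_count_measure {1..p})"
    unfolding log_esd_def by (rule integral_distr[OF _ assms(1)]) (simp add: measurable_def sets_uniform_count_measure space_uniform_count_measure)
  also have "\<dots> = (\<Sum>l=1..p. g (?f l)) / real p"
    by (simp add: integral_uniform_count_measure)
  also have "(\<Sum>l=1..p. g (?f l)) = (\<Sum>l<p. g (?f (Suc l)))"
    by (rule sum.reindex_bij_witness[where i = Suc and j = "\<lambda>l. l - 1"]) auto
  finally show ?thesis .
qed

text \<open>Averages do not depend on the order of the summands, hence a comparison with the sorted
  exponents is sufficient.\<close>

lemma average_perturbation: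
  fixes g :: "real \<Rightarrow> real" and h u :: "nat \<Rightarrow> real"
  assumes p: "p \<ge> 1" and u: "\<And>l. l < p \<Longrightarrow> \<bar>u l - (2 * sort (map h [0..<p]) ! l + 1)\<bar> \<le> \<delta>"
    and g: "\<And>t s. 1 \<le> t \<Longrightarrow> t \<le> 3 \<Longrightarrow> \<bar>s - t\<bar> \<le> \<delta> \<Longrightarrow> \<bar>g s - g t\<bar> \<le> \<epsilon>"
    and h: "\<And>l. l < p \<Longrightarrow> 0 < h l \<and> h l < 1"
  shows "\<bar>(\<Sum>l<p. g (u l)) / real p - (\<Sum>l<p. g (2 * h l + 1)) / real p\<bar> \<le> \<epsilon>"
proof -
  obtain f where f: "bij_betw f {..<p} {..<p}" "\<And>i. i < p \<Longrightarrow> sort (map h [0..<p]) ! i = h (f i)"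
    using sort_reindex by blast
  have "(\<Sum>l<p. g (2 * h l + 1)) = (\<Sum>l<p. g (2 * h (f l) + 1))"
    by (rule sum.reindex_bij_betw[OF f(1), symmetric])
  then have "\<bar>(\<Sum>l<p. g (u l)) - (\<Sum>l<p. g (2 * h l + 1))\<bar> = \<bar>\<Sum>l<p. g (u l) - g (2 * h (f l) + 1)\<bar>"
    by (simp add: sum_subtractf)
  also have "\<dots> \<le> (\<Sum>l<p. \<bar>g (u l) - g (2 * h (f l) + 1)\<bar>)" by (rule sum_abs)
  also have "\<dots> \<le> (\<Sum>l<p. \<epsilon>)"
  proof (rule sum_mono)
    fix l assume l: "l \<in> {..<p}"
    then have "f l < p" using f(1) by (auto simp: bij_betw_def)
    then show "\<bar>g (u l) - g (2 * h (f l) + 1)\<bar> \<le> \<epsilon>"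
      using u[of l] f(2)[of l] h[of "f l"] l by (intro g) auto
  qed
  finally have "\<bar>(\<Sum>l<p. g (u l)) - (\<Sum>l<p. g (2 * h l + 1))\<bar> \<le> real p * \<epsilon>" by simp
  moreover have "(\<Sum>l<p. g (u l)) / real p - (\<Sum>l<p. g (2 * h l + 1)) / real p = ((\<Sum>l<p. g (u l)) - (\<Sum>l<p. g (2 * h l + 1))) / real p"
    by (simp add: diff_divide_distrib)
  ultimately show ?thesis using p by (simp add: abs_mult field_simps)
qed

section \<open>Convergence of the empirical log-spectrum\<close>

lemma mixing_matrix_entry_measurable:
  assumes "prob_space M" "mixing_matrix M p P X" "i < p" "l < p"
  shows "(\<lambda>\<omega>. P \<omega> $$ (i, l)) \<in> borel_measurable M"
proof -
  interpret prob_space M by fact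
  have "(\<lambda>\<omega>. \<lambda>il\<in>{..<p} \<times> {..<p}. P \<omega> $$ il) \<in> measurable M (Pi\<^sub>M ({..<p} \<times> {..<p}) (\<lambda>_. borel))"
    using assms(2) unfolding mixing_matrix_def by (blast dest: indep_var_rv1)
  from measurable_compose[OF this measurable_component_singleton[of "(i, l)"]] show ?thesis
    using assms(3,4) by simp
qed

context compact_wavelet
begin

text \<open>The estimate for a fixed sample size. The four terms bound the probabilities that the quadratic
  form of the normalized coefficients is not controlled, that one of the extreme singular values
  is too small or too large, and that the empirical distribution of the exponents is far from its
  expectation. Outside these events the logarithms of all eigenvalues are determined up to
  \<open>\<delta>\<close> after rescaling. The bound is obtained through a measurable superset, so
  it is valid whether or not the event on the left is measurable.\<close>

theorem log_spectrum_deviation: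
  fixes X :: "nat \<Rightarrow> real \<Rightarrow> 'w \<Rightarrow> real" and H :: "nat \<Rightarrow> 'w \<Rightarrow> real" and g :: "real \<Rightarrow> real"
  assumes M: "prob_space M" and \<pi>: "real_distribution \<pi>" and p: "p \<ge> 1"
    and fin: "finite (measure_support \<pi>)" and supp: "measure_support \<pi> \<subseteq> {0<..<1}"
    and paths: "rH_fBm_paths M \<pi> p H X" and mix: "mixing_matrix M p P X"
    and hmin: "\<And>h. h \<in> measure_support \<pi> \<Longrightarrow> Hmin \<le> h"
    and S0: "0 \<le> S0" "\<And>h A. h \<in> measure_support \<pi> \<Longrightarrow> finite A \<Longrightarrow> (\<Sum>m\<in>A. (wavelet_autocov \<psi> h m)\<^sup>2) \<le> S0"
    and g0: "\<And>h. h \<in> measure_support \<pi> \<Longrightarrow> 3 * \<eta> \<le> wavelet_autocov \<psi> h 0"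
    and g1: "0 \<le> B" "\<And>h. h \<in> measure_support \<pi> \<Longrightarrow> wavelet_autocov \<psi> h 0 \<le> B"
    and small: "discretization_const * (2 ^ (m + j)) powr (- Hmin) \<le> \<eta>"
    and n: "n \<ge> 1" and \<eta>: "\<eta> > 0" and m: "m \<ge> 1"
    and g: "g \<in> borel_measurable borel" "\<And>x. \<bar>g x\<bar> \<le> K" "K > 0" and \<epsilon>: "\<epsilon> > 0"
    and unif: "\<And>t s. 1 \<le> t \<Longrightarrow> t \<le> 3 \<Longrightarrow> \<bar>s - t\<bar> \<le> \<delta> \<Longrightarrow> \<bar>g s - g t\<bar> \<le> \<epsilon> / 3"
    and const: "(\<bar>ln \<eta>\<bar> + \<bar>ln (B + 2 * \<eta>)\<bar> + 3 * real j * ln 2) / ln (2 ^ m) \<le> \<delta> / 6"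
  shows "measure M {\<omega>\<in>space M.
      \<bar>(\<integral>\<upsilon>. g \<upsilon> \<partial>log_esd (2 ^ m) p (wavelet_matrix \<phi> \<psi> p (measurements p (P \<omega>) (\<lambda>l t. X l t \<omega>)) (m + j) n))
        - (\<integral>\<upsilon>. g \<upsilon> \<partial>distr \<pi> borel (\<lambda>h. 2 * h + 1))\<bar> > \<epsilon>}
    \<le> 2 * (real p)\<^sup>2 * (2 * S0 + 2 * real n * (discretization_const * (2 ^ (m + j)) powr (- Hmin))\<^sup>2) / (real n * \<eta>\<^sup>2)
      + measure M {\<omega>\<in>space M. \<bar>ln (ordered_singular_value 1 (P \<omega>)) / ln (2 ^ m) - 0\<bar> > \<delta> / 6}
      + measure M {\<omega>\<in>space M. \<bar>ln (ordered_singular_value p (P \<omega>)) / ln (2 ^ m) - 0\<bar> > \<delta> / 6}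
      + 2 * exp (- ((\<epsilon> / 3)\<^sup>2 / (2 * K\<^sup>2)) * real p)" (is "measure M ?D \<le> _")
proof -
  interpret prob_space M by fact
  define W where "W \<omega> = wavelet_matrix \<phi> \<psi> p (measurements p (P \<omega>) (\<lambda>l t. X l t \<omega>)) (m + j) n" for \<omega>
  obtain E where E: "E \<in> sets M"
    "prob E \<le> 2 * (real p)\<^sup>2 * (2 * S0 + 2 * real n * (discretization_const * (2 ^ (m + j)) powr (- Hmin))\<^sup>2) / (real n * \<eta>\<^sup>2)"
    "\<And>\<omega>. \<omega> \<in> space M - E \<Longrightarrow> (\<forall>l<p. H l \<omega> \<in> measure_support \<pi>) \<and>
      quadratic_form_bounds (m + j) p n \<eta> (B + 2 * \<eta>) (\<lambda>l. H l \<omega>) (\<lambda>l t. X l t \<omega>)"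
    using rH_fBm_quadratic_form_bounds[OF M \<pi> p fin supp paths hmin S0 g0 g1(2) small n \<eta>] by blast
  have P: "P \<omega> \<in> carrier_mat p p" "invertible_mat (P \<omega>)" if "\<omega> \<in> space M" for \<omega>
    using mix that unfolding mixing_matrix_def by auto
  have p0: "0 < p" using p by simp
  note sm = measurable_extreme_singular_values[OF P(1) p0 mixing_matrix_entry_measurable[OF M mix]]
  define E1 where "E1 = {\<omega>\<in>space M. \<bar>ln (ordered_singular_value 1 (P \<omega>)) / ln (2 ^ m) - 0\<bar> > \<delta> / 6}"
  define E2 where "E2 = {\<omega>\<in>space M. \<bar>ln (ordered_singular_value p (P \<omega>)) / ln (2 ^ m) - 0\<bar> > \<delta> / 6}"
  have E12: "E1 \<in> sets M" "E2 \<in> sets M"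
    unfolding E1_def E2_def using sm by measurable
  have indep: "indep_vars (\<lambda>_. borel) H {..<p}" and distr: "\<And>l. l < p \<Longrightarrow> distr M borel (H l) = \<pi>"
    using paths unfolding rH_fBm_paths_def by auto
  define f where "f h = g (2 * h + 1)" for h
  have fm: "f \<in> borel_measurable borel" unfolding f_def using g(1) by measurable
  have fK: "\<bar>f x\<bar> \<le> K" for x using g(2) by (simp add: f_def)
  have \<epsilon>3: "\<epsilon> / 3 > 0" using \<epsilon> by simp
  define E3 where "E3 = {\<omega>\<in>space M. \<bar>(\<Sum>l<p. f (H l \<omega>)) / real p - (\<integral>x. f x \<partial>\<pi>)\<bar> \<ge> \<epsilon> / 3}"
  have E3: "E3 \<in> sets M" "prob E3 \<le> 2 * exp (- ((\<epsilon> / 3)\<^sup>2 / (2 * K\<^sup>2)) * real p)"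
    unfolding E3_def by (rule average_concentration[OF M p indep distr fm fK g(3) \<epsilon>3]; assumption)+
  have sets_\<pi>: "sets \<pi> = sets borel" using real_distribution.events_eq_borel[OF \<pi>] .
  have "(\<lambda>h. 2 * h + 1 :: real) \<in> measurable \<pi> borel"
    unfolding measurable_cong_sets[OF sets_\<pi> refl] by measurable
  then have limit: "(\<integral>\<upsilon>. g \<upsilon> \<partial>distr \<pi> borel (\<lambda>h. 2 * h + 1)) = (\<integral>x. f x \<partial>\<pi>)"
    unfolding f_def by (rule integral_distr[OF _ g(1)])
  have "\<bar>(\<integral>\<upsilon>. g \<upsilon> \<partial>log_esd (2 ^ m) p (W \<omega>)) - (\<integral>x. f x \<partial>\<pi>)\<bar> \<le> \<epsilon>"
    if \<omega>: "\<omega> \<in> space M" "\<omega> \<notin> E" "\<omega> \<notin> E1" "\<omega> \<notin> E2" "\<omega> \<notin> E3" for \<omega>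
  proof -
    let ?h = "\<lambda>l. H l \<omega>" and ?u = "\<lambda>l. ln (ordered_eigenvalue (Suc l) (W \<omega>)) / ln (2 ^ m)"
    have h: "0 < ?h l \<and> ?h l < 1" if "l < p" for l using E(3)[of \<omega>] \<omega> that supp by auto
    have q: "quadratic_form_bounds (m + j) p n \<eta> (B + 2 * \<eta>) ?h (\<lambda>l t. X l t \<omega>)" using E(3)[of \<omega>] \<omega> by blast
    have C: "0 < B + 2 * \<eta>" using g1(1) \<eta> by simp
    have "\<bar>?u l - (2 * sort (map ?h [0..<p]) ! l + 1)\<bar> \<le> \<delta>" if l: "l < p" for l
    proof -
      have "sort (map ?h [0..<p]) ! l \<in> set (sort (map ?h [0..<p]))" using l by (intro nth_mem) simp
      then have \<theta>: "0 < sort (map ?h [0..<p]) ! l" "sort (map ?h [0..<p]) ! l < 1" using h by auto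
      note b = wavelet_eigenvalue_bounds[OF P[OF \<omega>(1)] l q less_imp_le[OF \<eta>] less_imp_le[OF C]]
      have "\<bar>?u l - (2 * sort (map ?h [0..<p]) ! l + 1)\<bar> \<le>
        (\<bar>ln \<eta>\<bar> + \<bar>ln (B + 2 * \<eta>)\<bar> + 3 * real j * ln 2) / ln (2 ^ m)
        + 2 * \<bar>ln (ordered_singular_value 1 (P \<omega>)) / ln (2 ^ m)\<bar> + 2 * \<bar>ln (ordered_singular_value p (P \<omega>)) / ln (2 ^ m)\<bar>"
        unfolding W_def
        by (rule log_eigenvalue_bound[OF \<eta> C singular_value_bounds(1,2)[OF P[OF \<omega>(1)] p0] \<theta> m b])
      moreover have "\<bar>ln (ordered_singular_value 1 (P \<omega>)) / ln (2 ^ m)\<bar> \<le> \<delta> / 6" using \<omega> unfolding E1_def by simp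
      moreover have "\<bar>ln (ordered_singular_value p (P \<omega>)) / ln (2 ^ m)\<bar> \<le> \<delta> / 6" using \<omega> unfolding E2_def by simp
      \<comment> \<open>\<open>\<delta>\<close> is composed of \<open>\<delta>/6\<close> for the constants and twice
        \<open>\<delta>/6\<close> for each singular value.\<close>
      ultimately show ?thesis using const by linarith
    qed
    then have "\<bar>(\<Sum>l<p. g (?u l)) / real p - (\<Sum>l<p. g (2 * ?h l + 1)) / real p\<bar> \<le> \<epsilon> / 3"
      by (rule average_perturbation[OF p _ unif h])
    moreover have "\<bar>(\<Sum>l<p. g (2 * ?h l + 1)) / real p - (\<integral>x. f x \<partial>\<pi>)\<bar> < \<epsilon> / 3"
      using \<omega> unfolding E3_def f_def by simp
    ultimately show ?thesis using \<epsilon> unfolding log_esd_integral[OF g(1) p] by linarith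
  qed
  then have sub: "?D \<subseteq> ((E \<union> E1) \<union> E2) \<union> E3" unfolding limit W_def[symmetric] by fastforce
  have "measure M ?D \<le> prob (((E \<union> E1) \<union> E2) \<union> E3)" by (rule finite_measure_mono[OF sub]) (use E E12 E3 in auto)
  also have "\<dots> \<le> prob ((E \<union> E1) \<union> E2) + prob E3" by (rule measure_Un_le) (use E E12 E3 in auto)
  also have "prob ((E \<union> E1) \<union> E2) \<le> prob (E \<union> E1) + prob E2" by (rule measure_Un_le) (use E E12 E3 in auto)
  also have "prob (E \<union> E1) \<le> prob E + prob E1" by (rule measure_Un_le) (use E E12 E3 in auto)
  finally show ?thesis using E(2) E3(2) unfolding E1_def[symmetric] E2_def[symmetric] by linarith
qed

end

lemma compact_wavelet_mra:
  assumes mra: "mra_wavelet \<phi> \<psi>" and N: "2 \<le> N" "vanishing_moments N \<psi>"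
    and int: "integrable lborel \<phi>" "integrable lborel \<psi>"
    and supp: "compactly_supported \<phi>" "compactly_supported \<psi>" and f: "fourier \<phi> 0 = 1"
  shows "\<exists>R. compact_wavelet \<phi> \<psi> R N"
proof -
  obtain V where V: "multiresolution_analysis V \<phi>" using mra unfolding mra_wavelet_def by blast
  obtain R1 :: nat where R1: "R1 \<ge> 1" "\<And>t. \<bar>t\<bar> > real R1 \<Longrightarrow> \<phi> t = 0" by (rule compactly_supported_bound[OF supp(1)]) (rule that)
  obtain R2 :: nat where R2: "R2 \<ge> 1" "\<And>t. \<bar>t\<bar> > real R2 \<Longrightarrow> \<psi> t = 0" by (rule compactly_supported_bound[OF supp(2)]) (rule that)
  define R where "R = max R1 R2"
  have \<phi>R: "\<phi> t = 0" if "\<bar>t\<bar> > real R" for t using R1(2)[of t] that unfolding R_def by simp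
  have \<psi>R: "\<psi> t = 0" if "\<bar>t\<bar> > real R" for t using R2(2)[of t] that unfolding R_def by simp
  have "complex_of_real (\<integral>t. \<phi> t \<partial>lborel) = 1"
    using f unfolding fourier_def by simp
  then have one: "(\<integral>t. \<phi> t \<partial>lborel) = 1" by (metis of_real_eq_1_iff)
  have "\<phi> \<in> L2" by (rule mra_shift_L2(1)[OF V])
  moreover have "AE t in lborel. lattice_sum 1 \<phi> t = 1"
    by (rule partition_of_unity[where R=R, OF V \<phi>R int(1) one])
  ultimately have "compact_wavelet \<phi> \<psi> R N"
    using N int \<phi>R \<psi>R R1(1) unfolding compact_wavelet_def vanishing_moments_def R_def by auto
  then show ?thesis ..
qed

text \<open>With \<open>N = n / (2\<^sup>j a)\<close>, the three limits are \<open>a \<rightarrow>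
  \<infinity>\<close>, \<open>N (2\<^sup>J)\<^bsup>-2H\<^esup> \<rightarrow> 0\<close> and
  \<open>p\<^sup>2/N \<rightarrow> 0\<close> in the notation of the introduction.\<close>

lemma scaling_limits:
  fixes S :: "nat set" and F :: "nat filter" and a p :: "nat \<Rightarrow> nat" and Hmin :: real
  assumes F: "F = inf at_top (principal S)" and H: "0 < Hmin" "Hmin < 1"
    and a: "\<And>n. n \<in> S \<Longrightarrow> a n \<ge> 1" and N: "\<And>n. n \<in> S \<Longrightarrow> a n * 2 ^ j dvd n"
    and lim: "((\<lambda>n. real (a n) / real n + real n / real (a n) powr (1 + 2 * Hmin)) \<longlongrightarrow> 0) F"
    and p_small: "(\<lambda>n. real (p n)) \<in> o[F](\<lambda>n. sqrt (real n / real (a n)))"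
  shows "filterlim (\<lambda>n. real (a n)) at_top F"
    and "((\<lambda>n. real (n div (a n * 2 ^ j)) * ((real (a n) * 2 ^ j) powr (- Hmin))\<^sup>2) \<longlongrightarrow> 0) F"
    and "((\<lambda>n. (real (p n))\<^sup>2 / real (n div (a n * 2 ^ j))) \<longlongrightarrow> 0) F"
proof -
  have inS: "eventually (\<lambda>n. n \<in> S) F" unfolding F eventually_inf_principal by simp
  have FT: "F \<le> at_top" unfolding F by simp
  have lim2: "((\<lambda>n. real n / real (a n) powr (1 + 2 * Hmin)) \<longlongrightarrow> 0) F"
    by (rule tendsto_sandwich[OF _ _ tendsto_const lim]) (auto intro!: always_eventually)
  show "filterlim (\<lambda>n. real (a n)) at_top F"
    unfolding filterlim_at_top
  proof
    fix Z :: real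
    \<comment> \<open>Eventually \<open>n < a\<^bsup>1 + 2 Hmin\<^esup> \<le> a\<^sup>3\<close>, thus \<open>a\<close>
      exceeds any bound along with \<open>n\<close>.\<close>
    define Y where "Y = max Z 1"
    have "eventually (\<lambda>n. n \<ge> nat \<lceil>Y ^ 3\<rceil>) F" using FT eventually_ge_at_top filter_leD by blast
    moreover have "eventually (\<lambda>n. real n / real (a n) powr (1 + 2 * Hmin) < 1) F"
      using order_tendstoD(2)[OF lim2, of 1] by simp
    ultimately show "eventually (\<lambda>n. Z \<le> real (a n)) F" using inS
    proof eventually_elim
      case (elim n)
      have a1: "real (a n) \<ge> 1" using a[OF elim(3)] by simp
      have "real n < real (a n) powr (1 + 2 * Hmin)" using elim(2) a1 by (simp add: divide_less_eq)
      also have "\<dots> \<le> real (a n) powr 3" using a1 H by (intro powr_mono) auto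
      also have "\<dots> = real (a n) ^ 3" using a1 by (simp add: powr_numeral)
      finally have "Y ^ 3 \<le> real (a n) ^ 3" using elim(1) by linarith
      then have "Y \<le> real (a n)" by (rule power_le_imp_le_base[of _ 2, unfolded numeral_2_eq_2, folded numeral_3_eq_3]) simp
      then show ?case unfolding Y_def by simp
    qed
  qed
  have Nr: "real (n div (a n * 2 ^ j)) = real n / (real (a n) * 2 ^ j)" if "n \<in> S" for n
    using real_of_nat_div[OF N[OF that]] by simp
  show "((\<lambda>n. real (n div (a n * 2 ^ j)) * ((real (a n) * 2 ^ j) powr (- Hmin))\<^sup>2) \<longlongrightarrow> 0) F"
  proof (rule tendsto_sandwich[OF _ _ tendsto_const lim2])
    show "eventually (\<lambda>n. 0 \<le> real (n div (a n * 2 ^ j)) * ((real (a n) * 2 ^ j) powr (- Hmin))\<^sup>2) F" by simp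
    show "eventually (\<lambda>n. real (n div (a n * 2 ^ j)) * ((real (a n) * 2 ^ j) powr (- Hmin))\<^sup>2
        \<le> real n / real (a n) powr (1 + 2 * Hmin)) F"
      using inS
    proof eventually_elim
      case (elim n)
      have a1: "real (a n) \<ge> 1" using a[OF elim] by simp
      have pos: "real (a n) powr (1 + 2 * Hmin) > 0" using a1 by simp
      have b: "real (a n) \<le> real (a n) * 2 ^ j" using a1 by (simp add: mult_le_cancel_left1)
      have b0: "real (a n) * 2 ^ j > 0" using a1 by simp
      have "real (n div (a n * 2 ^ j)) * ((real (a n) * 2 ^ j) powr (- Hmin))\<^sup>2
        = real n / (real (a n) * 2 ^ j) powr (1 + 2 * Hmin)"
      proof -
        have "(real (a n) * 2 ^ j) powr (1 + 2 * Hmin) = (real (a n) * 2 ^ j) * (((real (a n) * 2 ^ j) powr Hmin)\<^sup>2)"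
          using b0 unfolding powr_add power2_eq_square by (simp add: powr_add[symmetric])
        moreover have "((real (a n) * 2 ^ j) powr (- Hmin))\<^sup>2 = 1 / ((real (a n) * 2 ^ j) powr Hmin)\<^sup>2"
          by (simp add: powr_minus power_inverse divide_inverse)
        ultimately show ?thesis unfolding Nr[OF elim] by simp
      qed
      also have "\<dots> \<le> real n / real (a n) powr (1 + 2 * Hmin)"
        using b a1 H pos by (intro divide_left_mono powr_mono2 mult_pos_pos) auto
      finally show ?case .
    qed
  qed
  have "((\<lambda>n. real (p n) / sqrt (real n / real (a n))) \<longlongrightarrow> 0) F" by (rule smalloD_tendsto[OF p_small])
  then have "((\<lambda>n. (real (p n) / sqrt (real n / real (a n)))\<^sup>2 * 2 ^ j) \<longlongrightarrow> 0\<^sup>2 * 2 ^ j) F"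
    by (intro tendsto_intros)
  then have "((\<lambda>n. (real (p n) / sqrt (real n / real (a n)))\<^sup>2 * 2 ^ j) \<longlongrightarrow> 0) F" by simp
  moreover have "eventually (\<lambda>n. (real (p n) / sqrt (real n / real (a n)))\<^sup>2 * 2 ^ j = (real (p n))\<^sup>2 / real (n div (a n * 2 ^ j))) F"
    using inS by eventually_elim (simp add: Nr power_divide)
  ultimately show "((\<lambda>n. (real (p n))\<^sup>2 / real (n div (a n * 2 ^ j))) \<longlongrightarrow> 0) F"
    by (rule Lim_transform_eventually)
qed

theorem theorem3p2:
  fixes M :: "'w measure" and \<pi> :: "real measure"
    and S :: "nat set" and F :: "nat filter"
    and a m p :: "nat \<Rightarrow> nat" and j N\<psi> :: nat and Hmin A \<alpha> :: real
    and H :: "nat \<Rightarrow> nat \<Rightarrow> 'w \<Rightarrow> real"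
    and X :: "nat \<Rightarrow> nat \<Rightarrow> real \<Rightarrow> 'w \<Rightarrow> real"
    and P :: "nat \<Rightarrow> 'w \<Rightarrow> real mat"
    and \<phi> \<psi> :: "real \<Rightarrow> real"
    and W :: "nat \<Rightarrow> 'w \<Rightarrow> real mat"
  assumes prob: "prob_space M"
    \<comment> \<open>sample sizes tend to infinity along an infinite set \<open>S\<close>: integrality of
        \<open>n / (a n * 2 ^ j)\<close> with dyadic \<open>a n \<rightarrow> \<infinity>\<close> cannot hold for all \<open>n\<close>\<close>
    and S: "infinite S"
    and F: "F = inf at_top (principal S)"
    \<comment> \<open>distribution of the Hurst exponents\<close>
    and A1_prob: "real_distribution \<pi>" "measure \<pi> {0<..<1} = 1"
    and A1_supp: "finite (measure_support \<pi>)" "measure_support \<pi> \<subseteq> {0<..<1}"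
    and A1_min: "Hmin = Min (measure_support \<pi>)"
    \<comment> \<open>latent process and measurements\<close>
    and A1_A2: "\<And>n. n \<in> S \<Longrightarrow> rH_fBm_paths M \<pi> (p n) (H n) (X n)"
    and A3: "\<And>n. n \<in> S \<Longrightarrow> mixing_matrix M (p n) (P n) (X n)"
    \<comment> \<open>scaling and dimension\<close>
    and A4_dyadic: "\<And>n. n \<in> S \<Longrightarrow> a n = 2 ^ m n"
    and A4_le: "\<And>n. n \<in> S \<Longrightarrow> real (a n) \<le> real n / 2 ^ j"
    and A4_lim: "((\<lambda>n. real (a n) / real n + real n / real (a n) powr (1 + 2 * Hmin)) \<longlongrightarrow> 0) F"
    and A4_p: "\<And>n. n \<in> S \<Longrightarrow> 1 \<le> p n \<and> real (p n) < real n / (real (a n) * 2 ^ j)"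
    and A4_p_lim: "filterlim p at_top F"
    and A4_p_small: "(\<lambda>n. real (p n)) \<in> o[F](\<lambda>n. sqrt (real n / real (a n)))"
    and A4_int: "\<And>n. n \<in> S \<Longrightarrow> a n * 2 ^ j dvd n"
    \<comment> \<open>extreme singular values of the mixing matrices\<close>
    and A5_min: "tendsto_in_prob M
          (\<lambda>n \<omega>. ln (ordered_singular_value 1 (P n \<omega>)) / ln (real (a n))) 0 F"
    and A5_max: "tendsto_in_prob M
          (\<lambda>n \<omega>. ln (ordered_singular_value (p n) (P n \<omega>)) / ln (real (a n))) 0 F"
    \<comment> \<open>scaling function and wavelet\<close>
    and MRA: "mra_wavelet \<phi> \<psi>"
    and W1: "2 \<le> N\<psi>" "vanishing_moments N\<psi> \<psi>"
    and W2: "integrable lborel \<phi>" "integrable lborel \<psi>"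
          "compactly_supported \<phi>" "compactly_supported \<psi>" "fourier \<phi> 0 = 1"
    and W3: "0 < A" "1 < \<alpha>" "fourier_decay A \<alpha> \<psi>"
    \<comment> \<open>the wavelet random matrix at scale \<open>2 ^ (m n + j) = a n * 2 ^ j\<close>\<close>
    and W: "\<And>n \<omega>. W n \<omega> =
          wavelet_matrix \<phi> \<psi> (p n) (measurements (p n) (P n \<omega>) (\<lambda>l t. X n l t \<omega>))
            (m n + j) (n div (a n * 2 ^ j))"
  shows "\<forall>g :: real \<Rightarrow> real. \<forall>\<epsilon> :: real.
    continuous_on UNIV g \<longrightarrow> bounded (range g) \<longrightarrow> \<epsilon> > 0 \<longrightarrow>
    ((\<lambda>n. measure M {\<omega> \<in> space M.
        \<bar>(\<integral>\<upsilon>. g \<upsilon> \<partial>log_esd (real (a n)) (p n) (W n \<omega>))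
          - (\<integral>\<upsilon>. g \<upsilon> \<partial>distr \<pi> borel (\<lambda>h. 2 * h + 1))\<bar> > \<epsilon>}) \<longlongrightarrow> 0) F"
proof -
  interpret M: prob_space M by (rule prob)
  obtain R where cw: "compact_wavelet \<phi> \<psi> R N\<psi>"
    using compact_wavelet_mra[OF MRA W1 W2] by blast
  interpret compact_wavelet \<phi> \<psi> R N\<psi> by (rule cw)
  let ?supp = "measure_support \<pi>"
  have ne: "?supp \<noteq> {}"
  proof
    assume "?supp = {}"
    then have "UNIV \<in> null_sets \<pi>" using measure_support_complement_null[OF A1_prob(1)] by simp
    then have "{0<..<1} \<in> null_sets \<pi>"
      by (rule null_sets_subset) (simp_all add: real_distribution.events_eq_borel[OF A1_prob(1)])
    then have "emeasure \<pi> {0<..<1} = 0" by (rule null_setsD1)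
    then show False using A1_prob(2) by (simp add: measure_def)
  qed
  have Hmin: "Hmin \<in> ?supp" "\<And>h. h \<in> ?supp \<Longrightarrow> Hmin \<le> h"
    unfolding A1_min using ne A1_supp(1) by auto
  have H01: "0 < Hmin" "Hmin < 1" using Hmin(1) A1_supp(2) by auto
  have H0: "0 < h" and H1: "h < 1" if "h \<in> ?supp" for h using that A1_supp(2) by auto
  have "\<forall>h\<in>?supp. \<exists>s. \<forall>A. finite A \<longrightarrow> (\<Sum>m\<in>A. (wavelet_autocov \<psi> h m)\<^sup>2) \<le> s"
    using wavelet_autocov_square_summable H0 H1 by blast
  then obtain s where s: "\<And>h A. h \<in> ?supp \<Longrightarrow> finite A \<Longrightarrow> (\<Sum>m\<in>A. (wavelet_autocov \<psi> h m)\<^sup>2) \<le> s h"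
    by metis
  have s0: "0 \<le> s h" if "h \<in> ?supp" for h using s[OF that, of "{}"] by simp
  \<comment> \<open>The sum over the support is one way to bound the finitely many constants simultaneously.\<close>
  define S0 where "S0 = (\<Sum>h\<in>?supp. s h)"
  have S0: "0 \<le> S0" unfolding S0_def by (rule sum_nonneg) (rule s0)
  have S0': "(\<Sum>m\<in>A. (wavelet_autocov \<psi> h m)\<^sup>2) \<le> S0" if "h \<in> ?supp" "finite A" for h A
    using s[OF that] member_le_sum[OF that(1), of s] s0 A1_supp(1) unfolding S0_def by force
  \<comment> \<open>One third of the least wavelet variance: one part is lost to discretization, one to sampling,
    and one remains.\<close>
  define \<eta> where "\<eta> = Min ((\<lambda>h. wavelet_autocov \<psi> h 0) ` ?supp) / 3"
  define B where "B = Max ((\<lambda>h. wavelet_autocov \<psi> h 0) ` ?supp)"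
  have g0: "3 * \<eta> \<le> wavelet_autocov \<psi> h 0" and g1: "wavelet_autocov \<psi> h 0 \<le> B" if "h \<in> ?supp" for h
    unfolding \<eta>_def B_def using A1_supp(1) that by simp_all
  have "Min ((\<lambda>h. wavelet_autocov \<psi> h 0) ` ?supp) \<in> (\<lambda>h. wavelet_autocov \<psi> h 0) ` ?supp"
    using A1_supp(1) ne by (intro Min_in) auto
  then have \<eta>: "0 < \<eta>" unfolding \<eta>_def using wavelet_autocov_positive H0 H1 by auto
  have B: "0 \<le> B" using g0[OF Hmin(1)] g1[OF Hmin(1)] \<eta> by linarith
  have inS: "eventually (\<lambda>n. n \<in> S) F" unfolding F eventually_inf_principal by simp
  have a1: "a n \<ge> 1" if "n \<in> S" for n using A4_dyadic[OF that] by simp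
  note lim = scaling_limits[OF F H01 a1 A4_int A4_lim A4_p_small]
  define b where "b n = real (a n) * 2 ^ j" for n
  define K where "K n = n div (a n * 2 ^ j)" for n
  have ln_a: "filterlim (\<lambda>n. ln (real (a n))) at_top F" by (rule filterlim_compose[OF ln_at_top lim(1)])
  have "filterlim b at_top F"
    unfolding b_def by (rule filterlim_at_top_mono[OF lim(1)]) (auto intro!: always_eventually simp: mult_le_cancel_left1)
  then have "((\<lambda>n. discretization_const * b n powr (- Hmin)) \<longlongrightarrow> discretization_const * 0) F"
    using H01 by (intro tendsto_mult tendsto_const tendsto_neg_powr) auto
  then have small: "eventually (\<lambda>n. discretization_const * b n powr (- Hmin) < \<eta>) F"
    using order_tendstoD(2)[of _ 0 F \<eta>] \<eta> by simp
  show ?thesis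
  proof (intro allI impI)
    fix g :: "real \<Rightarrow> real" and \<epsilon> :: real
    assume cont: "continuous_on UNIV g" and bdd: "bounded (range g)" and \<epsilon>: "\<epsilon> > 0"
    have gm: "g \<in> borel_measurable borel" using cont by (rule borel_measurable_continuous_onI)
    obtain G where G: "G > 0" "\<And>x. \<bar>g x\<bar> \<le> G" using bdd unfolding bounded_pos by auto
    \<comment> \<open>The values \<open>2 h + 1\<close> lie in \<open>(1, 3)\<close>; a margin of 1 on both sides
      accommodates the perturbed ones.\<close>
    have "uniformly_continuous_on {0..4} g"
      by (rule compact_uniformly_continuous[OF continuous_on_subset[OF cont]]) auto
    then obtain d where d: "d > 0" "\<And>t s. t \<in> {0..4} \<Longrightarrow> s \<in> {0..4} \<Longrightarrow> dist s t < d \<Longrightarrow> dist (g s) (g t) < \<epsilon> / 3"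
      unfolding uniformly_continuous_on_def using \<epsilon> by (metis zero_less_divide_iff zero_less_numeral)
    define \<delta> where "\<delta> = min (d / 2) 1"
    have \<delta>: "\<delta> > 0" unfolding \<delta>_def using d(1) by simp
    have unif: "\<bar>g s - g t\<bar> \<le> \<epsilon> / 3" if "1 \<le> t" "t \<le> 3" "\<bar>s - t\<bar> \<le> \<delta>" for t s
    proof -
      have "\<bar>s - t\<bar> \<le> d / 2" "\<bar>s - t\<bar> \<le> 1" using that(3) unfolding \<delta>_def by simp_all
      then have "0 \<le> s" "s \<le> 4" "\<bar>s - t\<bar> < d" using that(1,2) d(1) by linarith+
      then show ?thesis using d(2)[of t s] that(1,2) unfolding dist_real_def by simp
    qed
    define x where "x n = (real (p n))\<^sup>2 / real (K n) *
      ((2 / \<eta>\<^sup>2) * (2 * S0 + 2 * discretization_const\<^sup>2 * (real (K n) * (b n powr (- Hmin))\<^sup>2)))" for n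
    define y where "y n = M.prob {\<omega> \<in> space M. \<bar>ln (ordered_singular_value 1 (P n \<omega>)) / ln (real (a n)) - 0\<bar> > \<delta> / 6}" for n
    define z where "z n = M.prob {\<omega> \<in> space M. \<bar>ln (ordered_singular_value (p n) (P n \<omega>)) / ln (real (a n)) - 0\<bar> > \<delta> / 6}" for n
    define c where "c = (\<epsilon> / 3)\<^sup>2 / (2 * G\<^sup>2)"
    have c: "c > 0" unfolding c_def using \<epsilon> G(1) by simp
    have "(x \<longlongrightarrow> 0 * ((2 / \<eta>\<^sup>2) * (2 * S0 + 2 * discretization_const\<^sup>2 * 0))) F"
      unfolding x_def K_def b_def by (intro tendsto_mult tendsto_add tendsto_const lim(2,3))
    then have x: "(x \<longlongrightarrow> 0) F" by simp
    have \<delta>6: "\<delta> / 6 > 0" using \<delta> by simp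
    have y: "(y \<longlongrightarrow> 0) F" unfolding y_def using A5_min \<delta>6 unfolding tendsto_in_prob_def by blast
    have z: "(z \<longlongrightarrow> 0) F" unfolding z_def using A5_max \<delta>6 unfolding tendsto_in_prob_def by blast
    have "filterlim (\<lambda>n. real (p n)) at_top F" by (rule filterlim_compose[OF filterlim_real_sequentially A4_p_lim])
    then have "filterlim (\<lambda>n. - c * real (p n)) at_bot F"
      using c by (intro filterlim_tendsto_neg_mult_at_bot[OF tendsto_const]) auto
    then have e: "((\<lambda>n. exp (- c * real (p n))) \<longlongrightarrow> 0) F" by (rule filterlim_compose[OF exp_at_bot])
    have "((\<lambda>n. x n + y n + z n + 2 * exp (- c * real (p n))) \<longlongrightarrow> 0 + 0 + 0 + 2 * 0) F"
      by (intro tendsto_add tendsto_mult tendsto_const x y z e)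
    then have bound: "((\<lambda>n. x n + y n + z n + 2 * exp (- c * real (p n))) \<longlongrightarrow> 0) F" by simp
    have "((\<lambda>n. (\<bar>ln \<eta>\<bar> + \<bar>ln (B + 2 * \<eta>)\<bar> + 3 * real j * ln 2) / ln (real (a n))) \<longlongrightarrow> 0) F"
      by (rule tendsto_divide_0[OF tendsto_const filterlim_at_top_imp_at_infinity[OF ln_a]])
    then have const: "eventually (\<lambda>n. (\<bar>ln \<eta>\<bar> + \<bar>ln (B + 2 * \<eta>)\<bar> + 3 * real j * ln 2) / ln (real (a n)) < \<delta> / 6) F"
      by (rule order_tendstoD(2)) (rule \<delta>6)
    have a2: "eventually (\<lambda>n. real (a n) > 1) F" using lim(1) unfolding filterlim_at_top_dense by blast
    show "((\<lambda>n. M.prob {\<omega> \<in> space M. \<bar>(\<integral>\<upsilon>. g \<upsilon> \<partial>log_esd (real (a n)) (p n) (W n \<omega>))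
          - (\<integral>\<upsilon>. g \<upsilon> \<partial>distr \<pi> borel (\<lambda>h. 2 * h + 1))\<bar> > \<epsilon>}) \<longlongrightarrow> 0) F"
    proof (rule tendsto_sandwich[OF _ _ tendsto_const bound])
      show "eventually (\<lambda>n. M.prob {\<omega> \<in> space M. \<bar>(\<integral>\<upsilon>. g \<upsilon> \<partial>log_esd (real (a n)) (p n) (W n \<omega>))
          - (\<integral>\<upsilon>. g \<upsilon> \<partial>distr \<pi> borel (\<lambda>h. 2 * h + 1))\<bar> > \<epsilon>} \<le> x n + y n + z n + 2 * exp (- c * real (p n))) F"
        using inS a2 const small
      proof eventually_elim
        case (elim n)
        have an: "real (a n) = 2 ^ m n" using A4_dyadic[OF elim(1)] by simp
        have m1: "m n \<ge> 1"
        proof (rule ccontr)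
          assume "\<not> m n \<ge> 1"
          then have "m n = 0" by simp
          then show False using elim(2) an by simp
        qed
        have bn: "b n = 2 ^ (m n + j)" unfolding b_def an by (simp add: power_add)
        have p1: "p n \<ge> 1" using A4_p[OF elim(1)] by simp
        have "real (K n) = real n / (real (a n) * 2 ^ j)"
          unfolding K_def using real_of_nat_div[OF A4_int[OF elim(1)]] by simp
        then have K1: "K n \<ge> 1" using A4_p[OF elim(1)] by linarith
        have "2 * (real (p n))\<^sup>2 * (2 * S0 + 2 * real (K n) * (discretization_const * b n powr (- Hmin))\<^sup>2) / (real (K n) * \<eta>\<^sup>2) = x n"
          unfolding x_def using K1 \<eta> by (simp add: power_mult_distrib ac_simps)
        then show ?case
          using log_spectrum_deviation[OF prob A1_prob(1) p1 A1_supp A1_A2[OF elim(1)] A3[OF elim(1)] Hmin(2) S0 S0' g0 B g1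
              less_imp_le[OF elim(4)[unfolded bn]] K1 \<eta> m1 gm G(2,1) \<epsilon> unif less_imp_le[OF elim(3)[unfolded an]]]
          unfolding W y_def z_def c_def an bn K_def by simp
      qed
    qed simp
  qed
qed

end
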